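(* Let $A$ be the preprojective algebra of type $\mathrm{E}_6$ over a field $\mathbb{F}$. If $\mathrm{char}(\mathbb{F})=2$, then $\mathrm{HK}^\bullet_{hi}(A)=\mathrm{HK}^\bullet(A)$. If $\mathrm{char}(\mathbb{F})=3$, then $\mathrm{HK}^0_{hi}(A)=\mathrm{HK}^0(A)_{10}$ has dimension $2$ and is spanned by $\pi_0$ and $\pi_3$; $\mathrm{HK}^1_{hi}(A)=\mathrm{span}\{[\overline{\rho}_5]\}$; $\mathrm{HK}^2_{hi}(A)=\mathrm{HK}^2(A)$; and $\mathrm{HK}^p_{hi}(A)=0$ if $p>2$. If $\mathrm{char}(\mathbb{F})\notin\{2,3\}$, then $\mathrm{HK}^0_{hi}(A)=\mathrm{HK}^0(A)_{10}$ has dimension $2$ and is spanned by $\pi_0$ and $\pi_3$; $\mathrm{HK}^2_{hi}(A)=\mathrm{HK}^2(A)$; and $\mathrm{HK}^p_{hi}(A)=0$ if $p\neq0$ and $p\neq2$.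
   Context: The algebra. $\overline{Q}$ is the quiver with vertices $0,\ldots,5$ and arrows $a_0:0\to3$, $a_1:1\to2$, $a_2:2\to3$, $a_3:3\to4$, $a_4:4\to5$, together with reversed arrows $a_i^*$; paths are written from right to left. $k=\bigoplus_i\mathbb{F}e_i$, $V=\mathbb{F}\overline{Q}_1$, $k^e=k\otimes_{\mathbb{F}}k$, $A=\mathbb{F}\overline{Q}/(R)$ with $R\subseteq V\otimes_kV$ spanned by $\sigma_0=-a_0^*a_0$, $\sigma_1=-a_1^*a_1$, $\sigma_2=a_1a_1^*-a_2^*a_2$, $\sigma_3=a_0a_0^*+a_2a_2^*-a_3^*a_3$, $\sigma_4=a_3a_3^*-a_4^*a_4$, $\sigma_5=a_4a_4^*$. Put $c_0=a_0a_0^*$, $c_2=a_2a_2^*$, $c_3=a_3^*a_3$. $A$ is graded by path length. Koszul cohomology. $W_0=k$, $W_1=V$, $W_p=\bigcap_{i+2+j=p}V^{\otimes_k i}\otimes_kR\otimes_kV^{\otimes_k j}$ for $p\geq2$; elements of $W_p$ are written $x_1\ldots x_p$ (a sum is understood). $\mathrm{HK}^\bullet(A)=H^\bullet(\mathrm{Hom}_{k^e}(W_\bullet,A),b_K)$ with $b_K(f)(x_1\ldots x_{p+1})=f(x_1\ldots x_p)x_{p+1}-(-1)^px_1f(x_2\ldots x_{p+1})$ for $f:W_p\to A$; $\mathrm{HK}^p(A)_r$ is the part represented by cocycles $W_p\to A_r$. The Koszul cup product is induced by $(f\smile g)(x_1\ldots x_{p+q})=(-1)^{pq}f(x_1\ldots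 x_p)g(x_{p+1}\ldots x_{p+q})$. $\mathrm{HK}^0(A)$ is identified with the centre of $A$; $\overline{f}$ denotes the class of a cocycle $f$. Higher Koszul cohomology. Let $\overline{\mathfrak{e}}_A\in\mathrm{HK}^1(A)$ be the class of the cocycle $\mathfrak{e}_A:V\to A$, $x\mapsto x$; it satisfies $\mathfrak{e}_A\smile\mathfrak{e}_A=0$. $\mathrm{HK}^\bullet_{hi}(A)$ is the cohomology of $(\mathrm{HK}^\bullet(A),\overline{\mathfrak{e}}_A\smile-)$; classes in it are denoted with square brackets, and equalities with (parts of) $\mathrm{HK}^\bullet(A)$ are canonical. Elements. $\pi_0=a_0^*c_3^2c_0c_3a_0$, $\pi_3=c_3(c_0c_3)^2$. In characteristic $3$, $\rho_5\in\mathrm{Hom}_{k^e}(V,A)$ is the cocycle with $\rho_5(a_0)=c_2c_3a_0$, $\rho_5(a_1)=a_2^*c_0a_2a_1$, $\rho_5(a_2)=c_2c_0a_2$, $\rho_5(a_0^* )=-a_0^*c_3^2$, $\rho_5(a_1^* )=-a_1^*a_2^*c_0a_2$, $\rho_5(a_2^* )=a_2^*c_3^2$, and value $0$ on the other arrows. *)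

theory Defs
  imports "Jordan_Normal_Form.VS_Connect" "HOL-Algebra.AbelCoset"
begin

section \<open>The path algebra of the double quiver of type E6\<close>

datatype vertex = V0 | V1 | V2 | V3 | V4 | V5

text \<open>\<open>Bi\<close> is the reverse of \<open>Ai\<close>.\<close>

datatype arrow = A0 | A1 | A2 | A3 | A4 | B0 | B1 | B2 | B3 | B4

instance arrow :: finite
proof
  have "(UNIV :: arrow set) = {A0, A1, A2, A3, A4, B0, B1, B2, B3, B4}"
    using arrow.exhaust by auto
  then show "finite (UNIV :: arrow set)"
    by (metis finite.emptyI finite_insert)
qed

fun src :: "arrow \<Rightarrow> vertex" where
  "src A0 = V0" | "src A1 = V1" | "src A2 = V2" | "src A3 = V3" | "src A4 = V4"
| "src B0 = V3" | "src B1 = V2" | "src B2 = V3" | "src B3 = V4" | "src B4 = V5"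

fun tgt :: "arrow \<Rightarrow> vertex" where
  "tgt A0 = V3" | "tgt A1 = V2" | "tgt A2 = V3" | "tgt A3 = V4" | "tgt A4 = V5"
| "tgt B0 = V0" | "tgt B1 = V1" | "tgt B2 = V2" | "tgt B3 = V3" | "tgt B4 = V4"

text \<open>Paths are read from right to left: \<open>(v, [x\<^sub>1, \<dots>, x\<^sub>n])\<close> is the path
  \<open>x\<^sub>1 \<dots> x\<^sub>n\<close> whose last arrow \<open>x\<^sub>1\<close> ends in \<open>v\<close>; \<open>(v, [])\<close> is the trivial path \<open>e\<^sub>v\<close>.\<close>

type_synonym path = "vertex \<times> arrow list"

fun is_path :: "vertex \<Rightarrow> arrow list \<Rightarrow> bool" where
  "is_path v [] \<longleftrightarrow> True"
| "is_path v (x # xs) \<longleftrightarrow> tgt x = v \<and> is_path (src x) xs"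

fun start :: "vertex \<Rightarrow> arrow list \<Rightarrow> vertex" where
  "start v [] = v"
| "start v (x # xs) = start (src x) xs"

lemma is_path_append: "is_path v (xs @ ys) \<longleftrightarrow> is_path v xs \<and> is_path (start v xs) ys"
  by (induction xs arbitrary: v) auto

lemma start_append: "start v (xs @ ys) = start (start v xs) ys"
  by (induction xs arbitrary: v) auto

typedef (overloaded) ('f::field) path_alg =
  "{x :: path \<Rightarrow> 'f. finite {p. x p \<noteq> 0} \<and> (\<forall>v xs. x (v, xs) \<noteq> 0 \<longrightarrow> is_path v xs)}"
  morphisms coeff Abs_path_alg
  by (rule exI[of _ "\<lambda>_. 0"]) simp

setup_lifting type_definition_path_alg

lemma path_alg_eqI: "(\<And>v xs. coeff x (v, xs) = coeff y (v, xs)) \<Longrightarrow> x = y"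
  by (metis coeff_inject ext surj_pair)

lift_definition single :: "path \<Rightarrow> ('f::field) path_alg"
  is "\<lambda>p q. if q = p \<and> is_path (fst p) (snd p) then 1 else 0"
  by (auto split: if_splits)

abbreviation arr :: "arrow \<Rightarrow> ('f::field) path_alg" where
  "arr a \<equiv> single (tgt a, [a])"

lift_definition scale_path :: "'f::field \<Rightarrow> 'f path_alg \<Rightarrow> 'f path_alg"
  is "\<lambda>c x p. c * x p"
  by (auto elim: rev_finite_subset)

text \<open>The coefficient of a path in a product is the sum over all ways to cut the path in two.\<close>

instantiation path_alg :: (field) ring_1
begin

lift_definition zero_path_alg :: "'a path_alg" is "\<lambda>_. 0"
  by simp

lift_definition one_path_alg :: "'a path_alg" is "\<lambda>p. if snd p = [] then 1 else 0"
proof -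
  have "{p :: path. snd p = []} \<subseteq> (\<lambda>v. (v, [])) ` {V0, V1, V2, V3, V4, V5}"
    using vertex.exhaust by force
  then have "finite {p :: path. snd p = []}"
    by (rule finite_subset) simp
  then show "finite {p :: path. (if snd p = [] then 1 else (0 :: 'a)) \<noteq> 0} \<and>
      (\<forall>v xs. (if snd (v :: vertex, xs) = [] then 1 else (0 :: 'a)) \<noteq> 0 \<longrightarrow> is_path v xs)"
    by auto
qed

lift_definition plus_path_alg :: "'a path_alg \<Rightarrow> 'a path_alg \<Rightarrow> 'a path_alg"
  is "\<lambda>x y p. x p + y p"
proof (intro conjI allI impI)
  fix x y :: "path \<Rightarrow> 'a"
  assume x: "finite {p. x p \<noteq> 0} \<and> (\<forall>v xs. x (v, xs) \<noteq> 0 \<longrightarrow> is_path v xs)"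
    and y: "finite {p. y p \<noteq> 0} \<and> (\<forall>v xs. y (v, xs) \<noteq> 0 \<longrightarrow> is_path v xs)"
  show "finite {p. x p + y p \<noteq> 0}"
    by (rule finite_subset[of _ "{p. x p \<noteq> 0} \<union> {p. y p \<noteq> 0}"]) (use x y in auto)
  show "is_path v xs" if "x (v, xs) + y (v, xs) \<noteq> 0" for v xs
    using x y that by (metis add_0)
qed

lift_definition uminus_path_alg :: "'a path_alg \<Rightarrow> 'a path_alg"
  is "\<lambda>x p. - x p"
  by auto

definition minus_path_alg :: "'a path_alg \<Rightarrow> 'a path_alg \<Rightarrow> 'a path_alg" where
  "minus_path_alg x y = x + - y"

lift_definition times_path_alg :: "'a path_alg \<Rightarrow> 'a path_alg \<Rightarrow> 'a path_alg"
  is "\<lambda>x y (v, xs). \<Sum>i\<le>length xs. x (v, take i xs) * y (start v (take i xs), drop i xs)"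
proof (intro conjI allI impI)
  fix x y :: "path \<Rightarrow> 'a"
  assume x: "finite {p. x p \<noteq> 0} \<and> (\<forall>v xs. x (v, xs) \<noteq> 0 \<longrightarrow> is_path v xs)"
    and y: "finite {p. y p \<noteq> 0} \<and> (\<forall>v xs. y (v, xs) \<noteq> 0 \<longrightarrow> is_path v xs)"
  let ?z = "\<lambda>(v, xs). \<Sum>i\<le>length xs. x (v, take i xs) * y (start v (take i xs), drop i xs)"
  have cut: "\<exists>i\<le>length xs. x (v, take i xs) \<noteq> 0 \<and> y (start v (take i xs), drop i xs) \<noteq> 0"
    if nz: "?z (v, xs) \<noteq> 0" for v xs
  proof (rule ccontr)
    assume "\<not> ?thesis"
    then have "?z (v, xs) = 0"
      by (auto intro!: sum.neutral)
    with nz show False by blast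
  qed
  let ?S = "(\<lambda>((v, xs), (w, ys)). (v, xs @ ys)) ` ({p. x p \<noteq> 0} \<times> {p. y p \<noteq> 0})"
  have "{p. ?z p \<noteq> 0} \<subseteq> ?S"
  proof
    fix p assume "p \<in> {p. ?z p \<noteq> 0}"
    then have nz: "?z (fst p, snd p) \<noteq> 0" by simp
    then obtain i where "x (fst p, take i (snd p)) \<noteq> 0"
      "y (start (fst p) (take i (snd p)), drop i (snd p)) \<noteq> 0"
      using cut[OF nz] by blast
    then show "p \<in> ?S"
      by (intro image_eqI[of _ _ "((fst p, take i (snd p)), (start (fst p) (take i (snd p)), drop i (snd p)))"])
        auto
  qed
  then show "finite {p. ?z p \<noteq> 0}"
    by (rule finite_subset) (use x y in auto)
  fix v xs
  assume "?z (v, xs) \<noteq> 0"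
  from cut[OF this] obtain i where "x (v, take i xs) \<noteq> 0"
    "y (start v (take i xs), drop i xs) \<noteq> 0"
    by blast
  then have "is_path v (take i xs)" "is_path (start v (take i xs)) (drop i xs)"
    using x y by blast+
  then show "is_path v xs"
    using is_path_append[of v "take i xs" "drop i xs"] by simp
qed

instance
proof
  fix x y z :: "'a path_alg"
  show "x + y + z = x + (y + z)" by transfer (simp add: add.assoc)
  show "x + y = y + x" by transfer (simp add: add.commute)
  show "0 + x = x" by transfer simp
  show "- x + x = 0" by transfer simp
  show "x - y = x + - y" by (rule minus_path_alg_def)
  show "(0 :: 'a path_alg) \<noteq> 1"
    by transfer (auto simp: fun_eq_iff)
  show "(x + y) * z = x * z + y * z"
    by transfer (simp add: fun_eq_iff distrib_right sum.distrib)
  show "x * (y + z) = x * y + x * z"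
    by transfer (simp add: fun_eq_iff distrib_left sum.distrib)
  show "1 * x = x"
  proof (rule path_alg_eqI)
    fix v and xs :: "arrow list"
    have "coeff (1 * x) (v, xs)
        = (\<Sum>i\<le>length xs. if i = 0 then coeff x (v, xs) else 0)"
      unfolding times_path_alg.rep_eq one_path_alg.rep_eq prod.case
    proof (rule sum.cong)
      fix i assume "i \<in> {..length xs}"
      then show "(if snd (v, take i xs) = [] then 1 else 0) * coeff x (start v (take i xs), drop i xs)
          = (if i = 0 then coeff x (v, xs) else 0)"
        by (cases "i = 0") auto
    qed simp
    then show "coeff (1 * x) (v, xs) = coeff x (v, xs)" by simp
  qed
  show "x * 1 = x"
  proof (rule path_alg_eqI)
    fix v and xs :: "arrow list"
    have "coeff (x * 1) (v, xs)
        = (\<Sum>i\<le>length xs. if i = length xs then coeff x (v, xs) else 0)"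
      unfolding times_path_alg.rep_eq one_path_alg.rep_eq prod.case
    proof (rule sum.cong)
      fix i assume "i \<in> {..length xs}"
      then show "coeff x (v, take i xs) * (if snd (start v (take i xs), drop i xs) = [] then 1 else 0)
          = (if i = length xs then coeff x (v, xs) else 0)"
        by (cases "i = length xs") simp_all
    qed simp
    then show "coeff (x * 1) (v, xs) = coeff x (v, xs)" by simp
  qed
  show "x * y * z = x * (y * z)"
  proof (rule path_alg_eqI)
    fix v and xs :: "arrow list"
    let ?n = "length xs"
    define g where "g j k = coeff x (v, take j xs) *
      coeff y (start v (take j xs), take k (drop j xs)) *
      coeff z (start v (take (j + k) xs), drop (j + k) xs)" for j k
    have st: "start (start v (take j xs)) (take k (drop j xs)) = start v (take (j + k) xs)" for j k
      by (metis start_append take_add)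
    have "coeff (x * y * z) (v, xs) = (\<Sum>i\<le>?n. \<Sum>j\<le>i. g j (i - j))"
      unfolding times_path_alg.rep_eq prod.case sum_distrib_right
      by (intro sum.cong refl) (auto simp: g_def drop_take min_absorb1 min_absorb2)
    also have "\<dots> = (\<Sum>j\<le>?n. \<Sum>k\<le>?n - j. g j k)"
    proof -
      have "(\<Sum>(j, k)\<in>{(j, k). j + k \<le> ?n}. g j k) = (\<Sum>i\<le>?n. \<Sum>j\<le>i. g j (i - j))"
        by (rule sum.triangle_reindex_eq)
      moreover have "{(j, k). j + k \<le> ?n} = Sigma {..?n} (\<lambda>j. {..?n - j})"
        by auto
      ultimately show ?thesis
        by (simp add: sum.Sigma)
    qed
    also have "\<dots> = coeff (x * (y * z)) (v, xs)"
      unfolding times_path_alg.rep_eq prod.case sum_distrib_left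
      by (intro sum.cong) (auto simp: g_def st mult.assoc add.commute)
    finally show "coeff (x * y * z) (v, xs) = coeff (x * (y * z)) (v, xs)" .
  qed
qed

end

global_interpretation path_vs: vector_space "scale_path :: 'f::field \<Rightarrow> 'f path_alg \<Rightarrow> 'f path_alg"
  by unfold_locales (transfer, simp add: fun_eq_iff algebra_simps)+

lemma scale_path_mult_left: "scale_path c x * y = scale_path c (x * y)"
  by transfer (simp add: fun_eq_iff sum_distrib_left mult.assoc)

lemma scale_path_eq_mult: "scale_path c x = scale_path c 1 * x"
  by (simp add: scale_path_mult_left)

text \<open>The path algebra is the tensor algebra of \<open>V\<close> over \<open>k\<close>: products of paths are tensors over
  \<open>k\<close>, and \<open>tens_pow n\<close> is the \<open>n\<close>-fold tensor power of \<open>V\<close> over \<open>k\<close>. In particular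
  \<open>tens_pow 0 = k\<close> and \<open>tens_pow 1 = V\<close>.\<close>

definition tens_pow :: "nat \<Rightarrow> ('f::field) path_alg set" where
  "tens_pow n = path_vs.span {single (v, xs) | v xs. is_path v xs \<and> length xs = n}"

section \<open>The preprojective algebra\<close>

fun sigma :: "vertex \<Rightarrow> ('f::field) path_alg" where
  "sigma V0 = - (arr B0 * arr A0)"
| "sigma V1 = - (arr B1 * arr A1)"
| "sigma V2 = arr A1 * arr B1 - arr B2 * arr A2"
| "sigma V3 = arr A0 * arr B0 + arr A2 * arr B2 - arr B3 * arr A3"
| "sigma V4 = arr A3 * arr B3 - arr B4 * arr A4"
| "sigma V5 = arr A4 * arr B4"

definition rels :: "('f::field) path_alg set" where
  "rels = path_vs.span (range sigma)"

inductive_set ideal_gen :: "'r::ring_1 set \<Rightarrow> 'r set" for S :: "'r set" where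
  zero: "0 \<in> ideal_gen S"
| gen: "s \<in> S \<Longrightarrow> s \<in> ideal_gen S"
| add: "x \<in> ideal_gen S \<Longrightarrow> y \<in> ideal_gen S \<Longrightarrow> x + y \<in> ideal_gen S"
| left: "x \<in> ideal_gen S \<Longrightarrow> a * x \<in> ideal_gen S"
| right: "x \<in> ideal_gen S \<Longrightarrow> x * a \<in> ideal_gen S"

lemma ideal_gen_uminus: "x \<in> ideal_gen S \<Longrightarrow> - x \<in> ideal_gen S"
  using ideal_gen.left[of x S "- 1"] by simp

lemma ideal_gen_minus_add:
  "x - y \<in> ideal_gen S \<Longrightarrow> y - z \<in> ideal_gen S \<Longrightarrow> x - z \<in> ideal_gen S"
  using ideal_gen.add[of "x - y" S "y - z"] by simp

quotient_type (overloaded) 'f preproj = "('f::field) path_alg" / "\<lambda>x y. x - y \<in> ideal_gen rels"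
proof (rule equivpI)
  show "reflp (\<lambda>x y :: 'f path_alg. x - y \<in> ideal_gen rels)"
    by (auto intro!: reflpI ideal_gen.zero)
  show "symp (\<lambda>x y :: 'f path_alg. x - y \<in> ideal_gen rels)"
    by (metis (lifting) ideal_gen_uminus minus_diff_eq sympI)
  show "transp (\<lambda>x y :: 'f path_alg. x - y \<in> ideal_gen rels)"
    by (auto intro!: transpI intro: ideal_gen_minus_add)
qed

lemma coeff_trivial_mult:
  "coeff (x * y) (v, []) = coeff x (v, []) * coeff y (v, [])"
  by (simp add: times_path_alg.rep_eq)

lemma coeff_minus: "coeff (x - y) p = coeff x p - coeff y p"
  by (simp only: minus_path_alg_def plus_path_alg.rep_eq uminus_path_alg.rep_eq diff_conv_add_uminus)

lemma coeff_trivial_rels: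
  assumes "x \<in> rels"
  shows "coeff x (v, []) = 0"
  using assms unfolding rels_def
proof (induction rule: path_vs.span_induct_alt)
  case base
  then show ?case by (simp add: zero_path_alg.rep_eq)
next
  case (step c x y)
  have "coeff (sigma w) (v, []) = 0" for w
    by (cases w) (simp_all add: coeff_minus plus_path_alg.rep_eq uminus_path_alg.rep_eq
        coeff_trivial_mult single.rep_eq)
  with step show ?case
    by (auto simp: plus_path_alg.rep_eq scale_path.rep_eq)
qed

lemma coeff_trivial_ideal: "x \<in> ideal_gen rels \<Longrightarrow> coeff x (v, []) = 0"
  by (induction rule: ideal_gen.induct)
    (simp_all add: coeff_trivial_rels coeff_trivial_mult plus_path_alg.rep_eq zero_path_alg.rep_eq)

instantiation preproj :: (field) ring_1
begin

lift_definition zero_preproj :: "'a preproj" is 0 .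
lift_definition one_preproj :: "'a preproj" is 1 .

lift_definition plus_preproj :: "'a preproj \<Rightarrow> 'a preproj \<Rightarrow> 'a preproj" is "(+)"
  by (metis add_diff_add ideal_gen.add)

lift_definition uminus_preproj :: "'a preproj \<Rightarrow> 'a preproj" is uminus
  by (metis ideal_gen_uminus minus_diff_minus)

lift_definition minus_preproj :: "'a preproj \<Rightarrow> 'a preproj \<Rightarrow> 'a preproj" is "(-)"
proof -
  fix x x' y y' :: "'a path_alg"
  assume "x - x' \<in> ideal_gen rels" "y - y' \<in> ideal_gen rels"
  then have "(x - x') + - (y - y') \<in> ideal_gen rels"
    by (intro ideal_gen.add ideal_gen_uminus)
  then show "x - y - (x' - y') \<in> ideal_gen rels"
    by (simp add: algebra_simps)
qed

lift_definition times_preproj :: "'a preproj \<Rightarrow> 'a preproj \<Rightarrow> 'a preproj" is "(*)"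
proof -
  fix x x' y y' :: "'a path_alg"
  assume "x - x' \<in> ideal_gen rels" "y - y' \<in> ideal_gen rels"
  then have "(x - x') * y + x' * (y - y') \<in> ideal_gen rels"
    by (intro ideal_gen.add ideal_gen.left ideal_gen.right)
  then show "x * y - x' * y' \<in> ideal_gen rels"
    by (simp add: algebra_simps)
qed

instance
proof
  fix x y z :: "'a preproj"
  show "x + y + z = x + (y + z)" by transfer (simp add: add.assoc ideal_gen.zero)
  show "x + y = y + x" by transfer (simp add: add.commute ideal_gen.zero)
  show "0 + x = x" by transfer (simp add: ideal_gen.zero)
  show "- x + x = 0" by transfer (simp add: ideal_gen.zero)
  show "x - y = x + - y" by transfer (simp add: ideal_gen.zero)
  show "(x + y) * z = x * z + y * z" by transfer (simp add: distrib_right ideal_gen.zero)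
  show "x * (y + z) = x * y + x * z" by transfer (simp add: distrib_left ideal_gen.zero)
  show "1 * x = x" by transfer (simp add: ideal_gen.zero)
  show "x * 1 = x" by transfer (simp add: ideal_gen.zero)
  show "x * y * z = x * (y * z)" by transfer (simp add: mult.assoc ideal_gen.zero)
  show "(0 :: 'a preproj) \<noteq> 1"
  proof transfer
    show "0 - 1 \<notin> ideal_gen (rels :: 'a path_alg set)"
    proof
      assume "0 - 1 \<in> ideal_gen (rels :: 'a path_alg set)"
      from coeff_trivial_ideal[OF this, of V0] show False
        by (simp add: uminus_path_alg.rep_eq one_path_alg.rep_eq)
    qed
  qed
qed

end

lift_definition scale_preproj :: "'f::field \<Rightarrow> 'f preproj \<Rightarrow> 'f preproj" is scale_path
  by (metis ideal_gen.left path_vs.scale_right_diff_distrib scale_path_eq_mult)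

abbreviation proj :: "('f::field) path_alg \<Rightarrow> 'f preproj" where
  "proj \<equiv> abs_preproj"

abbreviation arrA :: "arrow \<Rightarrow> ('f::field) preproj" where
  "arrA a \<equiv> proj (arr a)"

definition preproj_deg :: "nat \<Rightarrow> ('f::field) preproj set" where
  "preproj_deg r = proj ` tens_pow r"

section \<open>Cohomology of a complex of vector spaces\<close>

text \<open>\<open>C p\<close> is the term of degree \<open>p \<ge> 0\<close> and \<open>d p\<close> the differential from \<open>C p\<close> to
  \<open>C (p + 1)\<close>.\<close>

definition quot_space :: "('f, 'm) module \<Rightarrow> 'm set \<Rightarrow> ('f, 'm set) module" where
  "quot_space M U = \<lparr>carrier = a_rcosets\<^bsub>M\<^esub> U, mult = undefined, one = undefined,
     zero = U, add = set_add M, smult = \<lambda>c X. \<Union>x\<in>X. a_r_coset M U (c \<odot>\<^bsub>M\<^esub> x)\<rparr>"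

definition cocycles :: "(nat \<Rightarrow> ('f, 'm) module) \<Rightarrow> (nat \<Rightarrow> 'm \<Rightarrow> 'm) \<Rightarrow> nat \<Rightarrow> 'm set" where
  "cocycles C d p = {x \<in> carrier (C p). d p x = \<zero>\<^bsub>C (Suc p)\<^esub>}"

definition coboundaries :: "(nat \<Rightarrow> ('f, 'm) module) \<Rightarrow> (nat \<Rightarrow> 'm \<Rightarrow> 'm) \<Rightarrow> nat \<Rightarrow> 'm set" where
  "coboundaries C d p = (case p of 0 \<Rightarrow> {\<zero>\<^bsub>C 0\<^esub>} | Suc q \<Rightarrow> d q ` carrier (C q))"

definition cohomology ::
  "(nat \<Rightarrow> ('f, 'm) module) \<Rightarrow> (nat \<Rightarrow> 'm \<Rightarrow> 'm) \<Rightarrow> nat \<Rightarrow> ('f, 'm set) module" where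
  "cohomology C d p = quot_space (C p\<lparr>carrier := cocycles C d p\<rparr>) (coboundaries C d p)"

definition cohomology_class ::
  "(nat \<Rightarrow> ('f, 'm) module) \<Rightarrow> (nat \<Rightarrow> 'm \<Rightarrow> 'm) \<Rightarrow> nat \<Rightarrow> 'm \<Rightarrow> 'm set" where
  "cohomology_class C d p x = a_r_coset (C p) (coboundaries C d p) x"

text \<open>The canonical identification of the \<open>p\<close>-th cohomology with a part \<open>S\<close> of \<open>C p\<close>:
  every element of \<open>S\<close> is a cocycle, and \<open>x \<mapsto> [x]\<close> is a bijection from \<open>S\<close> onto the
  cohomology. For \<open>S = carrier (C p)\<close> this says that the differentials into and out of
  \<open>C p\<close> vanish.\<close>

definition canonically_equal ::
  "(nat \<Rightarrow> ('f, 'm) module) \<Rightarrow> (nat \<Rightarrow> 'm \<Rightarrow> 'm) \<Rightarrow> nat \<Rightarrow> 'm set \<Rightarrow> bool" where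
  "canonically_equal C d p S \<longleftrightarrow> S \<subseteq> cocycles C d p \<and>
     bij_betw (cohomology_class C d p) S (carrier (cohomology C d p))"

section \<open>Koszul cohomology\<close>

definition W :: "nat \<Rightarrow> ('f::field) path_alg set" where
  "W p = (if p < 2 then tens_pow p else
     (\<Inter>(i, j)\<in>{(i, j). i + 2 + j = p}.
        path_vs.span {x * r * y | x r y. x \<in> tens_pow i \<and> r \<in> rels \<and> y \<in> tens_pow j}))"

type_synonym 'f cochain = "'f path_alg \<Rightarrow> 'f preproj"

text \<open>\<open>k\<^sup>e\<close>-linear maps from \<open>W p\<close> to \<open>A\<close>, extended by \<open>0\<close> outside of \<open>W p\<close>.
  Linearity over the ground field is the case \<open>u = scale_path c 1\<close>, \<open>v = 1\<close>.\<close>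

definition Hom_W :: "nat \<Rightarrow> ('f::field, 'f cochain) module" where
  "Hom_W p = \<lparr>carrier = {f. (\<forall>w. w \<notin> W p \<longrightarrow> f w = 0) \<and>
       (\<forall>x\<in>W p. \<forall>y\<in>W p. f (x + y) = f x + f y) \<and>
       (\<forall>x\<in>W p. \<forall>u\<in>W 0. \<forall>v\<in>W 0. f (u * x * v) = proj u * f x * proj v)},
     mult = undefined, one = undefined, zero = \<lambda>_. 0, add = \<lambda>f g w. f w + g w,
     smult = \<lambda>c f w. scale_preproj c (f w)\<rparr>"

text \<open>The value of \<open>f \<otimes> g\<close>, followed by the multiplication of \<open>A\<close>, at \<open>w\<close>. For
  \<open>k\<close>-subbimodules \<open>X\<close>, \<open>Y\<close> of tensor powers of \<open>V\<close> the product map from \<open>X \<otimes>\<^sub>k Y\<close> to the path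
  algebra is injective (\<open>k\<close> is semisimple), so for \<open>k\<close>-bilinear \<open>f\<close>, \<open>g\<close> the result does not
  depend on the way \<open>w\<close> is written as a sum of products \<open>x y\<close>. Such a decomposition exists for
  \<open>w \<in> W (p + q)\<close>, \<open>X = W p\<close>, \<open>Y = W q\<close>.\<close>

definition tensor_eval :: "('f::field) path_alg set \<Rightarrow> 'f cochain \<Rightarrow> 'f path_alg set \<Rightarrow> 'f cochain
    \<Rightarrow> 'f path_alg \<Rightarrow> 'f preproj" where
  "tensor_eval X f Y g w = (THE c. \<exists>ps. set ps \<subseteq> X \<times> Y \<and>
     w = (\<Sum>(x, y)\<leftarrow>ps. x * y) \<and> c = (\<Sum>(x, y)\<leftarrow>ps. f x * g y))"

text \<open>The inclusion of \<open>V\<close> into \<open>A\<close>, that is, the fundamental 1-cocycle of \<open>A\<close>.\<close>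

definition fund :: "('f::field) cochain" where
  "fund x = (if x \<in> W 1 then proj x else 0)"

definition b_K :: "nat \<Rightarrow> ('f::field) cochain \<Rightarrow> 'f cochain" where
  "b_K p f w = (if w \<in> W (Suc p)
     then tensor_eval (W p) f (W 1) fund w - (- 1) ^ p * tensor_eval (W 1) fund (W p) f w else 0)"

definition cup :: "nat \<Rightarrow> nat \<Rightarrow> ('f::field) cochain \<Rightarrow> 'f cochain \<Rightarrow> 'f cochain" where
  "cup p q f g w = (if w \<in> W (p + q)
     then (- 1) ^ (p * q) * tensor_eval (W p) f (W q) g w else 0)"

definition HK :: "nat \<Rightarrow> ('f::field, 'f cochain set) module" where
  "HK = cohomology Hom_W b_K"

definition HK_class :: "nat \<Rightarrow> ('f::field) cochain \<Rightarrow> 'f cochain set" where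
  "HK_class = cohomology_class Hom_W b_K"

definition HK_deg :: "nat \<Rightarrow> nat \<Rightarrow> ('f::field) cochain set set" where
  "HK_deg p r = {HK_class p f | f. f \<in> cocycles Hom_W b_K p \<and> f ` W p \<subseteq> preproj_deg r}"

definition cup_HK :: "nat \<Rightarrow> nat \<Rightarrow> ('f::field) cochain set \<Rightarrow> 'f cochain set \<Rightarrow> 'f cochain set" where
  "cup_HK p q X Y = (\<Union>f\<in>X. \<Union>g\<in>Y. HK_class (p + q) (cup p q f g))"

section \<open>Higher Koszul cohomology\<close>

definition d_hi :: "nat \<Rightarrow> ('f::field) cochain set \<Rightarrow> 'f cochain set" where
  "d_hi p X = cup_HK 1 p (HK_class 1 fund) X"

definition HK_hi :: "nat \<Rightarrow> ('f::field, 'f cochain set set) module" where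
  "HK_hi = cohomology HK d_hi"

definition HK_hi_class :: "nat \<Rightarrow> ('f::field) cochain set \<Rightarrow> 'f cochain set set" where
  "HK_hi_class = cohomology_class HK d_hi"

section \<open>Elements\<close>

definition c0 :: "('f::field) preproj" where "c0 = arrA A0 * arrA B0"
definition c2 :: "('f::field) preproj" where "c2 = arrA A2 * arrA B2"
definition c3 :: "('f::field) preproj" where "c3 = arrA B3 * arrA A3"

definition pi0 :: "('f::field) preproj" where "pi0 = arrA B0 * c3\<^sup>2 * c0 * c3 * arrA A0"
definition pi3 :: "('f::field) preproj" where "pi3 = c3 * (c0 * c3)\<^sup>2"

text \<open>The 0-cochain with which an element \<open>z\<close> of the centre of \<open>A\<close> is identified.\<close>

definition central_cochain :: "('f::field) preproj \<Rightarrow> 'f cochain" where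
  "central_cochain z u = (if u \<in> W 0 then z * proj u else 0)"

text \<open>The linear map on \<open>V\<close> with the given values on the arrows.\<close>

definition on_arrows :: "(arrow \<Rightarrow> 'f preproj) \<Rightarrow> ('f::field) cochain" where
  "on_arrows h x =
     (if x \<in> W 1 then \<Sum>a\<in>UNIV. scale_preproj (coeff x (tgt a, [a])) (h a) else 0)"

definition rho5 :: "('f::field) cochain" where
  "rho5 = on_arrows (\<lambda>a. case a of
       A0 \<Rightarrow> c2 * c3 * arrA A0
     | A1 \<Rightarrow> arrA B2 * c0 * arrA A2 * arrA A1
     | A2 \<Rightarrow> c2 * c0 * arrA A2
     | B0 \<Rightarrow> - (arrA B0 * c3\<^sup>2)
     | B1 \<Rightarrow> - (arrA B1 * arrA B2 * c0 * arrA A2)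
     | B2 \<Rightarrow> arrA B2 * c3\<^sup>2
     | _ \<Rightarrow> 0)"

end

theory Submission
  imports Defs "HOL-Library.Code_Binary_Nat"
begin

text \<open>The algebra \<open>A\<close> has a basis of 156 paths, on which the arrows act with integer coefficients.
  The tables below satisfy the relations and thus define a representation on coordinate vectors; since
  the relations also suffice to rewrite every path into the basis, this representation is faithful,
  and equations in \<open>A\<close> can be tested on coordinates, in every characteristic.

  As \<open>W p\<close> vanishes for \<open>p \<ge> 3\<close>, only the degrees 0, 1 and 2 matter. The quiver is bipartite, so in
  characteristic 2 the class of \<open>fund\<close> is zero and so is the differential \<open>d_hi\<close>. If 2 is
  invertible, the linear system for a 1-cocycle, solved separately in each path length, shows that up to coboundaries
  it has the form \<open>fund \<smile> z + l \<rho>\<^sub>5\<close> with \<open>z\<close> central and \<open>3 l = 0\<close>, and that \<open>fund \<smile> z\<close>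
  is a coboundary only for \<open>z\<close> in the span of \<open>\<pi>\<^sub>0\<close> and \<open>\<pi>\<^sub>3\<close>. Since \<open>fund \<smile> \<rho>\<^sub>5\<close> is a coboundary in
  characteristic 3, \<open>d_hi\<close> vanishes in degree 1.\<close>

section \<open>Quotients and cohomology\<close>

text \<open>Degree 2 is settled without computing \<open>HK 2\<close>. Since \<open>d_hi\<close>
  sends the class of a central \<open>z\<close> to that of \<open>fund \<smile> z\<close>, the
  normal form of 1-cocycles says that \<open>HK 1\<close> is the image of \<open>d_hi\<close> plus
  multiples of the class of \<open>rho5\<close>. This bounds the cohomology in degree 1, and
  \<open>d_hi\<close> is zero on all of \<open>HK 1\<close> as soon as it kills \<open>rho5\<close>;
  as degree 3 is zero, both differentials at \<open>HK 2\<close> then vanish. The obstacle is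
  arithmetic over all fields at once. Rewriting shows only that the 156 paths span; independence
  comes from the matrices, whose relations are checked over the integers and hence hold in every
  ring. The number 156 is h (h + 1) r / 6 for the Coxeter number h = 12 and the rank r = 6; the
  longest nonzero paths have length h - 2 = 10. The prime 3 enters through a single combination of
  cocycle equations, which reads \<open>3 * l = 0\<close>. The prime 2 enters because
  \<open>fund \<smile> z\<close> has the same scalars at an arrow and at its reverse, while inner
  derivations contribute opposite ones.\<close>

locale quotient_module = M: Module.module class_ring M for M :: "('f::field, 'm) module" +
  fixes U
  assumes U_subset: "U \<subseteq> carrier M"
    and U_zero: "\<zero>\<^bsub>M\<^esub> \<in> U"
    and U_add: "x \<in> U \<Longrightarrow> y \<in> U \<Longrightarrow> x \<oplus>\<^bsub>M\<^esub> y \<in> U"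
    and U_smult: "x \<in> U \<Longrightarrow> c \<odot>\<^bsub>M\<^esub> x \<in> U"
begin

abbreviation cls where "cls \<equiv> a_r_coset M U"

lemma minus_one_smult:
  assumes "x \<in> carrier M"
  shows "(- 1) \<odot>\<^bsub>M\<^esub> x = \<ominus>\<^bsub>M\<^esub> x"
  using M.smult_l_minus[of 1 x] M.smult_one[of x] assms by (simp add: class_ring_simps)

lemma abelian_subgroup_U: "abelian_subgroup U M"
proof (rule abelian_subgroupI3)
  have neg: "\<ominus>\<^bsub>M\<^esub> x \<in> U" if "x \<in> U" for x
    using U_smult[OF that, of "- 1"] U_subset that by (auto simp: minus_one_smult)
  show "additive_subgroup U M"
    by (rule additive_subgroupI, rule subgroup.intro)
      (use U_subset U_add U_zero neg in \<open>auto simp: a_inv_def[symmetric]\<close>)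
  show "abelian_group M" by (rule M.abelian_group_axioms)
qed

sublocale A: abelian_subgroup U M
  by (rule abelian_subgroup_U)

lemma carrier_quot: "carrier (quot_space M U) = cls ` carrier M"
  by (auto simp: quot_space_def A_RCOSETS_def')

lemma zero_quot: "\<zero>\<^bsub>quot_space M U\<^esub> = cls \<zero>\<^bsub>M\<^esub>"
  using U_subset by (simp add: quot_space_def M.a_coset_add_zero)

lemma cls_eq_iff:
  assumes "x \<in> carrier M" "y \<in> carrier M"
  shows "cls x = cls y \<longleftrightarrow> x \<ominus>\<^bsub>M\<^esub> y \<in> U"
proof -
  have "cls x = cls y \<longleftrightarrow> x \<in> cls y"
    using A.a_rcos_self[OF assms(1)] A.a_repr_independence'[OF _ assms(2), of x] by metis
  also have "\<dots> \<longleftrightarrow> x \<oplus>\<^bsub>M\<^esub> \<ominus>\<^bsub>M\<^esub> y \<in> U"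
    using A.a_rcos_module[OF assms(2,1)] by simp
  finally show ?thesis by (simp add: a_minus_def)
qed

lemma cls_eq_zero_iff:
  assumes "x \<in> carrier M"
  shows "cls x = cls \<zero>\<^bsub>M\<^esub> \<longleftrightarrow> x \<in> U"
  using cls_eq_iff[OF assms M.zero_closed] assms by (simp add: a_minus_def M.add.inv_one[folded a_inv_def])

lemma add_quot:
  assumes "x \<in> carrier M" "y \<in> carrier M"
  shows "cls x \<oplus>\<^bsub>quot_space M U\<^esub> cls y = cls (x \<oplus>\<^bsub>M\<^esub> y)"
  using A.a_rcos_sum[OF assms] by (simp add: quot_space_def)

lemma cls_add_U:
  assumes "x \<in> carrier M" "y \<in> cls x"
  shows "cls y = cls x"
  using A.a_repr_independence'[OF assms(2,1)] by simp

text \<open>\<open>quot_space\<close> scales a coset by a union over its elements. The union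
  collapses: for \<open>y\<close> equal to \<open>x\<close> plus an element \<open>u\<close> of
  \<open>U\<close>, the scaled elements differ by a multiple of \<open>u\<close>, so all cosets in
  the union coincide.\<close>

lemma smult_quot:
  assumes x: "x \<in> carrier M"
  shows "c \<odot>\<^bsub>quot_space M U\<^esub> cls x = cls (c \<odot>\<^bsub>M\<^esub> x)"
proof -
  have "cls (c \<odot>\<^bsub>M\<^esub> y) = cls (c \<odot>\<^bsub>M\<^esub> x)" if y: "y \<in> cls x" for y
  proof -
    obtain u where u: "u \<in> U" "y = u \<oplus>\<^bsub>M\<^esub> x"
      using y by (auto simp: a_r_coset_def')
    then have "c \<odot>\<^bsub>M\<^esub> y = (c \<odot>\<^bsub>M\<^esub> u) \<oplus>\<^bsub>M\<^esub> (c \<odot>\<^bsub>M\<^esub> x)"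
      using x U_subset M.smult_r_distr[of c u x] by auto
    then have "c \<odot>\<^bsub>M\<^esub> y \<in> cls (c \<odot>\<^bsub>M\<^esub> x)"
      using U_smult[OF u(1)] by (auto simp: a_r_coset_def')
    then show ?thesis
      using x by (intro cls_add_U) auto
  qed
  then have "(\<Union>y\<in>cls x. cls (c \<odot>\<^bsub>M\<^esub> y)) = cls (c \<odot>\<^bsub>M\<^esub> x)"
    using A.a_rcos_self[OF x] by blast
  then show ?thesis by (simp add: quot_space_def)
qed

lemma module_quot: "Module.module class_ring (quot_space M U)"
proof -
  let ?Q = "quot_space M U"
  have c: "X \<in> carrier ?Q \<longleftrightarrow> (\<exists>x\<in>carrier M. X = cls x)" for X
    by (auto simp: carrier_quot)
  have ab: "abelian_group ?Q"
  proof (rule abelian_groupI)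
    fix X Y assume "X \<in> carrier ?Q" "Y \<in> carrier ?Q"
    then show "X \<oplus>\<^bsub>?Q\<^esub> Y \<in> carrier ?Q" "X \<oplus>\<^bsub>?Q\<^esub> Y = Y \<oplus>\<^bsub>?Q\<^esub> X"
      unfolding c by (auto simp: add_quot M.a_comm)
    fix Z assume "Z \<in> carrier ?Q"
    with \<open>X \<in> carrier ?Q\<close> \<open>Y \<in> carrier ?Q\<close>
    show "X \<oplus>\<^bsub>?Q\<^esub> Y \<oplus>\<^bsub>?Q\<^esub> Z = X \<oplus>\<^bsub>?Q\<^esub> (Y \<oplus>\<^bsub>?Q\<^esub> Z)"
      unfolding c by (auto simp: add_quot M.a_assoc)
  next
    show "\<zero>\<^bsub>?Q\<^esub> \<in> carrier ?Q" by (auto simp: c zero_quot)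
    fix X assume "X \<in> carrier ?Q"
    then obtain x where x: "x \<in> carrier M" "X = cls x" by (auto simp: c)
    then show "\<zero>\<^bsub>?Q\<^esub> \<oplus>\<^bsub>?Q\<^esub> X = X" by (simp add: zero_quot add_quot)
    show "\<exists>Y\<in>carrier ?Q. Y \<oplus>\<^bsub>?Q\<^esub> X = \<zero>\<^bsub>?Q\<^esub>"
      by (rule bexI[of _ "cls (\<ominus>\<^bsub>M\<^esub> x)"]) (use x in \<open>auto simp: c zero_quot add_quot M.l_neg\<close>)
  qed
  show ?thesis
    by (rule moduleI) (use ab M.smult_l_distr M.smult_r_distr M.smult_assoc1 M.smult_one in
      \<open>auto simp: c add_quot smult_quot M.R.is_cring\<close>)
qed

end

text \<open>Interpreted twice: for Koszul cochains with \<open>b_K\<close>, and for the spaces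
  \<open>HK p\<close> with \<open>d_hi\<close>, whose vectors are themselves cosets.\<close>

locale cochain_complex =
  fixes C :: "nat \<Rightarrow> ('f::field, 'm) module" and d :: "nat \<Rightarrow> 'm \<Rightarrow> 'm"
  assumes module_C: "Module.module class_ring (C p)"
    and d_closed: "x \<in> carrier (C p) \<Longrightarrow> d p x \<in> carrier (C (Suc p))"
    and d_add: "x \<in> carrier (C p) \<Longrightarrow> y \<in> carrier (C p) \<Longrightarrow>
      d p (x \<oplus>\<^bsub>C p\<^esub> y) = d p x \<oplus>\<^bsub>C (Suc p)\<^esub> d p y"
    and d_smult: "x \<in> carrier (C p) \<Longrightarrow> d p (c \<odot>\<^bsub>C p\<^esub> x) = c \<odot>\<^bsub>C (Suc p)\<^esub> d p x"
    and d_d: "x \<in> carrier (C p) \<Longrightarrow> d (Suc p) (d p x) = \<zero>\<^bsub>C (Suc (Suc p))\<^esub>"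
begin

sublocale C: Module.module class_ring "C p" for p
  by (rule module_C)

lemma d_zero: "d p \<zero>\<^bsub>C p\<^esub> = \<zero>\<^bsub>C (Suc p)\<^esub>"
proof -
  have "d p \<zero>\<^bsub>C p\<^esub> = d p (0 \<odot>\<^bsub>C p\<^esub> \<zero>\<^bsub>C p\<^esub>)"
    using C.smult_r_null[of 0 p] by simp
  also have "\<dots> = 0 \<odot>\<^bsub>C (Suc p)\<^esub> d p \<zero>\<^bsub>C p\<^esub>" by (rule d_smult) simp
  finally show ?thesis
    using C.smult_l_null[OF d_closed[OF C.M.zero_closed[of p]], unfolded class_ring_simps] by metis
qed

lemma coboundaries_subset: "coboundaries C d p \<subseteq> cocycles C d p"
  by (cases p) (auto simp: coboundaries_def cocycles_def d_zero d_closed d_d)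

abbreviation Zmod where "Zmod p \<equiv> C p\<lparr>carrier := cocycles C d p\<rparr>"

lemma module_Z: "Module.module class_ring (Zmod p)"
proof -
  have sub: "LinearCombinations.submodule class_ring (cocycles C d p) (C p)"
  proof (rule LinearCombinations.submodule.intro)
    show "Module.module class_ring (C p)" by (rule module_C)
  qed (auto simp: cocycles_def d_zero d_add d_smult)
  show ?thesis
    by (rule C.submodule_is_module[OF sub])
qed

lemma cocycles_carrier: "x \<in> cocycles C d p \<Longrightarrow> x \<in> carrier (C p)"
  by (simp add: cocycles_def)

lemma coboundaries_zero: "\<zero>\<^bsub>C p\<^esub> \<in> coboundaries C d p"
  by (cases p) (auto simp: coboundaries_def d_zero[symmetric] intro!: imageI)

lemma quotient_module_Z: "quotient_module (Zmod p) (coboundaries C d p)"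
proof -
  interpret Z: Module.module class_ring "Zmod p" by (rule module_Z)
  show ?thesis
  proof (unfold_locales, goal_cases)
    case 1 then show ?case using coboundaries_subset by simp
  next
    case 2 then show ?case by (simp add: coboundaries_zero)
  next
    case (3 x y)
    then show ?case
      by (cases p) (auto simp: coboundaries_def d_add[symmetric])
  next
    case (4 x c)
    then show ?case
      by (cases p) (auto simp: coboundaries_def d_smult[symmetric] C.smult_r_null[of c 0])
  qed
qed

sublocale Q: quotient_module "Zmod p" "coboundaries C d p" for p
  by (rule quotient_module_Z)

abbreviation H where "H p \<equiv> cohomology C d p"
abbreviation cl where "cl p \<equiv> cohomology_class C d p"

lemma cls_cl: "Q.cls p = cl p"
  by (simp add: cohomology_class_def a_r_coset_def r_coset_def fun_eq_iff)

lemma module_H: "Module.module class_ring (H p)"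
  unfolding cohomology_def by (rule Q.module_quot)

lemma carrier_H: "carrier (H p) = cl p ` cocycles C d p"
  using Q.carrier_quot[of p] by (simp add: cohomology_def cls_cl)

lemma zero_H: "\<zero>\<^bsub>H p\<^esub> = cl p \<zero>\<^bsub>C p\<^esub>"
  using Q.zero_quot[of p] by (simp add: cohomology_def cls_cl)

lemma add_H:
  "x \<in> cocycles C d p \<Longrightarrow> y \<in> cocycles C d p \<Longrightarrow> cl p x \<oplus>\<^bsub>H p\<^esub> cl p y = cl p (x \<oplus>\<^bsub>C p\<^esub> y)"
  using Q.add_quot[of x p y] by (simp add: cohomology_def cls_cl)

lemma smult_H:
  "x \<in> cocycles C d p \<Longrightarrow> c \<odot>\<^bsub>H p\<^esub> cl p x = cl p (c \<odot>\<^bsub>C p\<^esub> x)"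
  using Q.smult_quot[of x p c] by (simp add: cohomology_def cls_cl)

lemma cl_eq_zero_iff:
  "x \<in> cocycles C d p \<Longrightarrow> cl p x = \<zero>\<^bsub>H p\<^esub> \<longleftrightarrow> x \<in> coboundaries C d p"
  using Q.cls_eq_zero_iff[of x p] by (simp add: zero_H cls_cl)

lemma cl_self: "x \<in> cocycles C d p \<Longrightarrow> x \<in> cl p x"
  using Q.A.a_rcos_self[of x p] by (simp add: cls_cl)

lemma cl_memE:
  assumes "y \<in> cl p x"
  obtains u where "u \<in> coboundaries C d p" "y = u \<oplus>\<^bsub>C p\<^esub> x"
  using assms by (auto simp: cohomology_class_def a_r_coset_def')

lemma cl_add_coboundary:
  assumes "x \<in> cocycles C d p" "u \<in> coboundaries C d p"
  shows "cl p (u \<oplus>\<^bsub>C p\<^esub> x) = cl p x"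
proof (rule Q.cls_add_U[of x p, simplified cls_cl])
  show "u \<oplus>\<^bsub>C p\<^esub> x \<in> cl p x"
    using assms(2) by (auto simp: cohomology_class_def a_r_coset_def')
qed (use assms in simp)

lemma cocycles_add:
  "x \<in> cocycles C d p \<Longrightarrow> y \<in> cocycles C d p \<Longrightarrow> x \<oplus>\<^bsub>C p\<^esub> y \<in> cocycles C d p"
  using C.zero_closed[of "Suc p"] by (auto simp: cocycles_def d_add)

lemma cocycles_smult:
  "x \<in> cocycles C d p \<Longrightarrow> c \<odot>\<^bsub>C p\<^esub> x \<in> cocycles C d p"
  by (auto simp: cocycles_def d_smult)

text \<open>When zero is the only coboundary, a class has just one representative, so passing to
  classes is injective on cocycles.\<close>

lemma canonically_equal_cocycles:
  assumes "coboundaries C d p = {\<zero>\<^bsub>C p\<^esub>}"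
  shows "canonically_equal C d p (cocycles C d p)"
proof -
  have "inj_on (cl p) (cocycles C d p)"
  proof (rule inj_onI)
    fix x y assume xy: "x \<in> cocycles C d p" "y \<in> cocycles C d p" "cl p x = cl p y"
    then have "x \<in> cl p y" using cl_self by metis
    then show "x = y"
      using assms xy(2) by (auto elim!: cl_memE simp: cocycles_def)
  qed
  then show ?thesis
    by (simp add: canonically_equal_def bij_betw_def carrier_H)
qed

end

section \<open>Linear maps on the path algebra\<close>

lemma coeff_add: "coeff (x + y) p = coeff x p + coeff y p"
  by (simp add: plus_path_alg.rep_eq)

lemma coeff_zero [simp]: "coeff 0 p = 0"
  by (simp add: zero_path_alg.rep_eq)

lemma coeff_uminus: "coeff (- x) p = - coeff x p"
  by (simp add: uminus_path_alg.rep_eq)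

lemma coeff_scale: "coeff (scale_path c x) p = c * coeff x p"
  by (simp add: scale_path.rep_eq)

lemma coeff_single: "coeff (single (v, xs)) p = (if p = (v, xs) \<and> is_path v xs then 1 else 0)"
  by (simp add: single.rep_eq)

lemma coeff_sum: "coeff (\<Sum>i\<in>I. f i) p = (\<Sum>i\<in>I. coeff (f i) p)"
  by (induction I rule: infinite_finite_induct) (simp_all add: coeff_add)

lemma finite_support: "finite {p. coeff x p \<noteq> 0}"
  using coeff[of x] by simp

lemma is_path_coeff: "coeff x (v, xs) \<noteq> 0 \<Longrightarrow> is_path v xs"
  using coeff[of x] by auto

lemma path_alg_expand: "x = (\<Sum>p | coeff x p \<noteq> 0. scale_path (coeff x p) (single p))"
proof (rule path_alg_eqI)
  fix v xs
  have "coeff (\<Sum>p | coeff x p \<noteq> 0. scale_path (coeff x p) (single p)) (v, xs)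
      = (\<Sum>p | coeff x p \<noteq> 0. if p = (v, xs) then coeff x (v, xs) else 0)"
    unfolding coeff_sum by (rule sum.cong) (auto simp: coeff_scale coeff_single is_path_coeff split: if_splits)
  then show "coeff x (v, xs) = coeff (\<Sum>p | coeff x p \<noteq> 0. scale_path (coeff x p) (single p)) (v, xs)"
    by (simp add: finite_support)
qed

text \<open>The way to prove bilinear identities below: products of paths are explicit by
  \<open>single_mult\<close>, so a comparison on scaled paths suffices.\<close>

lemma path_alg_induct [case_names zero single add]:
  assumes "P 0" and "\<And>c v xs. is_path v xs \<Longrightarrow> P (scale_path c (single (v, xs)))"
    and "\<And>x y. P x \<Longrightarrow> P y \<Longrightarrow> P (x + y)"
  shows "P x"
proof -
  have "P (\<Sum>p\<in>S. scale_path (coeff x p) (single p))" if "finite S" "S \<subseteq> {p. coeff x p \<noteq> 0}" for S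
    using that
  proof (induction S)
    case (insert p S)
    then show ?case using assms(2)[of "fst p" "snd p"] assms(3) is_path_coeff[of x "fst p" "snd p"] by auto
  qed (simp add: assms)
  from this[OF finite_support[of x]] show ?thesis
    using path_alg_expand[of x] by simp
qed

lemma single_mult:
  assumes "is_path v xs" "is_path u ys"
  shows "single (v, xs) * single (u, ys) = (if start v xs = u then single (v, xs @ ys) else 0)"
proof (rule path_alg_eqI)
  fix w zs
  have "coeff (single (v, xs) * single (u, ys)) (w, zs) =
    (\<Sum>i\<le>length zs. if (v, xs) = (w, take i zs) \<and> (u, ys) = (start w (take i zs), drop i zs) then 1 else (0 :: 'a))"
    unfolding times_path_alg.rep_eq prod.case
    by (rule sum.cong) (use assms in \<open>auto simp: coeff_single\<close>)
  also have "\<dots> = (\<Sum>i\<le>length zs. if i = length xs then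
      (if v = w \<and> zs = xs @ ys \<and> u = start v xs then 1 else 0) else (0 :: 'a))"
    by (rule sum.cong) (auto simp: append_eq_conv_conj)
  also have "\<dots> = coeff (if start v xs = u then single (v, xs @ ys) else 0) (w, zs)"
    using assms by (auto simp: coeff_single is_path_append)
  finally show "coeff (single (v, xs) * single (u, ys)) (w, zs) =
    coeff (if start v xs = u then single (v, xs @ ys) else (0 :: 'a path_alg)) (w, zs)" .
qed

lemma scale_path_mult_right: "x * scale_path c y = scale_path c (x * (y :: 'f::field path_alg))"
  by (rule path_alg_eqI)
    (simp add: coeff_scale times_path_alg.rep_eq sum_distrib_left mult.left_commute)

abbreviation idem :: "vertex \<Rightarrow> ('f::field) path_alg" where
  "idem v \<equiv> single (v, [])"

lemma one_eq_sum_idem: "1 = idem V0 + idem V1 + idem V2 + idem V3 + idem V4 + idem V5"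
proof (rule path_alg_eqI)
  fix v xs show "coeff 1 (v, xs) = coeff (idem V0 + idem V1 + idem V2 + idem V3 + idem V4 + idem V5) (v, xs)"
    by (cases v) (auto simp: one_path_alg.rep_eq coeff_add coeff_single)
qed

text \<open>The scaling \<open>s\<close> is a parameter because two targets occur: the algebra
  \<open>preproj\<close> for cochains, and the field for the coordinates of an action.\<close>

definition lin_ext :: "('f \<Rightarrow> 'm \<Rightarrow> 'm) \<Rightarrow> (path \<Rightarrow> 'm) \<Rightarrow> ('f::field) path_alg \<Rightarrow> 'm::ab_group_add" where
  "lin_ext s F x = (\<Sum>p | coeff x p \<noteq> 0. s (coeff x p) (F p))"

context vector_space
begin

lemma lin_ext_superset:
  assumes "finite S" "{p. coeff x p \<noteq> 0} \<subseteq> S"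
  shows "lin_ext scale F x = (\<Sum>p\<in>S. coeff x p *s F p)"
  unfolding lin_ext_def using assms by (intro sum.mono_neutral_left) auto

lemma lin_ext_add: "lin_ext scale F (x + y) = lin_ext scale F x + lin_ext scale F y"
proof -
  let ?S = "{p. coeff x p \<noteq> 0} \<union> {p. coeff y p \<noteq> 0}"
  have f: "finite ?S" by (simp add: finite_support)
  show ?thesis
    by (subst (1 2 3) lin_ext_superset[OF f])
      (auto simp: coeff_add scale_left_distrib sum.distrib)
qed

lemma lin_ext_scale: "lin_ext scale F (scale_path c x) = c *s lin_ext scale F x"
  by (subst (1 2) lin_ext_superset[OF finite_support[of x]])
    (auto simp: coeff_scale scale_sum_right)

lemma lin_ext_zero: "lin_ext scale F 0 = 0"
  by (simp add: lin_ext_def)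

lemma lin_ext_single: "is_path v xs \<Longrightarrow> lin_ext scale F (single (v, xs)) = F (v, xs)"
  by (subst lin_ext_superset[of "{(v, xs)}"]) (auto simp: coeff_single split: if_splits)

end

lemma scale_preproj_proj: "scale_preproj c (proj x) = proj (scale_path c x)"
  by (simp add: scale_preproj.abs_eq)

lemma proj_add: "proj (x + y) = proj x + proj y"
  by (simp add: plus_preproj.abs_eq)

lemma proj_mult: "proj (x * y) = proj x * proj y"
  by (simp add: times_preproj.abs_eq)

lemma proj_zero: "proj 0 = 0"
  by (simp add: zero_preproj_def)

lemma proj_one: "proj 1 = 1"
  by (simp add: one_preproj_def)

lemma proj_eq_zero: "x \<in> ideal_gen rels \<Longrightarrow> proj x = 0"
  unfolding zero_preproj_def by (simp add: preproj.abs_eq_iff)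

lemma proj_surj: obtains x' where "x = proj x'"
  by (metis Quotient3_abs_rep Quotient3_preproj)

global_interpretation preproj_vs: vector_space "scale_preproj :: 'f::field \<Rightarrow> 'f preproj \<Rightarrow> 'f preproj"
proof
  fix a b :: 'f and x y :: "'f preproj"
  obtain x' y' where xy: "x = proj x'" "y = proj y'" using proj_surj by metis
  show "scale_preproj a (x + y) = scale_preproj a x + scale_preproj a y"
    "scale_preproj (a + b) x = scale_preproj a x + scale_preproj b x"
    "scale_preproj a (scale_preproj b x) = scale_preproj (a * b) x"
    "scale_preproj 1 x = x"
    by (simp_all add: xy scale_preproj_proj flip: proj_add)
      (simp_all add: path_vs.scale_right_distrib path_vs.scale_left_distrib)
qed

lemma scale_preproj_mult_left: "scale_preproj c x * y = scale_preproj c (x * y)"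
  by (rule proj_surj[of x], rule proj_surj[of y])
    (simp add: scale_preproj_proj scale_path_mult_left flip: proj_mult)

lemma scale_preproj_mult_right: "x * scale_preproj c y = scale_preproj c (x * y)"
  by (rule proj_surj[of x], rule proj_surj[of y])
    (simp add: scale_preproj_proj scale_path_mult_right flip: proj_mult)

section \<open>Tensor powers and the spaces \<open>W\<close>\<close>

lemma tens_pow_iff: "x \<in> tens_pow n \<longleftrightarrow> (\<forall>v xs. coeff x (v, xs) \<noteq> 0 \<longrightarrow> length xs = n)"
proof
  assume "x \<in> tens_pow n"
  then show "\<forall>v xs. coeff x (v, xs) \<noteq> 0 \<longrightarrow> length xs = n"
    unfolding tens_pow_def
  proof (induction rule: path_vs.span_induct_alt)
    case (step c x y)
    then show ?case by (auto simp: coeff_add coeff_scale coeff_single split: if_splits)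
  qed simp
next
  assume a: "\<forall>v xs. coeff x (v, xs) \<noteq> 0 \<longrightarrow> length xs = n"
  have "(\<Sum>p | coeff x p \<noteq> 0. scale_path (coeff x p) (single p)) \<in> tens_pow n"
    unfolding tens_pow_def
  proof (intro path_vs.span_sum path_vs.span_scale path_vs.span_base)
    fix p assume "p \<in> {p. coeff x p \<noteq> 0}"
    then show "single p \<in> {single (v, xs) | v xs. is_path v xs \<and> length xs = n}"
      using a is_path_coeff by (cases p) blast
  qed
  then show "x \<in> tens_pow n" using path_alg_expand[of x] by simp
qed

text \<open>In the sum over all cuts of \<open>xs\<close>, homogeneity of \<open>x\<close> leaves
  only the cut after \<open>n\<close> arrows.\<close>

lemma coeff_tens_mult:
  assumes "x \<in> tens_pow n"
  shows "coeff (x * y) (v, xs) =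
    (if n \<le> length xs then coeff x (v, take n xs) * coeff y (start v (take n xs), drop n xs) else 0)"
proof -
  have "coeff (x * y) (v, xs) = (\<Sum>i\<le>length xs. if i = n then
      coeff x (v, take n xs) * coeff y (start v (take n xs), drop n xs) else 0)"
    unfolding times_path_alg.rep_eq prod.case
  proof (rule sum.cong)
    fix i assume "i \<in> {..length xs}"
    then show "coeff x (v, take i xs) * coeff y (start v (take i xs), drop i xs) = (if i = n then
      coeff x (v, take n xs) * coeff y (start v (take n xs), drop n xs) else 0)"
      using assms by (cases "i = n") (auto simp: tens_pow_iff dest!: spec[of _ v] spec[of _ "take i xs"])
  qed simp
  then show ?thesis by simp
qed

lemma tens_pow_mult: "x \<in> tens_pow m \<Longrightarrow> y \<in> tens_pow n \<Longrightarrow> x * y \<in> tens_pow (m + n)"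
  by (auto simp: tens_pow_iff[of "x * y"] coeff_tens_mult split: if_splits)
    (metis diff_add_inverse length_drop le_add_diff_inverse tens_pow_iff)

lemma subspace_tens_pow: "path_vs.subspace (tens_pow n)"
  unfolding tens_pow_def by (rule path_vs.subspace_span)

lemma one_in_tens_pow: "1 \<in> tens_pow 0"
  by (simp add: tens_pow_iff one_path_alg.rep_eq)

lemma idem_in_tens_pow: "idem v \<in> tens_pow 0"
  by (simp add: tens_pow_iff coeff_single)

lemma arr_in_tens_pow: "arr a \<in> tens_pow 1"
  by (auto simp: tens_pow_iff coeff_single split: if_splits)

section \<open>The relations and the bimodule they span\<close>

fun reverse :: "arrow \<Rightarrow> arrow" where
  "reverse A0 = B0" | "reverse A1 = B1" | "reverse A2 = B2" | "reverse A3 = B3" | "reverse A4 = B4"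
| "reverse B0 = A0" | "reverse B1 = A1" | "reverse B2 = A2" | "reverse B3 = A3" | "reverse B4 = A4"

text \<open>With these signs \<open>sigma v\<close> is the signed sum of
  \<open>arr a * arr (reverse a)\<close> over all arrows \<open>a\<close> ending in
  \<open>v\<close>, one formula for all six vertices.\<close>

definition sgn_arrow :: "arrow \<Rightarrow> int" where
  "sgn_arrow a = (if a \<in> {A0, A1, A2, A3, A4} then 1 else - 1)"

lemma reverse_simps [simp]: "reverse (reverse a) = a" "tgt (reverse a) = src a" "src (reverse a) = tgt a"
  by (cases a; simp)+

lemma coeff_sigma:
  "coeff (sigma u :: 'f::field path_alg) (v, xs) =
    (if v = u \<and> (\<exists>a. xs = [a, reverse a] \<and> tgt a = u) then of_int (sgn_arrow (hd xs)) else 0)"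
proof -
  have "(\<exists>a. xs = [a, reverse a] \<and> tgt a = u) \<longleftrightarrow> xs \<in> (case u of V0 \<Rightarrow> {[B0, A0]} | V1 \<Rightarrow> {[B1, A1]}
      | V2 \<Rightarrow> {[A1, B1], [B2, A2]} | V3 \<Rightarrow> {[A0, B0], [A2, B2], [B3, A3]}
      | V4 \<Rightarrow> {[A3, B3], [B4, A4]} | V5 \<Rightarrow> {[A4, B4]})"
  proof
    assume "\<exists>a. xs = [a, reverse a] \<and> tgt a = u"
    then obtain a where "xs = [a, reverse a]" "u = tgt a" by blast
    then show "xs \<in> (case u of V0 \<Rightarrow> {[B0, A0]} | V1 \<Rightarrow> {[B1, A1]}
      | V2 \<Rightarrow> {[A1, B1], [B2, A2]} | V3 \<Rightarrow> {[A0, B0], [A2, B2], [B3, A3]}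
      | V4 \<Rightarrow> {[A3, B3], [B4, A4]} | V5 \<Rightarrow> {[A4, B4]})"
      by (cases a) simp_all
  next
    assume "xs \<in> (case u of V0 \<Rightarrow> {[B0, A0]} | V1 \<Rightarrow> {[B1, A1]}
      | V2 \<Rightarrow> {[A1, B1], [B2, A2]} | V3 \<Rightarrow> {[A0, B0], [A2, B2], [B3, A3]}
      | V4 \<Rightarrow> {[A3, B3], [B4, A4]} | V5 \<Rightarrow> {[A4, B4]})"
    then show "\<exists>a. xs = [a, reverse a] \<and> tgt a = u"
      by (intro exI[of _ "hd xs"]) (cases u; auto)
  qed
  then show ?thesis
    by (cases u) (auto simp: single_mult coeff_single coeff_add coeff_minus coeff_uminus sgn_arrow_def)
qed

lemma rels_subset_tens: "x \<in> rels \<Longrightarrow> x \<in> tens_pow 2"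
  unfolding rels_def
proof (induction rule: path_vs.span_induct_alt)
  case (step c x y)
  then show ?case
    by (auto simp: tens_pow_iff coeff_add coeff_scale coeff_sigma split: if_splits)
qed (simp add: tens_pow_iff)

text \<open>The scalar \<open>\<kappa> v\<close> is the coefficient of \<open>sigma v\<close> in
  \<open>x\<close>. Different \<open>sigma v\<close> share no path, so it can be read off at any
  arrow ending in \<open>v\<close>.\<close>

lemma coeff_rels:
  assumes "x \<in> rels"
  shows "\<exists>\<kappa>. \<forall>v a b. coeff x (v, [a, b]) =
    (if tgt a = v \<and> b = reverse a then of_int (sgn_arrow a) * \<kappa> v else 0)"
  using assms unfolding rels_def
proof (induction rule: path_vs.span_induct_alt)
  case base
  then show ?case by (intro exI[of _ "\<lambda>_. 0"]) simp
next
  case (step c x y)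
  then obtain u \<kappa> where "x = sigma u" and "\<forall>v a b. coeff y (v, [a, b]) =
    (if tgt a = v \<and> b = reverse a then of_int (sgn_arrow a) * \<kappa> v else 0)"
    by blast
  then show ?case
    by (intro exI[of _ "\<lambda>v. (if v = u then c else 0) + \<kappa> v"])
      (auto simp: coeff_add coeff_scale coeff_sigma algebra_simps)
qed

lemma idem_mult_coeff: "coeff (idem u * x) (v, xs) = (if u = v then coeff x (v, xs) else 0)"
  by (simp add: coeff_tens_mult[OF idem_in_tens_pow] coeff_single)

lemma coeff_mult_idem: "coeff (x * idem u) (v, xs) = (if u = start v xs then coeff x (v, xs) else 0)"
proof (induction x rule: path_alg_induct)
  case (single c w ys)
  then show ?case
    by (auto simp: scale_path_mult_left single_mult coeff_scale coeff_single)
qed (simp_all add: distrib_right coeff_add)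

lemma coeff_sigma_eq_0:
  assumes "v \<noteq> u \<or> start v xs \<noteq> u"
  shows "coeff (sigma u) (v, xs) = 0"
proof -
  have "\<not> (v = u \<and> (\<exists>a. xs = [a, reverse a] \<and> tgt a = u))"
    using assms by auto
  then show ?thesis unfolding coeff_sigma by (rule if_not_P)
qed

lemma idem_sigma: "idem v * sigma u = (if u = v then sigma u else 0)"
proof (rule path_alg_eqI)
  fix w xs
  show "coeff (idem v * sigma u) (w, xs) = coeff (if u = v then sigma u else 0) (w, xs)"
    using coeff_sigma_eq_0[of w u xs] by (cases "u = v"; cases "v = w") (simp_all add: idem_mult_coeff)
qed

lemma sigma_idem: "sigma u * idem v = (if u = v then sigma u else 0)"
proof (rule path_alg_eqI)
  fix w xs
  show "coeff (sigma u * idem v) (w, xs) = coeff (if u = v then sigma u else 0) (w, xs)"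
    using coeff_sigma_eq_0[of w u xs]
    by (cases "u = v"; cases "v = start w xs") (simp_all add: coeff_mult_idem)
qed

lemma zero_rels: "0 \<in> rels"
  by (simp add: rels_def path_vs.span_zero)

lemma sigma_in_rels: "sigma v \<in> rels"
  by (simp add: rels_def path_vs.span_base)

lemma idem_rels:
  assumes "r \<in> rels"
  shows "idem v * r \<in> rels \<and> r * idem v \<in> rels"
  using assms unfolding rels_def
proof (induction rule: path_vs.span_induct_alt)
  case base
  then show ?case by (simp add: path_vs.span_zero)
next
  case (step c x y)
  from step(1) have "idem v * x \<in> {0, x}" "x * idem v \<in> {0, x}"
    by (auto simp: idem_sigma sigma_idem)
  then have "idem v * x \<in> rels" "x * idem v \<in> rels"
    using step(1) by (auto simp: zero_rels sigma_in_rels)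
  then have "scale_path c (idem v * x) + idem v * y \<in> rels" "scale_path c (x * idem v) + y * idem v \<in> rels"
    using step(2) by (simp_all only: rels_def path_vs.span_add path_vs.span_scale)
  then show ?case
    by (simp only: distrib_left distrib_right scale_path_mult_left scale_path_mult_right rels_def simp_thms)
qed

lemma rels_mult:
  assumes "r \<in> rels" "u \<in> tens_pow 0"
  shows "u * r \<in> rels" "r * u \<in> rels"
proof -
  have "u * r \<in> rels \<and> r * u \<in> rels"
    using assms(2) unfolding tens_pow_def
  proof (induction rule: path_vs.span_induct_alt)
    case base
    then show ?case by (simp add: zero_rels)
  next
    case (step c x y)
    then obtain v where "x = idem v" by auto
    then have "scale_path c (x * r) + y * r \<in> rels" "scale_path c (r * x) + r * y \<in> rels"
      using step(2) idem_rels[OF assms(1), of v]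
      by (simp_all only: rels_def path_vs.span_add path_vs.span_scale)
    then show ?case
      by (simp only: distrib_left distrib_right scale_path_mult_left scale_path_mult_right rels_def simp_thms)
  qed
  then show "u * r \<in> rels" "r * u \<in> rels" by auto
qed

section \<open>The spaces \<open>W p\<close>\<close>

lemma W_0: "W 0 = tens_pow 0" and W_1: "W (Suc 0) = tens_pow 1"
  by (simp_all add: W_def)

text \<open>Each \<open>sigma v\<close> consists of loops at \<open>v\<close>, hence
  \<open>rels\<close> is stable under \<open>k\<close> on both sides and the outer factors of degree
  0 add nothing.\<close>

lemma W_2: "W 2 = rels"
proof -
  have "{(i, j). i + 2 + j = (2 :: nat)} = {(0, 0)}" by auto
  then have "W 2 = path_vs.span {x * r * y | x r y. x \<in> tens_pow 0 \<and> r \<in> rels \<and> (y :: 'a path_alg) \<in> tens_pow 0}"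
    by (simp add: W_def)
  moreover have "{x * r * y | x r y. x \<in> tens_pow 0 \<and> r \<in> rels \<and> (y :: 'a path_alg) \<in> tens_pow 0} = rels"
  proof
    show "rels \<subseteq> {x * r * y | x r y. x \<in> tens_pow 0 \<and> r \<in> rels \<and> (y :: 'a path_alg) \<in> tens_pow 0}"
      using one_in_tens_pow by (metis (mono_tags, lifting) mem_Collect_eq mult_1 mult_1_right subsetI)
  qed (auto intro: rels_mult)
  ultimately show ?thesis by (simp add: rels_def path_vs.span_span)
qed

text \<open>These are the linear equations imposed by a relation in position \<open>i\<close>: words
  that do not turn back there have coefficient 0, and words that turn back at the same vertex have
  coefficients agreeing up to sign.\<close>

lemma coeff_tens_rels_tens:
  assumes "w \<in> path_vs.span {x * r * y | x r y. x \<in> tens_pow i \<and> r \<in> rels \<and> y \<in> tens_pow j}"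
    and "length us = i"
  shows "b \<noteq> reverse a \<Longrightarrow> coeff w (v, us @ a # b # zs) = 0"
    and "tgt c = tgt a \<Longrightarrow> of_int (sgn_arrow c) * coeff w (v, us @ a # reverse a # zs)
      = of_int (sgn_arrow a) * coeff w (v, us @ c # reverse c # zs)"
proof -
  have "(b \<noteq> reverse a \<longrightarrow> coeff w (v, us @ a # b # zs) = 0) \<and>
    (tgt c = tgt a \<longrightarrow> of_int (sgn_arrow c) * coeff w (v, us @ a # reverse a # zs)
      = of_int (sgn_arrow a) * coeff w (v, us @ c # reverse c # zs))"
    using assms(1)
  proof (induction rule: path_vs.span_induct_alt)
    case (step k x y)
    then obtain p r q where x: "x = p * (r * q)" "p \<in> tens_pow i" "r \<in> rels" "q \<in> tens_pow j"
      by (auto simp: mult.assoc)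
    obtain \<kappa> where \<kappa>: "\<And>v a b. coeff r (v, [a, b]) =
        (if tgt a = v \<and> b = reverse a then of_int (sgn_arrow a) * \<kappa> v else 0)"
      using coeff_rels[OF x(3)] by blast
    have "coeff x (v, us @ a # b # zs) = coeff p (v, us) * (coeff r (start v us, [a, b]) * coeff q (src b, zs))" for a b
      using assms(2) x(2) rels_subset_tens[OF x(3)] by (simp add: x(1) coeff_tens_mult)
    with step show ?case
      by (auto simp: \<kappa> coeff_add coeff_scale algebra_simps)
  qed simp
  then show "b \<noteq> reverse a \<Longrightarrow> coeff w (v, us @ a # b # zs) = 0"
    "tgt c = tgt a \<Longrightarrow> of_int (sgn_arrow c) * coeff w (v, us @ a # reverse a # zs)
      = of_int (sgn_arrow a) * coeff w (v, us @ c # reverse c # zs)"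
    by blast+
qed

lemma of_int_sgn_arrow: "of_int (sgn_arrow a) \<noteq> (0 :: 'a::ring_1)"
  by (simp add: sgn_arrow_def)

text \<open>Comparing coefficients of overlapping relations at an endpoint of \<open>a\<close> that a second arrow
  meets forces \<open>W 3 = 0\<close>.\<close>

lemma branch_or_leaf:
  "(\<exists>c. c \<noteq> a \<and> tgt c = tgt a) \<or> (\<exists>c. c \<noteq> reverse a \<and> tgt c = src a)"
proof (cases a)
  case A0 then show ?thesis by (intro disjI1 exI[of _ A2]) simp
next
  case A1 then show ?thesis by (intro disjI1 exI[of _ B2]) simp
next
  case A2 then show ?thesis by (intro disjI1 exI[of _ A0]) simp
next
  case A3 then show ?thesis by (intro disjI1 exI[of _ B4]) simp
next
  case A4 then show ?thesis by (intro disjI2 exI[of _ A3]) simp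
next
  case B0 then show ?thesis by (intro disjI2 exI[of _ A2]) simp
next
  case B1 then show ?thesis by (intro disjI2 exI[of _ B2]) simp
next
  case B2 then show ?thesis by (intro disjI1 exI[of _ A1]) simp
next
  case B3 then show ?thesis by (intro disjI1 exI[of _ A0]) simp
next
  case B4 then show ?thesis by (intro disjI1 exI[of _ A3]) simp
qed

lemma W_ge_3:
  assumes "3 \<le> p"
  shows "W p = {0}"
proof
  have mem: "w \<in> path_vs.span {x * r * y | x r y. x \<in> tens_pow i \<and> r \<in> rels \<and> y \<in> tens_pow j}"
    if "w \<in> W p" "i + 2 + j = p" for w :: "'a path_alg" and i j
    using that assms by (auto simp: W_def)
  show "W p \<subseteq> {0 :: 'a path_alg}"
  proof
    fix w :: "'a path_alg" assume w: "w \<in> W p"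
    have 0: "w \<in> path_vs.span {x * r * y | x r y. x \<in> tens_pow 0 \<and> r \<in> rels \<and> y \<in> tens_pow (p - 2)}"
      by (rule mem[OF w]) (use assms in simp)
    have 1: "w \<in> path_vs.span {x * r * y | x r y. x \<in> tens_pow 1 \<and> r \<in> rels \<and> y \<in> tens_pow (p - 3)}"
      by (rule mem[OF w]) (use assms in simp)
    have tens: "w \<in> tens_pow p"
    proof -
      have "{x * r * y | x r y. x \<in> tens_pow 0 \<and> r \<in> rels \<and> (y :: 'a path_alg) \<in> tens_pow (p - 2)} \<subseteq> tens_pow p"
      proof
        fix x :: "'a path_alg"
        assume "x \<in> {x * r * y | x r y. x \<in> tens_pow 0 \<and> r \<in> rels \<and> y \<in> tens_pow (p - 2)}"
        then obtain a r y where "x = a * r * y" "a \<in> tens_pow 0" "r \<in> tens_pow 2" "y \<in> tens_pow (p - 2)"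
          using rels_subset_tens by blast
        then have "x \<in> tens_pow ((0 + 2) + (p - 2))" by (simp only: tens_pow_mult)
        moreover have "(0 + 2) + (p - 2) = p" using assms by simp
        ultimately show "x \<in> tens_pow p" by metis
      qed
      from path_vs.span_minimal[OF this subspace_tens_pow] 0 show ?thesis by blast
    qed
    note r0 = coeff_tens_rels_tens[OF 0, of "[]", simplified]
    note r1 = coeff_tens_rels_tens[OF 1, of "[x]" for x, simplified]
    have "coeff w (v, xs) = 0" for v xs
    proof (cases "length xs = p")
      case True
      then obtain a b c zs where xs: "xs = a # b # c # zs"
        using assms by (cases xs; cases "tl xs"; cases "tl (tl xs)") auto
      show ?thesis
      proof (cases "b = reverse a \<and> c = a")
        \<comment> \<open>What is left are words beginning with \<open>a\<close>,
          \<open>reverse a\<close>, \<open>a\<close>. A second arrow \<open>e\<close> at an endpoint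
          of \<open>a\<close> replaces the pair that turns back there by one through
          \<open>e\<close>. In the new word the overlapping position does not turn back, so its
          coefficient is 0.\<close>
        case True
        from branch_or_leaf[of a] show ?thesis
        proof
          assume "\<exists>c. c \<noteq> a \<and> tgt c = tgt a"
          then obtain e where e: "e \<noteq> a" "tgt e = tgt a" by blast
          then have "coeff w (v, e # reverse e # a # zs) = 0"
            using r1(1)[of a "reverse e" v e zs] by simp
          then show ?thesis
            using r0(2)[OF e(2), of v "a # zs"] True by (simp add: xs of_int_sgn_arrow)
        next
          assume "\<exists>c. c \<noteq> reverse a \<and> tgt c = src a"
          then obtain e where e: "e \<noteq> reverse a" "tgt e = tgt (reverse a)" by auto
          then have "coeff w (v, a # e # reverse e # zs) = 0"
            using r0(1)[of e a v "reverse e # zs"] by simp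
          then show ?thesis
            using r1(2)[OF e(2), of v a zs] True by (simp add: xs of_int_sgn_arrow)
        qed
      next
        case False
        then show ?thesis
          using r0(1)[of b a v "c # zs"] r1(1)[of c b v a zs]
          by (cases "b = reverse a") (auto simp: xs)
      qed
    next
      case False
      with tens show ?thesis by (auto simp: tens_pow_iff)
    qed
    then show "w \<in> {0}" by (auto intro: path_alg_eqI)
  qed
  show "{0 :: 'a path_alg} \<subseteq> W p"
    using assms by (auto simp: W_def path_vs.span_zero)
qed

lemma W_cases [case_names 0 1 2 ge_3]:
  "(p = 0 \<Longrightarrow> P) \<Longrightarrow> (p = Suc 0 \<Longrightarrow> P) \<Longrightarrow> (p = 2 \<Longrightarrow> P) \<Longrightarrow> (3 \<le> p \<Longrightarrow> P) \<Longrightarrow> P"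
  by linarith

lemma subspace_W: "path_vs.subspace (W p)"
  by (cases p rule: W_cases)
    (auto simp: W_0 W_1 W_2 W_ge_3 subspace_tens_pow rels_def path_vs.subspace_span path_vs.subspace_single_0)

lemma W_mult:
  assumes "x \<in> W p" "u \<in> W 0"
  shows "u * x \<in> W p" "x * u \<in> W p"
  using assms tens_pow_mult[of u 0 x] tens_pow_mult[of x _ u 0]
  by (cases p rule: W_cases; auto simp: W_0 W_1 W_2 W_ge_3 rels_mult)+

section \<open>Koszul cochains\<close>

lemma Hom_W_simps [simp]:
  "f \<in> carrier (Hom_W p) \<longleftrightarrow> (\<forall>w. w \<notin> W p \<longrightarrow> f w = 0) \<and>
       (\<forall>x\<in>W p. \<forall>y\<in>W p. f (x + y) = f x + f y) \<and>
       (\<forall>x\<in>W p. \<forall>u\<in>W 0. \<forall>v\<in>W 0. f (u * x * v) = proj u * f x * proj v)"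
  "\<zero>\<^bsub>Hom_W p\<^esub> = (\<lambda>_. 0)"
  "f \<oplus>\<^bsub>Hom_W p\<^esub> g = (\<lambda>w. f w + g w)"
  "c \<odot>\<^bsub>Hom_W p\<^esub> f = (\<lambda>w. scale_preproj c (f w))"
  by (simp_all add: Hom_W_def)

declare Hom_W_simps(1) [simp del]

lemma Hom_W_D:
  assumes "f \<in> carrier (Hom_W p)"
  shows "w \<notin> W p \<Longrightarrow> f w = 0"
    and "x \<in> W p \<Longrightarrow> y \<in> W p \<Longrightarrow> f (x + y) = f x + f y"
    and "x \<in> W p \<Longrightarrow> u \<in> W 0 \<Longrightarrow> v \<in> W 0 \<Longrightarrow> f (u * x * v) = proj u * f x * proj v"
  using assms unfolding Hom_W_simps(1) by blast+

lemma one_in_W0: "1 \<in> W 0"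
  by (simp add: W_0 one_in_tens_pow)

lemma scale_path_one_in_W0: "scale_path c 1 \<in> W 0"
  using path_vs.subspace_scale[OF subspace_W one_in_W0] by blast

lemma Hom_W_mult:
  assumes "f \<in> carrier (Hom_W p)" "x \<in> W p" "u \<in> W 0"
  shows "f (u * x) = proj u * f x" "f (x * u) = f x * proj u"
  using Hom_W_D(3)[OF assms one_in_W0] Hom_W_D(3)[OF assms(1,2) one_in_W0 assms(3)]
  by (simp_all add: proj_one)

lemma Hom_W_scale:
  assumes "f \<in> carrier (Hom_W p)" "x \<in> W p"
  shows "f (scale_path c x) = scale_preproj c (f x)"
proof -
  have "f (scale_path c 1 * x) = proj (scale_path c 1) * f x"
    by (rule Hom_W_mult(1)[OF assms scale_path_one_in_W0])
  then show ?thesis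
    by (simp add: scale_path_mult_left scale_preproj_mult_left proj_one flip: scale_preproj_proj)
qed

lemma Hom_W_zero:
  assumes "f \<in> carrier (Hom_W p)"
  shows "f 0 = 0"
  using Hom_W_scale[OF assms path_vs.subspace_0[OF subspace_W], of 0] by simp

lemma abelian_group_Hom_W: "abelian_group (Hom_W p)"
proof (rule abelian_groupI)
  fix f assume f: "f \<in> carrier (Hom_W p :: ('f::field, 'f cochain) module)"
  show "\<exists>g\<in>carrier (Hom_W p). g \<oplus>\<^bsub>Hom_W p\<^esub> f = \<zero>\<^bsub>Hom_W p\<^esub>"
    by (rule bexI[of _ "\<lambda>w. - f w"]) (use f in \<open>auto simp: Hom_W_simps(1)\<close>)
qed (auto simp: Hom_W_simps(1) add.assoc add.commute add.left_commute distrib_left distrib_right)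

lemma module_Hom_W: "Module.module class_ring (Hom_W p)"
proof (rule moduleI)
  show "cring (class_ring :: 'a ring)" by (rule class_cring.cring_axioms)
  show "abelian_group (Hom_W p :: ('a, 'a cochain) module)" by (rule abelian_group_Hom_W)
qed (auto simp: Hom_W_simps(1) scale_preproj_mult_left scale_preproj_mult_right
    preproj_vs.scale_right_distrib preproj_vs.scale_left_distrib)

section \<open>Evaluation of tensor products of cochains\<close>

text \<open>The condition is imposed at every list and not only at paths, so no path condition has
  to be carried along. It forces products of values to vanish at paths that cannot be
  composed.\<close>

definition bimodule_map :: "(path \<Rightarrow> ('f::field) preproj) \<Rightarrow> bool" where
  "bimodule_map F \<longleftrightarrow> (\<forall>v xs. proj (idem v) * F (v, xs) = F (v, xs) \<and> F (v, xs) * proj (idem (start v xs)) = F (v, xs))"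

abbreviation lin where "lin \<equiv> lin_ext scale_preproj"

lemma proj_idem_mult: "proj (idem v) * proj (idem w) = (if v = w then proj (idem v) else 0)"
  by (simp add: single_mult proj_zero flip: proj_mult)

lemma bimodule_map_orth:
  assumes "bimodule_map F" "bimodule_map G" "start v xs \<noteq> u"
  shows "F (v, xs) * G (u, ys) = 0"
proof -
  have "F (v, xs) * G (u, ys) = (F (v, xs) * proj (idem (start v xs))) * (proj (idem u) * G (u, ys))"
    using assms by (simp add: bimodule_map_def)
  also have "\<dots> = F (v, xs) * (proj (idem (start v xs)) * proj (idem u)) * G (u, ys)"
    by (simp only: mult.assoc)
  finally show ?thesis using assms(3) by (simp add: proj_idem_mult)
qed

text \<open>The product of \<open>F\<close> and \<open>G\<close> as a function of one argument: each
  path is cut after \<open>p\<close> arrows. It witnesses that \<open>tensor_eval\<close> does not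
  depend on the chosen decomposition.\<close>

definition tensor_map :: "nat \<Rightarrow> (path \<Rightarrow> ('f::field) preproj) \<Rightarrow> (path \<Rightarrow> 'f preproj) \<Rightarrow> 'f path_alg \<Rightarrow> 'f preproj" where
  "tensor_map p F G = lin (\<lambda>(v, xs). F (v, take p xs) * G (start v (take p xs), drop p xs))"

lemma lin_expand: "lin F x = (\<Sum>p | coeff x p \<noteq> 0. scale_preproj (coeff x p) (F p))"
  by (simp add: lin_ext_def)

text \<open>For paths \<open>x\<close> and \<open>y\<close> that cannot be composed, the left side
  is the value at 0 and the right side vanishes by \<open>bimodule_map_orth\<close>.\<close>

lemma tensor_map_mult:
  assumes F: "bimodule_map F" and G: "bimodule_map G" and x: "x \<in> tens_pow p"
  shows "tensor_map p F G (x * y) = lin F x * lin G y"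
proof -
  have single: "tensor_map p F G (single (v, xs) * y) = F (v, xs) * lin G y"
    if "is_path v xs" "length xs = p" for v xs
  proof (induction y rule: path_alg_induct)
    case (single c u ys)
    show ?case
    proof (cases "start v xs = u")
      case True
      then show ?thesis using that single
        by (simp add: tensor_map_def scale_path_mult_right single_mult preproj_vs.lin_ext_scale
            preproj_vs.lin_ext_single is_path_append scale_preproj_mult_right)
    next
      case False
      then show ?thesis using that single
        by (simp add: tensor_map_def scale_path_mult_right single_mult preproj_vs.lin_ext_scale
            preproj_vs.lin_ext_single preproj_vs.lin_ext_zero scale_preproj_mult_right
            bimodule_map_orth[OF F G])
    qed
  qed (simp_all add: tensor_map_def preproj_vs.lin_ext_zero preproj_vs.lin_ext_add distrib_left)
  show ?thesis
    using x unfolding tens_pow_def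
  proof (induction rule: path_vs.span_induct_alt)
    case base
    then show ?case by (simp add: tensor_map_def preproj_vs.lin_ext_zero)
  next
    case (step c x' z)
    then obtain v xs where x': "x' = single (v, xs)" "is_path v xs" "length xs = p" by auto
    have "tensor_map p F G ((scale_path c x' + z) * y)
        = scale_preproj c (tensor_map p F G (x' * y)) + tensor_map p F G (z * y)"
      by (simp add: tensor_map_def distrib_right scale_path_mult_left preproj_vs.lin_ext_add preproj_vs.lin_ext_scale)
    also have "\<dots> = lin F (scale_path c x' + z) * lin G y"
      using single[OF x'(2,3)] step(2) x'(2)
      by (simp add: x'(1) preproj_vs.lin_ext_add preproj_vs.lin_ext_scale preproj_vs.lin_ext_single
          distrib_right scale_preproj_mult_left)
    finally show ?case .
  qed
qed

lemma tens_pow_lin_eqI: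
  assumes x: "x \<in> tens_pow n"
    and add: "\<And>x y. x \<in> tens_pow n \<Longrightarrow> y \<in> tens_pow n \<Longrightarrow> f (x + y) = f x + (f y :: 'f::field preproj)"
    and scale: "\<And>c x. x \<in> tens_pow n \<Longrightarrow> f (scale_path c x) = scale_preproj c (f x)"
    and single: "\<And>v xs. is_path v xs \<Longrightarrow> length xs = n \<Longrightarrow> f (single (v, xs)) = F (v, xs)"
  shows "f x = lin F x"
proof -
  have zero: "(0 :: 'f path_alg) \<in> tens_pow n" by (simp add: tens_pow_iff)
  have "x \<in> tens_pow n \<and> f x = lin F x"
    using x unfolding tens_pow_def[of n]
  proof (induction rule: path_vs.span_induct_alt)
    case base
    have "f 0 = 0" using scale[of 0 0] zero by simp
    then show ?case using zero by (simp add: preproj_vs.lin_ext_zero tens_pow_def)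
  next
    case (step c x y)
    then obtain v xs where x: "x = single (v, xs)" "is_path v xs" "length xs = n" by auto
    have xt: "x \<in> tens_pow n" using x by (auto simp: tens_pow_iff coeff_single split: if_splits)
    have y: "y \<in> tens_pow n" "f y = lin F y" using step(2) by (simp_all add: tens_pow_def)
    have cx: "scale_path c x \<in> tens_pow n" by (rule path_vs.subspace_scale[OF subspace_tens_pow xt])
    have "f (scale_path c x + y) = lin F (scale_path c x + y)"
      using xt cx y x(2,3) by (simp add: add scale) (simp add: x(1) single preproj_vs.lin_ext_add
        preproj_vs.lin_ext_scale preproj_vs.lin_ext_single)
    then show ?case using path_vs.subspace_add[OF subspace_tens_pow cx y(1)] by (simp add: tens_pow_def)
  qed
  then show ?thesis ..
qed

lemma single_in_tens: "length xs = n \<Longrightarrow> single (v, xs) \<in> tens_pow n"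
  by (auto simp: tens_pow_iff coeff_single split: if_splits)

text \<open>Every cochain is the restriction of a linear map given on paths. In degree two, \<open>\<sigma>\<^sub>v\<close> is
  recovered from the value at one of the paths occurring in it.\<close>

lemma cochain_extension:
  fixes f :: "'f::field cochain"
  assumes f: "f \<in> carrier (Hom_W p)"
  shows "\<exists>F. bimodule_map F \<and> (\<forall>x\<in>W p. f x = lin F x)"
proof -
  have low: "\<exists>F. bimodule_map F \<and> (\<forall>x\<in>W p. f x = lin F x)" if Wp: "W p = (tens_pow p :: 'f path_alg set)"
  proof (intro exI conjI ballI)
    let ?F = "\<lambda>(v, xs). if is_path v xs \<and> length xs = p then f (single (v, xs)) else 0"
    show "bimodule_map ?F"
      unfolding bimodule_map_def
    proof (intro allI)
      fix v xs
      show "proj (idem v) * ?F (v, xs) = ?F (v, xs) \<and> ?F (v, xs) * proj (idem (start v xs)) = ?F (v, xs)"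
        using Hom_W_mult[OF f, of "single (v, xs)" "idem v"] Hom_W_mult[OF f, of "single (v, xs)" "idem (start v xs)"]
        by (auto simp: W_0 Wp single_in_tens idem_in_tens_pow single_mult)
    qed
    fix x :: "'f path_alg" assume "x \<in> W p"
    then show "f x = lin ?F x"
      unfolding Wp
      by (rule tens_pow_lin_eqI) (use Hom_W_D(2)[OF f] Hom_W_scale[OF f] in \<open>auto simp: Wp\<close>)
  qed
  show ?thesis
  proof (cases p rule: W_cases)
    case 0 then show ?thesis by (intro low) (simp add: W_0)
  next
    case 1 then show ?thesis by (intro low) (simp add: W_1)
  next
    case ge_3
    have "bimodule_map (\<lambda>_. 0 :: 'f preproj)" by (simp add: bimodule_map_def)
    moreover have "\<forall>x\<in>W p. f x = lin (\<lambda>_. 0) x"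
      using Hom_W_zero[OF f] by (simp add: W_ge_3[OF ge_3] preproj_vs.lin_ext_zero)
    ultimately show ?thesis by blast
  next
    case 2
    define lead where "lead v = (case v of V0 \<Rightarrow> B0 | V1 \<Rightarrow> B1 | V2 \<Rightarrow> A1 | V3 \<Rightarrow> A0 | V4 \<Rightarrow> A3 | V5 \<Rightarrow> A4)" for v
    have lead: "tgt (lead v) = v" for v by (cases v) (simp_all add: lead_def)
    define F :: "path \<Rightarrow> 'f preproj" where "F p = (if snd p = [lead (fst p), reverse (lead (fst p))] then
      of_int (sgn_arrow (lead (fst p))) * f (sigma (fst p)) else 0)" for p
    have W: "(sigma v :: 'f path_alg) \<in> W p" for v by (simp add: 2 W_2 sigma_in_rels)
    have bim: "bimodule_map F"
      unfolding bimodule_map_def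
    proof (intro allI)
      fix v xs
      have "proj (idem v) * f (sigma v) = f (sigma v)" "f (sigma v) * proj (idem v) = f (sigma v)"
        using Hom_W_mult[OF f W, of "idem v" v] by (simp_all add: W_0 idem_in_tens_pow idem_sigma sigma_idem)
      then show "proj (idem v) * F (v, xs) = F (v, xs) \<and> F (v, xs) * proj (idem (start v xs)) = F (v, xs)"
        by (auto simp: F_def sgn_arrow_def lead)
    qed
    have sig: "lin F (sigma v) = f (sigma v)" for v
    proof -
      have "lin F (sigma v) = (\<Sum>p\<in>{(v, [lead v, reverse (lead v)])}. scale_preproj (coeff (sigma v) p) (F p))"
        unfolding lin_expand
      proof (rule sum.mono_neutral_cong_right)
        show "finite {p. coeff (sigma v) p \<noteq> (0 :: 'f)}" by (rule finite_support)
        show "{(v, [lead v, reverse (lead v)])} \<subseteq> {p. coeff (sigma v) p \<noteq> (0 :: 'f)}"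
          by (simp add: coeff_sigma lead of_int_sgn_arrow)
        show "\<forall>p\<in>{p. coeff (sigma v) p \<noteq> (0 :: 'f)} - {(v, [lead v, reverse (lead v)])}.
            scale_preproj (coeff (sigma v) p) (F p) = 0"
          by (auto simp: F_def) (metis coeff_sigma_eq_0)+
      qed simp
      also have "\<dots> = f (sigma v)"
        by (simp add: coeff_sigma lead F_def sgn_arrow_def)
      finally show ?thesis .
    qed
    have "x \<in> W p \<and> f x = lin F x" if "x \<in> rels" for x :: "'f path_alg"
      using that unfolding rels_def
    proof (induction rule: path_vs.span_induct_alt)
      case base
      then show ?case using Hom_W_zero[OF f] path_vs.subspace_0[OF subspace_W]
        by (simp add: preproj_vs.lin_ext_zero)
    next
      case (step c x y)
      then obtain v where x: "x = sigma v" by auto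
      have cx: "scale_path c (sigma v) \<in> W p" by (rule path_vs.subspace_scale[OF subspace_W W])
      then show ?case
        using step(2) path_vs.subspace_add[OF subspace_W cx, of y] Hom_W_D(2)[OF f cx, of y] Hom_W_scale[OF f W, of c v]
        by (simp add: x preproj_vs.lin_ext_add preproj_vs.lin_ext_scale sig)
    qed
    with bim show ?thesis by (auto simp: 2 W_2)
  qed
qed

lemma W_subset_tens: "W p \<subseteq> tens_pow p"
proof (cases p rule: W_cases)
  case ge_3
  then show ?thesis by (auto simp: W_ge_3 tens_pow_iff)
qed (auto simp: W_0 W_1 W_2 rels_subset_tens)

abbreviation prods :: "('f::field path_alg \<times> 'f path_alg) list \<Rightarrow> 'f path_alg" where
  "prods ps \<equiv> (\<Sum>(x, y)\<leftarrow>ps. x * y)"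

text \<open>The definite description has a unique solution: every list with the same sum of products
  yields the value of \<open>tensor_map\<close> at that sum.\<close>

lemma tensor_eval_prods:
  assumes f: "f \<in> carrier (Hom_W p)" and g: "g \<in> carrier (Hom_W q)" and ps: "set ps \<subseteq> W p \<times> W q"
  shows "tensor_eval (W p) f (W q) g (prods ps) = (\<Sum>(x, y)\<leftarrow>ps. f x * g y)"
proof -
  obtain F G where F: "bimodule_map F" "\<And>x. x \<in> W p \<Longrightarrow> f x = lin F x"
    and G: "bimodule_map G" "\<And>x. x \<in> W q \<Longrightarrow> g x = lin G x"
    using cochain_extension[OF f] cochain_extension[OF g] by blast
  have eval: "(\<Sum>(x, y)\<leftarrow>qs. f x * g y) = tensor_map p F G (prods qs)" if "set qs \<subseteq> W p \<times> W q" for qs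
    using that
  proof (induction qs)
    case (Cons xy qs)
    obtain x y where xy: "xy = (x, y)" "x \<in> W p" "y \<in> W q" using Cons.prems by (cases xy) auto
    have "tensor_map p F G (x * y) = f x * g y"
      using tensor_map_mult[OF F(1) G(1), of x p y] xy W_subset_tens[of p] F(2) G(2) by auto
    then show ?case using Cons by (simp add: xy(1) tensor_map_def preproj_vs.lin_ext_add)
  qed (simp add: tensor_map_def preproj_vs.lin_ext_zero)
  show ?thesis
    unfolding tensor_eval_def
    by (rule the_equality) (use ps eval in \<open>auto simp del: split_paired_Ex\<close>)
qed

lemma sigma_prods: "\<exists>ps. set ps \<subseteq> W (Suc 0) \<times> W (Suc 0) \<and> (sigma v :: 'f::field path_alg) = prods ps"
proof -
  have "(single (u, [a]) :: 'f path_alg) \<in> W (Suc 0)" for u a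
    by (simp add: W_1 single_in_tens)
  moreover have "- (single (u, [a]) :: 'f path_alg) \<in> W (Suc 0)" for u a
    unfolding W_1 by (rule path_vs.subspace_neg[OF subspace_tens_pow single_in_tens]) simp
  ultimately show ?thesis
    by (intro exI[of _ "case v of V0 \<Rightarrow> [(- arr B0, arr A0)] | V1 \<Rightarrow> [(- arr B1, arr A1)]
      | V2 \<Rightarrow> [(arr A1, arr B1), (- arr B2, arr A2)]
      | V3 \<Rightarrow> [(arr A0, arr B0), (arr A2, arr B2), (- arr B3, arr A3)]
      | V4 \<Rightarrow> [(arr A3, arr B3), (- arr B4, arr A4)] | V5 \<Rightarrow> [(arr A4, arr B4)]"])
      (cases v; simp add: algebra_simps)
qed

lemma prods_map_left: "prods (map (\<lambda>(x, y). (u * x, y)) ps) = u * prods ps"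
  by (induction ps) (auto simp: distrib_left mult.assoc)

lemma prods_map_right: "prods (map (\<lambda>(x, y). (x, y * u)) ps) = prods ps * u"
  by (induction ps) (auto simp: distrib_right mult.assoc)

text \<open>If \<open>p\<close> or \<open>q\<close> is 0, a factor 1 can be inserted, and above
  degree 2 only \<open>w = 0\<close> is left. The case with content is \<open>1 + 1\<close>, where
  each relation is written out in products of arrows.\<close>

lemma W_decompose:
  fixes w :: "'f::field path_alg"
  assumes w: "w \<in> W (p + q)"
  obtains ps where "set ps \<subseteq> W p \<times> W q" "w = prods ps"
proof -
  have one: "(1 :: 'f path_alg) \<in> W 0" by (rule one_in_W0)
  consider "p = 0" | "q = 0" | "p = 1" "q = 1" | "3 \<le> p + q" by linarith
  then have "\<exists>ps. set ps \<subseteq> W p \<times> W q \<and> w = prods ps"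
  proof cases
    case 1
    then show ?thesis using w one by (intro exI[of _ "[(1, w)]"]) simp
  next
    case 2
    then show ?thesis using w one by (intro exI[of _ "[(w, 1)]"]) simp
  next
    case 4
    then show ?thesis using w by (intro exI[of _ "[]"]) (simp add: W_ge_3)
  next
    case 3
    have "w \<in> rels" using w 3 by (simp add: W_2 numeral_2_eq_2[symmetric])
    then show ?thesis
      unfolding rels_def
    proof (induction rule: path_vs.span_induct_alt)
      case base
      then show ?case by (intro exI[of _ "[]"]) simp
    next
      case (step c x y)
      then obtain v ps where "x = sigma v" "set ps \<subseteq> W p \<times> W q" "y = prods ps" by blast
      moreover obtain qs where qs: "set qs \<subseteq> W (Suc 0) \<times> W (Suc 0)" "sigma v = (prods qs :: 'f path_alg)"
        using sigma_prods by blast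
      moreover have "scale_path c (prods qs) = prods (map (\<lambda>(x, y). (scale_path c 1 * x, y)) qs)"
        unfolding prods_map_left by (rule scale_path_eq_mult)
      moreover have "set (map (\<lambda>(x, y). (scale_path c 1 * x, y)) qs) \<subseteq> W p \<times> W q"
        using qs(1) W_mult(1)[OF _ scale_path_one_in_W0] 3 by auto
      ultimately show ?case
        by (intro exI[of _ "map (\<lambda>(x, y). (scale_path c 1 * x, y)) qs @ ps"]) simp
    qed
  qed
  then show ?thesis using that by blast
qed

text \<open>The common part of \<open>b_K\<close> and \<open>cup\<close>. The value 0 outside
  \<open>W (p + q)\<close> hides whatever \<open>tensor_eval\<close> yields there.\<close>

definition tensor :: "nat \<Rightarrow> nat \<Rightarrow> ('f::field) cochain \<Rightarrow> 'f cochain \<Rightarrow> 'f cochain" where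
  "tensor p q f g w = (if w \<in> W (p + q) then tensor_eval (W p) f (W q) g w else 0)"

lemma tensor_prods:
  assumes "f \<in> carrier (Hom_W p)" "g \<in> carrier (Hom_W q)" "set ps \<subseteq> W p \<times> W q"
    and "prods ps \<in> W (p + q)"
  shows "tensor p q f g (prods ps) = (\<Sum>(x, y)\<leftarrow>ps. f x * g y)"
  using assms by (simp add: tensor_def tensor_eval_prods)

lemma tensor_closed:
  fixes f g :: "'f::field cochain"
  assumes f: "f \<in> carrier (Hom_W p)" and g: "g \<in> carrier (Hom_W q)"
  shows "tensor p q f g \<in> carrier (Hom_W (p + q))"
  unfolding Hom_W_simps(1)
proof (intro conjI ballI allI impI)
  fix w :: "'f path_alg" assume "w \<notin> W (p + q)"
  then show "tensor p q f g w = 0" by (simp add: tensor_def)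
next
  fix w w' :: "'f path_alg" assume w: "w \<in> W (p + q)" "w' \<in> W (p + q)"
  obtain ps where ps: "set ps \<subseteq> W p \<times> W q" "w = prods ps" using W_decompose[OF w(1)] .
  obtain qs where qs: "set qs \<subseteq> W p \<times> W q" "w' = prods qs" using W_decompose[OF w(2)] .
  have "w + w' = prods (ps @ qs)" "w + w' \<in> W (p + q)"
    using ps qs path_vs.subspace_add[OF subspace_W w] by simp_all
  then have "tensor p q f g (w + w') = (\<Sum>(x, y)\<leftarrow>ps @ qs. f x * g y)"
    using tensor_prods[OF f g, of "ps @ qs"] ps(1) qs(1) by simp
  then show "tensor p q f g (w + w') = tensor p q f g w + tensor p q f g w'"
    using tensor_prods[OF f g ps(1)] tensor_prods[OF f g qs(1)] w by (simp add: ps(2) qs(2))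
next
  fix w u v :: "'f path_alg" assume w: "w \<in> W (p + q)" and u: "u \<in> W 0" and v: "v \<in> W 0"
  obtain ps where ps: "set ps \<subseteq> W p \<times> W q" "w = prods ps" using W_decompose[OF w] .
  let ?qs = "map (\<lambda>(x, y). (x, y * v)) (map (\<lambda>(x, y). (u * x, y)) ps)"
  have qs: "set ?qs \<subseteq> W p \<times> W q" using ps(1) u v by (auto intro: W_mult)
  have uwv: "u * w * v = prods ?qs" unfolding prods_map_left prods_map_right ps(2) ..
  have "u * w * v \<in> W (p + q)" using w u v by (intro W_mult)
  then have "tensor p q f g (u * w * v) = (\<Sum>(x, y)\<leftarrow>?qs. f x * g y)"
    unfolding uwv by (rule tensor_prods[OF f g qs])
  also have "\<dots> = proj u * (\<Sum>(x, y)\<leftarrow>ps. f x * g y) * proj v"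
    using ps(1) u v
    by (induction ps) (auto simp: Hom_W_mult[OF f] Hom_W_mult[OF g] algebra_simps)
  also have "(\<Sum>(x, y)\<leftarrow>ps. f x * g y) = tensor p q f g w"
    using tensor_prods[OF f g ps(1)] w ps(2) by simp
  finally show "tensor p q f g (u * w * v) = proj u * tensor p q f g w * proj v" .
qed

lemma fund_closed: "fund \<in> carrier (Hom_W (Suc 0))"
  unfolding Hom_W_simps(1) fund_def
  by (auto simp: proj_add proj_mult path_vs.subspace_add[OF subspace_W] W_mult)

lemma b_K_eq: "b_K p f w = tensor p 1 f fund w - (- 1) ^ p * tensor 1 p fund f w"
  by (simp add: b_K_def tensor_def)

lemma cup_eq: "cup p q f g w = (- 1) ^ (p * q) * tensor p q f g w"
  by (simp add: cup_def tensor_def)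

lemma minus_one_power_mult: "(- 1 :: 'f::field preproj) ^ n * x = (if even n then x else - x)"
  by simp

lemma Hom_W_lincomb:
  assumes "f \<in> carrier (Hom_W p)" "g \<in> carrier (Hom_W p)"
  shows "(\<lambda>w. f w - g w) \<in> carrier (Hom_W p)" "(\<lambda>w. - f w) \<in> carrier (Hom_W p)"
    "(\<lambda>w. f w + g w) \<in> carrier (Hom_W p)" "(\<lambda>w. scale_preproj c (f w)) \<in> carrier (Hom_W p)"
    "(\<lambda>w. 0) \<in> carrier (Hom_W p)"
  using assms
  by (auto simp: Hom_W_simps(1) algebra_simps scale_preproj_mult_left scale_preproj_mult_right
      preproj_vs.scale_right_distrib)

lemma b_K_closed:
  fixes f :: "'f::field cochain"
  assumes f: "f \<in> carrier (Hom_W p)"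
  shows "b_K p f \<in> carrier (Hom_W (Suc p))"
proof -
  have "tensor p 1 f fund \<in> carrier (Hom_W (Suc p))" "tensor 1 p fund f \<in> carrier (Hom_W (Suc p))"
    using tensor_closed[OF f fund_closed] tensor_closed[OF fund_closed f] by simp_all
  then show ?thesis
    using Hom_W_lincomb(1)[of "tensor p 1 f fund" "Suc p" "tensor 1 p fund f"]
      Hom_W_lincomb(3)[of "tensor p 1 f fund" "Suc p" "tensor 1 p fund f"]
    by (cases "even p") (simp_all add: b_K_eq[abs_def] minus_one_power_mult)
qed

lemma cup_closed:
  fixes f g :: "'f::field cochain"
  assumes "f \<in> carrier (Hom_W p)" "g \<in> carrier (Hom_W q)"
  shows "cup p q f g \<in> carrier (Hom_W (p + q))"
  using tensor_closed[OF assms] Hom_W_lincomb(2)[OF tensor_closed[OF assms] tensor_closed[OF assms]]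
  by (cases "even (p * q)") (simp_all add: cup_eq[abs_def] minus_one_power_mult)

lemma tensor_add_left:
  fixes f f' g :: "'f::field cochain"
  assumes f: "f \<in> carrier (Hom_W p)" "f' \<in> carrier (Hom_W p)" and g: "g \<in> carrier (Hom_W q)"
  shows "tensor p q (\<lambda>x. f x + f' x) g w = tensor p q f g w + tensor p q f' g w"
proof (cases "w \<in> W (p + q)")
  case True
  obtain ps where ps: "set ps \<subseteq> W p \<times> W q" "w = prods ps" using W_decompose[OF True] .
  note [simp] = tensor_prods[OF _ _ ps(1) True[unfolded ps(2)]] f g Hom_W_lincomb(3)[OF f]
  show ?thesis by (simp add: ps(2)) (simp add: distrib_right case_prod_unfold sum_list_addf)
qed (simp add: tensor_def)

lemma tensor_add_right:
  fixes f g g' :: "'f::field cochain"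
  assumes f: "f \<in> carrier (Hom_W p)" and g: "g \<in> carrier (Hom_W q)" "g' \<in> carrier (Hom_W q)"
  shows "tensor p q f (\<lambda>x. g x + g' x) w = tensor p q f g w + tensor p q f g' w"
proof (cases "w \<in> W (p + q)")
  case True
  obtain ps where ps: "set ps \<subseteq> W p \<times> W q" "w = prods ps" using W_decompose[OF True] .
  note [simp] = tensor_prods[OF _ _ ps(1) True[unfolded ps(2)]] f g Hom_W_lincomb(3)[OF g]
  show ?thesis by (simp add: ps(2)) (simp add: distrib_left case_prod_unfold sum_list_addf)
qed (simp add: tensor_def)

lemma scale_preproj_sum_list: "scale_preproj c (sum_list xs) = sum_list (map (scale_preproj c) xs)"
  by (induction xs) (simp_all add: preproj_vs.scale_right_distrib)

lemma tensor_scale: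
  fixes f g :: "'f::field cochain"
  assumes f: "f \<in> carrier (Hom_W p)" and g: "g \<in> carrier (Hom_W q)"
  shows "tensor p q (\<lambda>x. scale_preproj c (f x)) g w = scale_preproj c (tensor p q f g w)"
    and "tensor p q f (\<lambda>x. scale_preproj c (g x)) w = scale_preproj c (tensor p q f g w)"
proof -
  have "tensor p q (\<lambda>x. scale_preproj c (f x)) g w = scale_preproj c (tensor p q f g w) \<and>
    tensor p q f (\<lambda>x. scale_preproj c (g x)) w = scale_preproj c (tensor p q f g w)"
  proof (cases "w \<in> W (p + q)")
    case True
    obtain ps where ps: "set ps \<subseteq> W p \<times> W q" "w = prods ps" using W_decompose[OF True] .
    note [simp] = tensor_prods[OF _ _ ps(1) True[unfolded ps(2)]] f g Hom_W_lincomb(4)[OF f f] Hom_W_lincomb(4)[OF g g]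
    show ?thesis
      by (simp add: ps(2)) (simp add: scale_preproj_sum_list case_prod_unfold scale_preproj_mult_left
          scale_preproj_mult_right comp_def)
  qed (simp add: tensor_def)
  then show "tensor p q (\<lambda>x. scale_preproj c (f x)) g w = scale_preproj c (tensor p q f g w)"
    "tensor p q f (\<lambda>x. scale_preproj c (g x)) w = scale_preproj c (tensor p q f g w)" by auto
qed

section \<open>Koszul cohomology as a complex\<close>

lemma Hom_W_ge_3: "f \<in> carrier (Hom_W p) \<Longrightarrow> 3 \<le> p \<Longrightarrow> f = (\<lambda>_. 0)"
proof (rule ext)
  fix w assume f: "f \<in> carrier (Hom_W p)" and p: "3 \<le> p"
  show "f w = 0"
    using Hom_W_D(1)[OF f, of w] Hom_W_zero[OF f] by (cases "w = 0") (simp_all add: W_ge_3[OF p])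
qed

lemma fund_eq: "w \<in> W (Suc 0) \<Longrightarrow> fund w = proj w"
  by (simp add: fund_def)

lemma Hom_W_0:
  assumes "f \<in> carrier (Hom_W 0)" "u \<in> W 0"
  shows "f u = f 1 * proj u" "f u = proj u * f 1"
  using Hom_W_mult[OF assms(1) one_in_W0 assms(2)] by simp_all

lemma tensor_1_0:
  assumes "f \<in> carrier (Hom_W p)" "z \<in> carrier (Hom_W 0)" "w \<in> W p"
  shows "tensor p 0 f z w = f w * z 1" "tensor 0 p z f w = z 1 * f w"
  using tensor_prods[OF assms(1,2), of "[(w, 1)]"] tensor_prods[OF assms(2,1), of "[(1, w)]"] assms(3) one_in_W0
  by simp_all

text \<open>A 0-cochain is determined by its value at 1, and its coboundary is the inner derivation
  given by that value.\<close>

lemma b_K_0: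
  assumes "f \<in> carrier (Hom_W 0)" "w \<in> W (Suc 0)"
  shows "b_K 0 f w = f 1 * proj w - proj w * f 1"
  using tensor_1_0[OF fund_closed assms] by (simp add: b_K_eq fund_eq[OF assms(2)])

text \<open>For \<open>p = 1\<close> the sign in \<open>b_K\<close> becomes a plus. A 1-cocycle is
  thus a map on \<open>V\<close> whose extension by the Leibniz rule kills the relations, that is, a
  derivation of \<open>A\<close>.\<close>

lemma b_K_1:
  assumes f: "f \<in> carrier (Hom_W (Suc 0))" and ps: "set ps \<subseteq> W (Suc 0) \<times> W (Suc 0)" "prods ps \<in> W 2"
  shows "b_K (Suc 0) f (prods ps) = (\<Sum>(x, y)\<leftarrow>ps. f x * proj y + proj x * f y)"
proof -
  have W2: "prods ps \<in> W (Suc 0 + Suc 0)" using ps(2) by (simp add: numeral_2_eq_2)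
  have "b_K (Suc 0) f (prods ps) = (\<Sum>(x, y)\<leftarrow>ps. f x * fund y) + (\<Sum>(x, y)\<leftarrow>ps. fund x * f y)"
    using tensor_prods[OF f fund_closed ps(1) W2] tensor_prods[OF fund_closed f ps(1) W2]
    by (simp add: b_K_eq)
  also have "\<dots> = (\<Sum>(x, y)\<leftarrow>ps. f x * proj y + proj x * f y)"
    using ps(1) by (induction ps) (auto simp: fund_eq)
  finally show ?thesis .
qed

lemma proj_rels: "w \<in> W 2 \<Longrightarrow> proj w = 0"
  by (simp add: W_2 proj_eq_zero ideal_gen.gen)

lemma proj_prods: "proj (prods ps) = (\<Sum>(x, y)\<leftarrow>ps. proj x * proj y)"
  by (induction ps) (auto simp: proj_zero proj_add proj_mult)

lemma W_2_decompose:
  fixes w :: "'f::field path_alg"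
  assumes "w \<in> W 2"
  obtains ps where "set ps \<subseteq> W (Suc 0) \<times> W (Suc 0)" "w = prods ps"
  using W_decompose[of w "Suc 0" "Suc 0"] assms by (auto simp: numeral_2_eq_2)

text \<open>From degree 0, the Leibniz sum of an inner derivation telescopes to the commutator of
  \<open>f 1\<close> with \<open>proj w\<close>, and \<open>proj w\<close> is 0 for a relation. From
  degree 1 on, the target is zero.\<close>

lemma b_K_b_K:
  assumes f: "f \<in> carrier (Hom_W p)"
  shows "b_K (Suc p) (b_K p f) = (\<lambda>_. 0)"
proof (cases p)
  case 0
  show ?thesis
  proof
    fix w
    have bf: "b_K 0 f \<in> carrier (Hom_W (Suc 0))" using b_K_closed[OF f] 0 by simp
    show "b_K (Suc p) (b_K p f) w = 0"
    proof (cases "w \<in> W 2")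
      case True
      then obtain ps where ps: "set ps \<subseteq> W (Suc 0) \<times> W (Suc 0)" "w = prods ps"
        using W_2_decompose by blast
      have "b_K (Suc p) (b_K p f) w = (\<Sum>(x, y)\<leftarrow>ps. b_K 0 f x * proj y + proj x * b_K 0 f y)"
        using b_K_1[OF bf ps(1)] True by (simp add: 0 ps(2))
      also have "\<dots> = f 1 * (\<Sum>(x, y)\<leftarrow>ps. proj x * proj y) - (\<Sum>(x, y)\<leftarrow>ps. proj x * proj y) * f 1"
        using ps(1) f[unfolded 0] by (induction ps) (auto simp: b_K_0 algebra_simps)
      also have "\<dots> = 0"
        using proj_rels[OF True] by (simp add: proj_prods ps(2))
      finally show ?thesis .
    next
      case False
      then show ?thesis
        using Hom_W_D(1)[OF b_K_closed[OF bf]] by (simp add: 0 numeral_2_eq_2)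
    qed
  qed
next
  case (Suc q)
  show ?thesis
    by (rule Hom_W_ge_3[OF b_K_closed[OF b_K_closed[OF f]]]) (simp add: Suc)
qed

lemma b_K_add:
  assumes f: "f \<in> carrier (Hom_W p)" "g \<in> carrier (Hom_W p)"
  shows "b_K p (\<lambda>x. f x + g x) w = b_K p f w + b_K p g w"
  using tensor_add_left[OF f fund_closed, of w] tensor_add_right[OF fund_closed f, of w]
  by (simp add: b_K_eq algebra_simps)

lemma b_K_scale:
  assumes f: "f \<in> carrier (Hom_W p)"
  shows "b_K p (\<lambda>x. scale_preproj c (f x)) w = scale_preproj c (b_K p f w)"
  using tensor_scale(1)[OF f fund_closed, of c w] tensor_scale(2)[OF fund_closed f, of c w]
  by (cases "even p") (simp_all add: b_K_eq preproj_vs.scale_right_diff_distrib preproj_vs.scale_right_distrib minus_one_power_mult)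

interpretation K: cochain_complex "Hom_W :: nat \<Rightarrow> ('f::field, 'f cochain) module" b_K
  by (rule cochain_complex.intro)
    (simp_all add: module_Hom_W b_K_closed b_K_add b_K_scale b_K_b_K fun_eq_iff)

lemma HK_eq: "HK p = cohomology Hom_W b_K p" "HK_class p = cohomology_class Hom_W b_K p"
  by (simp_all add: HK_def HK_class_def)

lemma Z_iff: "f \<in> cocycles Hom_W b_K p \<longleftrightarrow> f \<in> carrier (Hom_W p) \<and> b_K p f = (\<lambda>_. 0)"
  by (simp add: cocycles_def)

lemma Z_0_commute:
  assumes "z \<in> cocycles Hom_W b_K 0" "w \<in> W (Suc 0)"
  shows "z 1 * proj w = proj w * z 1"
  using b_K_0[of z w] assms by (simp add: Z_iff)

lemma B_0: "coboundaries Hom_W b_K 0 = {\<lambda>_. 0}"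
  by (simp add: coboundaries_def)

lemma B_Suc: "coboundaries Hom_W b_K (Suc p) = b_K p ` carrier (Hom_W p)"
  by (simp add: coboundaries_def)

text \<open>At a relation \<open>w\<close> the coboundary is twice \<open>proj w\<close>, which is 0
  in \<open>A\<close>.\<close>

lemma fund_cocycle: "fund \<in> cocycles Hom_W b_K (Suc 0)"
proof -
  have "b_K (Suc 0) fund w = 0" for w :: "'a path_alg"
  proof (cases "w \<in> W 2")
    case True
    then obtain ps where ps: "set ps \<subseteq> W (Suc 0) \<times> W (Suc 0)" "w = prods ps"
      using W_2_decompose by blast
    have "b_K (Suc 0) fund w = (\<Sum>(x, y)\<leftarrow>ps. fund x * proj y + proj x * fund y)"
      using b_K_1[OF fund_closed ps(1)] True ps(2) by simp
    also have "\<dots> = (\<Sum>(x, y)\<leftarrow>ps. proj x * proj y) + (\<Sum>(x, y)\<leftarrow>ps. proj x * proj y)"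
      using ps(1) by (induction ps) (auto simp: fund_eq algebra_simps)
    also have "\<dots> = 0"
      using proj_rels[OF True] by (simp add: proj_prods ps(2))
    finally show ?thesis .
  next
    case False
    then show ?thesis
      using Hom_W_D(1)[OF b_K_closed[OF fund_closed], of w] by (simp add: numeral_2_eq_2)
  qed
  then show ?thesis by (simp add: Z_iff fund_closed fun_eq_iff)
qed

lemma cup_1_0:
  assumes "f \<in> carrier (Hom_W (Suc 0))" "z \<in> carrier (Hom_W 0)"
  shows "cup (Suc 0) 0 f z w = f w * z 1"
  using tensor_1_0[OF assms] Hom_W_D(1)[OF assms(1)] by (cases "w \<in> W (Suc 0)") (auto simp: cup_eq tensor_def)

lemma cup_1_1:
  assumes "f \<in> carrier (Hom_W (Suc 0))" "g \<in> carrier (Hom_W (Suc 0))"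
    and "set ps \<subseteq> W (Suc 0) \<times> W (Suc 0)" "prods ps \<in> W 2"
  shows "cup (Suc 0) (Suc 0) f g (prods ps) = - (\<Sum>(x, y)\<leftarrow>ps. f x * g y)"
  using tensor_prods[OF assms(1,2,3)] assms(4) by (simp add: cup_eq numeral_2_eq_2)

lemma cup_ge_2:
  assumes "f \<in> carrier (Hom_W 1)" "g \<in> carrier (Hom_W p)" "2 \<le> p"
  shows "cup 1 p f g = (\<lambda>_. 0)"
  by (rule Hom_W_ge_3[OF cup_closed[OF assms(1,2)]]) (use assms(3) in simp)

text \<open>A 0-cocycle is a central element \<open>z\<close>, which can be moved to the right of
  the Leibniz sum; there remains twice a relation times \<open>z\<close>. In higher degrees the
  target is zero.\<close>

lemma cup_fund_cocycle:
  assumes g: "g \<in> cocycles Hom_W b_K p"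
  shows "cup 1 p fund g \<in> cocycles Hom_W b_K (Suc p)"
proof -
  have gc: "g \<in> carrier (Hom_W p)" using g by (simp add: Z_iff)
  have c: "cup 1 p fund g \<in> carrier (Hom_W (Suc p))"
    using cup_closed[OF fund_closed gc] by simp
  have "b_K (Suc p) (cup 1 p fund g) = (\<lambda>_. 0)"
  proof (cases p)
    case 0
    have c: "cup 1 0 fund g \<in> carrier (Hom_W (Suc 0))" using c 0 by simp
    show ?thesis
    proof
      fix w
      show "b_K (Suc p) (cup 1 p fund g) w = 0"
      proof (cases "w \<in> W 2")
        case True
        then obtain ps where ps: "set ps \<subseteq> W (Suc 0) \<times> W (Suc 0)" "w = prods ps"
          using W_2_decompose by blast
        have comm: "x \<in> W (Suc 0) \<Longrightarrow> g 1 * proj x = proj x * g 1" for x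
          using Z_0_commute[of g x] g 0 by simp
        have "b_K (Suc p) (cup 1 p fund g) w = (\<Sum>(x, y)\<leftarrow>ps. cup 1 0 fund g x * proj y + proj x * cup 1 0 fund g y)"
          using b_K_1[OF c ps(1)] True by (simp add: 0 ps(2))
        also have "\<dots> = (\<Sum>(x, y)\<leftarrow>ps. proj x * proj y) * g 1 + (\<Sum>(x, y)\<leftarrow>ps. proj x * proj y) * g 1"
          using ps(1)
        proof (induction ps)
          case (Cons a ps)
          obtain x y where a: "a = (x, y)" "x \<in> W (Suc 0)" "y \<in> W (Suc 0)" using Cons.prems by (cases a) auto
          have "cup 1 0 fund g x * proj y = proj x * proj y * g 1" "proj x * cup 1 0 fund g y = proj x * proj y * g 1"
            using cup_1_0[OF fund_closed gc[unfolded 0]] a comm[of y] by (simp_all add: fund_eq mult.assoc)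
          then show ?case using Cons by (simp add: a(1) algebra_simps)
        qed simp
        also have "\<dots> = 0"
          using proj_rels[OF True] by (simp add: proj_prods ps(2))
        finally show ?thesis .
      next
        case False
        then show ?thesis
          using Hom_W_D(1)[OF b_K_closed[OF c], of w] by (simp add: 0 numeral_2_eq_2)
      qed
    qed
  next
    case (Suc q)
    show ?thesis
      by (rule Hom_W_ge_3[OF b_K_closed[OF c]]) (simp add: Suc)
  qed
  with c show ?thesis by (simp add: Z_iff)
qed

text \<open>For cocycles \<open>g\<close> and \<open>g + b\<^sub>K(t)\<close> one has
  \<open>(\<ee>\<^sub>A + b\<^sub>K(u)) \<smile> (g + b\<^sub>K(t)) - \<ee>\<^sub>A \<smile> g = b\<^sub>K(u \<smile> (g + b\<^sub>K(t)) - \<ee>\<^sub>A \<smile> t)\<close>.\<close>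

lemma cup_independent:
  fixes g g' :: "'f::field cochain"
  assumes g: "g \<in> cocycles Hom_W b_K p" and g': "g' \<in> K.cl p g" and f: "f \<in> K.cl (Suc 0) fund"
  shows "K.cl (Suc p) (cup 1 p f g') = K.cl (Suc p) (cup 1 p fund g)"
proof -
  have gc: "g \<in> carrier (Hom_W p)" using g by (simp add: Z_iff)
  obtain u where u: "u \<in> carrier (Hom_W 0)" "f = (\<lambda>w. b_K 0 u w + fund w)"
    using f by (auto elim!: K.cl_memE simp: B_Suc)
  have bu: "b_K 0 u \<in> carrier (Hom_W (Suc 0))" using b_K_closed[OF u(1)] .
  have fc: "f \<in> carrier (Hom_W (Suc 0))" unfolding u(2) by (rule Hom_W_lincomb(3)[OF bu fund_closed])
  have u_comm: "u 1 * proj a = proj a * u 1" if "a \<in> W 0" for a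
    using Hom_W_0[OF u(1) that] by simp
  consider "p = 0" | "p = Suc 0" | "2 \<le> p" by linarith
  then have "\<exists>h\<in>carrier (Hom_W p). cup 1 p f g' = (\<lambda>w. b_K p h w + cup 1 p fund g w)"
  proof cases
    case 1
    have g'g: "g' = g" using g' by (auto elim!: K.cl_memE simp: 1 B_0)
    let ?h = "\<lambda>x. u x * g 1"
    have comm: "g 1 * proj a = proj a * g 1" if "a \<in> W 0" for a
      using Hom_W_0[OF gc[unfolded 1] that] by simp
    have h: "?h \<in> carrier (Hom_W 0)"
      unfolding Hom_W_simps(1)
    proof (intro conjI ballI allI impI)
      fix x a b :: "'f path_alg" assume "x \<in> W 0" "a \<in> W 0" "b \<in> W 0"
      then show "u (a * x * b) * g 1 = proj a * (u x * g 1) * proj b"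
        using Hom_W_D(3)[OF u(1), of x a b] comm[of b] by (simp add: mult.assoc)
    qed (use u(1) in \<open>simp_all add: Hom_W_D(1)[OF u(1)] Hom_W_D(2)[OF u(1)] distrib_right\<close>)
    have "cup 1 0 f g w = b_K 0 ?h w + cup 1 0 fund g w" for w
    proof (cases "w \<in> W (Suc 0)")
      case True
      have "u 1 * proj w * g 1 = u 1 * g 1 * proj w"
        using Z_0_commute[of g w] g True by (simp add: 1 mult.assoc)
      moreover have "cup 1 0 f g w = (u 1 * proj w - proj w * u 1 + proj w) * g 1"
        using cup_1_0[OF fc gc[unfolded 1], of w] b_K_0[OF u(1) True] by (simp add: u(2) fund_eq[OF True])
      moreover have "cup 1 0 fund g w = proj w * g 1"
        using cup_1_0[OF fund_closed gc[unfolded 1], of w] by (simp add: fund_eq[OF True])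
      moreover have "b_K 0 ?h w = u 1 * g 1 * proj w - proj w * (u 1 * g 1)"
        by (rule b_K_0[OF h True])
      ultimately show ?thesis
        by (simp only: distrib_right left_diff_distrib mult.assoc)
    next
      case False
      then show ?thesis
        using cup_1_0[OF fc gc[unfolded 1], of w] cup_1_0[OF fund_closed gc[unfolded 1], of w]
          Hom_W_D(1)[OF fc, of w] Hom_W_D(1)[OF fund_closed, of w] Hom_W_D(1)[OF b_K_closed[OF h], of w] by simp
    qed
    with h show ?thesis by (auto simp: 1 g'g)
  next
    case 2
    obtain t where t: "t \<in> carrier (Hom_W 0)" "g' = (\<lambda>w. b_K 0 t w + g w)"
      using g' by (auto elim!: K.cl_memE simp: 2 B_Suc)
    have bt: "b_K 0 t \<in> carrier (Hom_W (Suc 0))" using b_K_closed[OF t(1)] .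
    have g'c: "g' \<in> carrier (Hom_W (Suc 0))" unfolding t(2) by (rule Hom_W_lincomb(3)[OF bt gc[unfolded 2]])
    have g'z: "b_K (Suc 0) g' = (\<lambda>_. 0)"
      using b_K_add[OF bt gc[unfolded 2]] b_K_b_K[OF t(1)] g by (simp add: t(2) Z_iff 2 fun_eq_iff)
    have t_comm: "t 1 * proj a = proj a * t 1" if "a \<in> W 0" for a
      using Hom_W_0[OF t(1) that] by simp
    let ?h = "\<lambda>x. u 1 * g' x - fund x * t 1"
    have h: "?h \<in> carrier (Hom_W (Suc 0))"
      unfolding Hom_W_simps(1)
    proof (intro conjI ballI allI impI)
      fix x a b :: "'f path_alg" assume x: "x \<in> W (Suc 0)" and ab: "a \<in> W 0" "b \<in> W 0"
      have "u 1 * (proj a * (g' x * proj b)) = proj a * (u 1 * (g' x * proj b))"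
        using u_comm[OF ab(1)] by (metis mult.assoc)
      then show "u 1 * g' (a * x * b) - fund (a * x * b) * t 1 = proj a * (u 1 * g' x - fund x * t 1) * proj b"
        using Hom_W_D(3)[OF g'c x ab] Hom_W_D(3)[OF fund_closed x ab] t_comm[OF ab(2)]
        by (simp add: algebra_simps)
    qed (simp_all add: Hom_W_D(1)[OF g'c] Hom_W_D(2)[OF g'c] Hom_W_D(1)[OF fund_closed]
          Hom_W_D(2)[OF fund_closed] algebra_simps)
    have "cup (Suc 0) (Suc 0) f g' w = b_K (Suc 0) ?h w + cup (Suc 0) (Suc 0) fund g w" for w
    proof (cases "w \<in> W 2")
      case True
      then obtain ps where ps: "set ps \<subseteq> W (Suc 0) \<times> W (Suc 0)" "w = prods ps"
        using W_2_decompose by blast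
      note W = True[unfolded ps(2)]
      let ?P = "\<Sum>(x, y)\<leftarrow>ps. proj x * proj y"
      let ?G = "\<Sum>(x, y)\<leftarrow>ps. g' x * proj y + proj x * g' y"
      have P: "?P = 0" using proj_rels[OF True] by (simp add: proj_prods ps(2))
      have G: "?G = 0" using b_K_1[OF g'c ps(1) W] by (simp add: g'z)
      have "(\<Sum>(x, y)\<leftarrow>ps. ?h x * proj y + proj x * ?h y) - (\<Sum>(x, y)\<leftarrow>ps. fund x * g y)
          = u 1 * ?G - ?P * t 1 - ?P * t 1 - (\<Sum>(x, y)\<leftarrow>ps. f x * g' y)"
        using ps(1)
      proof (induction ps)
        case (Cons a ps)
        obtain x y where a: "a = (x, y)" "x \<in> W (Suc 0)" "y \<in> W (Suc 0)" using Cons.prems by (cases a) auto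
        have fx: "f x = u 1 * proj x - proj x * u 1 + proj x"
          using b_K_0[OF u(1) a(2)] by (simp add: u(2) fund_eq[OF a(2)])
        have gy: "g y = g' y - (t 1 * proj y - proj y * t 1)"
          using b_K_0[OF t(1) a(3)] by (simp add: t(2))
        show ?case
          using Cons by (simp add: a(1) fx gy fund_eq[OF a(2)] fund_eq[OF a(3)] algebra_simps)
      qed simp
      then show ?thesis
        using cup_1_1[OF fc g'c ps(1) W] cup_1_1[OF fund_closed gc[unfolded 2] ps(1) W] b_K_1[OF h ps(1) W]
        by (simp add: ps(2) P G)
    next
      case False
      then show ?thesis
        using Hom_W_D(1)[OF cup_closed[OF fc g'c], of w] Hom_W_D(1)[OF cup_closed[OF fund_closed gc[unfolded 2]], of w]
          Hom_W_D(1)[OF b_K_closed[OF h], of w] by (simp add: numeral_2_eq_2)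
    qed
    with h show ?thesis by (auto simp: 2)
  next
    case 3
    have g'c: "g' \<in> carrier (Hom_W p)"
      using g' gc K.coboundaries_subset[of p]
      by (auto elim!: K.cl_memE simp: Z_iff intro!: Hom_W_lincomb(3))
    have "cup 1 p f g' = (\<lambda>_. 0)" "cup 1 p fund g = (\<lambda>_. 0)"
      using cup_ge_2[OF _ g'c 3, of f] cup_ge_2[OF _ gc 3, of fund] fc fund_closed by simp_all
    then show ?thesis
      using gc b_K_scale[OF gc, of 0] by (intro bexI[of _ "\<lambda>_. 0"]) (auto simp: fun_eq_iff Hom_W_lincomb(5)[OF gc gc])
  qed
  then obtain h where h: "h \<in> carrier (Hom_W p)" "cup 1 p f g' = (\<lambda>w. b_K p h w + cup 1 p fund g w)"
    by blast
  have "K.cl (Suc p) (b_K p h \<oplus>\<^bsub>Hom_W (Suc p)\<^esub> cup 1 p fund g) = K.cl (Suc p) (cup 1 p fund g)"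
    by (rule K.cl_add_coboundary[OF cup_fund_cocycle[OF g]]) (simp add: B_Suc h(1))
  then show ?thesis unfolding h(2) by simp
qed

lemma d_hi_class:
  assumes g: "g \<in> cocycles Hom_W b_K p"
  shows "d_hi p (K.cl p g) = K.cl (Suc p) (cup 1 p fund g)"
proof -
  have "(\<Union>f\<in>K.cl (Suc 0) fund. \<Union>g'\<in>K.cl p g. K.cl (Suc p) (cup 1 p f g')) = K.cl (Suc p) (cup 1 p fund g)"
    using cup_independent[OF g] K.cl_self[OF g] K.cl_self[OF fund_cocycle] by blast
  then show ?thesis
    by (simp add: d_hi_def cup_HK_def HK_eq)
qed

text \<open>Frees the choice of representative for the class of \<open>fund\<close>; in
  characteristic 2 the zero cochain will be taken.\<close>

lemma d_hi_class_shift: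
  assumes g: "g \<in> cocycles Hom_W b_K p" and f: "f \<in> K.cl (Suc 0) fund"
  shows "d_hi p (K.cl p g) = K.cl (Suc p) (cup 1 p f g)"
  using cup_independent[OF g K.cl_self[OF g] f] d_hi_class[OF g] by simp

lemma cup_add_right:
  fixes f g g' :: "'f::field cochain"
  assumes "f \<in> carrier (Hom_W p)" "g \<in> carrier (Hom_W q)" "g' \<in> carrier (Hom_W q)"
  shows "cup p q f (\<lambda>x. g x + g' x) w = cup p q f g w + cup p q f g' w"
  using tensor_add_right[OF assms, of w] by (simp add: cup_eq algebra_simps)

lemma cup_scale_right:
  fixes f g :: "'f::field cochain"
  assumes "f \<in> carrier (Hom_W p)" "g \<in> carrier (Hom_W q)"
  shows "cup p q f (\<lambda>x. scale_preproj c (g x)) w = scale_preproj c (cup p q f g w)"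
  using tensor_scale(2)[OF assms, of c w]
  by (cases "even (p * q)") (simp_all add: cup_eq minus_one_power_mult)

text \<open>Only \<open>p = 0\<close> has content: in the sum of \<open>x (y z)\<close> over a
  relation, the sum of \<open>x y\<close> already vanishes in \<open>A\<close>.\<close>

lemma cup_fund_cup_fund:
  assumes g: "g \<in> cocycles Hom_W b_K p"
  shows "cup 1 (Suc p) fund (cup 1 p fund g) = (\<lambda>_. 0)"
proof (cases p)
  case 0
  have gc: "g \<in> carrier (Hom_W 0)" using g by (simp add: Z_iff 0)
  have c: "cup 1 0 fund g \<in> carrier (Hom_W (Suc 0))" using cup_closed[OF fund_closed gc] by simp
  have "cup 1 (Suc 0) fund (cup 1 0 fund g) w = 0" for w :: "'a path_alg"
  proof (cases "w \<in> W 2")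
    case True
    then obtain ps where ps: "set ps \<subseteq> W (Suc 0) \<times> W (Suc 0)" "w = prods ps"
      using W_2_decompose by blast
    have "(\<Sum>(x, y)\<leftarrow>ps. fund x * cup 1 0 fund g y) = (\<Sum>(x, y)\<leftarrow>ps. proj x * proj y) * g 1"
      using ps(1) by (induction ps) (auto simp: cup_1_0[OF fund_closed gc] fund_eq algebra_simps)
    also have "\<dots> = 0" using proj_rels[OF True] by (simp add: proj_prods ps(2))
    finally show ?thesis
      using cup_1_1[OF fund_closed c ps(1)] True by (simp add: ps(2))
  next
    case False
    then show ?thesis
      using Hom_W_D(1)[OF cup_closed[OF fund_closed c], of w] by (simp add: numeral_2_eq_2)
  qed
  then show ?thesis by (simp add: 0 fun_eq_iff)
next
  case (Suc q)
  have "cup 1 p fund g \<in> carrier (Hom_W (Suc p))"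
    using cup_fund_cocycle[OF g] by (simp add: Z_iff)
  then show ?thesis
    using cup_ge_2[of fund "cup 1 p fund g" "Suc p"] fund_closed Suc by simp
qed

interpretation HI: cochain_complex "HK :: nat \<Rightarrow> ('f::field, 'f cochain set) module" d_hi
proof (rule cochain_complex.intro)
  fix p
  show "Module.module class_ring (HK p :: ('f, 'f cochain set) module)"
    by (simp add: HK_eq K.module_H)
  fix X assume "X \<in> carrier (HK p :: ('f, 'f cochain set) module)"
  then obtain g where g: "g \<in> cocycles Hom_W b_K p" "X = K.cl p g"
    by (auto simp: HK_eq K.carrier_H)
  have gc: "g \<in> carrier (Hom_W p)" using g by (simp add: Z_iff)
  note fg = cup_fund_cocycle[OF g(1)]
  show "d_hi p X \<in> carrier (HK (Suc p))"
    using fg by (auto simp: HK_eq K.carrier_H g d_hi_class)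
  show "d_hi (Suc p) (d_hi p X) = \<zero>\<^bsub>HK (Suc (Suc p))\<^esub>"
    using d_hi_class[OF fg] by (simp add: g d_hi_class cup_fund_cup_fund[OF g(1), simplified] HK_eq K.zero_H)
  show "d_hi p (c \<odot>\<^bsub>HK p\<^esub> X) = c \<odot>\<^bsub>HK (Suc p)\<^esub> d_hi p X" for c
  proof -
    have "cup 1 p fund (\<lambda>x. scale_preproj c (g x)) = (\<lambda>w. scale_preproj c (cup 1 p fund g w))"
      using cup_scale_right[OF fund_closed gc, of c] by (simp add: fun_eq_iff)
    then show ?thesis
      using K.smult_H[OF g(1), of c] K.smult_H[OF fg, of c] K.cocycles_smult[OF g(1), of c]
      by (simp add: g d_hi_class HK_eq)
  qed
  fix Y assume "Y \<in> carrier (HK p :: ('f, 'f cochain set) module)"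
  then obtain h where h: "h \<in> cocycles Hom_W b_K p" "Y = K.cl p h"
    by (auto simp: HK_eq K.carrier_H)
  have hc: "h \<in> carrier (Hom_W p)" using h by (simp add: Z_iff)
  have "cup 1 p fund (\<lambda>x. g x + h x) = (\<lambda>w. cup 1 p fund g w + cup 1 p fund h w)"
    using cup_add_right[OF fund_closed gc hc] by (simp add: fun_eq_iff)
  then show "d_hi p (X \<oplus>\<^bsub>HK p\<^esub> Y) = d_hi p X \<oplus>\<^bsub>HK (Suc p)\<^esub> d_hi p Y"
    using K.add_H[OF g(1) h(1)] K.add_H[OF fg cup_fund_cocycle[OF h(1)]] K.cocycles_add[OF g(1) h(1)]
    by (simp add: g h d_hi_class HK_eq)
qed

text \<open>An integer matrix as a list of entries (column, row, coefficient). Entries at the same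
  position count as added up, so sums and products are plain concatenations.\<close>

type_synonym sparse = "(nat \<times> nat \<times> int) list"

section \<open>Multiplication tables\<close>

text \<open>The basis paths are numbered by increasing length, the trivial paths being 0 to 5. An entry
  \<open>(n, m)\<close> of \<open>generators a\<close> says that \<open>a\<close> times the \<open>n\<close>-th basis path is the \<open>m\<close>-th one, and an entry
  \<open>(n, m, c)\<close> of \<open>reductions a\<close> or \<open>right_mult a\<close> that the product of \<open>a\<close> and the \<open>n\<close>-th basis path
  contains the \<open>m\<close>-th one with coefficient \<open>c\<close>. For \<open>(n, b)\<close> in \<open>pivots a\<close>, the product of \<open>a\<close> and
  the \<open>n\<close>-th basis path is not in the basis; it is eliminated by the relation that ends at the target of the
  \<open>b\<close>-th basis path, multiplied by that path.\<close>

fun generators :: "arrow \<Rightarrow> (nat \<times> nat) list" where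
  "generators A0 = [
    (0,15), (11,22), (19,33), (26,42), (31,48), (39,57), (44,64), (53,72), (62,82), (67,87),
    (78,96), (79,97), (93,112), (102,119), (107,124), (109,126), (117,132), (122,137),
    (129,141), (136,147), (145,152)]"
| "generators A1 = [
    (1,14), (13,25), (23,38), (34,52), (47,66), (49,69), (58,77), (73,92), (83,101), (98,116),
    (104,121), (120,135), (125,139), (133,144), (142,151)]"
| "generators A2 = [
    (2,12), (10,21), (14,27), (18,32), (25,41), (29,46), (37,55), (38,56), (52,71), (61,81),
    (66,86), (69,89), (77,95), (85,103), (92,111), (101,118), (116,131), (139,149)]"
| "generators A3 = [
    (3,9), (8,17), (12,24), (15,28), (21,35), (22,36), (27,43), (33,50), (41,59), (42,60),
    (46,65), (48,68), (56,74), (57,75), (64,84), (71,90), (72,91), (82,99), (87,105), (89,108),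
    (96,113), (97,115), (112,127), (119,134), (124,138), (132,143), (137,148), (147,153)]"
| "generators A4 = [
    (4,7), (9,20), (24,40), (28,45), (36,54), (43,63), (50,70), (60,80), (68,88), (75,94),
    (91,110), (105,123), (113,130), (134,146), (148,154)]"
| "generators B0 = [
    (3,11), (8,19), (12,26), (16,31), (21,39), (27,44), (32,53), (41,62), (46,67), (55,78),
    (56,79), (71,93), (81,102), (86,107), (89,109), (95,117), (103,122), (111,129), (118,136),
    (131,145), (149,155)]"
| "generators B1 = [
    (2,13), (10,23), (18,34), (29,47), (30,49), (37,58), (51,73), (61,83), (76,98), (85,104),
    (100,120), (106,125), (114,133), (128,142), (140,150)]"
| "generators B2 = [
    (3,10), (8,18), (15,29), (16,30), (22,37), (33,51), (42,61), (57,76), (64,85), (82,100),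
    (87,106), (97,114), (112,128), (126,140)]"
| "generators B3 = [
    (4,8), (6,16)]"
| "generators B4 = [
    (5,6)]"

fun reductions :: "arrow \<Rightarrow> sparse" where
  "reductions A0 = []"
| "reductions A1 = []"
| "reductions A2 = [
    (30,48,-1), (51,71,-1), (51,72,-1), (76,95,-1), (76,96,-1), (76,97,-1), (100,118,-1),
    (100,119,-1), (106,124,-1), (114,131,-1), (114,132,1), (121,137,-1), (128,141,1),
    (135,147,1), (144,152,1)]"
| "reductions A3 = [
    (32,50,-1), (55,74,-1), (55,75,-1), (81,99,-1), (86,105,-1), (95,113,-1), (111,127,1),
    (118,134,-1), (131,143,1)]"
| "reductions A4 = [
    (35,54,-1), (59,80,-1), (74,94,-1), (90,110,-1)]"
| "reductions B0 = []"
| "reductions B1 = []"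
| "reductions B2 = [
    (12,25,1), (21,38,1), (32,52,1), (46,66,1), (48,69,-1), (55,77,1), (72,92,-1), (81,101,1),
    (96,114,-1), (96,116,-1), (103,121,1), (119,135,-1), (124,139,-1), (132,144,1), (141,151,1)]"
| "reductions B3 = [
    (9,21,1), (9,22,1), (17,32,1), (17,33,1), (24,41,1), (24,42,1), (28,46,1), (35,56,1),
    (35,57,1), (36,55,1), (43,64,1), (50,71,-1), (50,72,-1), (59,82,1), (60,81,1), (65,86,1),
    (65,87,1), (68,89,-1), (74,97,1), (75,95,-1), (75,96,-1), (75,97,-1), (84,103,1),
    (90,112,1), (91,111,-1), (99,118,-1), (99,119,-1), (105,124,-1), (108,126,1), (113,132,-1),
    (115,131,-1), (115,132,1), (127,141,1), (134,147,-1), (138,149,-1), (143,152,1)]"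
| "reductions B4 = [
    (7,17,1), (20,35,1), (20,36,1), (40,59,1), (40,60,1), (45,65,1), (54,74,-1), (54,75,-1),
    (63,84,1), (70,90,-1), (70,91,-1), (80,99,-1), (88,108,-1), (94,115,-1), (110,127,-1),
    (123,138,-1), (130,143,-1), (146,153,-1)]"

fun right_mult :: "arrow \<Rightarrow> sparse" where
  "right_mult A0 = [
    (3,15,1), (9,28,1), (10,29,1), (20,45,1), (21,46,1), (23,47,1), (35,65,1), (38,66,1),
    (39,67,1), (56,86,1), (57,87,1), (74,105,-1), (75,105,1), (76,106,1), (79,107,1),
    (94,123,1), (97,124,1), (98,125,1), (114,139,-1), (115,138,1), (116,139,1), (131,149,1),
    (145,155,1)]"
| "right_mult A1 = [
    (2,14,1), (12,27,1), (24,43,1), (26,44,1), (40,63,1), (42,64,1), (60,84,1), (61,85,1),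
    (81,103,1), (83,104,1), (101,121,1), (102,122,1), (118,137,-1), (119,137,1), (134,148,1),
    (146,154,1)]"
| "right_mult A2 = [
    (3,12,1), (9,24,1), (10,25,1), (11,26,1), (20,40,1), (21,41,1), (22,42,1), (35,59,1),
    (36,60,1), (37,61,1), (39,62,1), (54,80,1), (55,81,1), (57,82,1), (58,83,1), (75,99,1),
    (76,100,1), (77,101,1), (78,102,1), (95,118,1), (96,119,1), (98,120,1), (113,134,1),
    (116,135,1), (117,136,1), (130,146,1), (131,147,1), (132,147,1), (143,153,1)]"
| "right_mult A3 = [
    (4,9,1), (7,20,1), (8,21,1), (8,22,1), (17,35,1), (17,36,1), (18,37,1), (18,38,1),
    (19,39,1), (32,55,1), (32,56,1), (33,57,1), (34,58,1), (50,75,1), (51,76,1), (52,77,1),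
    (53,78,1), (53,79,1), (70,94,1), (71,95,1), (72,96,1), (72,97,1), (73,98,1), (90,113,-1),
    (91,113,1), (91,115,1), (92,116,1), (93,117,1), (110,130,1), (111,131,1), (112,132,1),
    (127,143,1), (128,144,1), (129,145,1), (141,152,1)]"
| "right_mult A4 = [
    (5,7,1), (6,17,1), (16,32,1), (16,33,1), (30,51,1), (30,52,1), (31,53,1), (48,72,1),
    (49,73,1), (68,91,1), (69,92,1), (88,110,1), (89,111,1), (108,127,1), (109,129,1),
    (126,141,1), (140,151,1)]"
| "right_mult B0 = [
    (0,11,1), (15,22,1), (28,36,1), (29,37,1), (45,54,1), (46,55,1), (47,58,1), (65,74,-1),
    (65,75,-1), (66,77,1), (67,78,1), (86,95,1), (87,96,1), (105,113,1), (106,114,-1),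
    (106,116,-1), (107,117,1), (123,130,1), (124,132,1), (125,133,-1), (138,143,1),
    (139,144,-1), (149,152,-1)]"
| "right_mult B1 = [
    (1,13,1), (14,25,1), (27,41,1), (43,59,1), (44,62,1), (63,80,-1), (64,82,1), (84,99,1),
    (85,100,1), (103,118,-1), (103,119,-1), (104,120,1), (121,135,1), (122,136,-1),
    (137,147,-1), (148,153,-1)]"
| "right_mult B2 = [
    (2,10,1), (12,21,1), (13,23,1), (24,35,1), (25,38,1), (26,39,1), (40,54,-1), (41,56,1),
    (42,57,1), (59,74,1), (60,75,1), (61,76,1), (62,79,1), (80,94,1), (81,95,-1), (81,96,-1),
    (81,97,-1), (82,97,1), (83,98,1), (99,115,1), (100,114,1), (101,116,1), (102,117,-1),
    (118,131,1), (119,132,-1), (120,133,1), (134,143,-1), (135,144,1), (136,145,1), (147,152,1)]"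
| "right_mult B3 = [
    (3,8,1), (9,17,1), (10,18,1), (11,19,1), (21,32,1), (22,33,1), (23,34,1), (35,50,-1),
    (36,50,1), (37,51,1), (38,52,1), (39,53,1), (54,70,1), (55,71,-1), (55,72,-1), (56,71,1),
    (57,72,1), (58,73,1), (74,90,1), (75,91,1), (76,92,-1), (77,92,1), (78,93,-1), (79,93,1),
    (94,110,1), (95,111,1), (96,112,-1), (97,112,1), (113,127,-1), (114,128,1), (115,127,1),
    (117,129,1), (132,141,1), (133,142,1), (144,151,1)]"
| "right_mult B4 = [
    (4,6,1), (8,16,1), (18,30,1), (19,31,1), (32,48,-1), (33,48,1), (34,49,1), (50,68,1),
    (51,69,-1), (52,69,1), (70,88,1), (71,89,1), (90,108,1), (93,109,1), (112,126,1),
    (128,140,1), (142,150,1)]"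

fun pivots :: "arrow \<Rightarrow> (nat \<times> nat) list" where
  "pivots A0 = [
    (155,149)]"
| "pivots A1 = [
    (150,140)]"
| "pivots A2 = [
    (30,16), (51,33), (76,57), (100,82), (106,87), (114,96), (121,103), (128,112), (135,119),
    (140,126), (144,132), (151,141)]"
| "pivots A3 = [
    (16,6), (32,17), (55,36), (81,60), (86,65), (95,75), (103,84), (111,91), (118,99),
    (126,108), (131,115), (141,127), (149,138), (152,143)]"
| "pivots A4 = [
    (6,5), (17,7), (35,20), (59,40), (65,45), (74,54), (84,63), (90,70), (99,80), (108,88),
    (115,94), (127,110), (138,123), (143,130), (153,146)]"
| "pivots B0 = [
    (15,0), (22,11), (33,19), (42,26), (48,31), (57,39), (64,44), (72,53), (82,62), (87,67),
    (96,78), (97,79), (112,93), (119,102), (124,107), (126,109), (132,117), (137,122),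
    (141,129), (147,136), (152,145)]"
| "pivots B1 = [
    (14,1), (25,13), (38,23), (52,34), (66,47), (69,49), (77,58), (92,73), (101,83), (116,98),
    (121,104), (135,120), (139,125), (144,133), (151,142)]"
| "pivots B2 = [
    (12,2), (21,10), (27,14), (32,18), (41,25), (46,29), (48,30), (55,37), (56,38), (71,52),
    (72,51), (81,61), (86,66), (89,69), (95,77), (96,76), (103,85), (111,92), (118,101),
    (119,100), (124,106), (131,116), (132,114), (137,121), (141,128), (147,135), (149,139),
    (152,144)]"
| "pivots B3 = [
    (9,3), (17,8), (24,12), (28,15), (35,21), (36,22), (43,27), (50,32), (59,41), (60,42),
    (65,46), (68,48), (74,56), (75,55), (84,64), (90,71), (91,72), (99,81), (105,86), (108,89),
    (113,95), (115,97), (127,111), (134,118), (138,124), (143,131), (148,137), (153,147)]"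
| "pivots B4 = [
    (7,4), (20,9), (40,24), (45,28), (54,35), (63,43), (70,50), (80,59), (88,68), (94,74),
    (110,90), (123,105), (130,113), (146,134), (154,148)]"

definition targets :: "vertex list" where
  "targets = [
    V0, V1, V2, V3, V4, V5, V4, V5, V3, V4, V2, V0, V3, V1, V2, V3, V3, V4, V2, V0, V5, V3, V3,
    V1, V4, V2, V0, V3, V4, V2, V2, V0, V3, V3, V1, V4, V4, V2, V2, V0, V5, V3, V3, V4, V0, V5,
    V3, V1, V3, V1, V4, V2, V2, V0, V5, V3, V3, V3, V1, V4, V4, V2, V0, V5, V3, V4, V2, V0, V4,
    V2, V5, V3, V3, V1, V4, V4, V2, V2, V0, V0, V5, V3, V3, V1, V4, V2, V3, V3, V5, V3, V4, V4,
    V2, V0, V5, V3, V3, V3, V1, V4, V2, V2, V0, V3, V1, V4, V2, V0, V4, V0, V5, V3, V3, V4, V2,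
    V4, V2, V0, V3, V3, V1, V2, V0, V5, V3, V1, V3, V4, V2, V0, V5, V3, V3, V1, V4, V2, V0, V3,
    V4, V2, V2, V3, V1, V4, V2, V0, V5, V3, V4, V3, V1, V2, V3, V4, V5, V0]"

definition sources :: "vertex list" where
  "sources = [
    V0, V1, V2, V3, V4, V5, V5, V4, V4, V3, V3, V3, V2, V2, V1, V0, V5, V4, V4, V4, V3, V3, V3,
    V3, V2, V2, V2, V1, V0, V0, V5, V5, V4, V4, V4, V3, V3, V3, V3, V3, V2, V2, V2, V1, V1, V0,
    V0, V0, V5, V5, V4, V4, V4, V4, V3, V3, V3, V3, V3, V2, V2, V2, V2, V1, V1, V0, V0, V0, V5,
    V5, V4, V4, V4, V4, V3, V3, V3, V3, V3, V3, V2, V2, V2, V2, V1, V1, V0, V0, V5, V5, V4, V4,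
    V4, V4, V3, V3, V3, V3, V3, V2, V2, V2, V2, V1, V1, V0, V0, V0, V5, V5, V4, V4, V4, V3, V3,
    V3, V3, V3, V2, V2, V2, V1, V1, V0, V0, V0, V5, V4, V4, V4, V3, V3, V3, V3, V2, V2, V2, V1,
    V0, V0, V5, V4, V4, V3, V3, V3, V2, V2, V1, V0, V5, V4, V3, V2, V1, V0]"

definition left_mult :: "arrow \<Rightarrow> sparse" where
  "left_mult a = map (\<lambda>(n, m). (n, m, 1)) (generators a) @ reductions a"

definition sp_mul :: "sparse \<Rightarrow> sparse \<Rightarrow> sparse" where
  "sp_mul A B = concat (map (\<lambda>(n, m, c). map (\<lambda>(k, l, d). (k, m, c * d))
     (filter (\<lambda>(k, l, d). l = n) B)) A)"

definition sp_scale :: "int \<Rightarrow> sparse \<Rightarrow> sparse" where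
  "sp_scale c = map (\<lambda>(n, m, d). (n, m, c * d))"

definition sp_null :: "sparse \<Rightarrow> bool" where
  "sp_null A \<longleftrightarrow> list_all (\<lambda>(n, m, _).
     sum_list (map (\<lambda>(k, l, c). if k = n \<and> l = m then c else 0) A) = 0) A"

definition sp_column :: "sparse \<Rightarrow> nat \<Rightarrow> sparse" where
  "sp_column A k = filter (\<lambda>(n, m, c). n = k) A"

definition target :: "nat \<Rightarrow> vertex" where
  "target n = (if n < 156 then targets ! n else V0)"

definition source :: "nat \<Rightarrow> vertex" where
  "source n = (if n < 156 then sources ! n else V0)"

definition arrows :: "arrow list" where
  "arrows = [A0, A1, A2, A3, A4, B0, B1, B2, B3, B4]"

fun root_index :: "vertex \<Rightarrow> nat" where
  "root_index V0 = 0" | "root_index V1 = 1" | "root_index V2 = 2" | "root_index V3 = 3" | "root_index V4 = 4" | "root_index V5 = 5"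

text \<open>Inverts the generator tables: \<open>(m, a, n)\<close> records that basis path
  \<open>m\<close> is \<open>a\<close> times path \<open>n\<close>. By \<open>stems_check\<close>
  every nontrivial basis path has exactly one such origin.\<close>

definition stems :: "(nat \<times> arrow \<times> nat) list" where
  "stems = concat (map (\<lambda>a. map (\<lambda>(n, m). (m, a, n)) (generators a)) arrows)"

definition sp_relation :: "vertex \<Rightarrow> sparse" where
  "sp_relation v = concat (map (\<lambda>a. sp_scale (sgn_arrow a) (sp_mul (left_mult a) (left_mult (reverse a))))
     (filter (\<lambda>a. tgt a = v) arrows))"

definition extends :: "arrow \<Rightarrow> nat \<Rightarrow> bool" where
  "extends a n \<longleftrightarrow> n \<in> set (map fst (generators a))"

text \<open>The relation at the target of path \<open>b\<close>, multiplied by that path, with the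
  inner products replaced by their table values. An entry \<open>(c, y, k)\<close> stands for
  \<open>c\<close> times the unevaluated product of \<open>y\<close> and path
  \<open>k\<close>.\<close>

definition relation_terms :: "nat \<Rightarrow> (int \<times> arrow \<times> nat) list" where
  "relation_terms b = concat (map (\<lambda>y. map (\<lambda>(n, m, c). (sgn_arrow y * c, y, m))
     (sp_column (left_mult (reverse y)) b)) (filter (\<lambda>y. tgt y = target b) arrows))"

text \<open>The relation can be solved for the product of \<open>a\<close> and path
  \<open>n\<close>: all other products involve earlier paths or are basis paths, and an integer with
  square 1 is invertible in every ring.\<close>

definition pivot_terms :: "arrow \<Rightarrow> nat \<Rightarrow> (int \<times> arrow \<times> nat) list \<Rightarrow> bool" where
  "pivot_terms a n ts \<longleftrightarrow> list_all (\<lambda>(c, y, k). y = a \<and> k = n \<or> k < n \<or> extends y k) ts \<and>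
     (case filter (\<lambda>(c, y, k). y = a \<and> k = n) ts of [(c, y, k)] \<Rightarrow> c * c = 1 | _ \<Rightarrow> False)"

text \<open>For path \<open>n\<close> equal to \<open>y\<close> times path \<open>k\<close>: the
  tabulated product of \<open>n\<close> and \<open>b\<close>, minus \<open>y\<close> applied to the
  tabulated product of \<open>k\<close> and \<open>b\<close>. Its vanishing is
  associativity.\<close>

definition right_step :: "arrow \<Rightarrow> nat \<Rightarrow> arrow \<Rightarrow> nat \<Rightarrow> sparse" where
  "right_step b n y k = sp_column (right_mult b) n @
     concat (map (\<lambda>(k', l, d). map (\<lambda>(l', m, c). (n, m, - (c * d))) (sp_column (left_mult y) l))
       (sp_column (right_mult b) k))"

section \<open>Properties of the tables, decided by evaluation\<close>

lemma relation_check: "list_all (\<lambda>v. sp_null (sp_relation v)) [V0, V1, V2, V3, V4, V5]"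
  by code_simp

lemma left_check: "list_all (\<lambda>a. list_all (\<lambda>(n, m, c). n < 156 \<and> m < 156 \<and> target n = src a \<and>
    target m = tgt a \<and> source m = source n) (left_mult a)) arrows"
  by code_simp

lemma root_check: "list_all (\<lambda>v. target (root_index v) = v \<and> source (root_index v) = v) [V0, V1, V2, V3, V4, V5]"
  by code_simp

lemma generators_check: "list_all (\<lambda>a. distinct (map fst (generators a)) \<and>
    list_all (\<lambda>(n, m). n < m) (generators a) \<and>
    list_all (\<lambda>(n, m, c). \<not> extends a n) (reductions a)) arrows"
  by code_simp

lemma stems_check: "sort (map fst stems) = [6..<156]"
  by code_simp

lemma right_root_check: "list_all (\<lambda>b. list_all (\<lambda>v. map snd (sp_column (right_mult b) (root_index v)) =
    (if tgt b = v then map snd (sp_column (left_mult b) (root_index (src b))) else []))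
    [V0, V1, V2, V3, V4, V5]) arrows"
  by code_simp

lemma right_index_check: "list_all (\<lambda>b. list_all (\<lambda>(n, m, c). n < 156 \<and> source n = tgt b) (right_mult b)) arrows"
  by code_simp

lemma right_check: "list_all (\<lambda>(n, y, k). list_all (\<lambda>b. tgt b = source n \<longrightarrow>
    sp_null (right_step b n y k)) arrows) stems"
  by code_simp

lemma pivot_check: "list_all (\<lambda>a. list_all (\<lambda>(n, b). b < n \<and>
    pivot_terms a n (relation_terms b)) (pivots a)) arrows"
  by code_simp

text \<open>Every product of \<open>a\<close> with a basis path ending at the source of
  \<open>a\<close> is accounted for exactly once, either as a basis path or through a pivot.\<close>

lemma pivot_cover: "list_all (\<lambda>a. sort (map fst (generators a) @ map fst (pivots a)) =
    map fst (filter (\<lambda>(n, v). v = src a) (zip [0..<156] targets))) arrows"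
  by code_simp

lemma table_lengths: "length targets = 156 \<and> length sources = 156"
  by code_simp

section \<open>Integer matrices over an arbitrary ring\<close>

definition sp_sum :: "sparse \<Rightarrow> (nat \<Rightarrow> nat \<Rightarrow> 'r::ring_1) \<Rightarrow> 'r" where
  "sp_sum A G = (\<Sum>(n, m, c)\<leftarrow>A. of_int c * G n m)"

lemma sp_sum_simps [simp]:
  "sp_sum [] G = 0"
  "sp_sum ((n, m, c) # A) G = of_int c * G n m + sp_sum A G"
  "sp_sum (A @ B) G = sp_sum A G + sp_sum B G"
  by (simp_all add: sp_sum_def)

lemma sp_sum_scale: "sp_sum (sp_scale c A) G = of_int c * sp_sum A G"
  by (induction A) (auto simp: sp_scale_def distrib_left mult.assoc)

lemma sp_sum_add: "sp_sum A (\<lambda>n m. G n m + H n m) = sp_sum A G + sp_sum A H"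
  by (induction A) (auto simp: algebra_simps)

lemma sp_sum_zero [simp]: "sp_sum A (\<lambda>n m. 0) = 0"
  by (induction A) auto

lemma sp_sum_mult_left: "sp_sum A (\<lambda>n m. x * G n m) = x * sp_sum A G"
proof (induction A)
  case (Cons e A)
  obtain n m c where "e = (n, m, c)" by (cases e)
  moreover have "of_int c * (x * G n m) = x * (of_int c * G n m)"
    by (metis mult.assoc mult_of_int_commute)
  ultimately show ?case using Cons by (simp add: distrib_left)
qed simp

lemma sp_sum_mult_right: "sp_sum A (\<lambda>n m. G n m * x) = sp_sum A G * x"
  by (induction A) (auto simp: distrib_right mult.assoc)

lemma sp_sum_sum: "sp_sum A (\<lambda>n m. \<Sum>i\<in>I. G i n m) = (\<Sum>i\<in>I. sp_sum A (G i))"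
  by (induction I rule: infinite_finite_induct) (simp_all add: sp_sum_add)

lemma sp_sum_cong: "(\<And>n m c. (n, m, c) \<in> set A \<Longrightarrow> G n m = H n m) \<Longrightarrow> sp_sum A G = sp_sum A H"
proof (induction A)
  case (Cons e A)
  obtain n m c where "e = (n, m, c)" by (cases e)
  moreover have "sp_sum A G = sp_sum A H" by (rule Cons.IH) (use Cons.prems in \<open>metis list.set_intros(2)\<close>)
  ultimately show ?case using Cons.prems[of n m c] by simp
qed simp

lemma sp_sum_column: "sp_sum (sp_column A k) G = sp_sum A (\<lambda>n m. if n = k then G n m else 0)"
  by (induction A) (auto simp: sp_column_def)

lemma sp_sum_concat: "sp_sum (concat (map f xs)) G = (\<Sum>x\<leftarrow>xs. sp_sum (f x) G)"
  by (induction xs) simp_all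

lemma sp_sum_mul: "sp_sum (sp_mul A B) G = sp_sum A (\<lambda>n m. sp_sum B (\<lambda>k l. if l = n then G k m else 0))"
proof -
  have "sp_sum (map (\<lambda>(k, l, d). (k, m, c * d)) (filter (\<lambda>(k, l, d). l = n) B)) G
      = of_int c * sp_sum B (\<lambda>k l. if l = n then G k m else 0)" for n m c
    by (induction B) (auto simp: distrib_left mult.assoc)
  then show ?thesis
    by (induction A) (auto simp: sp_mul_def)
qed

text \<open>Passes a checked identity of integer tables to every ring: the total coefficient at each
  position is 0, so every weighted sum over the entries vanishes. Columns, products and actions are
  all such sums.\<close>

lemma sp_null_sum:
  assumes "sp_null A"
  shows "sp_sum A G = 0"
proof -
  \<comment> \<open>The total coefficient at a position; grouping the entries by position turns the
    list sum into a sum over a finite set.\<close>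
  define ent where "ent A p = (\<Sum>(k, l, c)\<leftarrow>A. if k = fst p \<and> l = snd p then c else (0 :: int))" for A :: sparse and p
  have "(\<Sum>p\<in>S. of_int (ent A p) * G (fst p) (snd p)) = sp_sum A G"
    if "finite S" "(\<lambda>(n, m, c). (n, m)) ` set A \<subseteq> S" for A S
    using that(2)
  proof (induction A)
    case (Cons e A)
    obtain n m c where e: "e = (n, m, c)" by (cases e)
    have "(\<Sum>p\<in>S. of_int (ent (e # A) p) * G (fst p) (snd p))
        = (\<Sum>p\<in>S. (if p = (n, m) then of_int c * G n m else 0) + of_int (ent A p) * G (fst p) (snd p))"
      by (rule sum.cong) (auto simp: ent_def e distrib_right)
    also have "\<dots> = of_int c * G n m + (\<Sum>p\<in>S. of_int (ent A p) * G (fst p) (snd p))"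
      using Cons.prems that(1) by (simp add: sum.distrib e)
    finally show ?case using Cons by (simp add: e)
  qed (simp add: ent_def)
  from this[of "(\<lambda>(n, m, c). (n, m)) ` set A" A] have
    "(\<Sum>p\<in>(\<lambda>(n, m, c). (n, m)) ` set A. of_int (ent A p) * G (fst p) (snd p)) = sp_sum A G"
    by simp
  moreover have "ent A p = 0" if "p \<in> (\<lambda>(n, m, c). (n, m)) ` set A" for p
    using assms that unfolding sp_null_def ent_def by (fastforce simp: list_all_iff)
  ultimately show ?thesis by simp
qed

lemma in_arrows [simp]: "a \<in> set arrows"
  by (cases a) (simp_all add: arrows_def)

lemma in_vertices: "v \<in> set [V0, V1, V2, V3, V4, V5]"
  by (cases v) simp_all

lemma left_entry:
  assumes "(n, m, c) \<in> set (left_mult a)"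
  shows "n < 156" "m < 156" "target n = src a" "target m = tgt a" "source m = source n"
  using left_check assms unfolding list_all_iff by (fastforce dest: bspec[OF _ in_arrows[of a]])+

lemma right_entry:
  assumes "(n, m, c) \<in> set (right_mult b)"
  shows "n < 156" "source n = tgt b"
  using right_index_check assms unfolding list_all_iff
  by (fastforce dest: bspec[OF _ in_arrows[of b]])+

lemma target_root [simp]: "target (root_index v) = v" and source_root [simp]: "source (root_index v) = v"
  using root_check in_vertices[of v] by (auto simp: list_all_iff)

lemma root_less [simp]: "root_index v < 6"
  by (cases v) simp_all

lemma less_6_root: "n < 6 \<Longrightarrow> \<exists>v. n = root_index v"
proof -
  assume "n < 6"
  then consider "n = root_index V0" | "n = root_index V1" | "n = root_index V2" | "n = root_index V3" | "n = root_index V4" | "n = root_index V5"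
    by (simp, linarith)
  then show ?thesis by cases blast+
qed

definition sp_app :: "sparse \<Rightarrow> (nat \<Rightarrow> 'f::field) \<Rightarrow> nat \<Rightarrow> 'f" where
  "sp_app A \<mu> m = sp_sum A (\<lambda>n k. if k = m then \<mu> n else 0)"

lemma if_add: "(if b then x + y else (0 :: 'a::monoid_add)) = (if b then x else 0) + (if b then y else 0)"
  by simp

lemma sp_app_add: "sp_app A (\<lambda>n. \<mu> n + \<nu> n) = (\<lambda>m. sp_app A \<mu> m + sp_app A \<nu> m)"
  by (simp add: sp_app_def if_add sp_sum_add fun_eq_iff)

lemma sp_app_scale: "sp_app A (\<lambda>n. c * \<mu> n) = (\<lambda>m. c * sp_app A \<mu> m)"
  by (simp add: sp_app_def fun_eq_iff if_distrib[of "\<lambda>x. c * x"] flip: sp_sum_mult_left cong: if_cong)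

lemma sp_app_zero: "sp_app A (\<lambda>_. 0) = (\<lambda>_. 0)"
  by (simp add: sp_app_def fun_eq_iff)

lemma sp_app_mul: "sp_app (sp_mul A B) \<mu> = sp_app A (sp_app B \<mu>)"
proof
  fix m
  show "sp_app (sp_mul A B) \<mu> m = sp_app A (sp_app B \<mu>) m"
    unfolding sp_app_def sp_sum_mul by (rule sp_sum_cong) (simp cong: if_cong)
qed

abbreviation left :: "arrow \<Rightarrow> (nat \<Rightarrow> 'f::field) \<Rightarrow> nat \<Rightarrow> 'f" where
  "left a \<equiv> sp_app (left_mult a)"

definition at_target :: "vertex \<Rightarrow> (nat \<Rightarrow> 'f::field) \<Rightarrow> nat \<Rightarrow> 'f" where
  "at_target v \<mu> n = (if target n = v then \<mu> n else 0)"

definition at_source :: "vertex \<Rightarrow> (nat \<Rightarrow> 'f::field) \<Rightarrow> nat \<Rightarrow> 'f" where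
  "at_source v \<mu> n = (if source n = v then \<mu> n else 0)"

lemma left_at_target: "left a (at_target v \<mu>) = (if v = src a then left a \<mu> else (\<lambda>_. 0))"
proof
  fix m
  have "left a (at_target v \<mu>) m = sp_sum (left_mult a) (\<lambda>n k. if k = m then if v = src a then \<mu> n else 0 else 0)"
    unfolding sp_app_def by (rule sp_sum_cong) (auto simp: at_target_def dest: left_entry)
  then show "left a (at_target v \<mu>) m = (if v = src a then left a \<mu> else (\<lambda>_. 0)) m"
    by (cases "v = src a") (simp_all add: sp_app_def cong: if_cong)
qed

lemma at_target_left: "at_target v (left a \<mu>) = (if v = tgt a then left a \<mu> else (\<lambda>_. 0))"
proof
  fix m
  have "left a \<mu> m = 0" if "target m \<noteq> tgt a"
  proof -
    have "left a \<mu> m = sp_sum (left_mult a) (\<lambda>_ _. 0)"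
      unfolding sp_app_def by (rule sp_sum_cong) (use that in \<open>auto dest: left_entry\<close>)
    then show ?thesis by simp
  qed
  then show "at_target v (left a \<mu>) m = (if v = tgt a then left a \<mu> else (\<lambda>_. 0)) m"
    by (auto simp: at_target_def)
qed

lemma left_at_source: "left a (at_source v \<mu>) = at_source v (left a \<mu>)"
proof
  fix m
  have "left a (at_source v \<mu>) m = sp_sum (left_mult a) (\<lambda>n k. if k = m then if source m = v then \<mu> n else 0 else 0)"
    unfolding sp_app_def by (rule sp_sum_cong) (auto simp: at_source_def dest: left_entry)
  then show "left a (at_source v \<mu>) m = at_source v (left a \<mu>) m"
    by (cases "source m = v") (simp_all add: sp_app_def at_source_def cong: if_cong)
qed

text \<open>The matrices satisfy the defining relations because the integer matrix of
  \<open>sigma v\<close> is null.\<close>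

lemma left_relation:
  "(\<Sum>a\<leftarrow>filter (\<lambda>a. tgt a = v) arrows. of_int (sgn_arrow a) * left a (left (reverse a) \<mu>) m) = 0"
proof -
  have "sp_app (sp_relation v) \<mu> m = 0"
    unfolding sp_app_def using relation_check in_vertices[of v] by (intro sp_null_sum) (auto simp: list_all_iff)
  moreover have "sp_app (sp_relation v) \<mu> m = (\<Sum>a\<leftarrow>filter (\<lambda>a. tgt a = v) arrows.
      of_int (sgn_arrow a) * sp_app (sp_mul (left_mult a) (left_mult (reverse a))) \<mu> m)"
    unfolding sp_app_def sp_relation_def sp_sum_concat sp_sum_scale ..
  ultimately show ?thesis by (simp add: sp_app_mul)
qed

section \<open>The action on coordinate vectors\<close>

fun path_act :: "vertex \<Rightarrow> arrow list \<Rightarrow> (nat \<Rightarrow> 'f::field) \<Rightarrow> nat \<Rightarrow> 'f" where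
  "path_act v [] \<mu> = at_target v \<mu>"
| "path_act v (a # xs) \<mu> = left a (path_act (src a) xs \<mu>)"

lemma at_target_add: "at_target v (\<lambda>n. \<mu> n + \<nu> n) = (\<lambda>m. at_target v \<mu> m + at_target v \<nu> m)"
  and at_target_scale: "at_target v (\<lambda>n. c * \<mu> n) = (\<lambda>m. c * at_target v \<mu> m)"
  and at_target_zero: "at_target v (\<lambda>_. 0) = (\<lambda>_. 0)"
  and at_target_twice: "at_target v (at_target w \<mu>) = (if v = w then at_target v \<mu> else (\<lambda>_. 0))"
  by (auto simp: at_target_def fun_eq_iff)

lemma path_act_add: "path_act v xs (\<lambda>n. \<mu> n + \<nu> n) = (\<lambda>m. path_act v xs \<mu> m + path_act v xs \<nu> m)"
  by (induction xs arbitrary: v) (simp_all add: at_target_add sp_app_add)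

lemma path_act_scale: "path_act v xs (\<lambda>n. c * \<mu> n) = (\<lambda>m. c * path_act v xs \<mu> m)"
  by (induction xs arbitrary: v) (simp_all add: at_target_scale sp_app_scale)

lemma path_act_zero: "path_act v xs (\<lambda>_. 0) = (\<lambda>_. 0)"
  by (induction xs arbitrary: v) (simp_all add: at_target_zero sp_app_zero)

lemma at_target_path_act: "is_path w ys \<Longrightarrow> at_target v (path_act w ys \<mu>) = (if v = w then path_act w ys \<mu> else (\<lambda>_. 0))"
  by (cases ys) (auto simp: at_target_twice at_target_left)

lemma path_act_append:
  assumes "is_path v xs" "is_path w ys"
  shows "path_act v xs (path_act w ys \<mu>) = (if start v xs = w then path_act v (xs @ ys) \<mu> else (\<lambda>_. 0))"
  using assms by (induction xs arbitrary: v) (auto simp: at_target_path_act sp_app_zero)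

interpretation field_vs: vector_space "times :: 'f::field \<Rightarrow> 'f \<Rightarrow> 'f"
  by unfold_locales (simp_all add: algebra_simps)

definition act_path_alg :: "('f::field) path_alg \<Rightarrow> (nat \<Rightarrow> 'f) \<Rightarrow> nat \<Rightarrow> 'f" where
  "act_path_alg x \<mu> m = lin_ext times (\<lambda>(v, xs). path_act v xs \<mu> m) x"

lemma act_path_alg_add: "act_path_alg (x + y) \<mu> = (\<lambda>m. act_path_alg x \<mu> m + act_path_alg y \<mu> m)"
  and act_path_alg_scale: "act_path_alg (scale_path c x) \<mu> = (\<lambda>m. c * act_path_alg x \<mu> m)"
  and act_path_alg_zero: "act_path_alg 0 \<mu> = (\<lambda>_. 0)"
  by (simp_all add: act_path_alg_def fun_eq_iff field_vs.lin_ext_add field_vs.lin_ext_scale field_vs.lin_ext_zero)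

lemma act_path_alg_single: "is_path v xs \<Longrightarrow> act_path_alg (single (v, xs)) \<mu> = path_act v xs \<mu>"
  by (simp add: act_path_alg_def fun_eq_iff field_vs.lin_ext_single)

lemma act_path_alg_mult: "act_path_alg (x * y) \<mu> = act_path_alg x (act_path_alg y \<mu>)"
proof (induction x rule: path_alg_induct)
  case (single c v xs)
  have "act_path_alg (single (v, xs) * y) \<mu> = path_act v xs (act_path_alg y \<mu>)"
  proof (induction y rule: path_alg_induct)
    case (single d w ys)
    then show ?case using \<open>is_path v xs\<close>
      by (simp add: scale_path_mult_right single_mult act_path_alg_scale act_path_alg_single
          path_act_scale path_act_append act_path_alg_zero is_path_append)
  qed (simp_all add: distrib_left act_path_alg_add act_path_alg_zero path_act_add path_act_zero)
  with single show ?case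
    by (simp add: scale_path_mult_left act_path_alg_scale act_path_alg_single)
qed (simp_all add: distrib_right act_path_alg_add act_path_alg_zero)

lemma act_path_alg_linear:
  "act_path_alg x (\<lambda>n. \<mu> n + \<nu> n) = (\<lambda>m. act_path_alg x \<mu> m + act_path_alg x \<nu> m)"
  "act_path_alg x (\<lambda>_. 0) = (\<lambda>_. 0)"
  by (induction x rule: path_alg_induct)
    (simp_all add: act_path_alg_add act_path_alg_scale act_path_alg_zero act_path_alg_single
      path_act_add path_act_zero algebra_simps)

lemma act_path_alg_arr: "act_path_alg (arr a) \<mu> = left a \<mu>"
  by (simp add: act_path_alg_single left_at_target)

lemma sigma_sum: "sigma v = (\<Sum>a\<leftarrow>filter (\<lambda>a. tgt a = v) arrows. scale_path (of_int (sgn_arrow a)) (arr a * arr (reverse a)))"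
  by (cases v) (simp_all add: arrows_def sgn_arrow_def algebra_simps)

lemma act_path_alg_sum_list: "act_path_alg (sum_list (map f xs)) \<mu> = (\<lambda>m. \<Sum>x\<leftarrow>xs. act_path_alg (f x) \<mu> m)"
  by (induction xs) (simp_all add: act_path_alg_zero act_path_alg_add)

lemma act_path_alg_sigma: "act_path_alg (sigma v) \<mu> = (\<lambda>_. 0)"
  unfolding sigma_sum act_path_alg_sum_list act_path_alg_scale act_path_alg_mult act_path_alg_arr
  by (rule ext) (rule left_relation)

lemma act_path_alg_rels:
  assumes "x \<in> rels"
  shows "act_path_alg x \<mu> = (\<lambda>_. 0)"
  using assms unfolding rels_def
  by (induction rule: path_vs.span_induct_alt)
    (auto simp: act_path_alg_zero act_path_alg_add act_path_alg_scale act_path_alg_sigma)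

lemma act_path_alg_ideal:
  assumes "x \<in> ideal_gen rels"
  shows "act_path_alg x \<mu> = (\<lambda>_. 0)"
  using assms
  by (induction arbitrary: \<mu>)
    (simp_all add: act_path_alg_zero act_path_alg_rels act_path_alg_add act_path_alg_mult act_path_alg_linear)

text \<open>The relations act by zero, and since the action is multiplicative and linear in the
  vector, so does the ideal they generate. The representation therefore descends to
  \<open>A\<close>.\<close>

lift_definition act :: "('f::field) preproj \<Rightarrow> (nat \<Rightarrow> 'f) \<Rightarrow> nat \<Rightarrow> 'f" is act_path_alg
proof (intro ext)
  fix x y :: "'f path_alg" and \<mu> m
  assume "x - y \<in> ideal_gen rels"
  then have "act_path_alg (x - y) \<mu> m = 0" by (simp add: act_path_alg_ideal)
  then show "act_path_alg x \<mu> m = act_path_alg y \<mu> m"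
    using act_path_alg_add[of "x - y" y \<mu>] by (simp add: fun_eq_iff)
qed

lemma act_add: "act (x + y) \<mu> m = act x \<mu> m + act y \<mu> m"
  and act_mult: "act (x * y) \<mu> = act x (act y \<mu>)"
  and act_scale: "act (scale_preproj c x) \<mu> m = c * act x \<mu> m"
  and act_zero: "act 0 \<mu> m = 0"
  by (transfer, simp add: act_path_alg_add act_path_alg_mult act_path_alg_scale act_path_alg_zero)+

lemma act_proj: "act (proj x) = act_path_alg x"
  by (simp add: act.abs_eq)

lemma act_at_source: "act x (at_source v \<mu>) = at_source v (act x \<mu>)"
proof -
  obtain x' where x: "x = proj x'" by (rule proj_surj)
  have comm: "path_act w xs (at_source v \<mu>) = at_source v (path_act w xs \<mu>)" for w xs
  proof (induction xs arbitrary: w)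
    case Nil
    show ?case by (auto simp: at_source_def at_target_def fun_eq_iff)
  qed (simp add: left_at_source)
  have "act_path_alg x' (at_source v \<mu>) = at_source v (act_path_alg x' \<mu>)"
    by (induction x' rule: path_alg_induct)
      (simp_all add: act_path_alg_zero act_path_alg_add act_path_alg_scale act_path_alg_single comm,
        auto simp: at_source_def fun_eq_iff)
  then show ?thesis by (simp add: x act_proj)
qed

section \<open>Coordinates of elements\<close>

definition unit :: "nat \<Rightarrow> 'f::field" where
  "unit n = (if n < 6 then 1 else 0)"

text \<open>Acting on \<open>unit\<close>, the coordinate vector of 1, makes left multiplication
  immediate: the coordinates of \<open>x * y\<close> are \<open>act x (coords y)\<close>. Right
  multiplication has no such form and gets tables of its own.\<close>

definition coords :: "('f::field) preproj \<Rightarrow> nat \<Rightarrow> 'f" where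
  "coords x = act x unit"

lemma coords_add: "coords (x + y) n = coords x n + coords y n"
  and coords_scale: "coords (scale_preproj c x) n = c * coords x n"
  and coords_zero: "coords 0 n = 0"
  by (simp_all add: coords_def act_add act_scale act_zero)

lemma coords_uminus: "coords (- x) n = - coords x n"
  using coords_add[of x "- x" n] by (simp add: coords_zero eq_neg_iff_add_eq_0 add.commute)

lemma coords_diff: "coords (x - y) n = coords x n - coords y n"
  using coords_add[of x "- y" n] by (simp add: coords_uminus)

lemma coords_arr_mult: "coords (arrA a * x) m = sp_sum (left_mult a) (\<lambda>n k. if k = m then coords x n else 0)"
  unfolding coords_def act_mult act_proj act_path_alg_arr sp_app_def ..

lemma coords_idem_mult: "coords (proj (idem v) * x) n = (if target n = v then coords x n else 0)"
  by (simp add: coords_def act_mult act_proj act_path_alg_single at_target_def)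

lemma coords_idem: "coords (proj (idem v)) n = (if n = root_index v then 1 else 0)"
  using less_6_root[of n] by (auto simp: coords_def act_proj act_path_alg_single at_target_def unit_def)

text \<open>The action commutes with restriction to a source, since left multiplication does not
  change where a path starts; and \<open>idem v\<close> acts on \<open>unit\<close> as such a
  restriction.\<close>

lemma coords_mult_idem:
  fixes x :: "'f::field preproj"
  shows "coords (x * proj (idem v)) n = (if source n = v then coords x n else 0)"
proof -
  have "act (proj (idem v)) unit = at_source v (unit :: nat \<Rightarrow> 'f)"
    by (auto simp: act_proj act_path_alg_single at_target_def at_source_def unit_def fun_eq_iff dest!: less_6_root)
  then have "coords (x * proj (idem v)) = at_source v (coords x)"
    by (simp add: coords_def act_mult act_at_source)
  then show ?thesis
    by (simp add: at_source_def)
qed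

section \<open>The basis of the algebra\<close>

lemma generator_left: "(n, m) \<in> set (generators a) \<Longrightarrow> (n, m, 1) \<in> set (left_mult a)"
  by (auto simp: left_mult_def)

lemma stems_iff: "(m, a, n) \<in> set stems \<longleftrightarrow> (n, m) \<in> set (generators a)"
  by (auto simp: stems_def intro!: bexI[of _ a])

lemma stems_domain: "fst ` set stems = {6..<156}"
  using arg_cong[OF stems_check, of set] by (simp only: set_sort set_map set_upt)

lemma stems_distinct: "distinct (map fst stems)"
  by (metis stems_check distinct_sort distinct_upt)

lemma generator_bounds:
  assumes "(n, m) \<in> set (generators a)"
  shows "n < m" "6 \<le> m" "m < 156" "map_of stems m = Some (a, n)"
proof -
  show "n < m"
    using generators_check assms in_arrows[of a] by (fastforce simp: list_all_iff)
  have mem: "(m, a, n) \<in> set stems" using assms by (simp add: stems_iff)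
  then have "m \<in> fst ` set stems" by force
  then show "6 \<le> m" "m < 156" by (simp_all add: stems_domain)
  show "map_of stems m = Some (a, n)"
    using mem stems_distinct by simp
qed

lemma generator_exists:
  assumes "6 \<le> m" "m < 156"
  obtains a n where "(n, m) \<in> set (generators a)"
proof -
  have "m \<in> fst ` set stems" using assms by (simp add: stems_domain)
  then show ?thesis using that stems_iff by force
qed

text \<open>The column has the single entry 1: the indices in \<open>generators a\<close> are
  distinct and avoid those of \<open>reductions a\<close>.\<close>

lemma generator_column:
  assumes "(n, m) \<in> set (generators a)"
  shows "sp_sum (sp_column (left_mult a) n) G = G n m"
proof -
  have d: "distinct (map fst (generators a))" and r: "\<And>l c. (n, l, c) \<notin> set (reductions a)"
    using generators_check assms in_arrows[of a] by (fastforce simp: list_all_iff extends_def)+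
  have "sp_sum (map (\<lambda>(n, m). (n, m, 1)) xs) (\<lambda>k l. if k = n then G k l else 0)
      = (if (n, m) \<in> set xs then G n m else 0)"
    if "distinct (map fst xs)" "n \<in> fst ` set xs \<Longrightarrow> (n, m) \<in> set xs" for xs
    using that
  proof (induction xs)
    case (Cons p xs)
    show ?case
    proof (cases "fst p = n")
      case True
      then have "n \<notin> fst ` set xs" using Cons.prems(1) by (cases p) auto
      moreover from this have "(n, m) \<notin> set xs" by force
      moreover have "p = (n, m)" using Cons.prems True \<open>n \<notin> fst ` set xs\<close> by (cases p) force
      ultimately show ?thesis using Cons by auto
    next
      case False
      have "n \<in> fst ` set xs \<Longrightarrow> (n, m) \<in> set xs" using Cons.prems(2) False by (cases p) auto
      then show ?thesis using Cons False by (cases p) auto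
    qed
  qed simp
  moreover have "sp_sum (reductions a) (\<lambda>k l. if k = n then G k l else 0) = sp_sum (reductions a) (\<lambda>_ _. 0)"
    by (rule sp_sum_cong) (use r in auto)
  ultimately show ?thesis
    using d assms by (simp add: sp_sum_column left_mult_def)
qed

text \<open>The guard \<open>k < n\<close> makes the recursion terminate. By
  \<open>generator_bounds\<close> every stem satisfies it, so below 156 neither default value 0 is
  taken.\<close>

function basis :: "nat \<Rightarrow> ('f::field) preproj" where
  "basis n = (if n < 6 then proj (idem (target n)) else
     case map_of stems n of None \<Rightarrow> 0 | Some (a, k) \<Rightarrow> if k < n then arrA a * basis k else 0)"
  by auto
termination by (relation "measure id") auto

declare basis.simps [simp del]

lemma basis_root: "basis (root_index v) = proj (idem v)"
  unfolding basis.simps[of "root_index v"] by simp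

lemma basis_generator: "(n, m) \<in> set (generators a) \<Longrightarrow> basis m = arrA a * basis n"
  using generator_bounds[of n m a] unfolding basis.simps[of m] by simp

lemma basis_induct [consumes 1, case_names root_index generator]:
  assumes "m < 156" "\<And>v. P (root_index v)"
    and "\<And>a n m. (n, m) \<in> set (generators a) \<Longrightarrow> P n \<Longrightarrow> P m"
  shows "P m"
  using assms(1)
proof (induction m rule: less_induct)
  case (less m)
  show ?case
  proof (cases "m < 6")
    case True
    then obtain v where "m = root_index v" using less_6_root by blast
    then show ?thesis using assms(2) by simp
  next
    case False
    then have "6 \<le> m" by simp
    from generator_exists[OF this less.prems] obtain a n where g: "(n, m) \<in> set (generators a)"
      by blast
    then have "n < m" by (rule generator_bounds)
    with less have "P n" by simp
    with g show ?thesis by (rule assms(3))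
  qed
qed

lemma proj_arr: "arrA a = proj (idem (tgt a)) * arrA a" "arrA a = arrA a * proj (idem (src a))"
  by (simp_all add: single_mult flip: proj_mult)

lemma idem_basis: "m < 156 \<Longrightarrow> proj (idem (target m)) * basis m = basis m"
proof (induction rule: basis_induct)
  case (root_index v)
  then show ?case by (simp add: basis_root proj_idem_mult)
next
  case (generator a n m)
  then show ?case
    using left_entry(4)[OF generator_left[OF generator(1)]]
    by (simp add: basis_generator) (metis mult.assoc proj_arr(1))
qed

lemma basis_idem: "m < 156 \<Longrightarrow> basis m * proj (idem (source m)) = basis m"
proof (induction rule: basis_induct)
  case (root_index v)
  then show ?case by (simp add: basis_root proj_idem_mult)
next
  case (generator a n m)
  then show ?case
    using left_entry(5)[OF generator_left[OF generator(1)]]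
    by (simp add: basis_generator mult.assoc)
qed

lemma arr_basis_0: "n < 156 \<Longrightarrow> src a \<noteq> target n \<Longrightarrow> arrA a * basis n = 0"
proof -
  assume n: "n < 156" "src a \<noteq> target n"
  have "arrA a * basis n = (arrA a * proj (idem (src a))) * (proj (idem (target n)) * basis n)"
    by (simp only: idem_basis[OF n(1)] proj_arr(2)[symmetric])
  also have "\<dots> = arrA a * (proj (idem (src a)) * proj (idem (target n))) * basis n"
    by (simp only: mult.assoc)
  finally show ?thesis using n(2) by (simp add: proj_idem_mult)
qed

lemma basis_arr_0: "n < 156 \<Longrightarrow> tgt a \<noteq> source n \<Longrightarrow> basis n * arrA a = 0"
proof -
  assume n: "n < 156" "tgt a \<noteq> source n"
  have "basis n * arrA a = (basis n * proj (idem (source n))) * (proj (idem (tgt a)) * arrA a)"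
    by (simp only: basis_idem[OF n(1)] proj_arr(1)[symmetric])
  also have "\<dots> = basis n * (proj (idem (source n)) * proj (idem (tgt a))) * arrA a"
    by (simp only: mult.assoc)
  finally show ?thesis using n(2) by (simp add: proj_idem_mult)
qed

lemma scale_preproj_of_int: "scale_preproj (of_int c) x = of_int c * x"
  by (induction c rule: int_induct[of _ 0])
    (simp_all add: preproj_vs.scale_left_distrib preproj_vs.scale_left_diff_distrib algebra_simps)

lemma proj_relation_sum: "proj (\<Sum>y\<leftarrow>ys. scale_path (of_int (sgn_arrow y)) (arr y * arr (reverse y))) * z =
    (\<Sum>y\<leftarrow>ys. of_int (sgn_arrow y) * (arrA y * (arrA (reverse y) * z)))"
  by (induction ys)
    (simp_all add: proj_zero proj_add distrib_right scale_preproj_of_int proj_mult mult.assoc flip: scale_preproj_proj)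

lemma sum_list_filter_split:
  "(\<Sum>x\<leftarrow>xs. f x) = (\<Sum>x\<leftarrow>filter P xs. f x) + (\<Sum>x\<leftarrow>filter (\<lambda>x. \<not> P x) xs. (f x :: 'a::comm_monoid_add))"
  by (induction xs) (auto simp: add_ac)

text \<open>What the table claims the product of \<open>a\<close> and path \<open>n\<close> to be;
  \<open>arr_basis\<close> proves the claim.\<close>

abbreviation reduced :: "arrow \<Rightarrow> nat \<Rightarrow> ('f::field) preproj" where
  "reduced a n \<equiv> sp_sum (sp_column (left_mult a) n) (\<lambda>_ m. basis m)"

lemma relation_terms_sum:
  "(\<Sum>(c, y, k)\<leftarrow>relation_terms b. of_int c * G y k) =
   (\<Sum>y\<leftarrow>filter (\<lambda>y. tgt y = target b) arrows. of_int (sgn_arrow y) *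
     sp_sum (sp_column (left_mult (reverse y)) b) (\<lambda>_ m. G y m))"
proof -
  have "(\<Sum>(c, y', k)\<leftarrow>map (\<lambda>(n, m, c). (sgn_arrow y * c, y, m)) A. of_int c * G y' k)
      = of_int (sgn_arrow y) * sp_sum A (\<lambda>_ m. G y m)" for y and A :: sparse
    by (induction A) (auto simp: distrib_left mult.assoc)
  then have "(\<Sum>(c, y', k)\<leftarrow>concat (map (\<lambda>y. map (\<lambda>(n, m, c). (sgn_arrow y * c, y, m))
      (sp_column (left_mult (reverse y)) b)) ys). of_int c * G y' k)
    = (\<Sum>y\<leftarrow>ys. of_int (sgn_arrow y) * sp_sum (sp_column (left_mult (reverse y)) b) (\<lambda>_ m. G y m))" for ys
    by (induction ys) (simp_all del: map_map)
  then show ?thesis by (simp add: relation_terms_def)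
qed

text \<open>As the matrices satisfy the relations, the tabulated products fulfil the same linear
  equation as the true products.\<close>

lemma relation_terms_reduced: "(\<Sum>(c, y, k)\<leftarrow>relation_terms b. of_int c * reduced y k) = 0"
proof -
  have "sp_sum (sp_column (sp_relation (target b)) b) (\<lambda>_ l. basis l) = (0 :: 'a preproj)"
    unfolding sp_sum_column
    using relation_check in_vertices[of "target b"] by (intro sp_null_sum) (auto simp: list_all_iff)
  moreover have "sp_sum (sp_column (sp_relation v) b) (\<lambda>_ l. basis l) =
      (\<Sum>y\<leftarrow>filter (\<lambda>y. tgt y = v) arrows. of_int (sgn_arrow y) *
     sp_sum (sp_column (left_mult (reverse y)) b) (\<lambda>_ m. reduced y m :: 'a preproj))" for v
  proof -
    have "sp_sum (sp_column (sp_mul A B) b) (\<lambda>_ l. basis l) =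
        sp_sum (sp_column B b) (\<lambda>_ m. sp_sum (sp_column A m) (\<lambda>_ l. basis l :: 'a preproj))" for A B
    proof -
      have "sp_sum A (\<lambda>n l. sp_sum B (\<lambda>k m. if m = n then if k = b then basis l else 0 else 0)) =
         sp_sum B (\<lambda>k m. if k = b then sp_sum A (\<lambda>n l. if n = m then basis l else 0) else (0 :: 'a preproj))"
      proof (induction B)
        case (Cons e B)
        obtain k m c where e: "e = (k, m, c)" by (cases e)
        have "sp_sum A (\<lambda>n l. of_int c * (if m = n then if k = b then basis l else 0 else 0)) =
           of_int c * (if k = b then sp_sum A (\<lambda>n l. if n = m then basis l else 0) else (0 :: 'a preproj))"
          unfolding sp_sum_mult_left
          by (cases "k = b") (auto intro!: arg_cong[of _ _ "\<lambda>x. of_int c * x"] sp_sum_cong cong: if_cong)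
        with Cons show ?case by (simp add: e sp_sum_add)
      qed simp
      then show ?thesis by (simp add: sp_sum_column sp_sum_mul)
    qed
    then show ?thesis
      by (simp add: sp_relation_def sp_sum_column sp_sum_concat sp_sum_scale)
  qed
  ultimately show ?thesis by (simp add: relation_terms_sum)
qed

lemma case_singletonE:
  assumes "case xs of [(c, y, k)] \<Rightarrow> P c | _ \<Rightarrow> False"
  obtains c y k where "xs = [(c, y, k)]" "P c"
  using assms by (cases xs; cases "tl xs"; cases "hd xs") auto

lemma in_set_zip_upt:
  assumes "length xs = k" "n < k" "P (xs ! n)"
  shows "n \<in> set (map fst (filter (\<lambda>(n, v). P v) (zip [0..<k] xs)))"
proof -
  have "(n, xs ! n) \<in> set (zip [0..<k] xs)"
    using assms by (auto simp: in_set_zip intro!: exI[of _ n])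
  then show ?thesis using assms(3) by force
qed

text \<open>True and tabulated products satisfy the same relation, so their differences, weighted by
  its coefficients, add up to 0. By induction or because the product is a basis path, all
  differences vanish except the one at the pivot, whose coefficient is 1 or -1.\<close>

lemma arr_basis: "n < 156 \<Longrightarrow> arrA a * basis n = (reduced a n :: ('f::field) preproj)"
proof (induction n arbitrary: a rule: less_induct)
  case (less n)
  have gen: "arrA y * basis k = (reduced y k :: 'f preproj)" if "extends y k" for y k
  proof -
    obtain m where "(k, m) \<in> set (generators y)" using \<open>extends y k\<close> by (auto simp: extends_def)
    then show ?thesis by (simp add: generator_column basis_generator)
  qed
  show ?case
  proof (cases "src a = target n")
    case False
    have "sp_sum (left_mult a) (\<lambda>k m. if k = n then basis m else 0) = sp_sum (left_mult a) (\<lambda>_ _. 0 :: 'f preproj)"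
      by (rule sp_sum_cong) (use False in \<open>auto dest: left_entry\<close>)
    then have "reduced a n = (0 :: 'f preproj)" by (simp add: sp_sum_column)
    with False less.prems show ?thesis by (simp add: arr_basis_0)
  next
    case True
    have "n \<in> set (map fst (generators a) @ map fst (pivots a))"
      using in_set_zip_upt[of targets 156 n "\<lambda>v. v = src a"] table_lengths less.prems True
      unfolding bspec[OF pivot_cover[unfolded list_all_iff] in_arrows[of a], symmetric] set_sort
      by (simp only: target_def if_True simp_thms)
    then consider "extends a n" | b where "(n, b) \<in> set (pivots a)"
      by (auto simp: extends_def)
    then show ?thesis
    proof cases
      case 1
      then show ?thesis by (rule gen)
    next
      case (2 b)
      let ?ts = "relation_terms b"
      let ?\<delta> = "\<lambda>y k. arrA y * basis k - (reduced y k :: 'f preproj)"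
      have b: "b < n" "pivot_terms a n ?ts"
        using pivot_check in_arrows[of a] 2 by (fastforce simp: list_all_iff)+
      \<comment> \<open>The inner products with path \<open>b\<close> may be exchanged for table
        values, because \<open>b < n\<close> puts them under the induction hypothesis.\<close>
      have "(\<Sum>(c, y, k)\<leftarrow>?ts. of_int c * (arrA y * basis k)) =
          (\<Sum>y\<leftarrow>filter (\<lambda>y. tgt y = target b) arrows. of_int (sgn_arrow y) *
            (arrA y * (arrA (reverse y) * basis b :: 'f preproj)))"
        using less.IH[OF b(1)] b(1) less.prems
        by (simp add: relation_terms_sum[where G = "\<lambda>y k. arrA y * basis k"] sp_sum_mult_left del: reverse_simps)
      also have "\<dots> = proj (sigma (target b)) * basis b"
        unfolding sigma_sum by (rule proj_relation_sum[symmetric])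
      also have "\<dots> = 0"
        by (simp add: proj_eq_zero ideal_gen.gen sigma_in_rels)
      finally have "(\<Sum>(c, y, k)\<leftarrow>?ts. of_int c * ?\<delta> y k) = 0"
        using relation_terms_reduced[of b, where 'a = 'f]
        by (simp add: right_diff_distrib case_prod_unfold sum_list_subtractf)
      moreover have "(\<Sum>(c, y, k)\<leftarrow>filter (\<lambda>x. \<not> (case x of (c, y, k) \<Rightarrow> y = a \<and> k = n)) ?ts. of_int c * ?\<delta> y k) = 0"
      proof -
        have "?\<delta> y k = 0" if "(c, y, k) \<in> set ?ts" "\<not> (y = a \<and> k = n)" for c y k
        proof (cases "k < n")
          case True
          then show ?thesis using less.IH[of k y] less.prems by simp
        next
          case False
          then have "extends y k"
            using b(2) that by (fastforce simp: pivot_terms_def list_all_iff)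
          then show ?thesis using gen by simp
        qed
        then have "(\<Sum>(c, y, k)\<leftarrow>filter (\<lambda>x. \<not> (case x of (c, y, k) \<Rightarrow> y = a \<and> k = n)) ?ts. of_int c * ?\<delta> y k)
            = (\<Sum>x\<leftarrow>filter (\<lambda>x. \<not> (case x of (c, y, k) \<Rightarrow> y = a \<and> k = n)) ?ts. 0)"
          by (intro arg_cong[of _ _ sum_list] map_cong) fastforce+
        then show ?thesis by simp
      qed
      moreover obtain c where c: "filter (\<lambda>(c, y, k). y = a \<and> k = n) ?ts = [(c, a, n)]" "c * c = 1"
      proof -
        obtain c y k where f: "filter (\<lambda>(c, y, k). y = a \<and> k = n) ?ts = [(c, y, k)]" "c * c = 1"
          using b(2) unfolding pivot_terms_def by (elim conjE case_singletonE)
        then have "(c, y, k) \<in> set (filter (\<lambda>(c, y, k). y = a \<and> k = n) ?ts)" by simp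
        then have "y = a" "k = n" by auto
        with f that show thesis by simp
      qed
      ultimately have "of_int c * ?\<delta> a n = 0"
        using sum_list_filter_split[of "\<lambda>(c, y, k). of_int c * ?\<delta> y k" ?ts "\<lambda>(c, y, k). y = a \<and> k = n"]
        by simp
      \<comment> \<open>A second factor \<open>c\<close> turns the coefficient into 1 without
        dividing.\<close>
      then have "of_int (c * c) * ?\<delta> a n = 0"
        by (simp add: mult.assoc)
      then show ?thesis by (simp add: c(2))
    qed
  qed
qed

definition of_coords :: "(nat \<Rightarrow> 'f) \<Rightarrow> ('f::field) preproj" where
  "of_coords \<mu> = (\<Sum>n<156. scale_preproj (\<mu> n) (basis n))"

text \<open>Makes \<open>of_coords\<close> a map of left modules from coordinate vectors to
  \<open>A\<close>; the content is \<open>arr_basis\<close>.\<close>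

lemma of_coords_left: "of_coords (left a \<mu>) = arrA a * of_coords \<mu>"
proof -
  have "of_coords (left a \<mu>) = (\<Sum>m<156. sp_sum (left_mult a) (\<lambda>n k. if k = m then scale_preproj (\<mu> n) (basis k) else 0))"
  proof -
    have "scale_preproj (sp_sum A (\<lambda>n k. if k = m then \<mu> n else 0)) (basis m)
        = sp_sum A (\<lambda>n k. if k = m then scale_preproj (\<mu> n) (basis k) else 0)" for A m
      by (induction A) (auto simp: preproj_vs.scale_left_distrib scale_preproj_of_int
          simp flip: preproj_vs.scale_scale)
    then show ?thesis by (simp add: of_coords_def sp_app_def)
  qed
  also have "\<dots> = sp_sum (left_mult a) (\<lambda>n k. scale_preproj (\<mu> n) (basis k))"
    unfolding sp_sum_sum[symmetric] by (rule sp_sum_cong) (auto dest: left_entry)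
  also have "\<dots> = sp_sum (left_mult a) (\<lambda>n k. \<Sum>i<156. if n = i then scale_preproj (\<mu> i) (basis k) else 0)"
    by (rule sp_sum_cong) (auto dest: left_entry)
  also have "\<dots> = (\<Sum>i<156. scale_preproj (\<mu> i) (reduced a i))"
  proof -
    have "sp_sum A (\<lambda>n k. if n = i then scale_preproj (\<mu> i) (basis k) else 0)
       = scale_preproj (\<mu> i) (sp_sum A (\<lambda>n k. if n = i then basis k else 0))" for A i
      by (induction A) (auto simp: preproj_vs.scale_right_distrib scale_preproj_mult_right)
    then show ?thesis unfolding sp_sum_sum sp_sum_column by simp
  qed
  also have "\<dots> = arrA a * of_coords \<mu>"
    by (simp add: of_coords_def sum_distrib_left scale_preproj_mult_right arr_basis)
  finally show ?thesis .
qed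

lemma of_coords_add: "of_coords (\<lambda>n. \<mu> n + \<nu> n) = of_coords \<mu> + of_coords \<nu>"
  by (simp add: of_coords_def preproj_vs.scale_left_distrib sum.distrib)

lemma of_coords_scale: "of_coords (\<lambda>n. c * \<mu> n) = scale_preproj c (of_coords \<mu>)"
  by (simp add: of_coords_def preproj_vs.scale_sum_right)

lemma of_coords_zero: "of_coords (\<lambda>n. 0) = 0"
  by (simp add: of_coords_def)

text \<open>Both maps commute with arrows and agree on trivial paths, so induction along paths gives
  the identity. Hence the 156 elements span \<open>A\<close> and an element is determined by its
  coordinates.\<close>

lemma of_coords_coords:
  fixes x :: "'f::field preproj"
  shows "of_coords (coords x) = x"
proof -
  obtain x' where x: "x = proj x'" by (rule proj_surj)
  have path: "of_coords (path_act v xs unit) = (proj (single (v, xs)) :: 'f preproj)" if "is_path v xs" for v xs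
    using that
  proof (induction xs arbitrary: v)
    case Nil
    have "of_coords (path_act v [] unit) = (\<Sum>n<156. if n = root_index v then (proj (idem v) :: 'f preproj) else 0)"
      unfolding of_coords_def
    proof (rule sum.cong)
      fix n
      show "scale_preproj (path_act v [] unit n) (basis n) = (if n = root_index v then proj (idem v) else 0)"
        using less_6_root[of n] by (auto simp: at_target_def unit_def basis_root)
    qed simp
    moreover have "root_index v < 156" using root_less[of v] by linarith
    ultimately show ?case by simp
  next
    case (Cons a xs)
    then have "single (v, a # xs) = arr a * (single (src a, xs) :: 'f path_alg)"
      by (simp add: single_mult)
    then have "proj (single (v, a # xs)) = arrA a * (proj (single (src a, xs)) :: 'f preproj)"
      by (simp only: proj_mult)
    moreover have "of_coords (path_act (src a) xs unit) = (proj (single (src a, xs)) :: 'f preproj)"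
      using Cons by simp
    ultimately show ?case by (simp only: path_act.simps of_coords_left)
  qed
  have "of_coords (act_path_alg x' unit) = proj x'"
    by (induction x' rule: path_alg_induct)
      (simp_all add: act_path_alg_zero act_path_alg_scale act_path_alg_add act_path_alg_single path
        of_coords_zero of_coords_scale of_coords_add proj_zero proj_add scale_preproj_proj)
  then show ?thesis by (simp add: x coords_def act_proj)
qed

lemma coords_eqI: "(\<And>n. n < 156 \<Longrightarrow> coords x n = coords y n) \<Longrightarrow> x = y"
  using of_coords_coords[of x] of_coords_coords[of y] by (simp add: of_coords_def)

text \<open>Independence of the 156 elements. Each is built from a trivial path by generators, and
  the columns of generators are unit vectors.\<close>

lemma coords_basis: "n < 156 \<Longrightarrow> coords (basis n) m = (if m = n then 1 else (0 :: 'f::field))"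
proof (induction arbitrary: m rule: basis_induct)
  case (root_index v)
  then show ?case by (simp add: basis_root coords_idem)
next
  case (generator a k n)
  have "coords (basis n) m = sp_sum (left_mult a) (\<lambda>l i. if l = k then if i = m then 1 else 0 else (0 :: 'f))"
    unfolding basis_generator[OF generator(1)] coords_arr_mult by (rule sp_sum_cong) (simp add: generator(2))
  also have "\<dots> = (if n = m then 1 else 0)"
    using generator_column[OF generator(1), of "\<lambda>_ i. if i = m then 1 else 0"] by (simp add: sp_sum_column)
  finally show ?case by auto
qed

lemma coords_sum: "coords (\<Sum>i\<in>I. f i) m = (\<Sum>i\<in>I. coords (f i) m)"
  by (induction I rule: infinite_finite_induct) (simp_all add: coords_zero coords_add)

lemma coords_of_coords: "m < 156 \<Longrightarrow> coords (of_coords \<mu>) m = \<mu> m"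
  by (simp add: of_coords_def coords_sum coords_scale coords_basis if_distrib[of "\<lambda>x. _ * x"] cong: if_cong)

section \<open>Right multiplication\<close>

text \<open>Evaluates the second half of \<open>right_step\<close> at coordinate \<open>m\<close>:
  the entries of the column \<open>A\<close> are pushed through the matrix \<open>L\<close>, with a
  minus sign.\<close>

lemma compose_columns:
  "sp_sum (concat (map (\<lambda>(k', l, d). map (\<lambda>(l', m, c). (n, m, - (c * d))) (sp_column L l)) A))
      (\<lambda>_ k. if k = m then 1 else (0 :: 'f::field))
    = - sp_sum L (\<lambda>l' i. if i = m then sp_sum A (\<lambda>_ l. if l = l' then 1 else 0) else 0)"
proof (induction A)
  case Nil
  show ?case by (simp cong: if_cong)
next
  case (Cons e A)
  let ?G = "\<lambda>k. if k = m then 1 else (0 :: 'f)"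
  obtain k' l d where e: "e = (k', l, d)" by (cases e)
  have 1: "sp_sum (map (\<lambda>(l', m, c). (n, m, - (c * d))) B) (\<lambda>_. ?G) = - (sp_sum B (\<lambda>_. ?G) * of_int d)" for B
  proof (induction B)
    case (Cons x B)
    obtain l' i c where x: "x = (l', i, c)" by (cases x)
    have "of_int (- (c * d)) * ?G i = - (of_int c * ?G i * of_int d)"
      by (simp only: of_int_minus of_int_mult mult_minus_left mult.assoc mult.commute[of "of_int d"])
    then show ?case
      unfolding x list.map prod.case sp_sum_simps Cons.IH by (simp only: distrib_right minus_add_distrib)
  qed simp
  have 2: "sp_sum (sp_column L l) (\<lambda>_. ?G) * of_int d =
      sp_sum L (\<lambda>l' i. if i = m then if l = l' then of_int d else 0 else 0)"
  proof -
    have "sp_sum (sp_column L l) (\<lambda>_. ?G) * of_int d = sp_sum L (\<lambda>l' i. (if l' = l then ?G i else 0) * of_int d)"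
      by (simp only: sp_sum_column sp_sum_mult_right)
    also have "\<dots> = sp_sum L (\<lambda>l' i. if i = m then if l = l' then of_int d else 0 else 0)"
      by (rule arg_cong[of _ _ "sp_sum L"]) (auto simp: fun_eq_iff)
    finally show ?thesis .
  qed
  have 3: "sp_sum L (\<lambda>l' i. if i = m then sp_sum (e # A) (\<lambda>_ l. if l = l' then 1 else 0) else 0)
    = sp_sum L (\<lambda>l' i. if i = m then if l = l' then of_int d else 0 else 0) +
      sp_sum L (\<lambda>l' i. if i = m then sp_sum A (\<lambda>_ l. if l = l' then 1 else (0 :: 'f)) else 0)"
    unfolding sp_sum_add[symmetric] by (rule sp_sum_cong) (simp add: e)
  have "sp_sum (concat (map (\<lambda>(k', l, d). map (\<lambda>(l', m, c). (n, m, - (c * d))) (sp_column L l)) (e # A))) (\<lambda>_. ?G)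
    = - (sp_sum (sp_column L l) (\<lambda>_. ?G) * of_int d) + sp_sum (concat (map (\<lambda>(k', l, d).
        map (\<lambda>(l', m, c). (n, m, - (c * d))) (sp_column L l)) A)) (\<lambda>_. ?G)"
    unfolding e list.map concat.simps prod.case sp_sum_simps 1 ..
  then show ?case
    unfolding 3 Cons.IH 2 by (simp only: minus_add_distrib)
qed

lemma coords_one: "coords 1 = (unit :: nat \<Rightarrow> 'f::field)"
proof
  fix n
  have "coords 1 n = coords (proj (idem V0)) n + coords (proj (idem V1)) n + coords (proj (idem V2)) n +
      coords (proj (idem V3)) n + coords (proj (idem V4)) n + (coords (proj (idem V5)) n :: 'f)"
    unfolding proj_one[symmetric] one_eq_sum_idem proj_add coords_add ..
  also have "\<dots> = unit n"
    unfolding coords_idem root_index.simps unit_def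
    by (cases "n < 6") (auto simp: less_Suc_eq numeral_eq_Suc)
  finally show "coords 1 n = (unit n :: 'f)" .
qed

text \<open>The right tables propagate along the stems: if path \<open>n\<close> is \<open>a\<close>
  times path \<open>k\<close>, its product with \<open>b\<close> is \<open>a\<close> times the
  product of \<open>k\<close> with \<open>b\<close>. The induction step is
  \<open>right_check\<close>.\<close>

lemma coords_basis_arr:
  "n < 156 \<Longrightarrow> coords (basis n * arrA b) m =
    sp_sum (sp_column (right_mult b) n) (\<lambda>_ k. if k = m then 1 else (0 :: 'f::field))"
proof (induction arbitrary: m rule: basis_induct)
  case (root_index v)
  have snd_sum: "sp_sum A (\<lambda>_ k. G k) = (\<Sum>(k, c)\<leftarrow>map snd A. of_int c * G k)" for A :: sparse and G :: "nat \<Rightarrow> 'f"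
    by (induction A) auto
  have col: "map snd (sp_column (right_mult b) (root_index v)) =
      (if tgt b = v then map snd (sp_column (left_mult b) (root_index (src b))) else [])"
    using right_root_check in_arrows[of b] in_vertices[of v] unfolding list_all_iff by fastforce
  show ?case
  proof (cases "tgt b = v")
    case True
    have "coords (basis (root_index v) * arrA b) m = coords (arrA b * 1 :: 'f preproj) m"
      unfolding basis_root True[symmetric] proj_arr(1)[symmetric] mult_1_right ..
    also have "\<dots> = sp_sum (left_mult b) (\<lambda>n k. if n = root_index (src b) then if k = m then 1 else 0 else 0)"
      unfolding coords_arr_mult coords_one
    proof (rule sp_sum_cong)
      fix n k c assume e: "(n, k, c) \<in> set (left_mult b)"
      then show "(if k = m then unit n else 0) = (if n = root_index (src b) then if k = m then 1 else 0 else (0 :: 'f))"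
        using left_entry(3)[OF e] less_6_root[of n] by (auto simp: unit_def)
    qed
    also have "\<dots> = sp_sum (sp_column (left_mult b) (root_index (src b))) (\<lambda>_ k. if k = m then 1 else 0)"
      by (simp only: sp_sum_column)
    finally show ?thesis
      by (simp only: snd_sum col True refl if_True)
  next
    case False
    moreover have "root_index v < 156" using root_less[of v] by linarith
    ultimately show ?thesis
      by (simp add: snd_sum col coords_zero basis_arr_0)
  qed
next
  case (generator a k n)
  note bounds = generator_bounds[OF generator(1)]
  show ?case
  proof (cases "tgt b = source n")
    case False
    have "sp_sum (right_mult b) (\<lambda>i k. if i = n then if k = m then 1 else 0 else 0) = sp_sum (right_mult b) (\<lambda>_ _. (0 :: 'f))"
      by (rule sp_sum_cong) (use False in \<open>auto dest: right_entry\<close>)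
    then show ?thesis
      using False bounds by (simp add: sp_sum_column coords_zero basis_arr_0)
  next
    case True
    have "(n, a, k) \<in> set stems" using generator(1) by (simp only: stems_iff)
    then have "sp_null (right_step b n a k)"
      using right_check in_arrows[of b] True unfolding list_all_iff by fast
    then have z: "sp_sum (right_step b n a k) (\<lambda>_ k. if k = m then 1 else (0 :: 'f)) = 0" by (rule sp_null_sum)
    have "coords (basis n * arrA b) m = sp_sum (left_mult a) (\<lambda>l i. if i = m then
        sp_sum (sp_column (right_mult b) k) (\<lambda>_ l'. if l' = l then 1 else (0 :: 'f)) else 0)"
      unfolding basis_generator[OF generator(1)] mult.assoc coords_arr_mult generator(2) ..
    then show ?thesis
      using z by (simp add: right_step_def compose_columns)
  qed
qed

lemma coords_mult_arr: "coords (x * arrA b) m = sp_sum (right_mult b) (\<lambda>n k. if k = m then coords x n else 0)"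
proof -
  have "coords (x * arrA b) m = (\<Sum>n<156. coords x n * sp_sum (sp_column (right_mult b) n) (\<lambda>_ k. if k = m then 1 else 0))"
    by (subst of_coords_coords[of x, symmetric])
      (simp add: of_coords_def sum_distrib_right scale_preproj_mult_left coords_sum coords_scale coords_basis_arr)
  also have "\<dots> = sp_sum (right_mult b) (\<lambda>n k. \<Sum>i<156. if n = i then if k = m then coords x i else 0 else 0)"
    unfolding sp_sum_sum sp_sum_column sp_sum_mult_left[symmetric]
    by (intro sum.cong refl sp_sum_cong) simp
  also have "\<dots> = sp_sum (right_mult b) (\<lambda>n k. if k = m then coords x n else 0)"
    by (rule sp_sum_cong) (auto dest: right_entry)
  finally show ?thesis .
qed

section \<open>Values at arrows and at vertices in coordinates\<close>

definition block :: "vertex \<Rightarrow> vertex \<Rightarrow> nat list" where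
  "block v w = map fst (filter (\<lambda>(n, t, s). t = v \<and> s = w) (zip [0..<156] (zip targets
      sources)))"

definition arrow_block :: "arrow \<Rightarrow> nat list" where
  "arrow_block a = block (tgt a) (src a)"

definition vertex_block :: "vertex \<Rightarrow> nat list" where
  "vertex_block v = block v v"

lemma arrow_block:
  "arrow_block A0 = [15, 46, 86, 87, 124, 149]"
  "arrow_block A1 = [14, 85, 121]"
  "arrow_block A2 = [12, 41, 42, 81, 82, 118, 119, 147]"
  "arrow_block A3 = [9, 35, 36, 74, 75, 113, 115, 143]"
  "arrow_block A4 = [7, 70, 110]"
  "arrow_block B0 = [11, 39, 78, 79, 117, 145]"
  "arrow_block B1 = [13, 83, 120]"
  "arrow_block B2 = [10, 37, 38, 76, 77, 114, 116, 144]"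
  "arrow_block B3 = [8, 32, 33, 71, 72, 111, 112, 141]"
  "arrow_block B4 = [6, 68, 108]"
  by code_simp+

lemma vertex_block:
  "vertex_block V0 = [0, 67, 107, 155]"
  "vertex_block V1 = [1, 104]"
  "vertex_block V2 = [2, 25, 61, 100, 101, 135]"
  "vertex_block V3 = [3, 21, 22, 55, 56, 57, 95, 96, 97, 131, 132, 152]"
  "vertex_block V4 = [4, 17, 50, 90, 91, 127]"
  "vertex_block V5 = [5, 88]"
  by code_simp+

lemma diagonal_index_check: "list_all (\<lambda>n. target n = source n) [0, 67, 107, 155, 1, 104, 2, 25,
    61, 100, 101, 135, 3, 21, 22, 55, 56, 57, 95, 96, 97, 131, 132, 152, 4, 17, 50, 90, 91, 127, 5, 88]"
  by code_simp

text \<open>The vertex \<open>v\<close> is kept free because the simplifier evaluates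
  \<open>tgt a\<close> inside \<open>arr a\<close>; the rules still match afterwards.\<close>

lemma coords_single_mult: "coords (proj (single (v, [a])) * x) m =
    (if tgt a = v then sp_sum (left_mult a) (\<lambda>n k. if k = m then coords x n else 0) else 0)"
  and coords_mult_single: "coords (x * proj (single (v, [a]))) m =
    (if tgt a = v then sp_sum (right_mult a) (\<lambda>n k. if k = m then coords x n else 0) else 0)"
proof -
  have "tgt a \<noteq> v \<Longrightarrow> single (v, [a]) = (0 :: 'a path_alg)"
    by (rule path_alg_eqI) (simp add: coeff_single)
  then show "coords (proj (single (v, [a])) * x) m =
    (if tgt a = v then sp_sum (left_mult a) (\<lambda>n k. if k = m then coords x n else 0) else 0)"
    "coords (x * proj (single (v, [a]))) m =
    (if tgt a = v then sp_sum (right_mult a) (\<lambda>n k. if k = m then coords x n else 0) else 0)"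
    using coords_arr_mult[of a x m] coords_mult_arr[of x a m]
    by (cases "tgt a = v"; simp add: proj_zero coords_zero)+
qed

lemmas row_simps = coords_single_mult coords_mult_single coords_add coords_diff coords_uminus
  coords_scale coords_zero left_mult_def

text \<open>The value at \<open>sigma v\<close> of the linear map that sends the product of arrows
  \<open>a\<close>, \<open>b\<close> to \<open>F a b\<close>. Coboundaries of 1-cochains and their
  products with \<open>fund\<close> take this form.\<close>

definition sigma_value :: "(arrow \<Rightarrow> arrow \<Rightarrow> ('f::field) preproj) \<Rightarrow> vertex \<Rightarrow> 'f preproj" where
  "sigma_value F v = (\<Sum>a\<leftarrow>filter (\<lambda>a. tgt a = v) arrows. of_int (sgn_arrow a) * F a (reverse a))"

text \<open>These are the sums of elements of the spaces from a vertex to itself, and exactly the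
  values at 1 of 0-cochains.\<close>

definition diagonal :: "('f::field) preproj \<Rightarrow> bool" where
  "diagonal x \<longleftrightarrow> (\<forall>v. proj (idem v) * x = x * proj (idem v))"

lemma diagonal_of_coords:
  assumes "\<And>n. \<mu> n \<noteq> 0 \<Longrightarrow> target n = source n"
  shows "diagonal (of_coords \<mu>)"
  unfolding diagonal_def
proof
  fix v
  show "proj (idem v) * of_coords \<mu> = of_coords \<mu> * proj (idem v)"
    by (rule coords_eqI) (simp add: coords_idem_mult coords_mult_idem coords_of_coords, metis assms)
qed

lemma diagonal_coords:
  assumes "diagonal x" "coords x n \<noteq> 0"
  shows "target n = source n"
proof -
  have "coords (proj (idem (target n)) * x) n = coords (x * proj (idem (target n))) n"
    using assms(1) by (simp add: diagonal_def)
  then show ?thesis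
    using assms(2) by (auto simp: coords_idem_mult coords_mult_idem split: if_splits)
qed

lemma diagonal_arr:
  assumes "diagonal z"
  shows "proj (idem (tgt a)) * (arrA a * z) = arrA a * z" "(arrA a * z) * proj (idem (src a)) = arrA a * z"
    "proj (idem (tgt a)) * (z * arrA a) = z * arrA a" "(z * arrA a) * proj (idem (src a)) = z * arrA a"
proof -
  have d: "z * proj (idem v) = proj (idem v) * z" for v using assms by (simp only: diagonal_def)
  show "proj (idem (tgt a)) * (arrA a * z) = arrA a * z"
    by (simp only: mult.assoc[symmetric] proj_arr(1)[symmetric])
  show "(z * arrA a) * proj (idem (src a)) = z * arrA a"
    by (simp only: mult.assoc proj_arr(2)[symmetric])
  have "(arrA a * z) * proj (idem (src a)) = arrA a * proj (idem (src a)) * z"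
    by (simp only: mult.assoc d)
  then show "(arrA a * z) * proj (idem (src a)) = arrA a * z"
    by (simp only: proj_arr(2)[symmetric])
  have "proj (idem (tgt a)) * (z * arrA a) = z * (proj (idem (tgt a)) * arrA a)"
    by (simp only: mult.assoc[symmetric] d)
  then show "proj (idem (tgt a)) * (z * arrA a) = z * arrA a"
    by (simp only: proj_arr(1)[symmetric])
qed

lemma in_block:
  assumes "n < 156"
  shows "n \<in> set (block (target n) (source n))"
proof -
  have "n \<in> set (map fst (filter (\<lambda>(i, t, s). t = xs ! n \<and> s = ys ! n) (zip [0..<k] (zip xs ys))))"
    if "length xs = k" "length ys = k" "n < k" for xs ys k
  proof -
    have "(n, xs ! n, ys ! n) \<in> set (zip [0..<k] (zip xs ys))"
      using that by (auto simp: in_set_zip intro!: exI[of _ n])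
    then show ?thesis by force
  qed
  from this[OF conjunct1[OF table_lengths] conjunct2[OF table_lengths] assms] show ?thesis
    using assms unfolding block_def target_def source_def by (simp only: if_True)
qed

text \<open>A value at \<open>a\<close> is fixed by the idempotents of the endpoints of
  \<open>a\<close>, which leaves at most eight coordinates to compare.\<close>

lemma arrow_eqI:
  assumes eq: "\<And>n. n \<in> set (arrow_block a) \<Longrightarrow> coords x n = coords y n"
    and x: "proj (idem (tgt a)) * x = x" "x * proj (idem (src a)) = x"
    and y: "proj (idem (tgt a)) * y = y" "y * proj (idem (src a)) = y"
  shows "x = y"
proof (rule coords_eqI)
  fix n :: nat assume n: "n < 156"
  have x0: "coords x n = (if target n = tgt a then coords x n else 0)" "coords x n = (if source n = src a then coords x n else 0)"
    using coords_idem_mult[of "tgt a" x n] coords_mult_idem[of x "src a" n] unfolding x by simp_all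
  have y0: "coords y n = (if target n = tgt a then coords y n else 0)" "coords y n = (if source n = src a then coords y n else 0)"
    using coords_idem_mult[of "tgt a" y n] coords_mult_idem[of y "src a" n] unfolding y by simp_all
  show "coords x n = coords y n"
  proof (cases "target n = tgt a \<and> source n = src a")
    case True
    then show ?thesis using eq in_block[OF n] by (simp add: arrow_block_def)
  next
    case False
    then show ?thesis using x0 y0 by (metis)
  qed
qed

lemma diagonal_eqI:
  assumes "diagonal x" "diagonal y" "\<And>n v. n \<in> set (vertex_block v) \<Longrightarrow> coords x n = coords y n"
  shows "x = y"
proof (rule coords_eqI)
  fix n :: nat assume n: "n < 156"
  show "coords x n = coords y n"
  proof (cases "target n = source n")
    case True
    then show ?thesis using assms(3) in_block[OF n] by (metis vertex_block_def)
  next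
    case False
    then show ?thesis using assms(1,2) diagonal_coords by metis
  qed
qed

text \<open>Splits membership in an explicit list into one goal per index, so that every coordinate
  is simplified on its own.\<close>

lemma set_elims:
  "x \<in> set (y # ys) \<Longrightarrow> (x = y \<Longrightarrow> P) \<Longrightarrow> (x \<in> set ys \<Longrightarrow> P) \<Longrightarrow> P"
  "x \<in> set [] \<Longrightarrow> P"
  by auto

lemmas diagonal_index = diagonal_index_check[unfolded list.pred_inject]

lemma basis_lincomb_eq: "m < 156 \<Longrightarrow> n < 156 \<Longrightarrow> m \<noteq> n \<Longrightarrow>
    scale_preproj s (basis m) + scale_preproj t (basis n) = of_coords ((\<lambda>_. 0)(m := s, n := t))"
  by (rule coords_eqI) (simp add: coords_add coords_scale coords_basis coords_of_coords)

lemma diagonal_lincomb: "diagonal (scale_preproj s (basis 155) + scale_preproj t (basis 152))"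
  by (subst basis_lincomb_eq) (simp_all, rule diagonal_of_coords, simp add: diagonal_index split: if_splits)

lemma single_basis:
  assumes "n < 156"
  shows "proj (single (v, [a])) * basis n =
    (if tgt a = v then sp_sum (left_mult a) (\<lambda>k m. if k = n then basis m else 0) else 0)"
proof -
  have "tgt a \<noteq> v \<Longrightarrow> single (v, [a]) = (0 :: 'a path_alg)"
    by (rule path_alg_eqI) (simp add: coeff_single)
  then show ?thesis
    using arr_basis[OF assms, of a] by (cases "tgt a = v") (auto simp: proj_zero sp_sum_column)
qed

section \<open>The elements \<open>rho5\<close>, \<open>pi0\<close> and \<open>pi3\<close> in the
  basis\<close>

definition rho5_value :: "arrow \<Rightarrow> ('f::field) preproj" where
  "rho5_value a = (case a of
       A0 \<Rightarrow> c2 * c3 * arrA A0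
     | A1 \<Rightarrow> arrA B2 * c0 * arrA A2 * arrA A1
     | A2 \<Rightarrow> c2 * c0 * arrA A2
     | B0 \<Rightarrow> - (arrA B0 * c3\<^sup>2)
     | B1 \<Rightarrow> - (arrA B1 * arrA B2 * c0 * arrA A2)
     | B2 \<Rightarrow> arrA B2 * c3\<^sup>2
     | _ \<Rightarrow> 0)"

lemma idem_single: "proj (idem v) * proj (single (w, [a])) =
    (if v = w then proj (single (w, [a])) else (0 :: 'f::field preproj))"
  and single_idem_arr: "proj (single (w, [a])) * proj (idem v) =
    (if v = src a then proj (single (w, [a])) else (0 :: 'f preproj))"
proof -
  have "idem v * single (w, [a]) = (if v = w then single (w, [a]) else (0 :: 'f path_alg))"
    by (rule path_alg_eqI) (auto simp: idem_mult_coeff coeff_single)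
  then show "proj (idem v) * proj (single (w, [a])) = (if v = w then proj (single (w, [a])) else (0 :: 'f preproj))"
    by (simp add: proj_zero flip: proj_mult)
  have "single (w, [a]) * idem v = (if v = src a then single (w, [a]) else (0 :: 'f path_alg))"
    by (rule path_alg_eqI) (auto simp: coeff_mult_idem coeff_single)
  then show "proj (single (w, [a])) * proj (idem v) = (if v = src a then proj (single (w, [a])) else (0 :: 'f preproj))"
    by (simp add: proj_zero flip: proj_mult)
qed

lemma idem_single_mult: "proj (idem v) * (proj (single (w, [a])) * x) = (if v = w then proj (single (w, [a])) * x else 0)"
  by (simp add: idem_single flip: mult.assoc)

lemma rho5_local:
  "proj (idem (tgt a)) * rho5_value a = rho5_value a" "rho5_value a * proj (idem (src a)) = rho5_value a"
  by (cases a; simp add: rho5_value_def c0_def c2_def c3_def mult.assoc idem_single_mult single_idem_arr power2_eq_square)+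

text \<open>Appending a trivial path gives the table lookup a starting point: the arrows of a word
  are then applied one by one from the right.\<close>

lemma eval_at_root:
  assumes "x * proj (idem v) = x"
  shows "x = x * basis (root_index v)"
  using assms by (simp add: basis_root)

lemmas word_simps = c0_def c2_def c3_def mult.assoc power2_eq_square single_basis left_mult_def
  distrib_left right_diff_distrib

lemma rho5_basis:
  "rho5_value A0 = basis 86" "rho5_value A1 = basis 85" "rho5_value A2 = basis 81"
  "rho5_value A3 = 0" "rho5_value A4 = 0" "rho5_value B0 = - basis 78 - basis 79"
  "rho5_value B1 = - basis 83" "rho5_value B2 = basis 76 + basis 77" "rho5_value B3 = 0" "rho5_value B4 = 0"
  by (subst eval_at_root[OF rho5_local(2)], simp add: rho5_value_def word_simps)+

lemma pi_basis: "pi0 = basis 155" "pi3 = - basis 152"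
proof -
  have "pi0 * proj (idem V0) = pi0"
    by (simp add: pi0_def c0_def c3_def mult.assoc single_idem_arr)
  from eval_at_root[OF this] show "pi0 = basis 155"
    by (simp add: pi0_def word_simps)
  have "pi3 * proj (idem V3) = pi3"
    by (simp add: pi3_def c0_def c3_def mult.assoc single_idem_arr power2_eq_square)
  from eval_at_root[OF this] show "pi3 = - basis 152"
    by (simp add: pi3_def word_simps)
qed

text \<open>The length of the \<open>n\<close>-th basis path: the thresholds are the first indices
  of lengths 1 to 10.\<close>

definition level :: "nat \<Rightarrow> nat" where
  "level n = length (filter (\<lambda>t. t \<le> n) [6, 16, 30, 48, 68, 88, 108, 126, 140, 150])"

lemma level_check: "list_all (\<lambda>a. list_all (\<lambda>(n, m, c). level m = Suc (level n)) (left_mult a)) arrows"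
  by code_simp

text \<open>The longest paths join each vertex to its image under the Nakayama permutation, the
  reflection of the diagram. It fixes only \<open>V0\<close> and \<open>V3\<close>, so there are two
  longest loops.\<close>

lemma level_block: "list_all (\<lambda>n. level n = 10 \<longrightarrow> n = 152 \<or> n = 155)
    (concat (map vertex_block [V0, V1, V2, V3, V4, V5]))"
  by code_simp

text \<open>With \<open>mult_zeroI\<close> it assembles certificates: a linear combination of
  expressions known to be 0 is 0.\<close>

lemma add_zeroI: "x = 0 \<Longrightarrow> y = 0 \<Longrightarrow> x + y = (0 :: 'a::monoid_add)"
  by simp

lemma mult_zeroI: "x = 0 \<Longrightarrow> c * x = (0 :: 'a::mult_zero)"
  by simp

section \<open>The linear systems in each path length\<close>

text \<open>The variable \<open>a2_41\<close> stands for coordinate 41 of the value at \<open>A2\<close>, and likewise \<open>b2_37\<close> for \<open>B2\<close>;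
  \<open>z\<close> and \<open>u\<close> belong to the central and the inner part, and \<open>e57\<close> is coordinate 57 of the
  cocycle condition. The solutions, and the combinations of the equations that verify them, were found by
  Gaussian elimination over the rationals with only powers of 2 in the denominators.\<close>

lemma cocycle_degree_1:
  fixes a0_15 a1_14 a2_12 a3_9 a4_7 b0_11 b1_13 b2_10 b3_8 b4_6 :: "'f::field"
  assumes two: "(2 :: 'f) \<noteq> 0"
    and e25: "a1_14 - a2_12 + b1_13 - b2_10 = 0"
    and e21: "a2_12 - a3_9 + b2_10 - b3_8 = 0"
    and e22: "a0_15 - a3_9 + b0_11 - b3_8 = 0"
    and e17: "a3_9 - a4_7 + b3_8 - b4_6 = 0"
  shows "\<exists>z0 u1 u2 u3 u4 u5. a0_15 = z0 + u3 \<and>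
    a1_14 = z0 - u1 + u2 \<and>
    a2_12 = z0 - u2 + u3 \<and>
    a3_9 = z0 - u3 + u4 \<and>
    a4_7 = z0 - u4 + u5 \<and>
    b0_11 = z0 - u3 \<and>
    b1_13 = z0 + u1 - u2 \<and>
    b2_10 = z0 + u2 - u3 \<and>
    b3_8 = z0 + u3 - u4 \<and>
    b4_6 = z0 + u4 - u5"
proof -
  \<comment> \<open>Halving all unknowns first gives the parameters below integer coefficients, so
    the checks become identities of integer linear forms.\<close>
  define p0_15 where "p0_15 = a0_15 / 2"
  define p1_14 where "p1_14 = a1_14 / 2"
  define p2_12 where "p2_12 = a2_12 / 2"
  define p3_9 where "p3_9 = a3_9 / 2"
  define p4_7 where "p4_7 = a4_7 / 2"
  define q0_11 where "q0_11 = b0_11 / 2"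
  define q1_13 where "q1_13 = b1_13 / 2"
  define q2_10 where "q2_10 = b2_10 / 2"
  define q3_8 where "q3_8 = b3_8 / 2"
  define q4_6 where "q4_6 = b4_6 / 2"
  note y_defs = p0_15_def p1_14_def p2_12_def p3_9_def p4_7_def q0_11_def q1_13_def q2_10_def q3_8_def
      q4_6_def
  have scale: "a0_15 = 2 * p0_15"
    "a1_14 = 2 * p1_14"
    "a2_12 = 2 * p2_12"
    "a3_9 = 2 * p3_9"
    "a4_7 = 2 * p4_7"
    "b0_11 = 2 * q0_11"
    "b1_13 = 2 * q1_13"
    "b2_10 = 2 * q2_10"
    "b3_8 = 2 * q3_8"
    "b4_6 = 2 * q4_6"
    using two by (simp_all add: y_defs)
  have f25: "p1_14 - p2_12 + q1_13 - q2_10 = 0"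
    using e25 by (simp add: y_defs flip: add_divide_distrib diff_divide_distrib)
  have f21: "p2_12 - p3_9 + q2_10 - q3_8 = 0"
    using e21 by (simp add: y_defs flip: add_divide_distrib diff_divide_distrib)
  have f22: "p0_15 - p3_9 + q0_11 - q3_8 = 0"
    using e22 by (simp add: y_defs flip: add_divide_distrib diff_divide_distrib)
  have f17: "p3_9 - p4_7 + q3_8 - q4_6 = 0"
    using e17 by (simp add: y_defs flip: add_divide_distrib diff_divide_distrib)
  define z0 where "z0 = p0_15 + q0_11"
  define u1 where "u1 = 3 * p0_15 - 2 * p1_14 - 2 * p2_12 + q0_11"
  define u2 where "u2 = 2 * p0_15 - 2 * p2_12"
  define u3 where "u3 = p0_15 - q0_11"
  define u4 where "u4 = 2 * p3_9 - 2 * q0_11"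
  define u5 where "u5 = - p0_15 + 2 * p3_9 + 2 * p4_7 - 3 * q0_11"
  note defs = z0_def u1_def u2_def u3_def u4_def u5_def
  have a0_15x: "a0_15 = z0 + u3"
    by (simp add: defs scale algebra_simps)
  have a1_14x: "a1_14 = z0 - u1 + u2"
    by (simp add: defs scale algebra_simps)
  have a2_12x: "a2_12 = z0 - u2 + u3"
    by (simp add: defs scale algebra_simps)
  have a3_9x: "a3_9 = z0 - u3 + u4"
    by (simp add: defs scale algebra_simps)
  have a4_7x: "a4_7 = z0 - u4 + u5"
    by (simp add: defs scale algebra_simps)
  have b0_11x: "b0_11 = z0 - u3"
    by (simp add: defs scale algebra_simps)
  have "2 * q1_13 = z0 + u1 - u2 + ((2) * (p1_14 - p2_12 + q1_13 - q2_10) + (2) * (p2_12 - p3_9 + q2_10 -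
      q3_8) + (-2) * (p0_15 - p3_9 + q0_11 - q3_8))"
    by (simp add: defs algebra_simps)
  then have b1_13x: "b1_13 = z0 + u1 - u2"
    unfolding f25 f21 f22 scale by simp
  have "2 * q2_10 = z0 + u2 - u3 + ((2) * (p2_12 - p3_9 + q2_10 - q3_8) + (-2) * (p0_15 - p3_9 + q0_11 -
      q3_8))"
    by (simp add: defs algebra_simps)
  then have b2_10x: "b2_10 = z0 + u2 - u3"
    unfolding f21 f22 scale by simp
  have "2 * q3_8 = z0 + u3 - u4 + ((-2) * (p0_15 - p3_9 + q0_11 - q3_8))"
    by (simp add: defs algebra_simps)
  then have b3_8x: "b3_8 = z0 + u3 - u4"
    unfolding f22 scale by simp
  have "2 * q4_6 = z0 + u4 - u5 + ((-2) * (p0_15 - p3_9 + q0_11 - q3_8) + (-2) * (p3_9 - p4_7 + q3_8 -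
      q4_6))"
    by (simp add: defs algebra_simps)
  then have b4_6x: "b4_6 = z0 + u4 - u5"
    unfolding f22 f17 scale by simp
  show ?thesis
    by (intro exI conjI) (fact a0_15x a1_14x a2_12x a3_9x a4_7x b0_11x b1_13x b2_10x b3_8x b4_6x)+
qed

text \<open>Only inner parameters occur, since the centre has nothing of length 2; compare
  \<open>central_degree_2\<close>.\<close>

lemma cocycle_degree_3:
  fixes a0_46 a2_41 a2_42 a3_35 a3_36 b0_39 b2_37 b2_38 b3_32 b3_33 :: "'f::field"
  assumes two: "(2 :: 'f) \<noteq> 0"
    and e67: "- a0_46 - b0_39 = 0"
    and e61: "- a2_42 - b2_37 = 0"
    and e55: "a0_46 - a3_36 + b2_37 - b3_32 = 0"
    and e56: "a2_41 - a3_35 + b2_38 - b3_32 = 0"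
    and e57: "a2_42 - a3_35 + b0_39 - b3_33 = 0"
    and e50: "- a3_35 + a3_36 - b3_32 + b3_33 = 0"
  shows "\<exists>u17 u21 u22 u25. a0_46 = u21 \<and>
    a2_41 = u21 - u25 \<and>
    a2_42 = u22 \<and>
    a3_35 = u17 - u21 \<and>
    a3_36 = u17 - u22 \<and>
    b0_39 = - u21 \<and>
    b2_37 = - u22 \<and>
    b2_38 = - u21 + u25 \<and>
    b3_32 = - u17 + u21 \<and>
    b3_33 = - u17 + u22"
proof -
  define u17 where "u17 = a0_46 + a3_35"
  define u21 where "u21 = a0_46"
  define u22 where "u22 = a2_42"
  define u25 where "u25 = a0_46 - a2_41"
  note defs = u17_def u21_def u22_def u25_def
  have a0_46x: "a0_46 = u21"
    by (simp add: defs algebra_simps)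
  have a2_41x: "a2_41 = u21 - u25"
    by (simp add: defs algebra_simps)
  have a2_42x: "a2_42 = u22"
    by (simp add: defs algebra_simps)
  have a3_35x: "a3_35 = u17 - u21"
    by (simp add: defs algebra_simps)
  have "2 * a3_36 = 2 * (u17 - u22) + ((-1) * (a0_46 - a3_36 + b2_37 - b3_32) + (-1) * (- a2_42 - b2_37) +
      (a2_42 - a3_35 + b0_39 - b3_33) + (- a3_35 + a3_36 - b3_32 + b3_33) + (- a0_46 - b0_39))"
    by (simp add: defs algebra_simps)
  then have "2 * a3_36 = 2 * (u17 - u22)"
    unfolding e55 e61 e57 e50 e67 by simp
  then have a3_36x: "a3_36 = u17 - u22"
    by (rule mult_left_cancel[OF two, THEN iffD1])
  have "b0_39 = - u21 + ((-1) * (- a0_46 - b0_39))"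
    by (simp add: defs algebra_simps)
  then have b0_39x: "b0_39 = - u21"
    unfolding e67 by simp
  have "b2_37 = - u22 + ((-1) * (- a2_42 - b2_37))"
    by (simp add: defs algebra_simps)
  then have b2_37x: "b2_37 = - u22"
    unfolding e61 by simp
  have "2 * b2_38 = 2 * (- u21 + u25) + ((2) * (a2_41 - a3_35 + b2_38 - b3_32) + (-1) * (a2_42 - a3_35 +
      b0_39 - b3_33) + (-1) * (- a2_42 - b2_37) + (-1) * (- a3_35 + a3_36 - b3_32 + b3_33) + (-1) * (a0_46
      - a3_36 + b2_37 - b3_32) + (-1) * (- a0_46 - b0_39))"
    by (simp add: defs algebra_simps)
  then have "2 * b2_38 = 2 * (- u21 + u25)"
    unfolding e56 e57 e61 e50 e55 e67 by simp
  then have b2_38x: "b2_38 = - u21 + u25"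
    by (rule mult_left_cancel[OF two, THEN iffD1])
  have "2 * b3_32 = 2 * (- u17 + u21) + ((-1) * (a2_42 - a3_35 + b0_39 - b3_33) + (-1) * (- a2_42 - b2_37)
      + (-1) * (- a3_35 + a3_36 - b3_32 + b3_33) + (-1) * (a0_46 - a3_36 + b2_37 - b3_32) + (-1) * (-
      a0_46 - b0_39))"
    by (simp add: defs algebra_simps)
  then have "2 * b3_32 = 2 * (- u17 + u21)"
    unfolding e57 e61 e50 e55 e67 by simp
  then have b3_32x: "b3_32 = - u17 + u21"
    by (rule mult_left_cancel[OF two, THEN iffD1])
  have "b3_33 = - u17 + u22 + ((-1) * (- a0_46 - b0_39) + (-1) * (a2_42 - a3_35 + b0_39 - b3_33))"
    by (simp add: defs algebra_simps)
  then have b3_33x: "b3_33 = - u17 + u22"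
    unfolding e67 e57 by simp
  show ?thesis
    by (intro exI conjI) (fact a0_46x a2_41x a2_42x a3_35x a3_36x b0_39x b2_37x b2_38x b3_32x b3_33x)+
qed

text \<open>The only length with a cocycle that is neither inner nor a product of
  \<open>fund\<close> with a central element. The parameter \<open>l\<close> measures the multiple
  of \<open>rho5\<close>, and the equations are consistent only if \<open>3 * l = 0\<close>.\<close>

lemma cocycle_degree_5:
  fixes a0_86 a0_87 a1_85 a2_81 a2_82 a3_74 a3_75 a4_70 b0_78 b0_79 b1_83 b2_76 b2_77 b3_71 b3_72 b4_68 ::
      "'f::field"
  assumes two: "(2 :: 'f) \<noteq> 0"
    and e107: "- a0_86 - b0_79 = 0"
    and e104: "- a1_85 - b1_83 = 0"
    and e100: "a1_85 - a2_82 - b2_76 = 0"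
    and e101: "- a2_81 + b1_83 - b2_77 = 0"
    and e95: "a0_86 - a2_81 + a3_75 - b2_76 + b2_77 - b3_71 = 0"
    and e96: "a0_87 - a2_81 + a3_75 + b0_78 - b2_76 - b3_72 = 0"
    and e97: "- a2_81 + a2_82 - a3_74 + a3_75 + b0_79 - b2_76 - b3_72 = 0"
    and e90: "a3_74 + a4_70 + b3_71 = 0"
    and e91: "a3_75 + a4_70 + b3_72 - b4_68 = 0"
    and e88: "a4_70 + b4_68 = 0"
  shows "\<exists>l u50 u55 u56 u57 u61 u67. a0_86 = l + u56 \<and>
    a0_87 = u57 - u67 \<and>
    a1_85 = l + u61 \<and>
    a2_81 = l + u55 - u61 \<and>
    a2_82 = u57 \<and>
    a3_74 = u55 - u56 \<and>
    a3_75 = u50 + u55 - u57 \<and>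
    a4_70 = - u50 \<and>
    b0_78 = - l - u55 + u67 \<and>
    b0_79 = - l - u56 \<and>
    b1_83 = - l - u61 \<and>
    b2_76 = l - u57 + u61 \<and>
    b2_77 = l - u55 \<and>
    b3_71 = u50 - u55 + u56 \<and>
    b3_72 = u50 - u55 + u57 \<and>
    b4_68 = u50 \<and>
    3 * l = 0"
proof -
  define l where "l = a0_86 - a2_82 - b3_71 + b3_72"
  define u50 where "u50 = - a4_70"
  define u55 where "u55 = a2_82 - a4_70 - b3_72"
  define u56 where "u56 = a2_82 + b3_71 - b3_72"
  define u57 where "u57 = a2_82"
  define u61 where "u61 = a0_86 - a2_81 - a4_70 - b3_71"
  define u67 where "u67 = - a0_87 + a2_82"
  note defs = l_def u50_def u55_def u56_def u57_def u61_def u67_def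
  have a0_86x: "a0_86 = l + u56"
    by (simp add: defs algebra_simps)
  have a0_87x: "a0_87 = u57 - u67"
    by (simp add: defs algebra_simps)
  have "a1_85 = l + u61 + ((- a0_86 - b0_79) + (a3_74 + a4_70 + b3_71) + (- a2_81 + a2_82 - a3_74 + a3_75
      + b0_79 - b2_76 - b3_72) + (-1) * (a0_86 - a2_81 + a3_75 - b2_76 + b2_77 - b3_71) + (-1) * (- a1_85
      - b1_83) + (-1) * (- a2_81 + b1_83 - b2_77))"
    by (simp add: defs algebra_simps)
  then have a1_85x: "a1_85 = l + u61"
    unfolding e107 e90 e97 e95 e104 e101 by simp
  have a2_81x: "a2_81 = l + u55 - u61"
    by (simp add: defs algebra_simps)
  have a2_82x: "a2_82 = u57"
    by (simp add: defs algebra_simps)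
  have "a3_74 = u55 - u56 + ((a3_74 + a4_70 + b3_71))"
    by (simp add: defs algebra_simps)
  then have a3_74x: "a3_74 = u55 - u56"
    unfolding e90 by simp
  have "a3_75 = u50 + u55 - u57 + ((a3_75 + a4_70 + b3_72 - b4_68) + (a4_70 + b4_68))"
    by (simp add: defs algebra_simps)
  then have a3_75x: "a3_75 = u50 + u55 - u57"
    unfolding e91 e88 by simp
  have a4_70x: "a4_70 = - u50"
    by (simp add: defs algebra_simps)
  have "b0_78 = - l - u55 + u67 + ((-1) * (- a0_86 - b0_79) + (-1) * (a3_74 + a4_70 + b3_71) + (-1) * (-
      a2_81 + a2_82 - a3_74 + a3_75 + b0_79 - b2_76 - b3_72) + (a0_87 - a2_81 + a3_75 + b0_78 - b2_76 -
      b3_72))"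
    by (simp add: defs algebra_simps)
  then have b0_78x: "b0_78 = - l - u55 + u67"
    unfolding e107 e90 e97 e96 by simp
  have "b0_79 = - l - u56 + ((-1) * (- a0_86 - b0_79))"
    by (simp add: defs algebra_simps)
  then have b0_79x: "b0_79 = - l - u56"
    unfolding e107 by simp
  have "b1_83 = - l - u61 + ((-1) * (- a0_86 - b0_79) + (-1) * (a3_74 + a4_70 + b3_71) + (-1) * (- a2_81 +
      a2_82 - a3_74 + a3_75 + b0_79 - b2_76 - b3_72) + (a0_86 - a2_81 + a3_75 - b2_76 + b2_77 - b3_71) +
      (- a2_81 + b1_83 - b2_77))"
    by (simp add: defs algebra_simps)
  then have b1_83x: "b1_83 = - l - u61"
    unfolding e107 e90 e97 e95 e101 by simp
  have "b2_76 = l - u57 + u61 + ((- a0_86 - b0_79) + (-1) * (- a2_81 + b1_83 - b2_77) + (a3_74 + a4_70 +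
      b3_71) + (- a2_81 + a2_82 - a3_74 + a3_75 + b0_79 - b2_76 - b3_72) + (-1) * (a1_85 - a2_82 - b2_76)
      + (-1) * (- a1_85 - b1_83) + (-1) * (a0_86 - a2_81 + a3_75 - b2_76 + b2_77 - b3_71))"
    by (simp add: defs algebra_simps)
  then have b2_76x: "b2_76 = l - u57 + u61"
    unfolding e107 e101 e90 e97 e100 e104 e95 by simp
  have "b2_77 = l - u55 + ((- a0_86 - b0_79) + (-1) * (a3_75 + a4_70 + b3_72 - b4_68) + (-1) * (- a2_81 +
      b1_83 - b2_77) + (a3_74 + a4_70 + b3_71) + (- a2_81 + a2_82 - a3_74 + a3_75 + b0_79 - b2_76 - b3_72)
      + (-1) * (a1_85 - a2_82 - b2_76) + (-1) * (- a1_85 - b1_83) + (-1) * (a4_70 + b4_68))"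
    by (simp add: defs algebra_simps)
  then have b2_77x: "b2_77 = l - u55"
    unfolding e107 e91 e101 e90 e97 e100 e104 e88 by simp
  have b3_71x: "b3_71 = u50 - u55 + u56"
    by (simp add: defs algebra_simps)
  have b3_72x: "b3_72 = u50 - u55 + u57"
    by (simp add: defs algebra_simps)
  have "b4_68 = u50 + ((a4_70 + b4_68))"
    by (simp add: defs algebra_simps)
  then have b4_68x: "b4_68 = u50"
    unfolding e88 by simp
  \<comment> \<open>A combination of the cocycle equations in which everything but this multiple of
    \<open>l\<close> cancels; it is the source of the exceptional characteristic 3.\<close>
  have "3 * l = (-2) * (- a0_86 - b0_79) + (a3_75 + a4_70 + b3_72 - b4_68) + (- a2_81 + b1_83 - b2_77) +
      (-2) * (a3_74 + a4_70 + b3_71) + (-2) * (- a2_81 + a2_82 - a3_74 + a3_75 + b0_79 - b2_76 - b3_72) +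
      (a1_85 - a2_82 - b2_76) + (- a1_85 - b1_83) + (a4_70 + b4_68) + (a0_86 - a2_81 + a3_75 - b2_76 +
      b2_77 - b3_71)"
    by (simp add: defs algebra_simps)
  then have lx: "3 * l = 0"
    unfolding e107 e91 e101 e90 e97 e100 e104 e88 e95 by simp
  show ?thesis
    by (intro exI conjI) (fact a0_86x a0_87x a1_85x a2_81x a2_82x a3_74x a3_75x a4_70x b0_78x b0_79x
        b1_83x b2_76x b2_77x b3_71x b3_72x b4_68x lx)+
qed

text \<open>The central element of length 6 contributes here, with parameter \<open>z6\<close>.
  Solving introduces the denominator 4, hence the quarters below.\<close>

lemma cocycle_degree_7:
  fixes a0_124 a1_121 a2_118 a2_119 a3_113 a3_115 a4_110 b0_117 b1_120 b2_114 b2_116 b3_111 b3_112 b4_108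
      :: "'f::field"
  assumes two: "(2 :: 'f) \<noteq> 0"
    and e135: "a1_121 + a2_119 + b1_120 - b2_116 = 0"
    and e131: "a2_118 + a3_115 - b2_114 + b2_116 - b3_111 = 0"
    and e132: "a0_124 - a2_119 + a3_113 - a3_115 + b0_117 + b2_114 - b3_112 = 0"
    and e127: "- a3_113 + a3_115 + a4_110 + b3_111 + b3_112 - b4_108 = 0"
  shows "\<exists>z6 u88 u90 u91 u95 u96 u97 u100 u101 u107. a0_124 = u97 - u107 \<and>
    a1_121 = - z6 + u101 \<and>
    a2_118 = u95 + u100 - u101 \<and>
    a2_119 = z6 + u96 + u100 \<and>
    a3_113 = z6 - u90 + u91 + u95 - u96 \<and>
    a3_115 = u91 - u97 \<and>
    a4_110 = z6 + u88 + u90 - u91 \<and>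
    b0_117 = - u95 + u107 \<and>
    b1_120 = - z6 - u100 \<and>
    b2_114 = - z6 + u96 - u97 + u100 \<and>
    b2_116 = - z6 + u96 + u101 \<and>
    b3_111 = u91 + u95 \<and>
    b3_112 = - z6 - u90 - u96 + u97 \<and>
    b4_108 = - z6 + u88 + u90"
proof -
  have four: "(4 :: 'f) \<noteq> 0"
    using two by (metis mult_2 mult_eq_0_iff numeral_Bit0 numeral_times_numeral)
  define p0_124 where "p0_124 = a0_124 / 4"
  define p1_121 where "p1_121 = a1_121 / 4"
  define p2_118 where "p2_118 = a2_118 / 4"
  define p2_119 where "p2_119 = a2_119 / 4"
  define p3_113 where "p3_113 = a3_113 / 4"
  define p3_115 where "p3_115 = a3_115 / 4"
  define p4_110 where "p4_110 = a4_110 / 4"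
  define q0_117 where "q0_117 = b0_117 / 4"
  define q1_120 where "q1_120 = b1_120 / 4"
  define q2_114 where "q2_114 = b2_114 / 4"
  define q2_116 where "q2_116 = b2_116 / 4"
  define q3_111 where "q3_111 = b3_111 / 4"
  define q3_112 where "q3_112 = b3_112 / 4"
  define q4_108 where "q4_108 = b4_108 / 4"
  note y_defs = p0_124_def p1_121_def p2_118_def p2_119_def p3_113_def p3_115_def p4_110_def q0_117_def
      q1_120_def q2_114_def q2_116_def q3_111_def q3_112_def q4_108_def
  have scale: "a0_124 = 4 * p0_124"
    "a1_121 = 4 * p1_121"
    "a2_118 = 4 * p2_118"
    "a2_119 = 4 * p2_119"
    "a3_113 = 4 * p3_113"
    "a3_115 = 4 * p3_115"
    "a4_110 = 4 * p4_110"
    "b0_117 = 4 * q0_117"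
    "b1_120 = 4 * q1_120"
    "b2_114 = 4 * q2_114"
    "b2_116 = 4 * q2_116"
    "b3_111 = 4 * q3_111"
    "b3_112 = 4 * q3_112"
    "b4_108 = 4 * q4_108"
    using four by (simp_all add: y_defs)
  have f135: "p1_121 + p2_119 + q1_120 - q2_116 = 0"
    using e135 by (simp add: y_defs flip: add_divide_distrib diff_divide_distrib)
  have f131: "p2_118 + p3_115 - q2_114 + q2_116 - q3_111 = 0"
    using e131 by (simp add: y_defs flip: add_divide_distrib diff_divide_distrib)
  have f132: "p0_124 - p2_119 + p3_113 - p3_115 + q0_117 + q2_114 - q3_112 = 0"
    using e132 by (simp add: y_defs flip: add_divide_distrib diff_divide_distrib)
  have f127: "- p3_113 + p3_115 + p4_110 + q3_111 + q3_112 - q4_108 = 0"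
    using e127 by (simp add: y_defs flip: add_divide_distrib diff_divide_distrib)
  define z6 where "z6 = p0_124 + 2 * p3_113 - p3_115 + q0_117 - q3_111 - 2 * q3_112"
  define u88 where "u88 = 4 * p2_119 + 4 * p3_115 + 4 * p4_110 + 4 * q1_120 + 4 * q3_112"
  define u90 where "u90 = p0_124 - 4 * p2_119 - 2 * p3_113 - p3_115 + q0_117 - 4 * q1_120 + 3 * q3_111 - 2
      * q3_112"
  define u91 where "u91 = 2 * p0_124 + 2 * p3_115 + 2 * q0_117 + 2 * q3_111"
  define u95 where "u95 = - 2 * p0_124 - 2 * p3_115 - 2 * q0_117 + 2 * q3_111"
  define u96 where "u96 = 4 * p2_119 + 4 * q1_120"
  define u97 where "u97 = 2 * p0_124 - 2 * p3_115 + 2 * q0_117 + 2 * q3_111"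
  define u100 where "u100 = - p0_124 - 2 * p3_113 + p3_115 - q0_117 - 4 * q1_120 + q3_111 + 2 * q3_112"
  define u101 where "u101 = p0_124 + 4 * p1_121 + 2 * p3_113 - p3_115 + q0_117 - q3_111 - 2 * q3_112"
  define u107 where "u107 = - 2 * p0_124 - 2 * p3_115 + 2 * q0_117 + 2 * q3_111"
  note defs = z6_def u88_def u90_def u91_def u95_def u96_def u97_def u100_def u101_def u107_def
  have a0_124x: "a0_124 = u97 - u107"
    by (simp add: defs scale algebra_simps)
  have a1_121x: "a1_121 = - z6 + u101"
    by (simp add: defs scale algebra_simps)
  have "4 * p2_118 = u95 + u100 - u101 + ((4) * (p1_121 + p2_119 + q1_120 - q2_116) + (4) * (p2_118 +
      p3_115 - q2_114 + q2_116 - q3_111) + (4) * (p0_124 - p2_119 + p3_113 - p3_115 + q0_117 + q2_114 -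
      q3_112))"
    by (simp add: defs algebra_simps)
  then have a2_118x: "a2_118 = u95 + u100 - u101"
    unfolding f135 f131 f132 scale by simp
  have a2_119x: "a2_119 = z6 + u96 + u100"
    by (simp add: defs scale algebra_simps)
  have a3_113x: "a3_113 = z6 - u90 + u91 + u95 - u96"
    by (simp add: defs scale algebra_simps)
  have a3_115x: "a3_115 = u91 - u97"
    by (simp add: defs scale algebra_simps)
  have a4_110x: "a4_110 = z6 + u88 + u90 - u91"
    by (simp add: defs scale algebra_simps)
  have b0_117x: "b0_117 = - u95 + u107"
    by (simp add: defs scale algebra_simps)
  have b1_120x: "b1_120 = - z6 - u100"
    by (simp add: defs scale algebra_simps)
  have "4 * q2_114 = - z6 + u96 - u97 + u100 + ((4) * (p0_124 - p2_119 + p3_113 - p3_115 + q0_117 + q2_114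
      - q3_112))"
    by (simp add: defs algebra_simps)
  then have b2_114x: "b2_114 = - z6 + u96 - u97 + u100"
    unfolding f132 scale by simp
  have "4 * q2_116 = - z6 + u96 + u101 + ((-4) * (p1_121 + p2_119 + q1_120 - q2_116))"
    by (simp add: defs algebra_simps)
  then have b2_116x: "b2_116 = - z6 + u96 + u101"
    unfolding f135 scale by simp
  have b3_111x: "b3_111 = u91 + u95"
    by (simp add: defs scale algebra_simps)
  have b3_112x: "b3_112 = - z6 - u90 - u96 + u97"
    by (simp add: defs scale algebra_simps)
  have "4 * q4_108 = - z6 + u88 + u90 + ((-4) * (- p3_113 + p3_115 + p4_110 + q3_111 + q3_112 - q4_108))"
    by (simp add: defs algebra_simps)
  then have b4_108x: "b4_108 = - z6 + u88 + u90"
    unfolding f127 scale by simp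
  show ?thesis
    by (intro exI conjI) (fact a0_124x a1_121x a2_118x a2_119x a3_113x a3_115x a4_110x b0_117x b1_120x
        b2_114x b2_116x b3_111x b3_112x b4_108x)+
qed

text \<open>The parameter \<open>z8\<close> belongs to the central element of length 8. This is the
  last case: neighbouring vertices are joined by paths of odd length only, and no basis path is
  longer than 10.\<close>

lemma cocycle_degree_9:
  fixes a0_149 a2_147 a3_143 b0_145 b2_144 b3_141 :: "'f::field"
  assumes two: "(2 :: 'f) \<noteq> 0"
    and e155: "- a0_149 - b0_145 = 0"
    and e152: "- a0_149 + a2_147 - a3_143 + b0_145 + b2_144 - b3_141 = 0"
  shows "\<exists>z8 u127 u131 u132. a0_149 = u131 \<and>
    a2_147 = z8 + u131 + u132 \<and>
    a3_143 = z8 + u127 - u131 - u132 \<and>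
    b0_145 = - u131 \<and>
    b2_144 = z8 - u132 \<and>
    b3_141 = z8 - u127 + u132"
proof -
  define p0_149 where "p0_149 = a0_149 / 2"
  define p2_147 where "p2_147 = a2_147 / 2"
  define p3_143 where "p3_143 = a3_143 / 2"
  define q0_145 where "q0_145 = b0_145 / 2"
  define q2_144 where "q2_144 = b2_144 / 2"
  define q3_141 where "q3_141 = b3_141 / 2"
  note y_defs = p0_149_def p2_147_def p3_143_def q0_145_def q2_144_def q3_141_def
  have scale: "a0_149 = 2 * p0_149"
    "a2_147 = 2 * p2_147"
    "a3_143 = 2 * p3_143"
    "b0_145 = 2 * q0_145"
    "b2_144 = 2 * q2_144"
    "b3_141 = 2 * q3_141"
    using two by (simp_all add: y_defs)
  have f155: "- p0_149 - q0_145 = 0"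
    using e155 by (simp add: y_defs flip: add_divide_distrib diff_divide_distrib)
  have f152: "- p0_149 + p2_147 - p3_143 + q0_145 + q2_144 - q3_141 = 0"
    using e152 by (simp add: y_defs flip: add_divide_distrib diff_divide_distrib)
  define z8 where "z8 = - p0_149 + p2_147 + q2_144"
  define u127 where "u127 = 2 * p0_149 + 2 * p3_143 - 2 * q2_144"
  define u131 where "u131 = 2 * p0_149"
  define u132 where "u132 = - p0_149 + p2_147 - q2_144"
  note defs = z8_def u127_def u131_def u132_def
  have a0_149x: "a0_149 = u131"
    by (simp add: defs scale algebra_simps)
  have a2_147x: "a2_147 = z8 + u131 + u132"
    by (simp add: defs scale algebra_simps)
  have a3_143x: "a3_143 = z8 + u127 - u131 - u132"
    by (simp add: defs scale algebra_simps)
  have "2 * q0_145 = - u131 + ((-2) * (- p0_149 - q0_145))"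
    by (simp add: defs algebra_simps)
  then have b0_145x: "b0_145 = - u131"
    unfolding f155 scale by simp
  have b2_144x: "b2_144 = z8 - u132"
    by (simp add: defs scale algebra_simps)
  have "2 * q3_141 = z8 - u127 + u132 + ((-2) * (- p0_149 - q0_145) + (-2) * (- p0_149 + p2_147 - p3_143 +
      q0_145 + q2_144 - q3_141))"
    by (simp add: defs algebra_simps)
  then have b3_141x: "b3_141 = z8 - u127 + u132"
    unfolding f155 f152 scale by simp
  show ?thesis
    by (intro exI conjI) (fact a0_149x a2_147x a3_143x b0_145x b2_144x b3_141x)+
qed

section \<open>Central elements whose product with \<open>fund\<close> is inner\<close>

lemma central_degree_0:
  fixes u0 u3 z0 z1 z2 z3 z4 z5 :: "'f::field"
  assumes two: "(2 :: 'f) \<noteq> 0"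
    and c_A0_15: "- z0 + z3 = 0"
    and c_A1_14: "- z1 + z2 = 0"
    and c_A2_12: "- z2 + z3 = 0"
    and c_A3_9: "- z3 + z4 = 0"
    and c_A4_7: "- z4 + z5 = 0"
    and e_A0_15: "u0 - u3 + z0 = 0"
    and e_B0_11: "- u0 + u3 + z3 = 0"
  shows "z0 = 0" "z1 = 0" "z2 = 0" "z3 = 0" "z4 = 0" "z5 = 0"
proof -
  \<comment> \<open>The scalar of \<open>z\<close> equals \<open>u3 - u0\<close> at
    \<open>A0\<close> but \<open>u0 - u3\<close> at the reverse arrow; adding the two equations
    gives twice the scalar.\<close>
  have eq0: "2 * z0 = (-1) * (- z0 + z3) + (- u0 + u3 + z3) + (u0 - u3 + z0)"
    by (simp add: algebra_simps)
  have "2 * z0 = 0"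
    by (rule trans[OF eq0 add_zeroI[OF add_zeroI[OF mult_zeroI[OF c_A0_15] e_B0_11] e_A0_15]])
  then show "z0 = 0"
    using two by simp
  have eq1: "2 * z1 = (-2) * (- z1 + z2) + (-2) * (- z2 + z3) + (- u0 + u3 + z3) + (u0 - u3 + z0) + (- z0
      + z3)"
    by (simp add: algebra_simps)
  have "2 * z1 = 0"
    by (rule trans[OF eq1 add_zeroI[OF add_zeroI[OF add_zeroI[OF add_zeroI[OF mult_zeroI[OF c_A1_14]
        mult_zeroI[OF c_A2_12]] e_B0_11] e_A0_15] c_A0_15]])
  then show "z1 = 0"
    using two by simp
  have eq2: "2 * z2 = (-2) * (- z2 + z3) + (- u0 + u3 + z3) + (u0 - u3 + z0) + (- z0 + z3)"
    by (simp add: algebra_simps)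
  have "2 * z2 = 0"
    by (rule trans[OF eq2 add_zeroI[OF add_zeroI[OF add_zeroI[OF mult_zeroI[OF c_A2_12] e_B0_11] e_A0_15]
        c_A0_15]])
  then show "z2 = 0"
    using two by simp
  have eq3: "2 * z3 = (- u0 + u3 + z3) + (u0 - u3 + z0) + (- z0 + z3)"
    by (simp add: algebra_simps)
  have "2 * z3 = 0"
    by (rule trans[OF eq3 add_zeroI[OF add_zeroI[OF e_B0_11 e_A0_15] c_A0_15]])
  then show "z3 = 0"
    using two by simp
  have eq4: "2 * z4 = (- u0 + u3 + z3) + (2) * (- z3 + z4) + (u0 - u3 + z0) + (- z0 + z3)"
    by (simp add: algebra_simps)
  have "2 * z4 = 0"
    by (rule trans[OF eq4 add_zeroI[OF add_zeroI[OF add_zeroI[OF e_B0_11 mult_zeroI[OF c_A3_9]] e_A0_15]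
        c_A0_15]])
  then show "z4 = 0"
    using two by simp
  have eq5: "2 * z5 = (- u0 + u3 + z3) + (2) * (- z3 + z4) + (2) * (- z4 + z5) + (u0 - u3 + z0) + (- z0 +
      z3)"
    by (simp add: algebra_simps)
  have "2 * z5 = 0"
    by (rule trans[OF eq5 add_zeroI[OF add_zeroI[OF add_zeroI[OF add_zeroI[OF e_B0_11 mult_zeroI[OF
        c_A3_9]] mult_zeroI[OF c_A4_7]] e_A0_15] c_A0_15]])
  then show "z5 = 0"
    using two by simp
qed

text \<open>Here and in length 4 centrality alone suffices, without any equation for an inner part:
  the centre has nothing in these lengths.\<close>

lemma central_degree_2:
  fixes z17 z21 z22 z25 :: "'f::field"
  assumes two: "(2 :: 'f) \<noteq> 0"
    and c_A0_46: "z21 = 0"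
    and c_A2_42: "z22 = 0"
    and c_A2_41: "z21 - z25 = 0"
    and c_A3_35: "z17 - z21 = 0"
  shows "z25 = 0" "z21 = 0" "z22 = 0" "z17 = 0"
proof -
  have eq25: "z25 = (-1) * (z21 - z25) + (z21)"
    by (simp add: algebra_simps)
  show "z25 = 0"
    by (rule trans[OF eq25 add_zeroI[OF mult_zeroI[OF c_A2_41] c_A0_46]])
  have eq21: "z21 = (z21)"
    by (simp add: algebra_simps)
  show "z21 = 0"
    by (rule trans[OF eq21 c_A0_46])
  have eq22: "z22 = (z22)"
    by (simp add: algebra_simps)
  show "z22 = 0"
    by (rule trans[OF eq22 c_A2_42])
  have eq17: "z17 = (z17 - z21) + (z21)"
    by (simp add: algebra_simps)
  show "z17 = 0"
    by (rule trans[OF eq17 add_zeroI[OF c_A3_35 c_A0_46]])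
qed

lemma central_degree_4:
  fixes z50 z55 z56 z57 z61 z67 :: "'f::field"
  assumes two: "(2 :: 'f) \<noteq> 0"
    and c_A1_85: "z61 = 0"
    and c_B2_77: "- z55 = 0"
    and c_A0_86: "z56 = 0"
    and c_A2_82: "z57 = 0"
    and c_A4_70: "- z50 = 0"
    and c_A0_87: "z57 - z67 = 0"
  shows "z67 = 0" "z61 = 0" "z55 = 0" "z56 = 0" "z57 = 0" "z50 = 0"
proof -
  have eq67: "z67 = (-1) * (z57 - z67) + (z57)"
    by (simp add: algebra_simps)
  show "z67 = 0"
    by (rule trans[OF eq67 add_zeroI[OF mult_zeroI[OF c_A0_87] c_A2_82]])
  have eq61: "z61 = (z61)"
    by (simp add: algebra_simps)
  show "z61 = 0"
    by (rule trans[OF eq61 c_A1_85])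
  have eq55: "z55 = (-1) * (- z55)"
    by (simp add: algebra_simps)
  show "z55 = 0"
    by (rule trans[OF eq55 mult_zeroI[OF c_B2_77]])
  have eq56: "z56 = (z56)"
    by (simp add: algebra_simps)
  show "z56 = 0"
    by (rule trans[OF eq56 c_A0_86])
  have eq57: "z57 = (z57)"
    by (simp add: algebra_simps)
  show "z57 = 0"
    by (rule trans[OF eq57 c_A2_82])
  have eq50: "z50 = (-1) * (- z50)"
    by (simp add: algebra_simps)
  show "z50 = 0"
    by (rule trans[OF eq50 mult_zeroI[OF c_A4_70]])
qed

text \<open>Once 2 is invertible, centrality leaves one free scalar, \<open>z104\<close>, up to sign
  the coordinate at every other index that can be nonzero. The equations for the inner part combine
  to four times that scalar.\<close>

lemma central_degree_6:
  fixes u91 u95 u97 u100 u101 u104 u107 z88 z90 z91 z95 z96 z97 z100 z101 z104 z107 :: "'f::field"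
  assumes two: "(2 :: 'f) \<noteq> 0"
    and c_A0_124: "z97 - z107 = 0"
    and c_B0_117: "- z95 + z107 = 0"
    and c_A1_121: "z101 - z104 = 0"
    and c_B1_120: "- z100 + z104 = 0"
    and c_A2_119: "z96 + z100 = 0"
    and c_B3_111: "z91 + z95 = 0"
    and c_A3_115: "z91 - z97 = 0"
    and c_B4_108: "z88 + z90 = 0"
    and c_B3_112: "- z90 - z96 + z97 = 0"
    and e_A0_124: "- u97 + u107 + z107 = 0"
    and e_B0_117: "u95 - u107 + z95 = 0"
    and e_A1_121: "- u101 + u104 + z104 = 0"
    and e_B1_120: "u100 - u104 + z100 = 0"
    and e_B3_111: "- u91 - u95 - z91 = 0"
    and e_A3_115: "- u91 + u97 + z97 = 0"
    and e_A2_118: "- u95 - u100 + u101 - z100 + z101 = 0"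
  shows "z107 = 0" "z104 = 0" "z100 = 0" "z101 = 0" "z95 = 0" "z96 = 0" "z97 = 0" "z90 = 0" "z91 = 0" "z88
      = 0"
proof -
  have four: "(4 :: 'f) \<noteq> 0"
    using two by (metis mult_2 mult_eq_0_iff numeral_Bit0 numeral_times_numeral)
  have eq107: "2 * z107 = (-1) * (z97 - z107) + (-1) * (z91 - z97) + (z91 + z95) + (- z95 + z107)"
    by (simp add: algebra_simps)
  have "2 * z107 = 0"
    by (rule trans[OF eq107 add_zeroI[OF add_zeroI[OF add_zeroI[OF mult_zeroI[OF c_A0_124] mult_zeroI[OF
        c_A3_115]] c_B3_111] c_B0_117]])
  then show "z107 = 0"
    using two by simp
  have eq104: "4 * z104 = (2) * (- u95 - u100 + u101 - z100 + z101) + (-2) * (z101 - z104) + (u95 - u107 +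
      z95) + (z91 - z97) + (-2) * (z91 + z95) + (- u97 + u107 + z107) + (- u91 + u97 + z97) + (-1) * (-
      z95 + z107) + (-1) * (- u91 - u95 - z91) + (2) * (- u101 + u104 + z104) + (2) * (u100 - u104 +
      z100)"
    by (simp add: algebra_simps)
  have "4 * z104 = 0"
    by (rule trans[OF eq104 add_zeroI[OF add_zeroI[OF add_zeroI[OF add_zeroI[OF add_zeroI[OF add_zeroI[OF
        add_zeroI[OF add_zeroI[OF add_zeroI[OF add_zeroI[OF mult_zeroI[OF e_A2_118] mult_zeroI[OF
        c_A1_121]] e_B0_117] c_A3_115] mult_zeroI[OF c_B3_111]] e_A0_124] e_A3_115] mult_zeroI[OF
        c_B0_117]] mult_zeroI[OF e_B3_111]] mult_zeroI[OF e_A1_121]] mult_zeroI[OF e_B1_120]]])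
  then show "z104 = 0"
    using four by simp
  have eq100: "4 * z100 = (2) * (- u95 - u100 + u101 - z100 + z101) + (-2) * (z101 - z104) + (-4) * (-
      z100 + z104) + (u95 - u107 + z95) + (z91 - z97) + (-2) * (z91 + z95) + (- u97 + u107 + z107) + (-
      u91 + u97 + z97) + (-1) * (- z95 + z107) + (-1) * (- u91 - u95 - z91) + (2) * (- u101 + u104 + z104)
      + (2) * (u100 - u104 + z100)"
    by (simp add: algebra_simps)
  have "4 * z100 = 0"
    by (rule trans[OF eq100 add_zeroI[OF add_zeroI[OF add_zeroI[OF add_zeroI[OF add_zeroI[OF add_zeroI[OF
        add_zeroI[OF add_zeroI[OF add_zeroI[OF add_zeroI[OF add_zeroI[OF mult_zeroI[OF e_A2_118]
        mult_zeroI[OF c_A1_121]] mult_zeroI[OF c_B1_120]] e_B0_117] c_A3_115] mult_zeroI[OF c_B3_111]]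
        e_A0_124] e_A3_115] mult_zeroI[OF c_B0_117]] mult_zeroI[OF e_B3_111]] mult_zeroI[OF e_A1_121]]
        mult_zeroI[OF e_B1_120]]])
  then show "z100 = 0"
    using four by simp
  have eq101: "4 * z101 = (2) * (z101 - z104) + (2) * (- u95 - u100 + u101 - z100 + z101) + (u95 - u107 +
      z95) + (z91 - z97) + (-2) * (z91 + z95) + (- u97 + u107 + z107) + (- u91 + u97 + z97) + (-1) * (-
      z95 + z107) + (-1) * (- u91 - u95 - z91) + (2) * (- u101 + u104 + z104) + (2) * (u100 - u104 +
      z100)"
    by (simp add: algebra_simps)
  have "4 * z101 = 0"
    by (rule trans[OF eq101 add_zeroI[OF add_zeroI[OF add_zeroI[OF add_zeroI[OF add_zeroI[OF add_zeroI[OF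
        add_zeroI[OF add_zeroI[OF add_zeroI[OF add_zeroI[OF mult_zeroI[OF c_A1_121] mult_zeroI[OF
        e_A2_118]] e_B0_117] c_A3_115] mult_zeroI[OF c_B3_111]] e_A0_124] e_A3_115] mult_zeroI[OF
        c_B0_117]] mult_zeroI[OF e_B3_111]] mult_zeroI[OF e_A1_121]] mult_zeroI[OF e_B1_120]]])
  then show "z101 = 0"
    using four by simp
  have eq95: "2 * z95 = (-1) * (- z95 + z107) + (-1) * (z97 - z107) + (-1) * (z91 - z97) + (z91 + z95)"
    by (simp add: algebra_simps)
  have "2 * z95 = 0"
    by (rule trans[OF eq95 add_zeroI[OF add_zeroI[OF add_zeroI[OF mult_zeroI[OF c_B0_117] mult_zeroI[OF
        c_A0_124]] mult_zeroI[OF c_A3_115]] c_B3_111]])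
  then show "z95 = 0"
    using two by simp
  have eq96: "4 * z96 = (-2) * (- u95 - u100 + u101 - z100 + z101) + (2) * (z101 - z104) + (4) * (- z100 +
      z104) + (-1) * (u95 - u107 + z95) + (-1) * (z91 - z97) + (2) * (z91 + z95) + (-1) * (- u97 + u107 +
      z107) + (-1) * (- u91 + u97 + z97) + (- z95 + z107) + (- u91 - u95 - z91) + (-2) * (- u101 + u104 +
      z104) + (4) * (z96 + z100) + (-2) * (u100 - u104 + z100)"
    by (simp add: algebra_simps)
  have "4 * z96 = 0"
    by (rule trans[OF eq96 add_zeroI[OF add_zeroI[OF add_zeroI[OF add_zeroI[OF add_zeroI[OF add_zeroI[OF
        add_zeroI[OF add_zeroI[OF add_zeroI[OF add_zeroI[OF add_zeroI[OF add_zeroI[OF mult_zeroI[OF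
        e_A2_118] mult_zeroI[OF c_A1_121]] mult_zeroI[OF c_B1_120]] mult_zeroI[OF e_B0_117]] mult_zeroI[OF
        c_A3_115]] mult_zeroI[OF c_B3_111]] mult_zeroI[OF e_A0_124]] mult_zeroI[OF e_A3_115]] c_B0_117]
        e_B3_111] mult_zeroI[OF e_A1_121]] mult_zeroI[OF c_A2_119]] mult_zeroI[OF e_B1_120]]])
  then show "z96 = 0"
    using four by simp
  have eq97: "2 * z97 = (-1) * (z91 - z97) + (z91 + z95) + (- z95 + z107) + (z97 - z107)"
    by (simp add: algebra_simps)
  have "2 * z97 = 0"
    by (rule trans[OF eq97 add_zeroI[OF add_zeroI[OF add_zeroI[OF mult_zeroI[OF c_A3_115] c_B3_111]
        c_B0_117] c_A0_124]])
  then show "z97 = 0"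
    using two by simp
  have eq90: "4 * z90 = (-4) * (- z90 - z96 + z97) + (-1) * (z91 - z97) + (- z95 + z107) + (2) * (z97 -
      z107) + (2) * (- u95 - u100 + u101 - z100 + z101) + (-2) * (z101 - z104) + (-4) * (- z100 + z104) +
      (u95 - u107 + z95) + (- u97 + u107 + z107) + (- u91 + u97 + z97) + (-1) * (- u91 - u95 - z91) + (2)
      * (- u101 + u104 + z104) + (-4) * (z96 + z100) + (2) * (u100 - u104 + z100)"
    by (simp add: algebra_simps)
  have "4 * z90 = 0"
    by (rule trans[OF eq90 add_zeroI[OF add_zeroI[OF add_zeroI[OF add_zeroI[OF add_zeroI[OF add_zeroI[OF
        add_zeroI[OF add_zeroI[OF add_zeroI[OF add_zeroI[OF add_zeroI[OF add_zeroI[OF add_zeroI[OF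
        mult_zeroI[OF c_B3_112] mult_zeroI[OF c_A3_115]] c_B0_117] mult_zeroI[OF c_A0_124]] mult_zeroI[OF
        e_A2_118]] mult_zeroI[OF c_A1_121]] mult_zeroI[OF c_B1_120]] e_B0_117] e_A0_124] e_A3_115]
        mult_zeroI[OF e_B3_111]] mult_zeroI[OF e_A1_121]] mult_zeroI[OF c_A2_119]] mult_zeroI[OF
        e_B1_120]]])
  then show "z90 = 0"
    using four by simp
  have eq91: "2 * z91 = (z91 + z95) + (- z95 + z107) + (z97 - z107) + (z91 - z97)"
    by (simp add: algebra_simps)
  have "2 * z91 = 0"
    by (rule trans[OF eq91 add_zeroI[OF add_zeroI[OF add_zeroI[OF c_B3_111 c_B0_117] c_A0_124] c_A3_115]])
  then show "z91 = 0"
    using two by simp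
  have eq88: "4 * z88 = (4) * (z88 + z90) + (4) * (- z90 - z96 + z97) + (z91 - z97) + (-1) * (- z95 +
      z107) + (-2) * (z97 - z107) + (-2) * (- u95 - u100 + u101 - z100 + z101) + (2) * (z101 - z104) + (4)
      * (- z100 + z104) + (-1) * (u95 - u107 + z95) + (-1) * (- u97 + u107 + z107) + (-1) * (- u91 + u97 +
      z97) + (- u91 - u95 - z91) + (-2) * (- u101 + u104 + z104) + (4) * (z96 + z100) + (-2) * (u100 -
      u104 + z100)"
    by (simp add: algebra_simps)
  have "4 * z88 = 0"
    by (rule trans[OF eq88 add_zeroI[OF add_zeroI[OF add_zeroI[OF add_zeroI[OF add_zeroI[OF add_zeroI[OF
        add_zeroI[OF add_zeroI[OF add_zeroI[OF add_zeroI[OF add_zeroI[OF add_zeroI[OF add_zeroI[OF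
        add_zeroI[OF mult_zeroI[OF c_B4_108] mult_zeroI[OF c_B3_112]] c_A3_115] mult_zeroI[OF c_B0_117]]
        mult_zeroI[OF c_A0_124]] mult_zeroI[OF e_A2_118]] mult_zeroI[OF c_A1_121]] mult_zeroI[OF
        c_B1_120]] mult_zeroI[OF e_B0_117]] mult_zeroI[OF e_A0_124]] mult_zeroI[OF e_A3_115]] e_B3_111]
        mult_zeroI[OF e_A1_121]] mult_zeroI[OF c_A2_119]] mult_zeroI[OF e_B1_120]]])
  then show "z88 = 0"
    using four by simp
qed

text \<open>Centrality leaves the one scalar \<open>z135\<close>; comparing \<open>A2\<close> with
  its reverse gives twice that scalar.\<close>

lemma central_degree_8:
  fixes u131 u132 u135 z127 z131 z132 z135 :: "'f::field"
  assumes two: "(2 :: 'f) \<noteq> 0"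
    and c_A0_149: "z131 = 0"
    and c_B2_144: "- z132 + z135 = 0"
    and c_B3_141: "- z127 + z132 = 0"
    and e_A0_149: "- u131 = 0"
    and e_B2_144: "u132 - u135 + z132 = 0"
    and e_A2_147: "- u131 - u132 + u135 + z135 = 0"
  shows "z135 = 0" "z131 = 0" "z132 = 0" "z127 = 0"
proof -
  have eq135: "2 * z135 = (- u131 - u132 + u135 + z135) + (-1) * (- u131) + (u132 - u135 + z132) + (- z132
      + z135)"
    by (simp add: algebra_simps)
  have "2 * z135 = 0"
    by (rule trans[OF eq135 add_zeroI[OF add_zeroI[OF add_zeroI[OF e_A2_147 mult_zeroI[OF e_A0_149]]
        e_B2_144] c_B2_144]])
  then show "z135 = 0"
    using two by simp
  have eq131: "z131 = (z131)"
    by (simp add: algebra_simps)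
  show "z131 = 0"
    by (rule trans[OF eq131 c_A0_149])
  have eq132: "2 * z132 = (-1) * (- z132 + z135) + (- u131 - u132 + u135 + z135) + (-1) * (- u131) + (u132
      - u135 + z132)"
    by (simp add: algebra_simps)
  have "2 * z132 = 0"
    by (rule trans[OF eq132 add_zeroI[OF add_zeroI[OF add_zeroI[OF mult_zeroI[OF c_B2_144] e_A2_147]
        mult_zeroI[OF e_A0_149]] e_B2_144]])
  then show "z132 = 0"
    using two by simp
  have eq127: "2 * z127 = (-2) * (- z127 + z132) + (-1) * (- z132 + z135) + (- u131 - u132 + u135 + z135)
      + (-1) * (- u131) + (u132 - u135 + z132)"
    by (simp add: algebra_simps)
  have "2 * z127 = 0"
    by (rule trans[OF eq127 add_zeroI[OF add_zeroI[OF add_zeroI[OF add_zeroI[OF mult_zeroI[OF c_B3_141]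
        mult_zeroI[OF c_B2_144]] e_A2_147] mult_zeroI[OF e_A0_149]] e_B2_144]])
  then show "z127 = 0"
    using two by simp
qed

section \<open>All lengths together\<close>

lemma cocycle_solution:
  fixes \<phi> :: "arrow \<Rightarrow> 'f::field preproj"
  assumes two: "(2 :: 'f) \<noteq> 0"
    and local: "\<And>a. proj (idem (tgt a)) * \<phi> a = \<phi> a" "\<And>a. \<phi> a * proj (idem (src
        a)) = \<phi> a"
    and cocycle: "\<And>v. sigma_value (\<lambda>a b. \<phi> a * arrA b + arrA a * \<phi> b) v = 0"
  shows "\<exists>z u l. diagonal z \<and> diagonal u \<and> (\<forall>a. arrA a * z = z * arrA a) \<and>
      3 * l = 0 \<and>
    (\<forall>a. \<phi> a = arrA a * z + (u * arrA a - arrA a * u) + scale_preproj l (rho5_value a))"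
proof -
  have E25: "coords (\<phi> A1) 14 - coords (\<phi> A2) 12 + coords (\<phi> B1) 13 - coords (\<phi> B2) 10
      = 0"
    using arg_cong[OF cocycle[of V2], of "\<lambda>x. coords x 25"] by (simp add: row_simps
        sigma_value_def arrows_def sgn_arrow_def algebra_simps)
  have E21: "coords (\<phi> A2) 12 - coords (\<phi> A3) 9 + coords (\<phi> B2) 10 - coords (\<phi> B3) 8 =
      0"
    using arg_cong[OF cocycle[of V3], of "\<lambda>x. coords x 21"] by (simp add: row_simps
        sigma_value_def arrows_def sgn_arrow_def algebra_simps)
  have E22: "coords (\<phi> A0) 15 - coords (\<phi> A3) 9 + coords (\<phi> B0) 11 - coords (\<phi> B3) 8 =
      0"
    using arg_cong[OF cocycle[of V3], of "\<lambda>x. coords x 22"] by (simp add: row_simps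
        sigma_value_def arrows_def sgn_arrow_def algebra_simps)
  have E17: "coords (\<phi> A3) 9 - coords (\<phi> A4) 7 + coords (\<phi> B3) 8 - coords (\<phi> B4) 6 = 0"
    using arg_cong[OF cocycle[of V4], of "\<lambda>x. coords x 17"] by (simp add: row_simps
        sigma_value_def arrows_def sgn_arrow_def algebra_simps)
  have E67: "- coords (\<phi> A0) 46 - coords (\<phi> B0) 39 = 0"
    using arg_cong[OF cocycle[of V0], of "\<lambda>x. coords x 67"] by (simp add: row_simps
        sigma_value_def arrows_def sgn_arrow_def algebra_simps neg_eq_iff_add_eq_0)
  have E61: "- coords (\<phi> A2) 42 - coords (\<phi> B2) 37 = 0"
    using arg_cong[OF cocycle[of V2], of "\<lambda>x. coords x 61"] by (simp add: row_simps
        sigma_value_def arrows_def sgn_arrow_def algebra_simps neg_eq_iff_add_eq_0)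
  have E55: "coords (\<phi> A0) 46 - coords (\<phi> A3) 36 + coords (\<phi> B2) 37 - coords (\<phi> B3) 32
      = 0"
    using arg_cong[OF cocycle[of V3], of "\<lambda>x. coords x 55"] by (simp add: row_simps
        sigma_value_def arrows_def sgn_arrow_def algebra_simps)
  have E56: "coords (\<phi> A2) 41 - coords (\<phi> A3) 35 + coords (\<phi> B2) 38 - coords (\<phi> B3) 32
      = 0"
    using arg_cong[OF cocycle[of V3], of "\<lambda>x. coords x 56"] by (simp add: row_simps
        sigma_value_def arrows_def sgn_arrow_def algebra_simps)
  have E57: "coords (\<phi> A2) 42 - coords (\<phi> A3) 35 + coords (\<phi> B0) 39 - coords (\<phi> B3) 33
      = 0"
    using arg_cong[OF cocycle[of V3], of "\<lambda>x. coords x 57"] by (simp add: row_simps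
        sigma_value_def arrows_def sgn_arrow_def algebra_simps)
  have E50: "- coords (\<phi> A3) 35 + coords (\<phi> A3) 36 - coords (\<phi> B3) 32 + coords (\<phi> B3)
      33 = 0"
    using arg_cong[OF cocycle[of V4], of "\<lambda>x. coords x 50"] by (simp add: row_simps
        sigma_value_def arrows_def sgn_arrow_def algebra_simps)
  have E107: "- coords (\<phi> A0) 86 - coords (\<phi> B0) 79 = 0"
    using arg_cong[OF cocycle[of V0], of "\<lambda>x. coords x 107"] by (simp add: row_simps
        sigma_value_def arrows_def sgn_arrow_def algebra_simps neg_eq_iff_add_eq_0)
  have E104: "- coords (\<phi> A1) 85 - coords (\<phi> B1) 83 = 0"
    using arg_cong[OF cocycle[of V1], of "\<lambda>x. coords x 104"] by (simp add: row_simps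
        sigma_value_def arrows_def sgn_arrow_def algebra_simps neg_eq_iff_add_eq_0)
  have E100: "coords (\<phi> A1) 85 - coords (\<phi> A2) 82 - coords (\<phi> B2) 76 = 0"
    using arg_cong[OF cocycle[of V2], of "\<lambda>x. coords x 100"] by (simp add: row_simps
        sigma_value_def arrows_def sgn_arrow_def algebra_simps)
  have E101: "- coords (\<phi> A2) 81 + coords (\<phi> B1) 83 - coords (\<phi> B2) 77 = 0"
    using arg_cong[OF cocycle[of V2], of "\<lambda>x. coords x 101"] by (simp add: row_simps
        sigma_value_def arrows_def sgn_arrow_def algebra_simps)
  have E95: "coords (\<phi> A0) 86 - coords (\<phi> A2) 81 + coords (\<phi> A3) 75 - coords (\<phi> B2) 76
      + coords (\<phi> B2) 77 - coords (\<phi> B3) 71 = 0"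
    using arg_cong[OF cocycle[of V3], of "\<lambda>x. coords x 95"] by (simp add: row_simps
        sigma_value_def arrows_def sgn_arrow_def algebra_simps)
  have E96: "coords (\<phi> A0) 87 - coords (\<phi> A2) 81 + coords (\<phi> A3) 75 + coords (\<phi> B0) 78
      - coords (\<phi> B2) 76 - coords (\<phi> B3) 72 = 0"
    using arg_cong[OF cocycle[of V3], of "\<lambda>x. coords x 96"] by (simp add: row_simps
        sigma_value_def arrows_def sgn_arrow_def algebra_simps)
  have E97: "- coords (\<phi> A2) 81 + coords (\<phi> A2) 82 - coords (\<phi> A3) 74 + coords (\<phi> A3)
      75 + coords (\<phi> B0) 79 - coords (\<phi> B2) 76 - coords (\<phi> B3) 72 = 0"
    using arg_cong[OF cocycle[of V3], of "\<lambda>x. coords x 97"] by (simp add: row_simps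
        sigma_value_def arrows_def sgn_arrow_def algebra_simps)
  have E90: "coords (\<phi> A3) 74 + coords (\<phi> A4) 70 + coords (\<phi> B3) 71 = 0"
    using arg_cong[OF cocycle[of V4], of "\<lambda>x. coords x 90"] by (simp add: row_simps
        sigma_value_def arrows_def sgn_arrow_def algebra_simps)
  have E91: "coords (\<phi> A3) 75 + coords (\<phi> A4) 70 + coords (\<phi> B3) 72 - coords (\<phi> B4) 68
      = 0"
    using arg_cong[OF cocycle[of V4], of "\<lambda>x. coords x 91"] by (simp add: row_simps
        sigma_value_def arrows_def sgn_arrow_def algebra_simps)
  have E88: "coords (\<phi> A4) 70 + coords (\<phi> B4) 68 = 0"
    using arg_cong[OF cocycle[of V5], of "\<lambda>x. coords x 88"] by (simp add: row_simps
        sigma_value_def arrows_def sgn_arrow_def algebra_simps)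
  have E135: "coords (\<phi> A1) 121 + coords (\<phi> A2) 119 + coords (\<phi> B1) 120 - coords (\<phi>
      B2) 116 = 0"
    using arg_cong[OF cocycle[of V2], of "\<lambda>x. coords x 135"] by (simp add: row_simps
        sigma_value_def arrows_def sgn_arrow_def algebra_simps)
  have E131: "coords (\<phi> A2) 118 + coords (\<phi> A3) 115 - coords (\<phi> B2) 114 + coords (\<phi>
      B2) 116 - coords (\<phi> B3) 111 = 0"
    using arg_cong[OF cocycle[of V3], of "\<lambda>x. coords x 131"] by (simp add: row_simps
        sigma_value_def arrows_def sgn_arrow_def algebra_simps)
  have E132: "coords (\<phi> A0) 124 - coords (\<phi> A2) 119 + coords (\<phi> A3) 113 - coords (\<phi>
      A3) 115 + coords (\<phi> B0) 117 + coords (\<phi> B2) 114 - coords (\<phi> B3) 112 = 0"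
    using arg_cong[OF cocycle[of V3], of "\<lambda>x. coords x 132"] by (simp add: row_simps
        sigma_value_def arrows_def sgn_arrow_def algebra_simps)
  have E127: "- coords (\<phi> A3) 113 + coords (\<phi> A3) 115 + coords (\<phi> A4) 110 + coords (\<phi>
      B3) 111 + coords (\<phi> B3) 112 - coords (\<phi> B4) 108 = 0"
    using arg_cong[OF cocycle[of V4], of "\<lambda>x. coords x 127"] by (simp add: row_simps
        sigma_value_def arrows_def sgn_arrow_def algebra_simps)
  have E155: "- coords (\<phi> A0) 149 - coords (\<phi> B0) 145 = 0"
    using arg_cong[OF cocycle[of V0], of "\<lambda>x. coords x 155"] by (simp add: row_simps
        sigma_value_def arrows_def sgn_arrow_def algebra_simps neg_eq_iff_add_eq_0)
  have E152: "- coords (\<phi> A0) 149 + coords (\<phi> A2) 147 - coords (\<phi> A3) 143 + coords (\<phi>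
      B0) 145 + coords (\<phi> B2) 144 - coords (\<phi> B3) 141 = 0"
    using arg_cong[OF cocycle[of V3], of "\<lambda>x. coords x 152"] by (simp add: row_simps
        sigma_value_def arrows_def sgn_arrow_def algebra_simps)
  obtain z0 u1 u2 u3 u4 u5 where D1:
    "coords (\<phi> A0) 15 = z0 + u3"
    "coords (\<phi> A1) 14 = z0 - u1 + u2"
    "coords (\<phi> A2) 12 = z0 - u2 + u3"
    "coords (\<phi> A3) 9 = z0 - u3 + u4"
    "coords (\<phi> A4) 7 = z0 - u4 + u5"
    "coords (\<phi> B0) 11 = z0 - u3"
    "coords (\<phi> B1) 13 = z0 + u1 - u2"
    "coords (\<phi> B2) 10 = z0 + u2 - u3"
    "coords (\<phi> B3) 8 = z0 + u3 - u4"
    "coords (\<phi> B4) 6 = z0 + u4 - u5"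
    using cocycle_degree_1[OF two E25 E21 E22 E17] by (elim exE conjE)
  obtain u17 u21 u22 u25 where D3:
    "coords (\<phi> A0) 46 = u21"
    "coords (\<phi> A2) 41 = u21 - u25"
    "coords (\<phi> A2) 42 = u22"
    "coords (\<phi> A3) 35 = u17 - u21"
    "coords (\<phi> A3) 36 = u17 - u22"
    "coords (\<phi> B0) 39 = - u21"
    "coords (\<phi> B2) 37 = - u22"
    "coords (\<phi> B2) 38 = - u21 + u25"
    "coords (\<phi> B3) 32 = - u17 + u21"
    "coords (\<phi> B3) 33 = - u17 + u22"
    using cocycle_degree_3[OF two E67 E61 E55 E56 E57 E50] by (elim exE conjE)
  obtain l u50 u55 u56 u57 u61 u67 where D5:
    "coords (\<phi> A0) 86 = l + u56"
    "coords (\<phi> A0) 87 = u57 - u67"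
    "coords (\<phi> A1) 85 = l + u61"
    "coords (\<phi> A2) 81 = l + u55 - u61"
    "coords (\<phi> A2) 82 = u57"
    "coords (\<phi> A3) 74 = u55 - u56"
    "coords (\<phi> A3) 75 = u50 + u55 - u57"
    "coords (\<phi> A4) 70 = - u50"
    "coords (\<phi> B0) 78 = - l - u55 + u67"
    "coords (\<phi> B0) 79 = - l - u56"
    "coords (\<phi> B1) 83 = - l - u61"
    "coords (\<phi> B2) 76 = l - u57 + u61"
    "coords (\<phi> B2) 77 = l - u55"
    "coords (\<phi> B3) 71 = u50 - u55 + u56"
    "coords (\<phi> B3) 72 = u50 - u55 + u57"
    "coords (\<phi> B4) 68 = u50"
    "3 * l = 0"
    using cocycle_degree_5[OF two E107 E104 E100 E101 E95 E96 E97 E90 E91 E88] by (elim exE conjE)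
  obtain z6 u88 u90 u91 u95 u96 u97 u100 u101 u107 where D7:
    "coords (\<phi> A0) 124 = u97 - u107"
    "coords (\<phi> A1) 121 = - z6 + u101"
    "coords (\<phi> A2) 118 = u95 + u100 - u101"
    "coords (\<phi> A2) 119 = z6 + u96 + u100"
    "coords (\<phi> A3) 113 = z6 - u90 + u91 + u95 - u96"
    "coords (\<phi> A3) 115 = u91 - u97"
    "coords (\<phi> A4) 110 = z6 + u88 + u90 - u91"
    "coords (\<phi> B0) 117 = - u95 + u107"
    "coords (\<phi> B1) 120 = - z6 - u100"
    "coords (\<phi> B2) 114 = - z6 + u96 - u97 + u100"
    "coords (\<phi> B2) 116 = - z6 + u96 + u101"
    "coords (\<phi> B3) 111 = u91 + u95"
    "coords (\<phi> B3) 112 = - z6 - u90 - u96 + u97"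
    "coords (\<phi> B4) 108 = - z6 + u88 + u90"
    using cocycle_degree_7[OF two E135 E131 E132 E127] by (elim exE conjE)
  obtain z8 u127 u131 u132 where D9:
    "coords (\<phi> A0) 149 = u131"
    "coords (\<phi> A2) 147 = z8 + u131 + u132"
    "coords (\<phi> A3) 143 = z8 + u127 - u131 - u132"
    "coords (\<phi> B0) 145 = - u131"
    "coords (\<phi> B2) 144 = z8 - u132"
    "coords (\<phi> B3) 141 = z8 - u127 + u132"
    using cocycle_degree_9[OF two E155 E152] by (elim exE conjE)
  \<comment> \<open>Coordinates 0, 104 and 135 of the inner part are set to 0. This is a
    normalisation: the central elements of lengths 0, 6 and 8 have nonzero coordinates there and do
    not change an inner derivation.\<close>
  define \<mu> :: "nat \<Rightarrow> 'f" where "\<mu> = (\<lambda>_. 0)(1 := u1, 2 := u2, 3 := u3, 4 :=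
      u4, 5 := u5, 17 := u17, 21 := u21, 22 := u22, 25 := u25, 50 := u50, 55 := u55, 56 := u56, 57 := u57,
      61 := u61, 67 := u67, 88 := u88, 90 := u90, 91 := u91, 95 := u95, 96 := u96, 97 := u97, 100 := u100,
      101 := u101, 107 := u107, 127 := u127, 131 := u131, 132 := u132)"
  \<comment> \<open>A combination of 1 and of one central element each of lengths 6 and 8. The
    longest loops are central as well but are left out, since their products with arrows are
    0.\<close>
  define \<zeta> :: "nat \<Rightarrow> 'f" where "\<zeta> = (\<lambda>_. 0)(0 := z0, 1 := z0, 2 := z0, 3
      := z0, 4 := z0, 5 := z0, 88 := z6, 90 := - z6, 96 := z6, 100 := - z6, 101 := - z6, 104 := - z6, 127
      := z8, 132 := z8, 135 := z8)"
  define u where "u = of_coords \<mu>"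
  define z where "z = of_coords \<zeta>"
  have coords_u: "n < 156 \<Longrightarrow> coords u n = \<mu> n" for n
    by (simp only: u_def coords_of_coords)
  have coords_z: "n < 156 \<Longrightarrow> coords z n = \<zeta> n" for n
    by (simp only: z_def coords_of_coords)
  have diag: "diagonal u" "diagonal z"
    unfolding u_def z_def \<mu>_def \<zeta>_def
    by (rule diagonal_of_coords, simp add: diagonal_index del: One_nat_def split: if_splits)+
  have central: "arrA a * z = z * arrA a" for a
  proof (rule arrow_eqI)
    show "coords (arrA a * z) n = coords (z * arrA a) n" if "n \<in> set (arrow_block a)" for n
      using that by (cases a; simp only: arrow_block; elim set_elims)
        (simp_all add: row_simps coords_z \<zeta>_def)
  qed (simp_all only: diagonal_arr[OF diag(2)])
  have "\<phi> a = arrA a * z + (u * arrA a - arrA a * u) + scale_preproj l (rho5_value a)" for a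
  proof (rule arrow_eqI)
    show "coords (\<phi> a) n = coords (arrA a * z + (u * arrA a - arrA a * u) + scale_preproj l
        (rho5_value a)) n"
      if "n \<in> set (arrow_block a)" for n
      using that by (cases a; simp only: arrow_block; elim set_elims)
        (simp_all add: row_simps coords_z coords_u \<mu>_def \<zeta>_def rho5_basis coords_basis D1 D3 D5
            D7 D9)
  qed (simp_all only: local distrib_left distrib_right left_diff_distrib right_diff_distrib
      diagonal_arr[OF diag(1)]
      diagonal_arr[OF diag(2)] scale_preproj_mult_left scale_preproj_mult_right rho5_local)
  with diag central D5 show ?thesis by blast
qed

lemma central_solution:
  fixes z u :: "'f::field preproj"
  assumes two: "(2 :: 'f) \<noteq> 0" and diag: "diagonal z"
    and central: "\<And>a. arrA a * z = z * arrA a"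
    and inner: "\<And>a. arrA a * z = u * arrA a - arrA a * u"
  shows "\<exists>s t. z = scale_preproj s (basis 155) + scale_preproj t (basis 152)"
proof -
  \<comment> \<open>The rule \<open>c\<close> expresses centrality and \<open>e\<close> the
    assumption that \<open>z\<close> times \<open>fund\<close> is inner. The names of the equations
    below record the arrow and the coordinate at which these are read.\<close>
  have c: "coords (z * arrA a) n - coords (arrA a * z) n = 0" for a n
    by (simp only: central diff_self)
  have e: "coords (arrA a * z) n - (coords (u * arrA a) n - coords (arrA a * u) n) = 0" for a n
    by (simp only: inner coords_diff diff_self)
  have c_A0_15: "- coords z 0 + coords z 3 = 0"
    using c[of A0 15] by (simp add: row_simps algebra_simps)
  have c_A1_14: "- coords z 1 + coords z 2 = 0"
    using c[of A1 14] by (simp add: row_simps algebra_simps)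
  have c_A2_12: "- coords z 2 + coords z 3 = 0"
    using c[of A2 12] by (simp add: row_simps algebra_simps)
  have c_A3_9: "- coords z 3 + coords z 4 = 0"
    using c[of A3 9] by (simp add: row_simps algebra_simps)
  have c_A4_7: "- coords z 4 + coords z 5 = 0"
    using c[of A4 7] by (simp add: row_simps algebra_simps)
  have e_A0_15: "coords u 0 - coords u 3 + coords z 0 = 0"
    using e[of A0 15] by (simp add: row_simps algebra_simps)
  have e_B0_11: "- coords u 0 + coords u 3 + coords z 3 = 0"
    using e[of B0 11] by (simp add: row_simps algebra_simps)
  have c_A0_46: "coords z 21 = 0"
    using c[of A0 46] by (simp add: row_simps algebra_simps)
  have c_A2_42: "coords z 22 = 0"
    using c[of A2 42] by (simp add: row_simps algebra_simps)
  have c_A2_41: "coords z 21 - coords z 25 = 0"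
    using c[of A2 41] by (simp add: row_simps algebra_simps)
  have c_A3_35: "coords z 17 - coords z 21 = 0"
    using c[of A3 35] by (simp add: row_simps algebra_simps)
  have c_A1_85: "coords z 61 = 0"
    using c[of A1 85] by (simp add: row_simps algebra_simps)
  have c_B2_77: "- coords z 55 = 0"
    using c[of B2 77] by (simp add: row_simps algebra_simps neg_eq_iff_add_eq_0)
  have c_A0_86: "coords z 56 = 0"
    using c[of A0 86] by (simp add: row_simps algebra_simps)
  have c_A2_82: "coords z 57 = 0"
    using c[of A2 82] by (simp add: row_simps algebra_simps)
  have c_A4_70: "- coords z 50 = 0"
    using c[of A4 70] by (simp add: row_simps algebra_simps neg_eq_iff_add_eq_0)
  have c_A0_87: "coords z 57 - coords z 67 = 0"
    using c[of A0 87] by (simp add: row_simps algebra_simps)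
  have c_A0_124: "coords z 97 - coords z 107 = 0"
    using c[of A0 124] by (simp add: row_simps algebra_simps)
  have c_B0_117: "- coords z 95 + coords z 107 = 0"
    using c[of B0 117] by (simp add: row_simps algebra_simps)
  have c_A1_121: "coords z 101 - coords z 104 = 0"
    using c[of A1 121] by (simp add: row_simps algebra_simps)
  have c_B1_120: "- coords z 100 + coords z 104 = 0"
    using c[of B1 120] by (simp add: row_simps algebra_simps)
  have c_A2_119: "coords z 96 + coords z 100 = 0"
    using c[of A2 119] by (simp add: row_simps algebra_simps)
  have c_B3_111: "coords z 91 + coords z 95 = 0"
    using c[of B3 111] by (simp add: row_simps algebra_simps)
  have c_A3_115: "coords z 91 - coords z 97 = 0"
    using c[of A3 115] by (simp add: row_simps algebra_simps)
  have c_B4_108: "coords z 88 + coords z 90 = 0"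
    using c[of B4 108] by (simp add: row_simps algebra_simps)
  have c_B3_112: "- coords z 90 - coords z 96 + coords z 97 = 0"
    using c[of B3 112] by (simp add: row_simps algebra_simps)
  have e_A0_124: "- coords u 97 + coords u 107 + coords z 107 = 0"
    using e[of A0 124] by (simp add: row_simps algebra_simps)
  have e_B0_117: "coords u 95 - coords u 107 + coords z 95 = 0"
    using e[of B0 117] by (simp add: row_simps algebra_simps)
  have e_A1_121: "- coords u 101 + coords u 104 + coords z 104 = 0"
    using e[of A1 121] by (simp add: row_simps algebra_simps)
  have e_B1_120: "coords u 100 - coords u 104 + coords z 100 = 0"
    using e[of B1 120] by (simp add: row_simps algebra_simps)
  have e_B3_111: "- coords u 91 - coords u 95 - coords z 91 = 0"
    using e[of B3 111] by (simp add: row_simps algebra_simps neg_eq_iff_add_eq_0)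
  have e_A3_115: "- coords u 91 + coords u 97 + coords z 97 = 0"
    using e[of A3 115] by (simp add: row_simps algebra_simps)
  have e_A2_118: "- coords u 95 - coords u 100 + coords u 101 - coords z 100 + coords z 101 = 0"
    using e[of A2 118] by (simp add: row_simps algebra_simps)
  have c_A0_149: "coords z 131 = 0"
    using c[of A0 149] by (simp add: row_simps algebra_simps)
  have c_B2_144: "- coords z 132 + coords z 135 = 0"
    using c[of B2 144] by (simp add: row_simps algebra_simps)
  have c_B3_141: "- coords z 127 + coords z 132 = 0"
    using c[of B3 141] by (simp add: row_simps algebra_simps)
  have e_A0_149: "- coords u 131 = 0"
    using e[of A0 149] by (simp add: row_simps algebra_simps neg_eq_iff_add_eq_0)
  have e_B2_144: "coords u 132 - coords u 135 + coords z 132 = 0"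
    using e[of B2 144] by (simp add: row_simps algebra_simps)
  have e_A2_147: "- coords u 131 - coords u 132 + coords u 135 + coords z 135 = 0"
    using e[of A2 147] by (simp add: row_simps algebra_simps)
  note Z0 = central_degree_0[OF two c_A0_15 c_A1_14 c_A2_12 c_A3_9 c_A4_7 e_A0_15 e_B0_11]
  note Z2 = central_degree_2[OF two c_A0_46 c_A2_42 c_A2_41 c_A3_35]
  note Z4 = central_degree_4[OF two c_A1_85 c_B2_77 c_A0_86 c_A2_82 c_A4_70 c_A0_87]
  note Z6 = central_degree_6[OF two c_A0_124 c_B0_117 c_A1_121 c_B1_120 c_A2_119 c_B3_111 c_A3_115
      c_B4_108 c_B3_112 e_A0_124 e_B0_117 e_A1_121 e_B1_120 e_B3_111 e_A3_115 e_A2_118]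
  note Z8 = central_degree_8[OF two c_A0_149 c_B2_144 c_B3_141 e_A0_149 e_B2_144 e_A2_147]
  have "z = scale_preproj (coords z 155) (basis 155) + scale_preproj (coords z 152) (basis 152)"
  proof (rule diagonal_eqI[OF diag])
    show "diagonal (scale_preproj (coords z 155) (basis 155) + scale_preproj (coords z 152) (basis 152))"
      by (rule diagonal_lincomb)
    show "coords z n = coords (scale_preproj (coords z 155) (basis 155) + scale_preproj (coords z 152)
        (basis 152)) n"
      if "n \<in> set (vertex_block v)" for n v
      using that by (cases v; simp only: vertex_block; elim set_elims)
        (simp_all add: coords_add coords_scale coords_basis Z0 Z2 Z4 Z6 Z8 del: One_nat_def)
  qed
  then show ?thesis by blast
qed

section \<open>Cochains in degrees 0, 1 and 2\<close>

lemma commute_tens_pow: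
  assumes "\<And>v xs. is_path v xs \<Longrightarrow> length xs = n \<Longrightarrow> proj (single (v, xs)) * z = z * (proj (single (v, xs)) :: 'f::field preproj)"
    and "u \<in> tens_pow n"
  shows "proj u * z = z * proj u"
  using assms(2) unfolding tens_pow_def
proof (induction rule: path_vs.span_induct_alt)
  case (step c x y)
  then obtain v xs where x: "x = single (v, xs)" "is_path v xs" "length xs = n" by auto
  have "proj x * z = z * proj x" unfolding x(1) by (rule assms(1)[OF x(2,3)])
  with step(2) show ?case
    by (simp add: proj_add distrib_left distrib_right scale_preproj_mult_left scale_preproj_mult_right flip: scale_preproj_proj)
qed (simp add: proj_zero)

lemma diagonal_commute: "diagonal z \<Longrightarrow> u \<in> W 0 \<Longrightarrow> proj u * z = z * proj u"
  unfolding W_0 by (erule commute_tens_pow[rotated]) (simp add: diagonal_def)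

lemma central_commute:
  assumes "\<And>a. arrA a * z = z * arrA a" "w \<in> W (Suc 0)"
  shows "proj w * z = z * (proj w :: 'f::field preproj)"
  using assms(2) unfolding W_1
proof (rule commute_tens_pow[rotated])
  fix v xs assume "is_path v xs" "length xs = 1"
  then obtain a where "xs = [a]" "v = tgt a" by (cases xs) auto
  with assms(1)[of a] show "proj (single (v, xs)) * z = z * (proj (single (v, xs)) :: 'f preproj)" by simp
qed

lemma central_cochain_closed:
  fixes z :: "'f::field preproj"
  assumes "diagonal z"
  shows "central_cochain z \<in> carrier (Hom_W 0)"
  unfolding Hom_W_simps(1) central_cochain_def
proof (intro conjI ballI allI impI)
  fix x u v :: "'f path_alg" assume x: "x \<in> W 0" and u: "u \<in> W 0" and v: "v \<in> W 0"
  have "z * (proj u * (proj x * proj v)) = proj u * (z * (proj x * proj v))"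
    using diagonal_commute[OF assms u] by (metis mult.assoc)
  then show "(if u * x * v \<in> W 0 then z * proj (u * x * v) else 0) = proj u * (if x \<in> W 0 then z * proj x else 0) * proj v"
    using x u v by (simp add: W_mult proj_mult mult.assoc)
qed (simp_all add: path_vs.subspace_add[OF subspace_W] proj_add distrib_left)

lemma central_cochain_one: "central_cochain z 1 = z"
  by (simp add: central_cochain_def one_in_W0 proj_one)

text \<open>Together with \<open>central_cochain_closed\<close> this identifies 0-cochains with
  diagonal elements; by \<open>b_K_0\<close> the cocycles among them are the central ones.\<close>

lemma Hom_W_0_diagonal:
  assumes "f \<in> carrier (Hom_W 0)"
  shows "diagonal (f 1)" "f = central_cochain (f 1)"
proof -
  have "idem v \<in> W 0" for v :: vertex by (simp add: W_0 idem_in_tens_pow)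
  then show "diagonal (f 1)"
    using Hom_W_0[OF assms] by (metis diagonal_def)
  show "f = central_cochain (f 1)"
    using Hom_W_0(1)[OF assms] Hom_W_D(1)[OF assms] by (auto simp: central_cochain_def fun_eq_iff)
qed

lemma central_cochain_cocycle:
  fixes z :: "'f::field preproj"
  assumes "diagonal z" "\<And>a. arrA a * z = z * arrA a"
  shows "central_cochain z \<in> cocycles Hom_W b_K 0"
proof -
  have c: "central_cochain z \<in> carrier (Hom_W 0)" by (rule central_cochain_closed[OF assms(1)])
  have "b_K 0 (central_cochain z) w = 0" for w
  proof (cases "w \<in> W (Suc 0)")
    case True
    then show ?thesis
      using b_K_0[OF c True] central_commute[OF assms(2) True] by (simp add: central_cochain_one)
  next
    case False
    then show ?thesis using Hom_W_D(1)[OF b_K_closed[OF c]] by simp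
  qed
  with c show ?thesis by (simp add: Z_iff fun_eq_iff)
qed

lemma arr_in_W: "arr a \<in> W (Suc 0)"
  by (simp only: W_1 arr_in_tens_pow)

lemma cocycle_0_central:
  assumes "f \<in> cocycles Hom_W b_K 0"
  shows "arrA a * f 1 = f 1 * arrA a"
  using Z_0_commute[OF assms arr_in_W[of a]] by simp

lemma Hom_W_1_local:
  fixes f :: "'f::field cochain"
  assumes "f \<in> carrier (Hom_W (Suc 0))"
  shows "proj (idem (tgt a)) * f (arr a) = f (arr a)" "f (arr a) * proj (idem (src a)) = f (arr a)"
proof -
  have i: "(idem v :: 'f path_alg) \<in> W 0" for v by (simp add: W_0 idem_in_tens_pow)
  have "f (idem (tgt a) * arr a) = proj (idem (tgt a)) * f (arr a)" "f (arr a * idem (src a)) = f (arr a) * proj (idem (src a))"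
    by (rule Hom_W_mult[OF assms arr_in_W i])+
  then show "proj (idem (tgt a)) * f (arr a) = f (arr a)" "f (arr a) * proj (idem (src a)) = f (arr a)"
    by (simp_all add: single_mult)
qed

lemma Hom_W_1_eqI:
  fixes f g :: "'f::field cochain"
  assumes f: "f \<in> carrier (Hom_W (Suc 0))" and g: "g \<in> carrier (Hom_W (Suc 0))"
    and eq: "\<And>a. f (arr a) = g (arr a)"
  shows "f = g"
proof
  fix w
  have "f w = g w" if "w \<in> W (Suc 0)"
  proof -
    have "w \<in> W (Suc 0) \<and> f w = g w"
      using that unfolding W_1 tens_pow_def[of 1]
    proof (induction rule: path_vs.span_induct_alt)
      case base
      then show ?case using Hom_W_zero[OF f] Hom_W_zero[OF g] by (simp add: path_vs.span_zero)
    next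
      case (step c x y)
      then obtain v xs where "x = single (v, xs)" "is_path v xs" "length xs = 1" by auto
      then obtain a where x: "x = arr a" by (cases xs) auto
      have y: "y \<in> W (Suc 0)" "f y = g y" using step(2) by (simp_all add: W_1 tens_pow_def)
      have cx: "scale_path c (arr a :: 'f path_alg) \<in> W (Suc 0)"
        by (rule path_vs.subspace_scale[OF subspace_W arr_in_W])
      have "f (scale_path c (arr a) + y) = g (scale_path c (arr a) + y)"
        unfolding Hom_W_D(2)[OF f cx y(1)] Hom_W_D(2)[OF g cx y(1)] Hom_W_scale[OF f arr_in_W] Hom_W_scale[OF g arr_in_W]
        by (simp only: eq y(2))
      moreover have "scale_path c (arr a) + y \<in> W (Suc 0)"
        by (rule path_vs.subspace_add[OF subspace_W cx y(1)])
      ultimately show ?case unfolding x W_1 tens_pow_def[of 1] by blast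
    qed
    then show ?thesis ..
  qed
  then show "f w = g w" using Hom_W_D(1)[OF f] Hom_W_D(1)[OF g] by metis
qed

lemma sigma_in_W: "sigma v \<in> W 2"
  by (simp add: W_2 sigma_in_rels)

lemma Hom_W_2_eqI:
  fixes f g :: "'f::field cochain"
  assumes f: "f \<in> carrier (Hom_W 2)" and g: "g \<in> carrier (Hom_W 2)"
    and eq: "\<And>v. f (sigma v) = g (sigma v)"
  shows "f = g"
proof
  fix w
  have "f w = g w" if "w \<in> W 2"
  proof -
    have "w \<in> W 2 \<and> f w = g w"
      using that unfolding W_2 rels_def
    proof (induction rule: path_vs.span_induct_alt)
      case base
      then show ?case using Hom_W_zero[OF f] Hom_W_zero[OF g] by (simp add: path_vs.span_zero)
    next
      case (step c x y)
      then obtain v where x: "x = sigma v" by auto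
      have y: "y \<in> W 2" "f y = g y" using step(2) by (simp_all add: W_2 rels_def)
      have cx: "scale_path c (sigma v :: 'f path_alg) \<in> W 2"
        by (rule path_vs.subspace_scale[OF subspace_W sigma_in_W])
      have "f (scale_path c (sigma v) + y) = g (scale_path c (sigma v) + y)"
        unfolding Hom_W_D(2)[OF f cx y(1)] Hom_W_D(2)[OF g cx y(1)] Hom_W_scale[OF f sigma_in_W] Hom_W_scale[OF g sigma_in_W]
        by (simp only: eq y(2))
      moreover have "scale_path c (sigma v) + y \<in> W 2"
        by (rule path_vs.subspace_add[OF subspace_W cx y(1)])
      ultimately show ?case unfolding x W_2 rels_def by blast
    qed
    then show ?thesis ..
  qed
  then show "f w = g w" using Hom_W_D(1)[OF f] Hom_W_D(1)[OF g] by metis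
qed

lemma Hom_W_2_local:
  fixes f :: "'f::field cochain"
  assumes "f \<in> carrier (Hom_W 2)"
  shows "proj (idem v) * f (sigma v) = f (sigma v)" "f (sigma v) * proj (idem v) = f (sigma v)"
proof -
  have i: "(idem v :: 'f path_alg) \<in> W 0" for v by (simp add: W_0 idem_in_tens_pow)
  have "f (idem v * sigma v) = proj (idem v) * f (sigma v)" "f (sigma v * idem v) = f (sigma v) * proj (idem v)"
    by (rule Hom_W_mult[OF assms sigma_in_W i])+
  then show "proj (idem v) * f (sigma v) = f (sigma v)" "f (sigma v) * proj (idem v) = f (sigma v)"
    by (simp_all add: idem_sigma sigma_idem)
qed

lemma coords_sigma_eqI:
  fixes f g :: "'f::field cochain"
  assumes f: "f \<in> carrier (Hom_W 2)" and g: "g \<in> carrier (Hom_W 2)"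
    and eq: "\<And>v n. n \<in> set (vertex_block v) \<Longrightarrow> coords (f (sigma v)) n = coords (g (sigma v)) n"
  shows "f = g"
proof (rule Hom_W_2_eqI[OF f g], rule coords_eqI)
  fix v and n :: nat assume n: "n < 156"
  have "coords (h (sigma v)) n = 0" if "h \<in> carrier (Hom_W 2)" "target n \<noteq> v \<or> source n \<noteq> v" for h :: "'f cochain"
    using coords_idem_mult[of v "h (sigma v)" n] coords_mult_idem[of "h (sigma v)" v n] that(2)
    unfolding Hom_W_2_local[OF that(1)] by auto
  then show "coords (f (sigma v)) n = coords (g (sigma v)) n"
    using f g eq[of n v] in_block[OF n] by (cases "target n = v \<and> source n = v") (auto simp: vertex_block_def)
qed

text \<open>The sign is absorbed into the left factor, so that the list has the form required by
  \<open>b_K_1\<close> and \<open>cup_1_1\<close>.\<close>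

lemma sigma_list:
  "set (map (\<lambda>a. (scale_path (of_int (sgn_arrow a)) (arr a), arr (reverse a))) as) \<subseteq> W (Suc 0) \<times> W (Suc 0)"
  "sigma v = prods (map (\<lambda>a. (scale_path (of_int (sgn_arrow a)) (arr a), arr (reverse a))) (filter (\<lambda>a. tgt a = v) arrows))"
proof -
  show "set (map (\<lambda>a. (scale_path (of_int (sgn_arrow a)) (arr a), arr (reverse a))) as) \<subseteq> W (Suc 0) \<times> W (Suc 0)"
    by (auto intro: path_vs.subspace_scale[OF subspace_W] arr_in_W simp del: reverse_simps)
  show "sigma v = prods (map (\<lambda>a. (scale_path (of_int (sgn_arrow a)) (arr a), arr (reverse a))) (filter (\<lambda>a. tgt a = v) arrows))"
    unfolding sigma_sum by (simp add: comp_def scale_path_mult_left del: reverse_simps)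
qed

lemma b_K_1_sigma:
  fixes f :: "'f::field cochain"
  assumes f: "f \<in> carrier (Hom_W (Suc 0))"
  shows "b_K (Suc 0) f (sigma v) = sigma_value (\<lambda>a b. f (arr a) * arrA b + arrA a * f (arr b)) v"
proof -
  have "f (scale_path c (arr a)) = scale_preproj c (f (arr a))" for c a
    by (rule Hom_W_scale[OF f arr_in_W])
  then show ?thesis
    using b_K_1[OF f sigma_list(1), of "filter (\<lambda>a. tgt a = v) arrows"]
    unfolding sigma_list(2)[of v, symmetric]
    by (simp add: sigma_in_W sigma_value_def comp_def scale_preproj_mult_left distrib_left mult.assoc scale_preproj_of_int
        flip: scale_preproj_proj del: reverse_simps)
qed

lemma cup_fund_sigma:
  fixes f :: "'f::field cochain"
  assumes f: "f \<in> carrier (Hom_W (Suc 0))"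
  shows "cup (Suc 0) (Suc 0) fund f (sigma v) = - sigma_value (\<lambda>a b. arrA a * f (arr b)) v"
proof -
  have "fund (scale_path c (arr a)) = scale_preproj c (arrA a :: 'f preproj)" for c a
    using Hom_W_scale[OF fund_closed arr_in_W] by (simp add: fund_eq[OF arr_in_W])
  then show ?thesis
    using cup_1_1[OF fund_closed f sigma_list(1), of "filter (\<lambda>a. tgt a = v) arrows"]
    unfolding sigma_list(2)[of v, symmetric]
    by (simp add: sigma_in_W sigma_value_def comp_def scale_preproj_mult_left mult.assoc scale_preproj_of_int del: reverse_simps)
qed

section \<open>Cochains prescribed on arrows\<close>

lemma coeff_tens0:
  fixes u :: "'f::field path_alg"
  assumes "u \<in> tens_pow 0"
  shows "u * idem v = scale_path (coeff u (v, [])) (idem v)" "idem v * u = scale_path (coeff u (v, [])) (idem v)"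
proof -
  have u: "coeff u (w, x # xs) = 0" for w x xs
    using assms unfolding tens_pow_iff by fastforce
  have "coeff (u * idem v) (w, xs) = coeff (scale_path (coeff u (v, [])) (idem v)) (w, xs)" for w xs
    by (cases xs) (simp_all add: coeff_mult_idem coeff_scale coeff_single u)
  then show "u * idem v = scale_path (coeff u (v, [])) (idem v)" by (rule path_alg_eqI)
  have "coeff (idem v * u) (w, xs) = coeff (scale_path (coeff u (v, [])) (idem v)) (w, xs)" for w xs
    by (cases xs) (simp_all add: idem_mult_coeff coeff_scale coeff_single u)
  then show "idem v * u = scale_path (coeff u (v, [])) (idem v)" by (rule path_alg_eqI)
qed

lemma on_arrows_closed:
  fixes h :: "arrow \<Rightarrow> 'f::field preproj"
  assumes h: "\<And>a. proj (idem (tgt a)) * h a = h a" "\<And>a. h a * proj (idem (src a)) = h a"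
  shows "on_arrows h \<in> carrier (Hom_W (Suc 0))"
  unfolding Hom_W_simps(1) on_arrows_def
proof (intro conjI ballI allI impI)
  fix x u v :: "'f path_alg" assume x: "x \<in> W (Suc 0)" and u: "u \<in> W 0" and v: "v \<in> W 0"
  have ut: "u \<in> tens_pow 0" and vt: "v \<in> tens_pow 0" using u v by (simp_all add: W_0)
  have xt: "x \<in> tens_pow 1" using x by (simp only: W_1)
  have uxv: "u * x * v \<in> W (Suc 0)" using x u v by (simp add: W_mult)
  \<comment> \<open>The elements \<open>u\<close> and \<open>v\<close> of \<open>k\<close> only
    rescale at the two ends of an arrow, so the coefficient factors.\<close>
  have c: "coeff (u * x * v) (tgt a, [a]) = coeff u (tgt a, []) * coeff x (tgt a, [a]) * coeff v (src a, [])" for a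
    using tens_pow_mult[OF ut xt]
    by (simp add: coeff_tens_mult[of "u * x" 1] coeff_tens_mult[OF ut])
  have pu: "proj u * h a = scale_preproj (coeff u (tgt a, [])) (h a)" for a
  proof -
    have "proj u * h a = proj (u * idem (tgt a)) * h a"
      unfolding proj_mult mult.assoc h(1) ..
    then show ?thesis
      by (simp only: coeff_tens0[OF ut] scale_preproj_proj[symmetric] scale_preproj_mult_left h(1))
  qed
  have pv: "h a * proj v = scale_preproj (coeff v (src a, [])) (h a)" for a
  proof -
    have "h a * proj v = h a * proj (idem (src a) * v)"
      unfolding proj_mult mult.assoc[symmetric] h(2) ..
    then show ?thesis
      by (simp only: coeff_tens0[OF vt] scale_preproj_proj[symmetric] scale_preproj_mult_right h(2))
  qed
  have term_eq: "scale_preproj (coeff (u * x * v) (tgt a, [a])) (h a) = proj u * scale_preproj (coeff x (tgt a, [a])) (h a) * proj v" for a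
    unfolding c scale_preproj_mult_left scale_preproj_mult_right pu pv preproj_vs.scale_scale
    by (simp only: mult_ac)
  have "(\<Sum>a\<in>UNIV. scale_preproj (coeff (u * x * v) (tgt a, [a])) (h a))
     = proj u * (\<Sum>a\<in>UNIV. scale_preproj (coeff x (tgt a, [a])) (h a)) * proj v"
    unfolding sum_distrib_left sum_distrib_right by (rule sum.cong[OF refl term_eq])
  then show "(if u * x * v \<in> W 1 then \<Sum>a\<in>UNIV. scale_preproj (coeff (u * x * v) (tgt a, [a])) (h a) else 0)
     = proj u * (if x \<in> W 1 then \<Sum>a\<in>UNIV. scale_preproj (coeff x (tgt a, [a])) (h a) else 0) * proj v"
    using x uxv unfolding One_nat_def by (simp only: if_True)
next
  fix x y :: "'f path_alg" assume x: "x \<in> W (Suc 0)" and y: "y \<in> W (Suc 0)"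
  have xy: "x + y \<in> W (Suc 0)" by (rule path_vs.subspace_add[OF subspace_W x y])
  show "(if x + y \<in> W 1 then \<Sum>a\<in>UNIV. scale_preproj (coeff (x + y) (tgt a, [a])) (h a) else 0)
     = (if x \<in> W 1 then \<Sum>a\<in>UNIV. scale_preproj (coeff x (tgt a, [a])) (h a) else 0)
     + (if y \<in> W 1 then \<Sum>a\<in>UNIV. scale_preproj (coeff y (tgt a, [a])) (h a) else 0)"
    using x y xy unfolding One_nat_def
    by (simp only: if_True coeff_add preproj_vs.scale_left_distrib sum.distrib)
qed simp

lemma on_arrows_arr:
  fixes h :: "arrow \<Rightarrow> 'f::field preproj"
  shows "on_arrows h (arr a) = h a"
proof -
  have "on_arrows h (arr a) = (\<Sum>b\<in>UNIV. scale_preproj (coeff (arr a) (tgt b, [b])) (h b))"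
    unfolding on_arrows_def One_nat_def by (simp only: if_True arr_in_W)
  also have "\<dots> = (\<Sum>b\<in>UNIV. if b = a then h b else 0)"
    by (rule sum.cong) (auto simp: coeff_single)
  finally show ?thesis by simp
qed

lemma rho5_on_arrows: "rho5 = on_arrows rho5_value"
  by (simp add: rho5_def rho5_value_def[abs_def])

lemma rho5_closed: "rho5 \<in> carrier (Hom_W (Suc 0))"
  unfolding rho5_on_arrows by (rule on_arrows_closed) (rule rho5_local)+

lemma rho5_arr: "rho5 (arr a) = rho5_value a"
  by (simp only: rho5_on_arrows on_arrows_arr)

section \<open>Spans of one and two vectors\<close>

lemma carrier_eq_span_single:
  fixes V :: "('f::field, 'm) module"
  assumes V: "Module.module class_ring V" and x: "x \<in> carrier V"
    and gen: "\<And>v. v \<in> carrier V \<Longrightarrow> \<exists>s. v = s \<odot>\<^bsub>V\<^esub> x"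
  shows "carrier V = LinearCombinations.module.span class_ring V {x}"
proof -
  interpret V: vectorspace class_ring V
    by (rule vectorspace.intro[OF V class_field])
  have lc: "V.lincomb a {x} = a x \<odot>\<^bsub>V\<^esub> x" for a
    using V.lincomb_insert[of "{}" a x] x V.smult_closed[of "a x" x] by (simp add: V.lincomb_def)
  show ?thesis
  proof
    show "carrier V \<subseteq> V.span {x}"
    proof
      fix v assume "v \<in> carrier V"
      then obtain s where "v = s \<odot>\<^bsub>V\<^esub> x" using gen by blast
      then have "v = V.lincomb (\<lambda>_. s) {x}" by (simp only: lc)
      then show "v \<in> V.span {x}"
        using V.finite_span[of "{x}"] x by auto
    qed
    show "V.span {x} \<subseteq> carrier V" by (rule V.span_is_subset2) (use x in simp)
  qed
qed

lemma two_vectors_basis: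
  fixes V :: "('f::field, 'm) module"
  assumes V: "Module.module class_ring V" and x: "x \<in> carrier V" and y: "y \<in> carrier V"
    and gen: "\<And>v. v \<in> carrier V \<Longrightarrow> \<exists>s t. v = s \<odot>\<^bsub>V\<^esub> x \<oplus>\<^bsub>V\<^esub> t \<odot>\<^bsub>V\<^esub> y"
    and indep: "\<And>s t. s \<odot>\<^bsub>V\<^esub> x \<oplus>\<^bsub>V\<^esub> t \<odot>\<^bsub>V\<^esub> y = \<zero>\<^bsub>V\<^esub> \<Longrightarrow> s = 0 \<and> t = 0"
  shows "vectorspace.dim class_ring V = 2"
    and "carrier V = LinearCombinations.module.span class_ring V {x, y}"
proof -
  interpret V: vectorspace class_ring V
    by (rule vectorspace.intro[OF V class_field])
  \<comment> \<open>Needed for \<open>{x, y}\<close> to have two elements; equal vectors would have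
    the dependence with coefficients 1 and -1.\<close>
  have ne: "x \<noteq> y"
  proof
    assume "x = y"
    moreover have "1 \<odot>\<^bsub>V\<^esub> x \<oplus>\<^bsub>V\<^esub> (- 1) \<odot>\<^bsub>V\<^esub> x = \<zero>\<^bsub>V\<^esub>"
      using V.smult_l_distr[of 1 "- 1" x] V.smult_l_null[OF x] x by simp
    ultimately show False using indep[of 1 "- 1"] by simp
  qed
  have lc: "V.lincomb a {x, y} = a x \<odot>\<^bsub>V\<^esub> x \<oplus>\<^bsub>V\<^esub> a y \<odot>\<^bsub>V\<^esub> y" for a
  proof -
    have "V.lincomb a {y} = a y \<odot>\<^bsub>V\<^esub> y"
      using V.lincomb_insert[of "{}" a y] y V.smult_closed[of "a y" y] by (simp add: V.lincomb_def)
    then show ?thesis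
      using V.lincomb_insert[of "{y}" a x] x y ne by (simp add: insert_commute)
  qed
  have sub: "{x, y} \<subseteq> carrier V" using x y by simp
  have "carrier V \<subseteq> V.span {x, y}"
  proof
    fix v assume "v \<in> carrier V"
    then obtain s t where "v = s \<odot>\<^bsub>V\<^esub> x \<oplus>\<^bsub>V\<^esub> t \<odot>\<^bsub>V\<^esub> y" using gen by blast
    then have "v = V.lincomb (\<lambda>w. if w = x then s else t) {x, y}"
      using ne by (simp add: lc)
    then show "v \<in> V.span {x, y}"
      using V.finite_span[OF _ sub] by auto
  qed
  then show span: "carrier V = V.span {x, y}"
    using V.span_is_subset2[OF sub] by blast
  have "V.lin_indpt {x, y}"
    by (rule V.finite_lin_indpt2[OF _ sub]) (use indep in \<open>auto simp: lc\<close>)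
  then have "V.basis {x, y}"
    unfolding V.basis_def using sub span by auto
  then show "V.dim = 2"
    using V.dim_basis[of "{x, y}"] ne by simp
qed

section \<open>Classes of cochains\<close>

lemma carrier_HK: "carrier (HK p) = K.cl p ` cocycles Hom_W b_K p"
  by (simp only: HK_eq K.carrier_H)

lemma zero_HK: "\<zero>\<^bsub>HK p\<^esub> = K.cl p (\<lambda>_. 0)"
  by (simp only: HK_eq K.zero_H Hom_W_simps(2))

lemma add_HK: "f \<in> cocycles Hom_W b_K p \<Longrightarrow> g \<in> cocycles Hom_W b_K p \<Longrightarrow>
    K.cl p f \<oplus>\<^bsub>HK p\<^esub> K.cl p g = K.cl p (\<lambda>w. f w + g w)"
  by (simp only: HK_eq K.add_H Hom_W_simps(3))

lemma smult_HK: "f \<in> cocycles Hom_W b_K p \<Longrightarrow>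
    c \<odot>\<^bsub>HK p\<^esub> K.cl p f = K.cl p (\<lambda>w. scale_preproj c (f w))"
  by (simp only: HK_eq K.smult_H Hom_W_simps(4))

lemma cl_eq_zero_HK: "f \<in> cocycles Hom_W b_K p \<Longrightarrow>
    K.cl p f = \<zero>\<^bsub>HK p\<^esub> \<longleftrightarrow> f \<in> coboundaries Hom_W b_K p"
  by (simp only: HK_eq K.cl_eq_zero_iff)

lemma cl_in_HK: "f \<in> cocycles Hom_W b_K p \<Longrightarrow> K.cl p f \<in> carrier (HK p)"
  by (simp add: carrier_HK)

lemma Z_carrier: "f \<in> cocycles Hom_W b_K p \<Longrightarrow> f \<in> carrier (Hom_W p)"
  by (simp add: Z_iff)

lemma Z_lincomb:
  assumes "f \<in> cocycles Hom_W b_K p" "g \<in> cocycles Hom_W b_K p"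
  shows "(\<lambda>w. f w + g w) \<in> cocycles Hom_W b_K p" "(\<lambda>w. scale_preproj c (f w)) \<in> cocycles Hom_W b_K p"
  using K.cocycles_add[OF assms] K.cocycles_smult[OF assms(1), of c] by simp_all

lemma zero_in_Z: "(\<lambda>_. 0) \<in> cocycles Hom_W b_K p"
  using K.coboundaries_zero[of p] K.coboundaries_subset[of p] by auto

lemma HK_ge_3:
  assumes "3 \<le> p"
  shows "carrier (HK p :: ('f::field, 'f cochain set) module) = {\<zero>\<^bsub>HK p\<^esub>}"
proof -
  have "f = (\<lambda>_. 0)" if "f \<in> cocycles Hom_W b_K p" for f :: "'f cochain"
    using Hom_W_ge_3[OF Z_carrier[OF that] assms] .
  then have "cocycles Hom_W b_K p = {\<lambda>_. 0 :: 'f preproj}" using zero_in_Z by blast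
  then show ?thesis by (simp only: carrier_HK zero_HK image_insert image_empty)
qed

lemma HK_hi_eq: "HK_hi p = cohomology HK d_hi p" "HK_hi_class p = cohomology_class HK d_hi p"
  by (simp_all add: HK_hi_def HK_hi_class_def)

lemma HK_hi_ge_3:
  assumes "3 \<le> p"
  shows "carrier (HK_hi p :: ('f::field, 'f cochain set set) module) = {\<zero>\<^bsub>HK_hi p\<^esub>}"
proof -
  let ?z = "\<zero>\<^bsub>HK p\<^esub> :: 'f cochain set"
  have "cocycles HK d_hi p \<subseteq> {?z}"
    using HK_ge_3[OF assms] HI.cocycles_carrier by blast
  moreover have "?z \<in> cocycles HK d_hi p"
    using HI.coboundaries_zero HI.coboundaries_subset by blast
  ultimately have "cocycles HK d_hi p = {?z}" by blast
  then show ?thesis by (simp only: HK_hi_eq HI.carrier_H HI.zero_H image_insert image_empty)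
qed

text \<open>If the adjacent differentials vanish, every class is a cocycle and zero is the only
  coboundary. In degree 0 the second assumption is vacuous.\<close>

lemma canonically_equal_HK:
  assumes out: "\<And>X :: 'f::field cochain set. X \<in> carrier (HK p) \<Longrightarrow> d_hi p X = \<zero>\<^bsub>HK (Suc p)\<^esub>"
    and into: "\<And>q (X :: 'f cochain set). p = Suc q \<Longrightarrow> X \<in> carrier (HK q) \<Longrightarrow> d_hi q X = \<zero>\<^bsub>HK p\<^esub>"
  shows "canonically_equal (HK :: nat \<Rightarrow> ('f, 'f cochain set) module) d_hi p (carrier (HK p))"
proof -
  let ?C = "HK :: nat \<Rightarrow> ('f, 'f cochain set) module"
  have "coboundaries ?C d_hi p = {\<zero>\<^bsub>HK p\<^esub>}"
  proof (cases p)
    case (Suc q)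
    have "d_hi q ` carrier (?C q) \<subseteq> {\<zero>\<^bsub>HK p\<^esub>}" using into[OF Suc] by blast
    moreover have "\<zero>\<^bsub>HK p\<^esub> \<in> coboundaries ?C d_hi p" by (rule HI.coboundaries_zero)
    ultimately show ?thesis unfolding coboundaries_def Suc nat.case by blast
  qed (simp add: coboundaries_def)
  moreover have "cocycles ?C d_hi p = carrier (?C p)"
    unfolding cocycles_def using out by blast
  ultimately show ?thesis using HI.canonically_equal_cocycles[of p] by metis
qed

section \<open>Characteristic 2\<close>

lemma two_eq_0: "CHAR('f::field) = 2 \<Longrightarrow> (2 :: 'f) = 0"
  using of_nat_CHAR[where ?'a = 'f] by simp

lemma three_eq_0: "CHAR('f::field) = 3 \<Longrightarrow> (3 :: 'f) = 0"
  using of_nat_CHAR[where ?'a = 'f] by simp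

text \<open>Otherwise the characteristic divides the prime \<open>p\<close>; being neither 0 nor 1,
  it equals \<open>p\<close>. Characteristic 0 is covered too.\<close>

lemma prime_neq_0:
  assumes "CHAR('f::field) \<noteq> p" "p = 2 \<or> p = 3"
  shows "(of_nat p :: 'f) \<noteq> 0"
proof
  assume "(of_nat p :: 'f) = 0"
  then have d: "CHAR('f) dvd p" by (simp add: of_nat_eq_0_iff_char_dvd)
  have "CHAR('f) \<noteq> 1" using of_nat_CHAR[where ?'a = 'f] by auto
  moreover have "CHAR('f) \<noteq> 0"
  proof
    assume "CHAR('f) = 0"
    with d have "p = 0" by simp
    with assms(2) show False by simp
  qed
  moreover have "CHAR('f) \<le> p" using dvd_imp_le[OF d] assms(2) by auto
  moreover have "CHAR('f) \<noteq> 2" if "p = 3" using d that by auto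
  ultimately show False using assms by linarith
qed

lemma two_neq_0: "CHAR('f::field) \<noteq> 2 \<Longrightarrow> (2 :: 'f) \<noteq> 0"
  using prime_neq_0[where ?'f = 'f and p = 2] by simp

lemma three_neq_0: "CHAR('f::field) \<noteq> 3 \<Longrightarrow> (3 :: 'f) \<noteq> 0"
  using prime_neq_0[where ?'f = 'f and p = 3] by simp

lemma idem_mult_idem: "proj (idem v) * proj (idem w) = (if v = w then proj (idem v) else (0 :: 'f::field preproj))"
  by (simp add: single_mult proj_zero flip: proj_mult)

text \<open>The quiver is bipartite, so up to signs \<open>fund\<close> is the inner derivation by the sum of the
  idempotents on one side.\<close>

lemma fund_coboundary:
  assumes "(2 :: 'f::field) = 0"
  shows "(fund :: 'f cochain) \<in> coboundaries Hom_W b_K (Suc 0)"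
proof -
  define u :: "'f preproj" where "u = proj (idem V0) + proj (idem V2) + proj (idem V4)"
  have neg: "- x = x" for x :: "'f preproj"
  proof -
    have "x + x = scale_preproj (1 + 1) x" by (simp only: preproj_vs.scale_left_distrib preproj_vs.scale_one)
    also have "\<dots> = 0" using assms by simp
    finally show ?thesis by (rule minus_unique)
  qed
  have "diagonal u"
    unfolding diagonal_def
  proof
    fix v show "proj (idem v) * u = u * proj (idem v)"
      by (cases v) (simp_all add: u_def distrib_left distrib_right idem_mult_idem)
  qed
  then have c: "central_cochain u \<in> carrier (Hom_W 0)" by (rule central_cochain_closed)
  have "fund = b_K 0 (central_cochain u)"
  proof (rule Hom_W_1_eqI[OF fund_closed b_K_closed[OF c]])
    fix a
    have "b_K 0 (central_cochain u) (arr a) = u * arrA a - arrA a * u"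
      by (simp only: b_K_0[OF c arr_in_W] central_cochain_one)
    also have "\<dots> = arrA a"
      by (cases a) (simp_all add: u_def distrib_left distrib_right idem_single single_idem_arr neg)
    finally show "fund (arr a) = b_K 0 (central_cochain u) (arr a)"
      by (simp only: fund_eq[OF arr_in_W])
  qed
  then show ?thesis unfolding B_Suc by (rule image_eqI[OF _ c])
qed

lemma cup_zero_left:
  fixes g :: "'f::field cochain"
  assumes "g \<in> carrier (Hom_W p)"
  shows "cup 1 p (\<lambda>_. 0) g = (\<lambda>_. 0 :: 'f::field preproj)"
proof -
  have z: "(\<lambda>_. 0 :: 'f preproj) \<in> carrier (Hom_W q)" for q
    by (rule Z_carrier[OF zero_in_Z])
  consider "p = 0" | "p = Suc 0" | "2 \<le> p" by linarith
  then show ?thesis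
  proof cases
    case 1
    then show ?thesis using cup_1_0[OF z] assms by (simp add: fun_eq_iff)
  next
    case 2
    with assms have g: "g \<in> carrier (Hom_W (Suc 0))" by simp
    have "cup (Suc 0) (Suc 0) (\<lambda>_. 0) g = (\<lambda>_. 0 :: 'f preproj)"
    proof (rule Hom_W_2_eqI[OF _ z])
      show "cup (Suc 0) (Suc 0) (\<lambda>_. 0) g \<in> carrier (Hom_W 2)"
        using cup_closed[OF z[of "Suc 0"] g] by (simp add: numeral_2_eq_2)
      show "cup (Suc 0) (Suc 0) (\<lambda>_. 0) g (sigma v) = 0" for v
        using cup_1_1[OF z g sigma_list(1), of "filter (\<lambda>a. tgt a = v) arrows"]
        unfolding sigma_list(2)[of v, symmetric]
        by (simp add: sigma_in_W comp_def del: reverse_simps)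
    qed
    with 2 show ?thesis by simp
  next
    case 3
    then show ?thesis using cup_ge_2[OF z assms] by simp
  qed
qed

text \<open>As \<open>fund\<close> is a coboundary, the zero cochain represents its class and may
  replace it in the product.\<close>

lemma d_hi_char_2:
  assumes two: "(2 :: 'f::field) = 0" and X: "X \<in> carrier (HK p :: ('f, 'f cochain set) module)"
  shows "d_hi p X = \<zero>\<^bsub>HK (Suc p)\<^esub>"
proof -
  obtain g where g: "g \<in> cocycles Hom_W b_K p" and Xg: "X = K.cl p g"
    using X by (auto simp: carrier_HK)
  have "K.cl (Suc 0) (fund :: 'f cochain) = K.cl (Suc 0) (\<lambda>_. 0)"
    using iffD2[OF cl_eq_zero_HK[OF fund_cocycle] fund_coboundary[OF two]] by (simp only: zero_HK)
  then have "(\<lambda>_. 0) \<in> K.cl (Suc 0) (fund :: 'f cochain)"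
    using K.cl_self[OF zero_in_Z] by metis
  then have "d_hi p X = K.cl (Suc p) (cup 1 p (\<lambda>_. 0) g)"
    unfolding Xg by (rule d_hi_class_shift[OF g])
  then show ?thesis by (simp only: cup_zero_left[OF Z_carrier[OF g]] zero_HK)
qed

lemma canonically_equal_char_2:
  assumes "(2 :: 'f::field) = 0"
  shows "canonically_equal (HK :: nat \<Rightarrow> ('f, 'f cochain set) module) d_hi p (carrier (HK p))"
  by (rule canonically_equal_HK) (simp_all only: d_hi_char_2[OF assms])

section \<open>Cocycles of degree 0\<close>

text \<open>The span of the two longest loops, at \<open>V0\<close> (index 155) and at
  \<open>V3\<close> (index 152). Arrows annihilate them, hence they are central, and they form the
  kernel of \<open>d_hi\<close> in degree 0 when 2 is invertible.\<close>

definition socle :: "'f \<Rightarrow> 'f \<Rightarrow> ('f::field) preproj" where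
  "socle s t = scale_preproj s (basis 155) + scale_preproj t (basis 152)"

lemma coords_socle: "coords (socle s t) n = (if n = 155 then s else if n = 152 then t else (0 :: 'f::field))"
  by (simp add: socle_def coords_add coords_scale coords_basis)

lemma diagonal_socle: "diagonal (socle s t)"
  unfolding socle_def by (rule diagonal_lincomb)

lemma socle_mult:
  fixes s t :: "'f::field"
  shows "arrA a * socle s t = 0" "socle s t * arrA a = 0"
proof -
  have z: "proj (idem v) * 0 = (0 :: 'f preproj)" "0 * proj (idem v) = (0 :: 'f preproj)" for v :: vertex
    by simp_all
  have left: "coords (arrA a * socle s t) n = coords 0 n" if "n \<in> set (arrow_block a)" for n
    using that by (cases a; simp only: arrow_block; elim set_elims) (simp_all add: row_simps coords_socle)
  show "arrA a * socle s t = 0"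
    by (rule arrow_eqI[OF left diagonal_arr(1,2)[OF diagonal_socle] z])
  have right: "coords (socle s t * arrA a) n = coords 0 n" if "n \<in> set (arrow_block a)" for n
    using that by (cases a; simp only: arrow_block; elim set_elims) (simp_all add: row_simps coords_socle)
  show "socle s t * arrA a = 0"
    by (rule arrow_eqI[OF right diagonal_arr(3,4)[OF diagonal_socle] z])
qed

lemma pi_socle: "pi0 = socle 1 0" "pi3 = socle 0 (- 1)"
  by (simp_all add: pi_basis socle_def)

lemma socle_cocycle: "central_cochain (socle s t) \<in> cocycles Hom_W b_K 0"
  by (rule central_cochain_cocycle[OF diagonal_socle]) (simp only: socle_mult)

lemma socle_linear:
  "socle (s + s') (t + t') = socle s t + socle s' t'"
  "socle (c * s) (c * t) = scale_preproj c (socle s t)"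
  by (simp_all add: socle_def preproj_vs.scale_left_distrib preproj_vs.scale_right_distrib algebra_simps)

lemma cup_fund_socle: "cup (Suc 0) 0 fund (central_cochain (socle s t)) = (\<lambda>_. 0 :: 'f::field preproj)"
proof -
  have c: "central_cochain (socle s t) \<in> carrier (Hom_W 0)" by (rule central_cochain_closed[OF diagonal_socle])
  show ?thesis
  proof (rule Hom_W_1_eqI[OF _ Z_carrier[OF zero_in_Z]])
    show "cup (Suc 0) 0 fund (central_cochain (socle s t)) \<in> carrier (Hom_W (Suc 0))"
      using cup_closed[OF fund_closed c] by simp
    show "cup (Suc 0) 0 fund (central_cochain (socle s t)) (arr a) = (0 :: 'f preproj)" for a
      by (simp only: cup_1_0[OF fund_closed c] central_cochain_one fund_eq[OF arr_in_W] socle_mult)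
  qed
qed

text \<open>If the product of \<open>fund\<close> with \<open>f\<close> is \<open>b_K 0 h\<close>,
  then \<open>f 1\<close> times each arrow is the value there of the inner derivation by
  \<open>h 1\<close>, which is the system solved in \<open>central_solution\<close>.\<close>

lemma kernel_socle:
  fixes f :: "'f::field cochain"
  assumes two: "(2 :: 'f) \<noteq> 0" and f: "f \<in> cocycles Hom_W b_K 0"
    and cob: "cup (Suc 0) 0 fund f \<in> coboundaries Hom_W b_K (Suc 0)"
  obtains s t where "f = central_cochain (socle s t)"
proof -
  have fc: "f \<in> carrier (Hom_W 0)" by (rule Z_carrier[OF f])
  obtain h where h: "h \<in> carrier (Hom_W 0)" "cup (Suc 0) 0 fund f = b_K 0 h"
    using cob by (auto simp: B_Suc)
  have "\<exists>s t. f 1 = scale_preproj s (basis 155) + scale_preproj t (basis 152)"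
  proof (rule central_solution[OF two Hom_W_0_diagonal(1)[OF fc] cocycle_0_central[OF f]])
    fix a
    show "arrA a * f 1 = h 1 * arrA a - arrA a * h 1"
      using cup_1_0[OF fund_closed fc, of "arr a"] b_K_0[OF h(1) arr_in_W, of a]
      by (simp only: h(2) fund_eq[OF arr_in_W])
  qed
  then obtain s t where "f 1 = socle s t" by (auto simp: socle_def)
  then show ?thesis using that Hom_W_0_diagonal(2)[OF fc] by metis
qed

lemma kernel_0:
  assumes two: "(2 :: 'f::field) \<noteq> 0"
  shows "cocycles (HK :: nat \<Rightarrow> ('f, 'f cochain set) module) d_hi 0 =
    {K.cl 0 (central_cochain (socle s t)) | s t. True}"
proof (intro equalityI subsetI)
  fix X :: "'f cochain set"
  assume "X \<in> cocycles HK d_hi 0"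
  then have X: "X \<in> carrier (HK 0)" "d_hi 0 X = \<zero>\<^bsub>HK (Suc 0)\<^esub>" by (simp_all add: cocycles_def)
  then obtain f where f: "f \<in> cocycles Hom_W b_K 0" "X = K.cl 0 f" by (auto simp: carrier_HK)
  have "cup (Suc 0) 0 fund f \<in> coboundaries Hom_W b_K (Suc 0)"
    using X(2) d_hi_class[OF f(1)] cl_eq_zero_HK[OF cup_fund_cocycle[OF f(1)]] by (simp add: f(2))
  from kernel_socle[OF two f(1) this] obtain s t where "f = central_cochain (socle s t)" .
  then show "X \<in> {K.cl 0 (central_cochain (socle s t)) | s t. True}" using f(2) by blast
next
  fix X :: "'f cochain set"
  assume "X \<in> {K.cl 0 (central_cochain (socle s t)) | s t. True}"
  then obtain s t where X: "X = K.cl 0 (central_cochain (socle s t))" by blast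
  have "d_hi 0 X = K.cl (Suc 0) (\<lambda>_. 0)"
    using d_hi_class[OF socle_cocycle[of s t]] cup_fund_socle[of s t] by (simp add: X)
  then show "X \<in> cocycles HK d_hi 0"
    using cl_in_HK[OF socle_cocycle[of s t]] by (simp add: cocycles_def X zero_HK)
qed

section \<open>The grading\<close>

lemma level_left:
  assumes "(n, m, c) \<in> set (left_mult a)"
  shows "level m = Suc (level n)"
  using level_check in_arrows[of a] assms unfolding list_all_iff by fastforce

text \<open>Trivial paths have level 0 and every arrow raises the level by one, so coordinates
  respect the grading by length.\<close>

lemma level_path:
  assumes "is_path v xs" "level n \<noteq> length xs"
  shows "coords (proj (single (v, xs))) n = (0 :: 'f::field)"
  using assms
proof (induction xs arbitrary: v n)
  case Nil
  have "level (root_index v) = 0" by (cases v) (simp_all add: level_def)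
  with Nil show ?case by (auto simp: coords_idem)
next
  case (Cons a xs)
  have "proj (single (v, a # xs)) = arrA a * (proj (single (src a, xs)) :: 'f preproj)"
    using Cons.prems(1) by (auto simp: single_mult simp flip: proj_mult)
  then have "coords (proj (single (v, a # xs))) n = sp_sum (left_mult a)
      (\<lambda>k m. if m = n then coords (proj (single (src a, xs))) k else (0 :: 'f))"
    by (simp only: coords_arr_mult)
  also have "\<dots> = sp_sum (left_mult a) (\<lambda>k m. 0)"
  proof (rule sp_sum_cong)
    fix k m c assume "(k, m, c) \<in> set (left_mult a)"
    then have "level m = Suc (level k)" by (rule level_left)
    then show "(if m = n then coords (proj (single (src a, xs))) k else 0) = (0 :: 'f)"
      using Cons.IH[of "src a" k] Cons.prems by auto
  qed
  finally show ?case by simp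
qed

lemma level_deg:
  assumes "x \<in> preproj_deg r" "level n \<noteq> r"
  shows "coords x n = (0 :: 'f::field)"
proof -
  obtain y where y: "y \<in> tens_pow r" "x = proj y" using assms(1) by (auto simp: preproj_deg_def)
  have "coords (proj y) n = 0"
    using y(1) unfolding tens_pow_def
  proof (induction rule: path_vs.span_induct_alt)
    case (step c x y)
    then obtain v xs where "x = single (v, xs)" "is_path v xs" "length xs = r" by auto
    then have "coords (proj x) n = 0" using level_path[of v xs n] assms(2) by simp
    with step(2) show ?case
      by (simp add: proj_add coords_add coords_scale flip: scale_preproj_proj)
  qed (simp add: proj_zero coords_zero)
  then show ?thesis by (simp only: y(2))
qed

lemma deg_mult: "x \<in> preproj_deg m \<Longrightarrow> y \<in> preproj_deg n \<Longrightarrow> x * y \<in> preproj_deg (m + n)"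
  unfolding preproj_deg_def by (auto simp: tens_pow_mult simp flip: proj_mult intro!: imageI)

lemma deg_arr: "arrA a \<in> preproj_deg 1"
  unfolding preproj_deg_def by (rule imageI, rule arr_in_tens_pow)

lemma deg_lincomb: "x \<in> preproj_deg n \<Longrightarrow> y \<in> preproj_deg n \<Longrightarrow>
    scale_preproj s x + scale_preproj t y \<in> preproj_deg n"
  unfolding preproj_deg_def
  by (auto simp: path_vs.subspace_add[OF subspace_tens_pow] path_vs.subspace_scale[OF subspace_tens_pow]
      scale_preproj_proj simp flip: proj_add intro!: imageI)

lemma deg_pi: "pi0 \<in> preproj_deg 10" "pi3 \<in> preproj_deg 10"
proof -
  have c: "c0 \<in> preproj_deg 2" "c3 \<in> preproj_deg 2"
    using deg_mult[OF deg_arr[of A0] deg_arr[of B0]] deg_mult[OF deg_arr[of B3] deg_arr[of A3]]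
    by (simp_all add: c0_def c3_def numeral_2_eq_2)
  have "arrA B0 * (c3 * c3) * c0 * c3 * arrA A0 \<in> preproj_deg (1 + (2 + 2) + 2 + 2 + 1)"
    by (intro deg_mult deg_arr c)
  then show "pi0 \<in> preproj_deg 10" by (simp add: pi0_def power2_eq_square)
  have "c3 * ((c0 * c3) * (c0 * c3)) \<in> preproj_deg (2 + ((2 + 2) + (2 + 2)))"
    by (intro deg_mult c)
  then show "pi3 \<in> preproj_deg 10" by (simp add: pi3_def power2_eq_square)
qed

lemma socle_pi: "socle s t = scale_preproj s pi0 + scale_preproj (- t) pi3"
  by (simp add: pi_basis socle_def)

lemma deg_socle: "socle s t \<in> preproj_deg 10"
  unfolding socle_pi by (rule deg_lincomb[OF deg_pi])

lemma diagonal_deg_10: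
  fixes x :: "'f::field preproj"
  assumes "diagonal x" "x \<in> preproj_deg 10"
  shows "x = socle (coords x 155) (coords x 152)"
proof (rule diagonal_eqI[OF assms(1) diagonal_socle])
  fix n v assume "n \<in> set (vertex_block v)"
  then have "level n = 10 \<longrightarrow> n = 152 \<or> n = 155"
    using level_block unfolding list_all_iff by (cases v) auto
  moreover have "level 155 = 10" "level 152 = 10" by (simp_all add: level_def)
  ultimately show "coords x n = coords (socle (coords x 155) (coords x 152)) n"
    using level_deg[OF assms(2), of n] by (auto simp: coords_socle)
qed

text \<open>In length 10 the cocycle condition removes nothing: diagonal elements are combinations
  of the two longest loops, and these are annihilated by arrows.\<close>

lemma HK_deg_0_10: "HK_deg 0 10 = {K.cl 0 (central_cochain (socle s t :: 'f::field preproj)) | s t. True}"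
proof (intro equalityI subsetI)
  fix X :: "'f cochain set"
  assume "X \<in> HK_deg 0 10"
  then obtain f where f: "X = K.cl 0 f" "f \<in> cocycles Hom_W b_K 0" "f ` W 0 \<subseteq> preproj_deg 10"
    by (auto simp: HK_deg_def HK_eq)
  have "f 1 \<in> preproj_deg 10" using f(3) one_in_W0 by blast
  from diagonal_deg_10[OF Hom_W_0_diagonal(1)[OF Z_carrier[OF f(2)]] this]
  have "f = central_cochain (socle (coords (f 1) 155) (coords (f 1) 152))"
    using Hom_W_0_diagonal(2)[OF Z_carrier[OF f(2)]] by metis
  then have "X = K.cl 0 (central_cochain (socle (coords (f 1) 155) (coords (f 1) 152)))"
    using f(1) by metis
  then show "X \<in> {K.cl 0 (central_cochain (socle s t)) | s t. True}" by blast
next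
  fix X :: "'f cochain set"
  assume "X \<in> {K.cl 0 (central_cochain (socle s t)) | s t. True}"
  then obtain s t where X: "X = K.cl 0 (central_cochain (socle s t))" by blast
  have "socle s t * proj u \<in> preproj_deg 10" if "u \<in> W 0" for u
    using deg_mult[OF deg_socle[of s t], of "proj u" 0] that by (auto simp: preproj_deg_def W_0)
  then have "central_cochain (socle s t) ` W 0 \<subseteq> preproj_deg 10"
    by (auto simp: central_cochain_def)
  then show "X \<in> HK_deg 0 10"
    using socle_cocycle[of s t] X by (auto simp: HK_deg_def HK_eq)
qed

section \<open>Degree 0\<close>

text \<open>The kernel of \<open>d_hi\<close> and the part of length 10 have been described by the
  same set, and in degree 0 zero is the only coboundary.\<close>

lemma canonically_equal_0:
  assumes "(2 :: 'f::field) \<noteq> 0"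
  shows "canonically_equal (HK :: nat \<Rightarrow> ('f, 'f cochain set) module) d_hi 0 (HK_deg 0 10)"
  unfolding HK_deg_0_10 kernel_0[OF assms, symmetric]
  by (rule HI.canonically_equal_cocycles) (simp add: coboundaries_def)

lemma central_cochain_linear:
  "central_cochain (y + z) = (\<lambda>w. central_cochain y w + central_cochain z w)"
  "central_cochain (scale_preproj c z) = (\<lambda>w. scale_preproj c (central_cochain z w))"
  by (auto simp: central_cochain_def distrib_right scale_preproj_mult_left)

abbreviation socle_class :: "'f \<Rightarrow> 'f \<Rightarrow> ('f::field) cochain set set" where
  "socle_class s t \<equiv> HI.cl 0 (K.cl 0 (central_cochain (socle s t)))"

text \<open>The rules for classes are applied twice, once per quotient, and reduce the module
  operations to arithmetic of the two parameters.\<close>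

lemma socle_class_lincomb:
  assumes two: "(2 :: 'f::field) \<noteq> 0"
  shows "a \<odot>\<^bsub>HK_hi 0\<^esub> socle_class s t \<oplus>\<^bsub>HK_hi 0\<^esub> b \<odot>\<^bsub>HK_hi 0\<^esub> socle_class s' t'
    = socle_class (a * s + b * s') (a * t + b * (t' :: 'f))"
proof -
  have c: "K.cl 0 (central_cochain (socle x y)) \<in> cocycles HK d_hi 0" for x y :: 'f
    unfolding kernel_0[OF two] by blast
  have scale: "a \<odot>\<^bsub>HK_hi 0\<^esub> socle_class x y = socle_class (a * x) (a * y)" for a x y :: 'f
    by (simp only: HK_hi_eq HI.smult_H[OF c] smult_HK[OF socle_cocycle] socle_linear central_cochain_linear)
  have "socle_class x y \<oplus>\<^bsub>HK_hi 0\<^esub> socle_class x' y' = socle_class (x + x') (y + y')" for x y x' y' :: 'f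
    by (simp only: HK_hi_eq HI.add_H[OF c c] add_HK[OF socle_cocycle socle_cocycle] socle_linear central_cochain_linear)
  then show ?thesis by (simp only: scale)
qed

lemma socle_class_eq_0:
  assumes two: "(2 :: 'f::field) \<noteq> 0" and z: "socle_class s t = \<zero>\<^bsub>HK_hi 0\<^esub>"
  shows "s = 0 \<and> t = (0 :: 'f)"
proof -
  have "K.cl 0 (central_cochain (socle s t)) \<in> cocycles HK d_hi 0"
    unfolding kernel_0[OF two] by blast
  then have "K.cl 0 (central_cochain (socle s t)) \<in> coboundaries HK d_hi 0"
    using z by (simp only: HK_hi_eq HI.cl_eq_zero_iff)
  then have "K.cl 0 (central_cochain (socle s t)) = \<zero>\<^bsub>HK 0\<^esub>" by (simp add: coboundaries_def)
  then have "central_cochain (socle s t) = (\<lambda>_. 0)"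
    by (simp only: cl_eq_zero_HK[OF socle_cocycle] B_0 singleton_iff)
  then have "socle s t = 0" using central_cochain_one[of "socle s t"] by simp
  then have "coords (socle s t) 155 = 0" "coords (socle s t) 152 = 0" by (simp_all only: coords_zero)
  then show ?thesis by (simp add: coords_socle)
qed

lemma HK_hi_0:
  assumes two: "(2 :: 'f::field) \<noteq> 0"
  shows "vectorspace.dim class_ring (HK_hi 0 :: ('f, 'f cochain set set) module) = 2"
    and "carrier (HK_hi 0 :: ('f, 'f cochain set set) module) =
      LinearCombinations.module.span class_ring (HK_hi 0)
        {HK_hi_class 0 (HK_class 0 (central_cochain pi0)), HK_hi_class 0 (HK_class 0 (central_cochain pi3))}"
proof -
  let ?H = "HK_hi 0 :: ('f, 'f cochain set set) module"
  have cl: "HK_hi_class 0 (HK_class 0 (central_cochain pi0)) = (socle_class 1 0 :: 'f cochain set set)"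
    "HK_hi_class 0 (HK_class 0 (central_cochain pi3)) = (socle_class 0 (- 1) :: 'f cochain set set)"
    by (simp_all only: HK_hi_eq HK_eq pi_socle)
  have car: "carrier ?H = {socle_class s t | s t. True}"
    unfolding HK_hi_eq HI.carrier_H kernel_0[OF two] by blast
  have V: "Module.module class_ring ?H" unfolding HK_hi_eq by (rule HI.module_H)
  have x: "socle_class 1 0 \<in> carrier ?H" and y: "socle_class 0 (- 1) \<in> carrier ?H"
    unfolding car by blast+
  have gen: "\<exists>s t. v = s \<odot>\<^bsub>?H\<^esub> socle_class 1 0 \<oplus>\<^bsub>?H\<^esub> t \<odot>\<^bsub>?H\<^esub> socle_class 0 (- 1)"
    if v: "v \<in> carrier ?H" for v
  proof -
    obtain s t where "v = socle_class s t" using v unfolding car by blast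
    \<comment> \<open>The sign of the second coefficient comes from \<open>pi3\<close> being minus
      the longest loop at \<open>V3\<close>.\<close>
    then have "v = s \<odot>\<^bsub>?H\<^esub> socle_class 1 0 \<oplus>\<^bsub>?H\<^esub> (- t) \<odot>\<^bsub>?H\<^esub> socle_class 0 (- 1)"
      unfolding socle_class_lincomb[OF two] by simp
    then show ?thesis by blast
  qed
  have indep: "s = 0 \<and> t = 0"
    if "s \<odot>\<^bsub>?H\<^esub> socle_class 1 0 \<oplus>\<^bsub>?H\<^esub> t \<odot>\<^bsub>?H\<^esub> socle_class 0 (- 1) = \<zero>\<^bsub>?H\<^esub>" for s t
    using socle_class_eq_0[OF two that[unfolded socle_class_lincomb[OF two]]] by simp
  show "vectorspace.dim class_ring ?H = 2"
    by (rule two_vectors_basis(1)[OF V x y gen indep])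
  show "carrier ?H = LinearCombinations.module.span class_ring ?H
      {HK_hi_class 0 (HK_class 0 (central_cochain pi0)), HK_hi_class 0 (HK_class 0 (central_cochain pi3))}"
    unfolding cl by (rule two_vectors_basis(2)[OF V x y gen indep])
qed

section \<open>Degree 1\<close>

lemma sigma_value_eqI:
  fixes f g :: "'f::field cochain"
  assumes f: "f \<in> carrier (Hom_W (Suc (Suc 0)))" and g: "g \<in> carrier (Hom_W (Suc (Suc 0)))"
    and "\<And>v. f (sigma v) = F v" "\<And>v. g (sigma v) = G v"
    and "\<And>v n. n \<in> set (vertex_block v) \<Longrightarrow> coords (F v) n = coords (G v) n"
  shows "f = g"
  by (rule coords_sigma_eqI[OF f[folded numeral_2_eq_2] g[folded numeral_2_eq_2]]) (simp only: assms(3-5))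

text \<open>All coordinates of the coboundary are multiples of 3.\<close>

lemma rho5_cocycle:
  assumes three: "(3 :: 'f::field) = 0"
  shows "(rho5 :: 'f cochain) \<in> cocycles Hom_W b_K (Suc 0)"
proof -
  have "b_K (Suc 0) rho5 = (\<lambda>_. 0 :: 'f preproj)"
  proof (rule sigma_value_eqI[OF b_K_closed[OF rho5_closed] Z_carrier[OF zero_in_Z]
        b_K_1_sigma[OF rho5_closed, unfolded rho5_arr] refl])
    fix v n assume "n \<in> set (vertex_block v)"
    then show "coords (sigma_value (\<lambda>a b. rho5_value a * arrA b + arrA a * rho5_value b) v) n = coords (0 :: 'f preproj) n"
      by (cases v; simp only: vertex_block; elim set_elims)
        (simp_all add: row_simps sigma_value_def arrows_def sgn_arrow_def rho5_basis coords_basis three)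
  qed
  then show ?thesis by (simp add: Z_iff rho5_closed)
qed

text \<open>In characteristic 3 the product of \<open>fund\<close> with \<open>rho5\<close> is the coboundary of the restriction
  of \<open>rho5\<close> to two arrows; this witness was found by solving a linear system.\<close>

lemma cup_fund_rho5:
  assumes three: "(3 :: 'f::field) = 0"
  shows "cup (Suc 0) (Suc 0) fund rho5 \<in> (coboundaries Hom_W b_K (Suc (Suc 0)) :: 'f cochain set)"
proof -
  define h :: "arrow \<Rightarrow> 'f preproj" where "h a = (if a = B0 \<or> a = B1 then rho5_value a else 0)" for a
  have h: "on_arrows h \<in> carrier (Hom_W (Suc 0))"
    by (rule on_arrows_closed) (simp_all add: h_def rho5_local)
  have two: "(2 :: 'f) = - 1"
    using three by (simp add: eq_neg_iff_add_eq_0)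
  have hv: "h A0 = 0" "h A1 = 0" "h A2 = 0" "h A3 = 0" "h A4 = 0" "h B0 = - basis 78 - basis 79"
    "h B1 = - basis 83" "h B2 = 0" "h B3 = 0" "h B4 = 0"
    by (simp_all add: h_def rho5_basis)
  have c: "cup (Suc 0) (Suc 0) fund rho5 \<in> (carrier (Hom_W (Suc (Suc 0))) :: 'f cochain set)"
    using cup_closed[OF fund_closed rho5_closed] by simp
  have "cup (Suc 0) (Suc 0) fund rho5 = b_K (Suc 0) (on_arrows h)"
  proof (rule sigma_value_eqI[OF c b_K_closed[OF h] cup_fund_sigma[OF rho5_closed, unfolded rho5_arr]
        b_K_1_sigma[OF h, unfolded on_arrows_arr]])
    fix v n assume "n \<in> set (vertex_block v)"
    then show "coords (- sigma_value (\<lambda>a b. arrA a * rho5_value b) v) n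
      = coords (sigma_value (\<lambda>a b. h a * arrA b + arrA a * h b) v) n"
      by (cases v; simp only: vertex_block; elim set_elims)
        (simp_all add: row_simps sigma_value_def arrows_def sgn_arrow_def rho5_basis hv coords_basis three two)
  qed
  then show ?thesis unfolding B_Suc by (rule image_eqI[OF _ h])
qed

abbreviation rho5_class :: "'f \<Rightarrow> ('f::field) cochain set" where
  "rho5_class l \<equiv> K.cl (Suc 0) (\<lambda>w. scale_preproj l (rho5 w))"

text \<open>Either 3 is 0 and \<open>rho5\<close> is a cocycle, or \<open>l\<close> is 0 and the
  multiple is trivial. The decomposition of \<open>HK 1\<close> can thus be stated without
  distinguishing characteristics.\<close>

lemma scaled_rho5:
  assumes l: "3 * l = (0 :: 'f::field)"
  shows "(\<lambda>w. scale_preproj l (rho5 w)) \<in> cocycles Hom_W b_K (Suc 0)"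
    and "d_hi (Suc 0) (rho5_class l) = \<zero>\<^bsub>HK (Suc (Suc 0))\<^esub>"
proof -
  have "(\<lambda>w. scale_preproj l (rho5 w)) \<in> cocycles Hom_W b_K (Suc 0) \<and>
    d_hi (Suc 0) (rho5_class l) = \<zero>\<^bsub>HK (Suc (Suc 0))\<^esub>"
  proof (cases "(3 :: 'f) = 0")
    case True
    note rho = rho5_cocycle[OF True]
    have "cup (Suc 0) (Suc 0) fund rho5 \<in> (cocycles Hom_W b_K (Suc (Suc 0)) :: 'f cochain set)"
      using cup_fund_rho5[OF True] K.coboundaries_subset by blast
    from cl_eq_zero_HK[OF this] have "d_hi (Suc 0) (K.cl (Suc 0) (rho5 :: 'f cochain)) = \<zero>\<^bsub>HK (Suc (Suc 0))\<^esub>"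
      using cup_fund_rho5[OF True] d_hi_class[OF rho] by simp
    then have "d_hi (Suc 0) (rho5_class l) = l \<odot>\<^bsub>HK (Suc (Suc 0))\<^esub> \<zero>\<^bsub>HK (Suc (Suc 0))\<^esub>"
      by (simp only: smult_HK[OF rho, symmetric] HI.d_smult[OF cl_in_HK[OF rho]])
    also have "\<dots> = (\<zero>\<^bsub>HK (Suc (Suc 0))\<^esub> :: 'f cochain set)"
      by (rule HI.C.smult_r_null) simp
    finally show ?thesis using Z_lincomb(2)[OF rho rho, of l] by blast
  next
    case False
    with l have "l = 0" by simp
    then show ?thesis by (simp add: zero_in_Z zero_HK HI.d_zero[of "Suc 0", unfolded zero_HK])
  qed
  then show "(\<lambda>w. scale_preproj l (rho5 w)) \<in> cocycles Hom_W b_K (Suc 0)"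
    "d_hi (Suc 0) (rho5_class l) = \<zero>\<^bsub>HK (Suc (Suc 0))\<^esub>" by blast+
qed

lemma cocycle_1_decompose:
  fixes g :: "'f::field cochain"
  assumes two: "(2 :: 'f) \<noteq> 0" and g: "g \<in> cocycles Hom_W b_K (Suc 0)"
  obtains z u l where "central_cochain z \<in> cocycles Hom_W b_K 0" "central_cochain u \<in> carrier (Hom_W 0)"
    "3 * l = 0" "g = (\<lambda>w. b_K 0 (central_cochain u) w
      + (cup (Suc 0) 0 fund (central_cochain z) w + scale_preproj l (rho5 w)))"
proof -
  have gc: "g \<in> carrier (Hom_W (Suc 0))" by (rule Z_carrier[OF g])
  have "sigma_value (\<lambda>a b. g (arr a) * arrA b + arrA a * g (arr b)) v = 0" for v
    using g b_K_1_sigma[OF gc, of v] by (simp add: Z_iff)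
  from cocycle_solution[OF two Hom_W_1_local[OF gc] this] obtain z u l where
    z: "diagonal z" "\<forall>a. arrA a * z = z * arrA a" and u: "diagonal u" and l: "3 * l = 0"
    and eq: "\<forall>a. g (arr a) = arrA a * z + (u * arrA a - arrA a * u) + scale_preproj l (rho5_value a)"
    by blast
  have Z: "central_cochain z \<in> cocycles Hom_W b_K 0"
    by (rule central_cochain_cocycle[OF z(1)]) (simp only: z(2))
  have U: "central_cochain u \<in> carrier (Hom_W 0)" by (rule central_cochain_closed[OF u])
  have "cup (Suc 0) 0 fund (central_cochain z) \<in> carrier (Hom_W (Suc 0))"
    using cup_closed[OF fund_closed Z_carrier[OF Z]] by simp
  then have "(\<lambda>w. b_K 0 (central_cochain u) w + (cup (Suc 0) 0 fund (central_cochain z) w + scale_preproj l (rho5 w)))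
      \<in> carrier (Hom_W (Suc 0))"
    by (intro Hom_W_lincomb(3) b_K_closed[OF U] Hom_W_lincomb(4)[OF rho5_closed rho5_closed])
  then have "g = (\<lambda>w. b_K 0 (central_cochain u) w + (cup (Suc 0) 0 fund (central_cochain z) w + scale_preproj l (rho5 w)))"
  proof (rule Hom_W_1_eqI[OF gc])
    fix a
    show "g (arr a) = b_K 0 (central_cochain u) (arr a)
        + (cup (Suc 0) 0 fund (central_cochain z) (arr a) + scale_preproj l (rho5 (arr a)))"
      by (simp only: eq b_K_0[OF U arr_in_W] cup_1_0[OF fund_closed Z_carrier[OF Z]] central_cochain_one
          fund_eq[OF arr_in_W] rho5_arr) (simp add: algebra_simps)
  qed
  with Z U l show ?thesis by (rule that)
qed

text \<open>The summand \<open>fund \<smile> z\<close> of a cocycle represents \<open>d_hi\<close>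
  of the class of \<open>z\<close>, so it becomes a coboundary of the higher complex, while the
  inner summand disappears in \<open>HK 1\<close>.\<close>

lemma HK_1_decompose:
  assumes two: "(2 :: 'f::field) \<noteq> 0" and X: "X \<in> carrier (HK (Suc 0) :: ('f, 'f cochain set) module)"
  obtains Y l where "Y \<in> coboundaries HK d_hi (Suc 0)" "3 * l = 0" "X = Y \<oplus>\<^bsub>HK (Suc 0)\<^esub> rho5_class l"
proof -
  obtain g where g: "g \<in> cocycles Hom_W b_K (Suc 0)" "X = K.cl (Suc 0) g"
    using X by (auto simp: carrier_HK)
  obtain z u l where z: "central_cochain z \<in> cocycles Hom_W b_K 0" and u: "central_cochain u \<in> carrier (Hom_W 0)"
    and l: "3 * l = 0" and eq: "g = (\<lambda>w. b_K 0 (central_cochain u) w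
      + (cup (Suc 0) 0 fund (central_cochain z) w + scale_preproj l (rho5 w)))"
    by (rule cocycle_1_decompose[OF two g(1)])
  have c: "cup (Suc 0) 0 fund (central_cochain z) \<in> cocycles Hom_W b_K (Suc 0)"
    using cup_fund_cocycle[OF z] by simp
  have B: "b_K 0 (central_cochain u) \<in> coboundaries Hom_W b_K (Suc 0)"
    unfolding B_Suc by (rule imageI[OF u])
  have "X = K.cl (Suc 0) (\<lambda>w. cup (Suc 0) 0 fund (central_cochain z) w + scale_preproj l (rho5 w))"
    using K.cl_add_coboundary[OF Z_lincomb(1)[OF c scaled_rho5(1)[OF l]] B]
    by (simp only: g(2) eq Hom_W_simps(3))
  also have "\<dots> = K.cl (Suc 0) (cup (Suc 0) 0 fund (central_cochain z)) \<oplus>\<^bsub>HK (Suc 0)\<^esub> rho5_class l"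
    by (rule add_HK[OF c scaled_rho5(1)[OF l], symmetric])
  also have "K.cl (Suc 0) (cup (Suc 0) 0 fund (central_cochain z)) = d_hi 0 (K.cl 0 (central_cochain z))"
    using d_hi_class[OF z] by simp
  finally have "X = d_hi 0 (K.cl 0 (central_cochain z)) \<oplus>\<^bsub>HK (Suc 0)\<^esub> rho5_class l" .
  moreover have "d_hi 0 (K.cl 0 (central_cochain z)) \<in> coboundaries HK d_hi (Suc 0)"
    by (simp add: coboundaries_def cl_in_HK[OF z])
  ultimately show ?thesis using that l by metis
qed

text \<open>The summand \<open>Y\<close> is killed because \<open>d_hi\<close> squares to zero, the
  multiple of \<open>rho5\<close> by \<open>scaled_rho5\<close>.\<close>

lemma d_hi_1:
  assumes two: "(2 :: 'f::field) \<noteq> 0" and X: "X \<in> carrier (HK (Suc 0) :: ('f, 'f cochain set) module)"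
  shows "d_hi (Suc 0) X = \<zero>\<^bsub>HK (Suc (Suc 0))\<^esub>"
proof -
  obtain Y l where Y: "Y \<in> coboundaries HK d_hi (Suc 0)" and l: "3 * l = 0"
    and eq: "X = Y \<oplus>\<^bsub>HK (Suc 0)\<^esub> rho5_class l"
    by (rule HK_1_decompose[OF two X])
  have "Y \<in> cocycles HK d_hi (Suc 0)" using Y HI.coboundaries_subset by blast
  then have "Y \<in> carrier (HK (Suc 0))" "d_hi (Suc 0) Y = \<zero>\<^bsub>HK (Suc (Suc 0))\<^esub>"
    by (simp_all add: cocycles_def)
  then show ?thesis
    using HI.d_add[OF _ cl_in_HK[OF scaled_rho5(1)[OF l]], of Y] HI.C.l_zero[of "\<zero>\<^bsub>HK (Suc (Suc 0))\<^esub>"]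
    by (simp add: eq scaled_rho5(2)[OF l])
qed

text \<open>What leaves \<open>HK 2\<close> lands in degree 3, which is zero, and what enters it is
  0 by \<open>d_hi_1\<close>; the space itself stays uncomputed.\<close>

lemma canonically_equal_2:
  assumes two: "(2 :: 'f::field) \<noteq> 0"
  shows "canonically_equal (HK :: nat \<Rightarrow> ('f, 'f cochain set) module) d_hi 2 (carrier (HK 2))"
proof (rule canonically_equal_HK)
  show "d_hi 2 X = \<zero>\<^bsub>HK (Suc 2)\<^esub>" if "X \<in> carrier (HK 2)" for X :: "'f cochain set"
    using HI.d_closed[OF that] HK_ge_3[where ?'f = 'f, of "Suc 2"] by simp
  show "d_hi q X = \<zero>\<^bsub>HK 2\<^esub>" if "2 = Suc q" "X \<in> carrier (HK q)" for q and X :: "'f cochain set"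
    using that d_hi_1[OF two, of X] by (auto simp: numeral_2_eq_2)
qed

lemma HK_hi_1_class:
  assumes two: "(2 :: 'f::field) \<noteq> 0" and v: "v \<in> carrier (HK_hi (Suc 0) :: ('f, 'f cochain set set) module)"
  obtains l where "3 * l = 0" "v = HI.cl (Suc 0) (rho5_class l)"
proof -
  obtain X where X: "X \<in> cocycles HK d_hi (Suc 0)" "v = HI.cl (Suc 0) X"
    using v by (auto simp: HK_hi_eq HI.carrier_H)
  obtain Y l where Y: "Y \<in> coboundaries HK d_hi (Suc 0)" and l: "3 * l = 0"
    and eq: "X = Y \<oplus>\<^bsub>HK (Suc 0)\<^esub> rho5_class l"
    by (rule HK_1_decompose[OF two HI.cocycles_carrier[OF X(1)]])
  have "rho5_class l \<in> cocycles HK d_hi (Suc 0)"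
    using cl_in_HK[OF scaled_rho5(1)[OF l]] scaled_rho5(2)[OF l] by (simp add: cocycles_def)
  from HI.cl_add_coboundary[OF this Y] show ?thesis
    using that[OF l] by (simp add: X(2) eq)
qed

lemma HK_hi_1_char_3:
  assumes two: "(2 :: 'f::field) \<noteq> 0" and three: "(3 :: 'f) = 0"
  shows "carrier (HK_hi 1 :: ('f, 'f cochain set set) module) =
    LinearCombinations.module.span class_ring (HK_hi 1) {HK_hi_class 1 (HK_class 1 rho5)}"
proof -
  let ?H = "HK_hi (Suc 0) :: ('f, 'f cochain set set) module"
  have rho: "K.cl (Suc 0) (rho5 :: 'f cochain) \<in> cocycles HK d_hi (Suc 0)"
    using cl_in_HK[OF rho5_cocycle[OF three]] d_hi_1[OF two] by (simp add: cocycles_def)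
  have V: "Module.module class_ring ?H" unfolding HK_hi_eq by (rule HI.module_H)
  have x: "HI.cl (Suc 0) (K.cl (Suc 0) rho5) \<in> carrier ?H"
    unfolding HK_hi_eq HI.carrier_H by (rule imageI[OF rho])
  have "carrier ?H = LinearCombinations.module.span class_ring ?H {HI.cl (Suc 0) (K.cl (Suc 0) rho5)}"
  proof (rule carrier_eq_span_single[OF V x])
    fix v assume "v \<in> carrier ?H"
    then obtain l where "v = HI.cl (Suc 0) (rho5_class l)" by (rule HK_hi_1_class[OF two])
    then have "v = l \<odot>\<^bsub>?H\<^esub> HI.cl (Suc 0) (K.cl (Suc 0) rho5)"
      by (simp only: HK_hi_eq HI.smult_H[OF rho] smult_HK[OF rho5_cocycle[OF three]])
    then show "\<exists>s. v = s \<odot>\<^bsub>?H\<^esub> HI.cl (Suc 0) (K.cl (Suc 0) rho5)" by blast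
  qed
  then show ?thesis by (simp only: One_nat_def HK_hi_eq(2) HK_eq(2))
qed

text \<open>With 3 invertible, \<open>3 * l = 0\<close> leaves only \<open>l = 0\<close>, so every
  class in \<open>HK 1\<close> is a coboundary of the higher complex.\<close>

lemma HK_hi_1_trivial:
  assumes two: "(2 :: 'f::field) \<noteq> 0" and three: "(3 :: 'f) \<noteq> 0"
  shows "carrier (HK_hi (Suc 0) :: ('f, 'f cochain set set) module) = {\<zero>\<^bsub>HK_hi (Suc 0)\<^esub>}"
proof -
  let ?H = "HK_hi (Suc 0) :: ('f, 'f cochain set set) module"
  have V: "Module.module class_ring ?H" unfolding HK_hi_eq by (rule HI.module_H)
  then interpret V: Module.module class_ring ?H .
  have "v = \<zero>\<^bsub>?H\<^esub>" if v: "v \<in> carrier ?H" for v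
  proof -
    obtain l where "3 * l = 0" "v = HI.cl (Suc 0) (rho5_class l)" by (rule HK_hi_1_class[OF two v])
    with three show ?thesis by (simp add: HK_hi_eq HI.zero_H zero_HK)
  qed
  then show ?thesis using V.M.zero_closed by blast
qed

theorem proposition6p15:
  shows
    "(CHAR('f::field) = 2 \<longrightarrow>
        (\<forall>p. canonically_equal (HK :: nat \<Rightarrow> ('f, 'f cochain set) module) d_hi p (carrier (HK p)))) \<and>
     (CHAR('f) = 3 \<longrightarrow>
        canonically_equal (HK :: nat \<Rightarrow> ('f, 'f cochain set) module) d_hi 0 (HK_deg 0 10) \<and>
        vectorspace.dim class_ring (HK_hi 0 :: ('f, 'f cochain set set) module) = 2 \<and>
        carrier (HK_hi 0 :: ('f, 'f cochain set set) module) =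
          LinearCombinations.module.span class_ring (HK_hi 0)
            {HK_hi_class 0 (HK_class 0 (central_cochain pi0)),
             HK_hi_class 0 (HK_class 0 (central_cochain pi3))} \<and>
        carrier (HK_hi 1 :: ('f, 'f cochain set set) module) =
          LinearCombinations.module.span class_ring (HK_hi 1) {HK_hi_class 1 (HK_class 1 rho5)} \<and>
        canonically_equal (HK :: nat \<Rightarrow> ('f, 'f cochain set) module) d_hi 2 (carrier (HK 2)) \<and>
        (\<forall>p>2. carrier (HK_hi p :: ('f, 'f cochain set set) module) = {\<zero>\<^bsub>HK_hi p\<^esub>})) \<and>
     (CHAR('f) \<notin> {2, 3} \<longrightarrow>
        canonically_equal (HK :: nat \<Rightarrow> ('f, 'f cochain set) module) d_hi 0 (HK_deg 0 10) \<and>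
        vectorspace.dim class_ring (HK_hi 0 :: ('f, 'f cochain set set) module) = 2 \<and>
        carrier (HK_hi 0 :: ('f, 'f cochain set set) module) =
          LinearCombinations.module.span class_ring (HK_hi 0)
            {HK_hi_class 0 (HK_class 0 (central_cochain pi0)),
             HK_hi_class 0 (HK_class 0 (central_cochain pi3))} \<and>
        canonically_equal (HK :: nat \<Rightarrow> ('f, 'f cochain set) module) d_hi 2 (carrier (HK 2)) \<and>
        (\<forall>p. p \<noteq> 0 \<and> p \<noteq> 2 \<longrightarrow>
           carrier (HK_hi p :: ('f, 'f cochain set set) module) = {\<zero>\<^bsub>HK_hi p\<^esub>}))"
proof (intro conjI)
  show "CHAR('f) = 2 \<longrightarrow>
      (\<forall>p. canonically_equal (HK :: nat \<Rightarrow> ('f, 'f cochain set) module) d_hi p (carrier (HK p)))"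
    using canonically_equal_char_2[OF two_eq_0] by blast
  show "CHAR('f) = 3 \<longrightarrow>
        canonically_equal (HK :: nat \<Rightarrow> ('f, 'f cochain set) module) d_hi 0 (HK_deg 0 10) \<and>
        vectorspace.dim class_ring (HK_hi 0 :: ('f, 'f cochain set set) module) = 2 \<and>
        carrier (HK_hi 0 :: ('f, 'f cochain set set) module) =
          LinearCombinations.module.span class_ring (HK_hi 0)
            {HK_hi_class 0 (HK_class 0 (central_cochain pi0)),
             HK_hi_class 0 (HK_class 0 (central_cochain pi3))} \<and>
        carrier (HK_hi 1 :: ('f, 'f cochain set set) module) =
          LinearCombinations.module.span class_ring (HK_hi 1) {HK_hi_class 1 (HK_class 1 rho5)} \<and>
        canonically_equal (HK :: nat \<Rightarrow> ('f, 'f cochain set) module) d_hi 2 (carrier (HK 2)) \<and>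
        (\<forall>p>2. carrier (HK_hi p :: ('f, 'f cochain set set) module) = {\<zero>\<^bsub>HK_hi p\<^esub>})"
  proof
    assume char: "CHAR('f) = 3"
    then have two: "(2 :: 'f) \<noteq> 0" by (intro two_neq_0) simp
    have "\<forall>p>2. carrier (HK_hi p :: ('f, 'f cochain set set) module) = {\<zero>\<^bsub>HK_hi p\<^esub>}"
      by (intro allI impI HK_hi_ge_3) simp
    with canonically_equal_0[OF two] HK_hi_0[OF two] HK_hi_1_char_3[OF two three_eq_0[OF char]] canonically_equal_2[OF two]
    show "canonically_equal (HK :: nat \<Rightarrow> ('f, 'f cochain set) module) d_hi 0 (HK_deg 0 10) \<and>
        vectorspace.dim class_ring (HK_hi 0 :: ('f, 'f cochain set set) module) = 2 \<and>
        carrier (HK_hi 0 :: ('f, 'f cochain set set) module) =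
          LinearCombinations.module.span class_ring (HK_hi 0)
            {HK_hi_class 0 (HK_class 0 (central_cochain pi0)),
             HK_hi_class 0 (HK_class 0 (central_cochain pi3))} \<and>
        carrier (HK_hi 1 :: ('f, 'f cochain set set) module) =
          LinearCombinations.module.span class_ring (HK_hi 1) {HK_hi_class 1 (HK_class 1 rho5)} \<and>
        canonically_equal (HK :: nat \<Rightarrow> ('f, 'f cochain set) module) d_hi 2 (carrier (HK 2)) \<and>
        (\<forall>p>2. carrier (HK_hi p :: ('f, 'f cochain set set) module) = {\<zero>\<^bsub>HK_hi p\<^esub>})"
      by (intro conjI)
  qed
  show "CHAR('f) \<notin> {2, 3} \<longrightarrow>
        canonically_equal (HK :: nat \<Rightarrow> ('f, 'f cochain set) module) d_hi 0 (HK_deg 0 10) \<and>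
        vectorspace.dim class_ring (HK_hi 0 :: ('f, 'f cochain set set) module) = 2 \<and>
        carrier (HK_hi 0 :: ('f, 'f cochain set set) module) =
          LinearCombinations.module.span class_ring (HK_hi 0)
            {HK_hi_class 0 (HK_class 0 (central_cochain pi0)),
             HK_hi_class 0 (HK_class 0 (central_cochain pi3))} \<and>
        canonically_equal (HK :: nat \<Rightarrow> ('f, 'f cochain set) module) d_hi 2 (carrier (HK 2)) \<and>
        (\<forall>p. p \<noteq> 0 \<and> p \<noteq> 2 \<longrightarrow>
           carrier (HK_hi p :: ('f, 'f cochain set set) module) = {\<zero>\<^bsub>HK_hi p\<^esub>})"
  proof
    assume char: "CHAR('f) \<notin> {2, 3}"
    then have two: "(2 :: 'f) \<noteq> 0" by (intro two_neq_0) simp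
    have three: "(3 :: 'f) \<noteq> 0" using char by (intro three_neq_0) simp
    have "\<forall>p. p \<noteq> 0 \<and> p \<noteq> 2 \<longrightarrow>
        carrier (HK_hi p :: ('f, 'f cochain set set) module) = {\<zero>\<^bsub>HK_hi p\<^esub>}"
    proof (intro allI impI)
      fix p :: nat assume "p \<noteq> 0 \<and> p \<noteq> 2"
      then consider "p = Suc 0" | "3 \<le> p" by linarith
      then show "carrier (HK_hi p :: ('f, 'f cochain set set) module) = {\<zero>\<^bsub>HK_hi p\<^esub>}"
        by cases (simp_all only: HK_hi_1_trivial[OF two three] HK_hi_ge_3)
    qed
    with canonically_equal_0[OF two] HK_hi_0[OF two] canonically_equal_2[OF two]
    show "canonically_equal (HK :: nat \<Rightarrow> ('f, 'f cochain set) module) d_hi 0 (HK_deg 0 10) \<and>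
        vectorspace.dim class_ring (HK_hi 0 :: ('f, 'f cochain set set) module) = 2 \<and>
        carrier (HK_hi 0 :: ('f, 'f cochain set set) module) =
          LinearCombinations.module.span class_ring (HK_hi 0)
            {HK_hi_class 0 (HK_class 0 (central_cochain pi0)),
             HK_hi_class 0 (HK_class 0 (central_cochain pi3))} \<and>
        canonically_equal (HK :: nat \<Rightarrow> ('f, 'f cochain set) module) d_hi 2 (carrier (HK 2)) \<and>
        (\<forall>p. p \<noteq> 0 \<and> p \<noteq> 2 \<longrightarrow>
           carrier (HK_hi p :: ('f, 'f cochain set set) module) = {\<zero>\<^bsub>HK_hi p\<^esub>})"
      by (intro conjI)
  qed
qed

end
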